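(* Let $R_n=\frac{3^n-2^{n+1}+3}{2}$. For every $n\geq2$ and every fixed $p>1$ with $p\neq2$, there is a connected complete graph on $n$ vertices with positive integer edge weights having at least $$R_n-n=\frac{3^n-2^{n+1}+3-2n}{2}$$ distinct eigenvalues that do not occur among the Krasnosel'skii genus min–max values. In particular, the number of such values is $$\left(\tfrac12+o(1)\right)3^n.$$ More generally, let $J$ be a compact subset of $(1,2)$ or a compact subset of $(2,\infty)$. A complete graph on $n$ vertices with positive integer edge weights can be chosen so that, for every $p\in J$ outside a finite set, at least $R_n-n$ of its spectral values do not belong to the $n$-term Krasnosel'skii genus min–max sequence. If $J\subset(2,\infty)$, the graph has exactly $R_n$ eigenlines and reduced Morse polynomial $M_n^+$ for every $p\in J$.
   Context: For positive weights $a=(a_{ij})_{i<j}$ on the complete graph $K_n$ (with $a_{ji}=a_{ij}$) and $p>1$, with $\Phi_p(t)=|t|^{p-2}t$, $\Phi_p(0)=0$, an eigenvalue (spectral value) is $\lambda\in\mathbb R$ such that some $x\in\mathbb R^n\setminus\{0\}$ satisfies $\sum_{j\ne i}a_{ij}\Phi_p(x_i-x_j)=\lambda\Phi_p(x_i)$ for all $i$; an eigenline is the class $[x]\in\mathbb RP^{n-1}$ of such an $x$. Let $E_{p,a}(x)=\sum_{i<j}a_{ij}|x_i-x_j|^p$ and $S_p=\{x\in\mathbb R^n:\sum_i|x_i|^p=1\}$. With $\gamma$ the Krasnosel'skii genus, the $n$-term Krasnosel'skii genus min–max sequence is $$\lambda_j^{\mathrm K}(a)=\inf_{\substack{C\subset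 S_p\text{ compact},\,C=-C\\ \gamma(C)\ge j}}\ \sup_{x\in C}E_{p,a}(x),\qquad j=1,\dots,n.$$ The reduced quotient is the function on $\mathbb P(\mathbb R^n/\mathbb R\mathbf 1)\cong\mathbb RP^{n-2}$ given by $\mathcal R_{p,a}([\bar x])=E_{p,a}(x)/\min_{c\in\mathbb R}\sum_i|x_i+c|^p$, where $\mathbf 1$ is the all-ones vector and $\bar x$ is the class of $x$ modulo $\mathbb R\mathbf 1$; its critical points correspond to the nonconstant eigenlines. When $\mathcal R_{p,a}$ is Morse, the reduced Morse polynomial is $\sum_z t^{\mathrm{ind}(z)}$ over its critical points $z$, where $\mathrm{ind}(z)$ is the Morse index. Finally $M_n^+(t)=\frac{(1+2t)^n-2(1+t)^n+1}{2t^2}$. *)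

theory Defs
  imports
    "HOL-Analysis.Analysis"
    "HOL-Library.Extended_Nat"
    "HOL-Computational_Algebra.Polynomial"
begin

(* The vertices of K_n are the elements of a finite linearly ordered type 'n with
   CARD('n) = n. A weight function is only ever evaluated off the diagonal. *)

definition positive_integer_weights :: "('n \<Rightarrow> 'n \<Rightarrow> real) \<Rightarrow> bool" where
  "positive_integer_weights a \<longleftrightarrow>
     (\<forall>i j. i \<noteq> j \<longrightarrow> a i j = a j i \<and> a i j > 0 \<and> a i j \<in> \<int>)"

(* 0 powr q = 0 for every q, so Phi p 0 = 0 also when p < 2. *)
definition Phi :: "real \<Rightarrow> real \<Rightarrow> real" where
  "Phi p t = \<bar>t\<bar> powr (p - 2) * t"

definition eigenpair ::
    "real \<Rightarrow> ('n \<Rightarrow> 'n \<Rightarrow> real) \<Rightarrow> real \<Rightarrow> real ^ 'n \<Rightarrow> bool" where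
  "eigenpair p a lam x \<longleftrightarrow> x \<noteq> 0 \<and>
     (\<forall>i. (\<Sum>j\<in>UNIV - {i}. a i j * Phi p (x $ i - x $ j)) = lam * Phi p (x $ i))"

definition eigenvalues :: "real \<Rightarrow> ('n::finite \<Rightarrow> 'n \<Rightarrow> real) \<Rightarrow> real set" where
  "eigenvalues p a = {lam. \<exists>x. eigenpair p a lam x}"

definition line_class :: "real ^ 'n \<Rightarrow> (real ^ 'n) set" where
  "line_class x = {s *\<^sub>R x | s. s \<noteq> 0}"

definition eigenlines :: "real \<Rightarrow> ('n \<Rightarrow> 'n \<Rightarrow> real) \<Rightarrow> (real ^ 'n) set set" where
  "eigenlines p a = {line_class x | x. \<exists>lam. eigenpair p a lam x}"

definition energy ::
    "real \<Rightarrow> ('n \<Rightarrow> 'n \<Rightarrow> real) \<Rightarrow> real ^ 'n::{finite,linorder} \<Rightarrow> real" where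
  "energy p a x = (\<Sum>(i, j)\<in>{(i, j). i < j}. a i j * \<bar>x $ i - x $ j\<bar> powr p)"

definition p_sphere :: "real \<Rightarrow> (real ^ 'n) set" where
  "p_sphere p = {x. (\<Sum>i\<in>UNIV. \<bar>x $ i\<bar> powr p) = 1}"

(* The least k admitting an odd continuous map C \<rightarrow> R^k - {0}, here given by its k
   component functions; it is \<infinity> (the infimum of the empty set) if there is no such k. *)
definition genus :: "(real ^ 'n) set \<Rightarrow> enat" where
  "genus C = Inf {enat k | k. \<exists>f :: nat \<Rightarrow> real ^ 'n \<Rightarrow> real.
     (\<forall>i<k. continuous_on C (f i) \<and> (\<forall>x\<in>C. f i (- x) = - f i x)) \<and>
     (\<forall>x\<in>C. \<exists>i<k. f i x \<noteq> 0)}"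

definition krasnoselskii_value ::
    "real \<Rightarrow> ('n::{finite,linorder} \<Rightarrow> 'n \<Rightarrow> real) \<Rightarrow> nat \<Rightarrow> real" where
  "krasnoselskii_value p a j =
     (INF C\<in>{C. C \<subseteq> p_sphere p \<and> compact C \<and> C = uminus ` C \<and> genus C \<ge> enat j}.
        SUP x\<in>C. energy p a x)"

definition missing_eigenvalues ::
    "real \<Rightarrow> ('n::{finite,linorder} \<Rightarrow> 'n \<Rightarrow> real) \<Rightarrow> real set" where
  "missing_eigenvalues p a = eigenvalues p a - krasnoselskii_value p a ` {1..CARD('n)}"

definition R_count :: "nat \<Rightarrow> real" where
  "R_count n = (3 ^ n - 2 ^ (n + 1) + 3) / 2"

(* Also meaningful for infinite sets, whose card is 0. *)
definition has_at_least :: "'a set \<Rightarrow> real \<Rightarrow> bool" where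
  "has_at_least A r \<longleftrightarrow> (\<exists>V\<subseteq>A. finite V \<and> real (card V) \<ge> r)"


(* A point of P(R^n/R1) is represented by the set of all vectors of R^n whose class modulo
   R1 lies on the given line and is nonzero. The vector 1 :: real ^ 'n is the all-ones vector. *)

definition reduced_class :: "real ^ 'n \<Rightarrow> (real ^ 'n) set" where
  "reduced_class x = {s *\<^sub>R x + c *\<^sub>R 1 | s c. s \<noteq> 0}"

definition reduced_space :: "(real ^ 'n) set set" where
  "reduced_space = reduced_class ` {x. \<nexists>c. x = c *\<^sub>R 1}"

definition rep :: "(real ^ 'n) set \<Rightarrow> real ^ 'n" where
  "rep z = (SOME x. x \<in> z)"

definition quotient_value ::
    "real \<Rightarrow> ('n \<Rightarrow> 'n \<Rightarrow> real) \<Rightarrow> real ^ 'n::{finite,linorder} \<Rightarrow> real" where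
  "quotient_value p a x = energy p a x / (INF c. \<Sum>i\<in>UNIV. \<bar>x $ i + c\<bar> powr p)"

definition reduced_quotient ::
    "real \<Rightarrow> ('n \<Rightarrow> 'n \<Rightarrow> real) \<Rightarrow> (real ^ 'n::{finite,linorder}) set \<Rightarrow> real" where
  "reduced_quotient p a z = quotient_value p a (rep z)"

lemma quotient_value_invariant:
  fixes a :: "'n::{finite,linorder} \<Rightarrow> 'n \<Rightarrow> real"
    and x :: "(real, 'n) vec"
  assumes s: "s \<noteq> 0"
  shows "quotient_value p a (s *\<^sub>R x + c *\<^sub>R 1) = quotient_value p a x"
proof -
  let ?F = "\<lambda>(y :: (real, 'n) vec) d. \<Sum>i\<in>UNIV. \<bar>y $ i + d\<bar> powr p"
  let ?y = "s *\<^sub>R x + c *\<^sub>R 1"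
  let ?k = "\<bar>s\<bar> powr p"
  have k: "?k > 0" using s by simp
  have E: "energy p a ?y = ?k * energy p a x"
    unfolding energy_def sum_distrib_left
    by (rule sum.cong)
       (auto simp: right_diff_distrib[symmetric] abs_mult powr_mult)
  have F: "?F ?y d = ?k * ?F x ((c + d) / s)" for d
  proof -
    have "\<bar>?y $ i + d\<bar> = \<bar>s\<bar> * \<bar>x $ i + (c + d) / s\<bar>" for i
      using s by (simp add: abs_mult[symmetric] field_simps)
    then show ?thesis by (simp add: sum_distrib_left powr_mult)
  qed
  have nn: "?F y d \<ge> 0" for y d by (simp add: sum_nonneg)
  have bdd: "bdd_below (range (?F y))" for y
    by (rule bdd_belowI[of _ 0]) (use nn in auto)
  have "(INF d. ?F ?y d) = ?k * (INF d. ?F x d)"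
  proof (rule antisym)
    have "(INF d. ?F ?y d) / ?k \<le> (INF d. ?F x d)"
    proof (rule cINF_greatest)
      fix d
      have "(INF d. ?F ?y d) \<le> ?F ?y (s * d - c)" by (rule cINF_lower[OF bdd]) simp
      also have "\<dots> = ?k * ?F x d" using s by (simp only: F) simp
      finally show "(INF d. ?F ?y d) / ?k \<le> ?F x d" using k by (simp add: field_simps)
    qed simp
    then show "(INF d. ?F ?y d) \<le> ?k * (INF d. ?F x d)" using k by (simp add: field_simps)
  next
    show "?k * (INF d. ?F x d) \<le> (INF d. ?F ?y d)"
    proof (rule cINF_greatest)
      fix d
      show "?k * (INF d. ?F x d) \<le> ?F ?y d"
        unfolding F by (intro mult_left_mono cINF_lower[OF bdd]) (use k in auto)
    qed simp
  qed
  then show ?thesis unfolding quotient_value_def E using k by simp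
qed

lemma reduced_quotient_reduced_class:
  "reduced_quotient p a (reduced_class x) = quotient_value p a x"
proof -
  have "x \<in> reduced_class x" unfolding reduced_class_def by (rule CollectI, intro exI[of _ 1] exI[of _ 0]) simp
  then have "rep (reduced_class x) \<in> reduced_class x" unfolding rep_def by (rule someI)
  then show ?thesis
    unfolding reduced_quotient_def reduced_class_def[of x]
    by (auto simp: quotient_value_invariant)
qed


(* Affine chart of P(R^n/R1) centred at z = [x]: the (n-2)-dimensional orthogonal complement
   of span {x, 1} parametrises the classes [x + w]. Since w is orthogonal to x and 1,
   x + w is never constant, so the chart is defined on the whole subspace. *)

definition chart_domain :: "(real ^ 'n) set \<Rightarrow> (real ^ 'n) set" where
  "chart_domain z = {w. w \<bullet> rep z = 0 \<and> w \<bullet> 1 = 0}"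

definition in_chart :: "((real ^ 'n) set \<Rightarrow> real) \<Rightarrow> (real ^ 'n) set \<Rightarrow> real ^ 'n \<Rightarrow> real" where
  "in_chart f z w = f (reduced_class (rep z + w))"

definition C2_on_subspace :: "'a::euclidean_space set \<Rightarrow> ('a \<Rightarrow> real) \<Rightarrow> bool" where
  "C2_on_subspace W g \<longleftrightarrow> (\<exists>G H.
     (\<forall>w\<in>W. (g has_derivative (\<lambda>v. G w \<bullet> v)) (at w within W) \<and>
             (G has_derivative H w) (at w within W)) \<and>
     (\<forall>v\<in>W. continuous_on W (\<lambda>w. H w v)))"

definition critical_point :: "((real ^ 'n) set \<Rightarrow> real) \<Rightarrow> (real ^ 'n) set \<Rightarrow> bool" where
  "critical_point f z \<longleftrightarrow> z \<in> reduced_space \<and>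
     (in_chart f z has_derivative (\<lambda>_. 0)) (at 0 within chart_domain z)"

definition hessian ::
    "((real ^ 'n) set \<Rightarrow> real) \<Rightarrow> (real ^ 'n) set \<Rightarrow> real ^ 'n \<Rightarrow> real ^ 'n \<Rightarrow> real" where
  "hessian f z u v =
     deriv (\<lambda>s. deriv (\<lambda>t. in_chart f z (s *\<^sub>R u + t *\<^sub>R v)) 0) 0"

definition morse_function :: "((real ^ 'n) set \<Rightarrow> real) \<Rightarrow> bool" where
  "morse_function f \<longleftrightarrow>
     (\<forall>z\<in>reduced_space. C2_on_subspace (chart_domain z) (in_chart f z)) \<and>
     (\<forall>z. critical_point f z \<longrightarrow>
        (\<forall>u\<in>chart_domain z. (\<forall>v\<in>chart_domain z. hessian f z u v = 0) \<longrightarrow> u = 0))"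

definition morse_index :: "((real ^ 'n) set \<Rightarrow> real) \<Rightarrow> (real ^ 'n) set \<Rightarrow> nat" where
  "morse_index f z = Max {dim S | S. subspace S \<and> S \<subseteq> chart_domain z \<and>
     (\<forall>v\<in>S - {0}. hessian f z v v < 0)}"

definition morse_polynomial :: "((real ^ 'n) set \<Rightarrow> real) \<Rightarrow> real poly" where
  "morse_polynomial f = (\<Sum>z\<in>{z. critical_point f z}. monom 1 (morse_index f z))"

definition M_plus :: "nat \<Rightarrow> real poly" where
  "M_plus n = ([:1, 2:] ^ n - 2 * [:1, 1:] ^ n + 1) div monom 2 2"

(* The division in M_plus is exact. *)
lemma M_plus_exact:
  "monom 2 2 * M_plus n = [:1, 2:] ^ n - 2 * [:1, 1:] ^ n + 1"
proof -
  let ?P = "\<lambda>n. [:1, 2:] ^ n - 2 * [:1, 1:] ^ n + (1 :: real poly)"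
  have lin: "\<exists>q. [:1, c:] ^ n = [:1, real n * c:] + monom 1 2 * q" for c :: real
  proof (induction n)
    case 0
    show ?case by (rule exI[of _ 0]) (simp add: one_pCons)
  next
    case (Suc n)
    then obtain q where q: "[:1, c:] ^ n = [:1, real n * c:] + monom 1 2 * q" by blast
    show ?case
      by (rule exI[of _ "[:1, c:] * q + [:real n * c * c:]"])
         (simp add: q algebra_simps monom_altdef power2_eq_square)
  qed
  obtain q1 q2 where "[:1, 2:] ^ n = [:1, real n * 2:] + monom 1 2 * q1"
    "[:1, 1:] ^ n = [:1, real n * 1:] + monom 1 2 * q2" using lin by blast
  then have "?P n = monom 1 2 * (q1 - 2 * q2)"
    by (simp add: algebra_simps one_pCons numeral_poly)
  also have "\<dots> = monom 2 2 * smult (1/2) (q1 - 2 * q2)"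
    by (simp add: monom_altdef)
  finally have "monom 2 2 dvd ?P n" by (rule dvdI)
  then show ?thesis unfolding M_plus_def by (rule dvd_mult_div_cancel)
qed

end

(* For uniform weights and p other than 2, the nonconstant eigenvectors are, up to scaling,
indexed by disjoint nonempty pairs (A, B). Each is nondegenerate, so it persists for the
weights M + b with M large; the integers b separate the resulting (R_n - 1) eigenvalues,
except at the isolated p where two of them cross. The genus values number at most n. *)

theory Submission
  imports Defs "HOL-Complex_Analysis.Complex_Analysis"
begin

text \<open>Base eigenvectors sit where the Rayleigh quotient is least smooth: many entries coincide
  or vanish, and \<open>|t|^p\<close> is not C2 at 0 for \<open>p < 2\<close>. Persistence is
  therefore variational. On a hyperplane slice through each base vector the quotient has a strict
  saddle whose directions swap with the sign of \<open>p - 2\<close>: a vanishing gap gives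
  \<open>|t|^p\<close>, negligible against \<open>t^2\<close> for \<open>p > 2\<close> and dominant
  for \<open>p < 2\<close>. The perturbed eigenvalue is a max-min value over two small balls, so it
  inherits Lipschitz bounds in \<open>p\<close> from the quotient without any control of how the
  eigenvector moves. Completeness of the list of eigenlines and the Morse data use the C2 quotient,
  hence \<open>p > 2\<close>. Pairs with equal block sizes share their base eigenvalue for every
  \<open>p\<close>, so \<open>b\<close> has to separate them to first order in \<open>1 / M\<close>,
  for a continuum of \<open>p\<close> at once. For different sizes, analyticity in
  \<open>1 / (p - 1)\<close> and the values at \<open>p = 3\<close> and \<open>p = 4\<close> leave
  finitely many crossings; near a crossing the slope in \<open>p\<close> must beat the Lipschitz
  error of the branches. The constant vector, with eigenvalue 0, completes the count to
  \<open>R_n\<close>.\<close>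

no_notation fps_nth (infixl \<open>$\<close> 75)

section \<open>The odd power map: joint continuity, derivatives and slope bounds\<close>

lemma Phi_0 [simp]: "Phi p 0 = 0"
 by (simp add: Phi_def)

lemma Phi_minus [simp]: "Phi p (- t) = - Phi p t"
 by (simp add: Phi_def)

lemma Phi_diff_commute: "Phi p (s - t) = - Phi p (t - s)"
 by (metis Phi_minus minus_diff_eq)

lemma Phi_mult: "Phi p (c * t) = Phi p c * Phi p t"
 by (simp add: Phi_def abs_mult powr_mult)

lemma Phi_pos_eq:
 assumes "t > 0"
 shows "Phi p t = t powr (p - 1)"
proof -
 have "t * t powr (p - 2) = t powr (1 + (p - 2))"
 using assms by (intro powr_mult_base) simp
 thus ?thesis using assms by (simp add: Phi_def mult.commute)
qed

text \<open>Expresses the odd power through powers of nonnegative bases, for which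
  \<open>powr\<close> is jointly continuous in base and exponent as long as the exponent
  \<open>p - 1\<close> is positive. All continuity in \<open>p\<close> rests on this form.\<close>

lemma Phi_eq_pos_neg:
 "Phi p t = (max t 0) powr (p - 1) - (max (- t) 0) powr (p - 1)"
proof (cases t "0 :: real" rule: linorder_cases)
 case less
 hence "Phi p t = - ((- t) powr (p - 1))"
 using Phi_pos_eq[of "- t" p] by simp
 with less show ?thesis by (simp add: max_def)
next
 case greater
 thus ?thesis by (simp add: max_def Phi_pos_eq)
qed simp

lemma Phi_eq_0_iff [simp]: "Phi p t = 0 \<longleftrightarrow> t = 0"
 by (simp add: Phi_def)

lemma Phi_pos_iff [simp]: "Phi p t > 0 \<longleftrightarrow> t > 0"
 by (auto simp: Phi_def zero_less_mult_iff)

lemma Phi_neg_iff [simp]: "Phi p t < 0 \<longleftrightarrow> t < 0"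
 using Phi_pos_iff[of p "- t"] by simp

lemma Phi_times_self: "Phi p t * t = abs t powr p"
proof (cases "t = 0")
 case False
 have "abs t powr p = abs t powr (p - 2) * abs t powr 2"
 unfolding powr_add[symmetric] by simp
 also have "abs t powr 2 = t * t"
 using False by (simp add: powr_numeral power2_eq_square)
 finally show ?thesis by (simp add: Phi_def mult.assoc)
qed simp

lemma powr_Phi: "abs t powr (p - 2) * t = Phi p t"
 by (simp add: Phi_def)

lemma abs_Phi: "abs (Phi p t) = abs t powr (p - 1)"
proof (cases "t = 0")
 case False
 have "abs (Phi p t) = Phi p (abs t)" by (simp add: Phi_def abs_mult)
 thus ?thesis using False by (simp add: Phi_pos_eq)
qed simp

lemma Phi_strict_mono:
 assumes "p > 1" "s < t"
 shows "Phi p s < Phi p t"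
proof -
 have pos: "Phi p u < Phi p v" if "0 <= u" "u < v" for u v
 using that assms by (cases "u = 0") (auto simp: Phi_pos_eq intro: powr_less_mono2)
 consider "0 <= s" | "s < 0" "t >= 0" | "t < 0" using assms by linarith
 thus ?thesis
 proof cases
 case 1
 thus ?thesis using pos assms by blast
 next
 case 2
 hence "Phi p s < 0" "Phi p t >= 0"
 by (simp, metis Phi_neg_iff not_le)
 thus ?thesis by linarith
 next
 case 3
 hence "Phi p (- t) < Phi p (- s)" using pos[of "- t" "- s"] assms by simp
 thus ?thesis by simp
 qed
qed

lemma Phi_less_iff: "p > 1 ==> Phi p s < Phi p t \<longleftrightarrow> s < t"
 by (metis Phi_strict_mono linorder_neqE_linordered_idom order_less_asym)

lemma Phi_inject: "p > 1 ==> Phi p s = Phi p t \<longleftrightarrow> s = t"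
 by (metis Phi_strict_mono linorder_neqE_linordered_idom order_less_irrefl)

lemma Phi_mono_mult: "p > 1 ==> (Phi p s - Phi p t) * (s - t) >= 0"
 using Phi_less_iff[of p s t] Phi_less_iff[of p t s]
 by (cases s t rule: linorder_cases) (auto simp: zero_le_mult_iff)

lemma continuous_on_Phi_param [continuous_intros]:
 fixes f g :: "'a::topological_space => real"
 assumes "continuous_on S f" "continuous_on S g" "!!x. x : S ==> f x > 1"
 shows "continuous_on S (%x. Phi (f x) (g x))"
 unfolding Phi_eq_pos_neg
 by (intro continuous_intros continuous_on_powr' assms)
 (use assms(3) in \<open>force simp: max_def\<close>)+

lemma continuous_on_abs_powr [continuous_intros]:
 fixes f g :: "'a::topological_space => real"
 assumes "continuous_on S f" "continuous_on S g" "!!x. x : S ==> f x > 0"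
 shows "continuous_on S (%x. abs (g x) powr f x)"
 by (intro continuous_intros continuous_on_powr' assms)
 (use assms(3) in force)+

lemma tendsto_Phi_param [tendsto_intros]:
 assumes "(f \<longlongrightarrow> a) F" "(g \<longlongrightarrow> b) F" "a > 1"
 shows "((%x. Phi (f x) (g x)) \<longlongrightarrow> Phi a b) F"
 unfolding Phi_eq_pos_neg
 by (intro tendsto_intros tendsto_powr' assms tendsto_max) (use assms(3) in auto)

lemma tendsto_abs_powr [tendsto_intros]:
 assumes "(f \<longlongrightarrow> a) F" "(g \<longlongrightarrow> b) F" "a > (0::real)"
 shows "((%x. abs (g x :: real) powr f x) \<longlongrightarrow> abs b powr a) F"
 by (intro tendsto_intros tendsto_powr' assms) (use assms(3) in auto)

lemma DERIV_Phi_nz: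
 assumes "t ~= 0"
 shows "(Phi p has_real_derivative (p - 1) * abs t powr (p - 2)) (at t)"
proof (cases "t > 0")
 case True
 have "((%t. t powr (p - 1)) has_real_derivative (p - 1) * t powr (p - 1 - 1)) (at t)"
 using True by (auto intro!: derivative_eq_intros)
 hence "(Phi p has_real_derivative (p - 1) * t powr (p - 1 - 1)) (at t)"
 by (rule has_field_derivative_transform_within_open[where S = "{0<..}"])
 (use True in \<open>auto simp: Phi_pos_eq\<close>)
 thus ?thesis using True by simp
next
 case False
 hence t: "t < 0" using assms by simp
 have "((%t. - ((- t) powr (p - 1))) has_real_derivative (p - 1) * (- t) powr (p - 1 - 1)) (at t)"
 using t by (auto intro!: derivative_eq_intros)
 hence "(Phi p has_real_derivative (p - 1) * (- t) powr (p - 1 - 1)) (at t)"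
 by (rule has_field_derivative_transform_within_open[where S = "{..<0}"])
 (use t in \<open>auto simp: Phi_eq_pos_neg max_def\<close>)
 thus ?thesis using t by simp
qed

text \<open>At 0 the difference quotient is \<open>|h| powr (p - 2)\<close>, which tends to 0
  because \<open>p > 2\<close>; for smaller \<open>p\<close> only \<open>DERIV_Phi_nz\<close> is
  available.\<close>

lemma DERIV_Phi:
 assumes "p > 2"
 shows "(Phi p has_real_derivative (p - 1) * abs t powr (p - 2)) (at t)"
proof (cases "t = 0")
 case True
 have "((%h. abs h powr (p - 2)) \<longlongrightarrow> abs 0 powr (p - 2)) (at (0::real))"
 by (intro tendsto_intros) (use assms in auto)
 hence "((%h. (Phi p (0 + h) - Phi p 0) / h) \<longlongrightarrow> abs 0 powr (p - 2)) (at 0)"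
 by (rule Lim_transform_eventually)
 (use assms in \<open>auto simp: Phi_def eventually_at intro!: exI[of _ 1]\<close>)
 thus ?thesis using True by (simp add: DERIV_def)
qed (rule DERIV_Phi_nz)

lemma DERIV_abs_powr:
 assumes "p > 1"
 shows "((%t. abs t powr p) has_real_derivative p * Phi p t) (at t)"
proof (cases t "0::real" rule: linorder_cases)
 case equal
 have "((%h. Phi p h) \<longlongrightarrow> Phi p 0) (at (0::real))"
 by (intro tendsto_intros) (use assms in auto)
 hence "((%h. (abs (0 + h) powr p - abs 0 powr p) / h) \<longlongrightarrow> Phi p 0) (at 0)"
 by (rule Lim_transform_eventually)
 (auto simp: Phi_times_self[symmetric] eventually_at intro!: exI[of _ 1])
 thus ?thesis using equal by (simp add: DERIV_def)
next
 case greater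
 have "((%t. t powr p) has_real_derivative p * Phi p t) (at t)"
 using greater by (auto intro!: derivative_eq_intros simp: Phi_pos_eq)
 thus ?thesis
 by (rule has_field_derivative_transform_within_open[where S = "{0<..}"]) (use greater in auto)
next
 case less
 have "((%t. (- t) powr p) has_real_derivative p * Phi p t) (at t)"
 using less by (auto intro!: derivative_eq_intros simp: Phi_eq_pos_neg max_def)
 thus ?thesis
 by (rule has_field_derivative_transform_within_open[where S = "{..<0}"]) (use less in auto)
qed

lemma isCont_Phi: "p > 1 ==> isCont (Phi p) t"
 unfolding isCont_def by (intro tendsto_intros) auto

text \<open>Since \<^term>\<open>Phi p\<close> may fail to be differentiable at 0, the mean value theorem is
  applied on both sides of 0 separately.\<close>

lemma Phi_diff_lower:
 assumes p: "p > 1" and st: "s <= t"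
 and low: "!!xi. s < xi ==> xi < t ==> xi ~= 0 ==> ka <= abs (xi) powr (p - 2)"
 shows "(p - 1) * ka * (t - s) <= Phi p t - Phi p s"
proof -
 have main: "(p - 1) * ka * (t - s) <= Phi p t - Phi p s"
 if "s <= t" "0 ~: {s<..<t}" "!!xi. s < xi ==> xi < t ==> xi ~= 0 ==> ka <= abs (xi) powr (p - 2)"
 for s t :: real
 proof (cases "s = t")
 case False
 hence lt: "s < t" using that by simp
 have "EX l z. s < z & z < t & DERIV (Phi p) z :> l & Phi p t - Phi p s = (t - s) * l"
 proof (rule MVT[OF lt])
 show "continuous_on {s..t} (Phi p)"
 using isCont_Phi[OF p] by (simp add: continuous_at_imp_continuous_on)
 show "Phi p differentiable at x" if "s < x" "x < t" for x
 using that \<open>0 ~: {s<..<t}\<close> DERIV_Phi_nz[of x p] real_differentiable_def by fastforce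
 qed
 then obtain l z where z: "s < z" "z < t" "DERIV (Phi p) z :> l"
 "Phi p t - Phi p s = (t - s) * l" by blast
 have z0: "z ~= 0" using z that by auto
 hence "l = (p - 1) * abs z powr (p - 2)" using z DERIV_Phi_nz DERIV_unique by blast
 moreover have "ka <= abs z powr (p - 2)" using that z z0 by blast
 ultimately have "(p - 1) * ka <= l" using p by (simp add: mult_left_mono)
 hence "(p - 1) * ka * (t - s) <= l * (t - s)" using lt by (intro mult_right_mono) auto
 thus ?thesis using z by (simp add: mult.commute)
 qed simp
 show ?thesis
 proof (cases "0 : {s<..<t}")
 case True
 have "(p - 1) * ka * (t - 0) <= Phi p t - Phi p 0"
 by (rule main, use True in simp, simp, rule low) (use True in auto)
 moreover have "(p - 1) * ka * (0 - s) <= Phi p 0 - Phi p s"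
 by (rule main, use True in simp, simp, rule low) (use True in auto)
 ultimately show ?thesis by (simp add: algebra_simps)
 qed (rule main, use st low in auto)
qed

lemma Phi_diff_lower_mult:
 assumes p: "p > 1"
 and low: "!!xi. min s t < xi ==> xi < max s t ==> xi ~= 0 ==> ka <= abs (xi) powr (p - 2)"
 shows "(p - 1) * ka * (s - t)^2 <= (Phi p s - Phi p t) * (s - t)"
proof -
 have *: "(p - 1) * ka * (s - t)^2 <= (Phi p s - Phi p t) * (s - t)"
 if "t <= s" "!!xi. t < xi ==> xi < s ==> xi ~= 0 ==> ka <= abs (xi) powr (p - 2)" for s t
 using mult_right_mono[OF Phi_diff_lower[OF p that], of "s - t"] that
 by (simp add: power2_eq_square mult.assoc)
 show ?thesis
 proof (cases "t <= s")
 case True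
 show ?thesis by (rule *) (use True low in auto)
 next
 case False
 have "(p - 1) * ka * (t - s)^2 <= (Phi p t - Phi p s) * (t - s)"
 by (rule *) (use False low in auto)
 thus ?thesis by (simp add: power2_commute algebra_simps)
 qed
qed

text \<open>The assumption \<open>st\<close> guarantees differentiability on the whole segment
  between the points: either they have the same sign, or \<open>p > 2\<close>.\<close>

lemma Phi_diff_upper_mult:
 assumes p: "p > 1" and st: "s ~= 0 & t ~= 0 & (0 < s \<longleftrightarrow> 0 < t) | p > 2"
 and up: "!!xi. min s t < xi ==> xi < max s t ==> xi ~= 0 ==> abs (xi) powr (p - 2) <= ka"
 and k: "ka >= 0"
 shows "(Phi p s - Phi p t) * (s - t) <= (p - 1) * ka * (s - t)^2"
proof -
 have *: "(Phi p s - Phi p t) * (s - t) <= (p - 1) * ka * (s - t)^2"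
 if lt: "t < s" and st: "s ~= 0 & t ~= 0 & (0 < s \<longleftrightarrow> 0 < t) | p > 2"
 and up: "!!xi. t < xi ==> xi < s ==> xi ~= 0 ==> abs (xi) powr (p - 2) <= ka" for s t
 proof -
 have der: "DERIV (Phi p) x :> (p - 1) * abs x powr (p - 2)" if "t < x" "x < s" for x
 using that st DERIV_Phi_nz[of x p] DERIV_Phi[of p x] by fastforce
 have "EX l z. t < z & z < s & DERIV (Phi p) z :> l & Phi p s - Phi p t = (s - t) * l"
 proof (rule MVT[OF lt])
 show "continuous_on {t..s} (Phi p)"
 using isCont_Phi[OF p] by (simp add: continuous_at_imp_continuous_on)
 qed (use der real_differentiable_def in blast)
 then obtain l z where z: "t < z" "z < s" "DERIV (Phi p) z :> l"
 "Phi p s - Phi p t = (s - t) * l" by blast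
 have "l = (p - 1) * abs z powr (p - 2)" using z der DERIV_unique by blast
 moreover have "abs z powr (p - 2) <= ka" using up[of z] z k by (cases "z = 0") auto
 ultimately have "l <= (p - 1) * ka" using p by (simp add: mult_left_mono)
 hence "(s - t) * l * (s - t) <= (s - t) * ((p - 1) * ka) * (s - t)"
 using lt by (intro mult_right_mono mult_left_mono) auto
 thus ?thesis unfolding z(4) by (simp add: power2_eq_square ac_simps)
 qed
 show ?thesis
 proof (cases s t rule: linorder_cases)
 case greater
 show ?thesis by (rule *) (use greater st up in auto)
 next
 case less
 have "(Phi p t - Phi p s) * (t - s) <= (p - 1) * ka * (t - s)^2"
 by (rule *) (use less st up in auto)
 thus ?thesis by (simp add: power2_commute algebra_simps)
 qed simp
qed

lemma continuous_pos_lower_bound: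
 fixes f :: "real => real"
 assumes "continuous_on {l..r} f" "!!p. p : {l..r} ==> f p > 0"
 shows "EX c>0. ALL p:{l..r}. c <= f p"
proof (cases "l <= r")
 case True
 then obtain q where "q : {l..r}" "ALL p:{l..r}. f q <= f p"
 using continuous_attains_inf[OF compact_Icc _ assms(1)] by auto
 thus ?thesis using assms(2) by blast
qed (auto intro: exI[of _ 1])

lemma continuous_upper_bound:
 fixes f :: "'a::topological_space => real"
 assumes "compact S" "continuous_on S f"
 shows "EX C>0. ALL p:S. abs (f p) <= C"
proof -
 have "bounded (f ` S)" using assms by (simp add: compact_continuous_image compact_imp_bounded)
 thus ?thesis unfolding bounded_pos by (auto)
qed

section \<open>Energy, norm and eigenpairs\<close>

definition sym_weights :: "('n => 'n => real) => bool" where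
 "sym_weights w \<longleftrightarrow> (ALL i j. w i j = w j i)"

text \<open>A halved sum over all ordered pairs, so that no order on the vertices is involved.
  Diagonal terms vanish because \<open>0 powr p = 0\<close>.\<close>

definition Ew :: "real => ('n::finite => 'n => real) => real ^ 'n => real" where
 "Ew p w x = (SUM i:UNIV. SUM j:UNIV. w i j * abs (x $ i - x $ j) powr p) / 2"

definition Nn :: "real => real ^ 'n::finite => real" where
 "Nn p x = (SUM i:UNIV. abs (x $ i) powr p)"

definition Rq :: "real => ('n::finite => 'n => real) => real ^ 'n => real" where
 "Rq p w x = Ew p w x / Nn p x"

text \<open>The residual of the eigenvalue equation. For symmetric weights and \<open>p > 1\<close>,
  \<open>p\<close> times this vector is the gradient of \<open>Ew p w - lam * Nn p\<close> at
  \<open>x\<close> with \<open>lam\<close> held fixed.\<close>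

definition Tv :: "real => ('n::finite => 'n => real) => real => real ^ 'n => real ^ 'n" where
 "Tv p w lam x = (\<chi> i. (SUM j:UNIV. w i j * Phi p (x $ i - x $ j)) - lam * Phi p (x $ i))"

lemma eigenpair_iff_Tv: "eigenpair p w lam x \<longleftrightarrow> x ~= 0 & Tv p w lam x = 0"
proof -
 have "(SUM j:UNIV - {i}. w i j * Phi p (x $ i - x $ j)) = (SUM j:UNIV. w i j * Phi p (x $ i - x $ j))" for i
 by (rule sum.mono_neutral_left) auto
 thus ?thesis
 unfolding eigenpair_def Tv_def by (auto simp: vec_eq_iff)
qed

lemma energy_eq_Ew:
 fixes w :: "'n::{finite,linorder} => 'n => real"
 assumes "sym_weights w"
 shows "energy p w x = Ew p w x"
proof -
 let ?f = "%(i, j). w i j * abs (x $ i - x $ j) powr p"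
 have "(SUM i:UNIV. SUM j:UNIV. w i j * abs (x $ i - x $ j) powr p) = sum ?f UNIV"
 by (simp add: sum.cartesian_product)
 also have "(UNIV :: ('n \<times> 'n) set) = {(i, j). i < j} Un ({(i, j). j < i} Un {(i, j). i = j})"
 by auto
 also have "sum ?f ... = sum ?f {(i, j). i < j} + (sum ?f {(i, j). j < i} + sum ?f {(i, j). i = j})"
 by (subst sum.union_disjoint; (auto simp: finite_subset[OF subset_UNIV])?)
 (subst sum.union_disjoint; auto simp: finite_subset[OF subset_UNIV])
 also have "sum ?f {(i, j). i = j} = 0"
 by (rule sum.neutral) auto
 also have "sum ?f {(i, j). j < i} = sum ?f {(i, j). i < j}"
 by (rule sum.reindex_bij_witness[of _ prod.swap prod.swap])
 (use assms in \<open>auto simp: sym_weights_def abs_minus_commute\<close>)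
 finally show ?thesis by (simp add: energy_def Ew_def)
qed

text \<open>Summation by parts: exchanging \<open>i\<close> and \<open>j\<close> preserves the
  weight and reverses the sign of \<open>Phi\<close>.\<close>

lemma sum_sym_Phi:
 assumes "sym_weights w"
 shows "(SUM i:UNIV. (SUM j:UNIV. w i j * Phi p (x $ i - x $ j)) * d i) =
 (SUM i:UNIV. SUM j:UNIV. w i j * Phi p (x $ i - x $ j) * (d i - d j)) / 2"
proof -
 have "(SUM i:UNIV. SUM j:UNIV. w i j * Phi p (x $ i - x $ j) * d j) =
 (SUM j:UNIV. SUM i:UNIV. w i j * Phi p (x $ i - x $ j) * d j)"
 by (rule sum.swap)
 also have "... = - (SUM i:UNIV. SUM j:UNIV. w i j * Phi p (x $ i - x $ j) * d i)"
 unfolding sum_negf[symmetric]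
 proof (intro sum.cong refl)
 fix i j
 have "w j i = w i j" using assms by (simp add: sym_weights_def)
 thus "w j i * Phi p (x $ j - x $ i) * d i = - (w i j * Phi p (x $ i - x $ j) * d i)"
 using Phi_diff_commute[of p "x $ j" "x $ i"] by simp
 qed
 finally show ?thesis
 by (simp add: right_diff_distrib sum_subtractf sum_distrib_right)
qed

lemma Nn_nonneg [simp]: "Nn p x >= 0"
 by (simp add: Nn_def sum_nonneg)

lemma Nn_pos:
 assumes "x ~= 0"
 shows "Nn p x > 0"
proof -
 obtain i where "x $ i ~= 0" using assms by (auto simp: vec_eq_iff)
 thus ?thesis unfolding Nn_def by (intro sum_pos2[of _ i]) auto
qed

lemma Tv_inner:
 assumes "sym_weights w"
 shows "Tv p w lam x \<bullet> d =
 (SUM i:UNIV. SUM j:UNIV. w i j * Phi p (x $ i - x $ j) * (d $ i - d $ j)) / 2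
 - lam * (SUM i:UNIV. Phi p (x $ i) * d $ i)"
 unfolding inner_vec_def Tv_def
 using sum_sym_Phi[OF assms, of p x "%i. d $ i"]
 by (simp add: left_diff_distrib sum_subtractf sum_distrib_left mult.assoc)

lemma Tv_inner_self:
 assumes "sym_weights w"
 shows "Tv p w lam x \<bullet> x = Ew p w x - lam * Nn p x"
 unfolding Tv_inner[OF assms] Ew_def Nn_def
 by (simp add: Phi_times_self mult.assoc)

lemma eigenpair_Rq:
 assumes "sym_weights w" "eigenpair p w lam x"
 shows "lam = Rq p w x"
proof -
 have "Tv p w lam x \<bullet> x = 0" "x ~= 0" using assms by (auto simp: eigenpair_iff_Tv)
 thus ?thesis
 using Nn_pos[of x p] unfolding Tv_inner_self[OF assms(1)] Rq_def by (simp add: field_simps)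
qed

lemma Ew_pos:
 fixes x :: "real ^ 'n::finite"
 assumes "!!i j. w i j >= 0" "!!i j. i ~= j ==> w i j > 0" "\<nexists>c. x = c *\<^sub>R 1"
 shows "Ew p w x > 0"
proof -
 obtain k :: 'n where True by blast
 obtain i where i: "x $ i ~= x $ k"
 using assms(3) by (auto simp: vec_eq_iff)
 hence "i ~= k" by auto
 have "(SUM i:UNIV. SUM j:UNIV. w i j * abs (x $ i - x $ j) powr p) > 0"
 proof (rule sum_pos2[of _ i])
 show "0 < (SUM j:UNIV. w i j * abs (x $ i - x $ j) powr p)"
 by (rule sum_pos2[of _ k]) (use assms i \<open>i ~= k\<close> in auto)
 qed (use assms in \<open>auto intro: sum_nonneg\<close>)
 thus ?thesis by (simp add: Ew_def)
qed

text \<open>Pairing the equation with the vector 1 annihilates the graph part and leaves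
  \<open>lam\<close> times the sum; \<open>lam\<close> is positive because a nonconstant vector has
  positive energy.\<close>

lemma eigenpair_sum_Phi:
 assumes "sym_weights w" "!!i j. w i j >= 0" "!!i j. i ~= j ==> w i j > 0"
 and "eigenpair p w lam x" "\<nexists>c. x = c *\<^sub>R 1"
 shows "lam > 0" "(SUM i:UNIV. Phi p (x $ i)) = 0"
proof -
 have T: "Tv p w lam x = 0" and "x ~= 0" using assms(4) by (auto simp: eigenpair_iff_Tv)
 moreover have "Ew p w x > 0" by (rule Ew_pos[OF assms(2,3,5)])
 ultimately show *: "lam > 0"
 using eigenpair_Rq[OF assms(1,4)] Nn_pos[of x p] by (simp add: Rq_def)
 have "Tv p w lam x \<bullet> 1 = 0" using T by simp
 thus "(SUM i:UNIV. Phi p (x $ i)) = 0"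
 unfolding Tv_inner[OF assms(1)] using * by simp
qed

lemma eigenpair_scale:
 assumes "c ~= 0"
 shows "eigenpair p w lam (c *\<^sub>R x) \<longleftrightarrow> eigenpair p w lam x"
proof -
 have "Phi p (c * s - c * t) = Phi p c * Phi p (s - t)" for s t
 by (simp add: Phi_mult flip: right_diff_distrib)
 hence "Tv p w lam (c *\<^sub>R x) = Phi p c *\<^sub>R Tv p w lam x"
 unfolding Tv_def vec_eq_iff
 by (simp add: Phi_mult sum_distrib_left right_diff_distrib mult.left_commute)
 thus ?thesis using assms by (simp add: eigenpair_iff_Tv)
qed

lemma eigenpair_weight_scale:
 assumes "M ~= 0"
 shows "eigenpair p (%i j. M * w i j) (M * lam) x \<longleftrightarrow> eigenpair p w lam x"
proof -
 have "Tv p (%i j. M * w i j) (M * lam) x = M *\<^sub>R Tv p w lam x"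
 unfolding Tv_def vec_eq_iff
 by (simp add: sum_distrib_left algebra_simps)
 thus ?thesis using assms by (simp add: eigenpair_iff_Tv)
qed

lemma Ew_scale: "Ew p w (c *\<^sub>R x) = abs c powr p * Ew p w x"
 unfolding Ew_def
 by (simp add: right_diff_distrib[symmetric] abs_mult powr_mult sum_distrib_left mult.left_commute)

lemma Nn_scale: "Nn p (c *\<^sub>R x) = abs c powr p * Nn p x"
 unfolding Nn_def by (simp add: abs_mult powr_mult sum_distrib_left)

lemma Rq_scale: "c ~= 0 ==> Rq p w (c *\<^sub>R x) = Rq p w x"
 by (simp add: Rq_def Ew_scale Nn_scale)

lemma has_derivative_abs_powr_linear:
 assumes "p > 1" "bounded_linear L"
 shows "((%x. abs (L x) powr p) has_derivative (%d. p * Phi p (L x) * L d)) (at x within S)"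
proof -
 have "((%t. abs t powr p) has_derivative (%d. p * Phi p (L x) * d)) (at (L x) within L ` S)"
 using DERIV_abs_powr[OF assms(1), of "L x"]
 by (auto simp: has_field_derivative_def intro: has_derivative_at_withinI)
 from has_derivative_in_compose[OF bounded_linear_imp_has_derivative[OF assms(2)] this]
 show ?thesis by simp
qed

lemma has_derivative_Ew:
 assumes "p > 1" "sym_weights w"
 shows "(Ew p w has_derivative (%d. SUM i:UNIV. p * (SUM j:UNIV. w i j * Phi p (x $ i - x $ j)) * d $ i)) (at x within S)"
proof -
 have *: "bounded_linear (%x :: real ^ 'a. x $ i - x $ j)" for i j
 by (intro bounded_linear_sub bounded_linear_vec_nth)
 have "(Ew p w has_derivative
 (%d. (SUM i:UNIV. SUM j:UNIV. w i j * (p * Phi p (x $ i - x $ j) * (d $ i - d $ j))) / 2)) (at x within S)"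
 unfolding Ew_def[abs_def] divide_inverse
 by (intro has_derivative_mult_left has_derivative_sum has_derivative_mult_right
 has_derivative_abs_powr_linear[OF assms(1)] *)
 moreover have "(SUM i:UNIV. SUM j:UNIV. w i j * (p * Phi p (x $ i - x $ j) * (d $ i - d $ j))) / 2
 = (SUM i:UNIV. p * (SUM j:UNIV. w i j * Phi p (x $ i - x $ j)) * d $ i)" for d :: "real ^ 'a"
 using arg_cong[OF sum_sym_Phi[OF assms(2), of p x "%i. d $ i"], of "%u. p * u"]
 by (simp add: sum_distrib_left mult_ac)
 ultimately show ?thesis by simp
qed

lemma has_derivative_Nn:
 assumes "p > 1"
 shows "(Nn p has_derivative (%d. SUM i:UNIV. p * Phi p (x $ i) * d $ i)) (at x within S)"
 unfolding Nn_def[abs_def]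
 by (intro has_derivative_sum has_derivative_abs_powr_linear[OF assms(1)] bounded_linear_vec_nth)

definition gR :: "real => ('n::finite => 'n => real) => real ^ 'n => real ^ 'n" where
 "gR p w x = (p / Nn p x) *\<^sub>R Tv p w (Rq p w x) x"

lemma has_derivative_Rq:
 assumes "p > 1" "sym_weights w" "x ~= 0"
 shows "(Rq p w has_derivative (%d. gR p w x \<bullet> d)) (at x within S)"
proof -
 let ?E' = "%d. SUM i:UNIV. p * (SUM j:UNIV. w i j * Phi p (x $ i - x $ j)) * d $ i"
 let ?N' = "%d. SUM i:UNIV. p * Phi p (x $ i) * d $ i"
 have N: "Nn p x > 0" using Nn_pos assms by blast
 have "(Rq p w has_derivative (%d. (?E' d * Nn p x - Ew p w x * ?N' d) / (Nn p x * Nn p x))) (at x within S)"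
 unfolding Rq_def[abs_def]
 by (rule has_derivative_divide'[OF has_derivative_Ew has_derivative_Nn]) (use assms N in auto)
 moreover have "(?E' d * Nn p x - Ew p w x * ?N' d) / (Nn p x * Nn p x) = gR p w x \<bullet> d" for d
 proof -
 have "?E' d - Rq p w x * ?N' d = p * (Tv p w (Rq p w x) x \<bullet> d)"
 unfolding Tv_def inner_vec_def
 by (simp add: sum_distrib_left sum_subtractf left_diff_distrib right_diff_distrib mult_ac)
 thus ?thesis using N
 by (simp add: gR_def Rq_def field_simps)
 qed
 ultimately show ?thesis by simp
qed

lemma continuous_on_Ew [continuous_intros]: "p > 0 ==> continuous_on S (Ew p w)"
 unfolding Ew_def[abs_def] by (intro continuous_intros) auto

lemma continuous_on_Nn [continuous_intros]: "p > 0 ==> continuous_on S (Nn p)"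
 unfolding Nn_def[abs_def] by (intro continuous_intros) auto

lemma continuous_on_Rq: "p > 0 ==> 0 ~: S ==> continuous_on S (Rq p w)"
 unfolding Rq_def[abs_def]
 by (intro continuous_intros) (auto, metis Nn_pos less_irrefl)

lemma continuous_on_gR:
 assumes "p > 1" "0 ~: S"
 shows "continuous_on S (gR p w)"
proof -
 have "Nn p x ~= 0" if "x : S" for x using Nn_pos[of x p] that assms by force
 thus ?thesis
 unfolding gR_def[abs_def] Tv_def
 by (intro continuous_intros continuous_on_Rq) (use assms in auto)
qed

lemma gR_eq_0_imp_eigenpair:
 assumes "p > 1" "x ~= 0" "gR p w x = 0"
 shows "eigenpair p w (Rq p w x) x"
 using assms Nn_pos[of x p] by (simp add: gR_def eigenpair_iff_Tv)

section \<open>Eigenvectors of the uniform complete graph\<close>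

abbreviation unit_weights :: "'n => 'n => real" where
 "unit_weights \<equiv> %_ _. 1"

lemma sym_unit_weights [simp]: "sym_weights unit_weights"
 by (simp add: sym_weights_def)

definition pair_ok :: "'n set => 'n set => bool" where
 "pair_ok A B \<longleftrightarrow> A ~= {} & B ~= {} & A Int B = {}"

definition cr :: "real => nat => real" where
 "cr p k = real k powr (1 / (p - 1))"

text \<open>The normalisation makes \<open>Phi\<close> of the entries equal to
  \<open>card B\<close>, \<open>- card A\<close> and 0, which sum to 0 over all vertices. For
  \<open>p > 1\<close> every nonzero entry and every nonzero gap has modulus at least 1.\<close>

definition base :: "real => 'n::finite set => 'n set => real ^ 'n" where
 "base p A B = (\<chi> i. if i : A then cr p (card B) else if i : B then - cr p (card A) else 0)"

text \<open>Read off at a vertex of \<open>A\<close>: after division by \<open>Phi = card B\<close>,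
  each vertex outside \<open>A Un B\<close> contributes 1, and the \<open>card B\<close> vertices of
  \<open>B\<close> together contribute the power.\<close>

definition lam0 :: "real => 'n::finite set => 'n set => real" where
 "lam0 p A B = real (card (- (A Un B))) + (cr p (card A) + cr p (card B)) powr (p - 1)"

lemma pair_okD:
 fixes A B :: "'n::finite set"
 assumes "pair_ok A B"
 shows "card A >= 1" "card B >= 1" "A Int B = {}"
 using assms by (auto simp: pair_ok_def Suc_le_eq card_gt_0_iff)

lemma cr_ge_1: "p > 1 ==> k >= 1 ==> cr p k >= 1"
 by (simp add: cr_def ge_one_powr_ge_zero)

lemma cr_powr: "p > 1 ==> k >= 1 ==> cr p k powr (p - 1) = real k"
 by (simp add: cr_def powr_powr)

lemma Phi_cr: "p > 1 ==> k >= 1 ==> Phi p (cr p k) = real k"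
 using cr_ge_1[of p k] by (simp add: Phi_pos_eq cr_powr)

lemma sum_UNIV_split:
 fixes A B :: "'n::finite set"
 assumes "A Int B = {}"
 shows "sum f UNIV = sum f A + sum f B + sum f (- (A Un B))"
proof -
 have "sum f ((A Un B) Un - (A Un B)) = sum f A + sum f B + sum f (- (A Un B))"
 using assms by (subst sum.union_disjoint) (auto simp: sum.union_disjoint)
 thus ?thesis by (simp only: Compl_partition)
qed

lemma Phi_base:
 assumes "p > 1" "pair_ok A B"
 shows "Phi p (base p A B $ i) = (if i : A then real (card B) else if i : B then - real (card A) else 0)"
 using assms pair_okD[OF assms(2)] by (simp add: base_def Phi_cr)

lemma base_nonzero:
 assumes "p > 1" "pair_ok A B"
 shows "base p A B ~= 0"
proof -
 obtain i where "i : A" using assms by (auto simp: pair_ok_def)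
 hence "base p A B $ i >= 1" using assms pair_okD[OF assms(2)] by (simp add: base_def cr_ge_1)
 thus ?thesis by auto
qed

lemma eigenpair_base:
 assumes "p > 1" "pair_ok A B"
 shows "eigenpair p unit_weights (lam0 p A B) (base p A B)"
proof -
 note ok = pair_okD[OF assms(2)]
 let ?al = "cr p (card B)" and ?be = "cr p (card A)"
 have pos: "?al >= 1" "?be >= 1" using assms ok by (auto intro: cr_ge_1)
 have P: "Phi p ?al = card B" "Phi p ?be = card A" using assms ok by (auto intro: Phi_cr)
 define S where "S = (?be + ?al) powr (p - 1)"
 have P2: "Phi p (?al + ?be) = S" "Phi p (?be + ?al) = S" "Phi p (- (?al + ?be)) = - S"
 using pos Phi_pos_eq[of "?al + ?be" p] Phi_diff_commute[of p 0 "?al + ?be"] Phi_minus[of p "?al + ?be"]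
 by (simp_all add: add.commute S_def)
 have P3: "Phi p (- ?be - ?al) = - S" "Phi p (- ?al - ?be) = - S"
 using P2(1,2) by (metis Phi_minus minus_add_distrib diff_conv_add_uminus)+
 have AB: "j ~: A" if "j : B" for j using that ok by auto
 have bA: "base p A B $ j = ?al" if "j : A" for j using that by (simp add: base_def)
 have bB: "base p A B $ j = - ?be" if "j : B" for j using that AB by (simp add: base_def)
 have bZ: "base p A B $ j = 0" if "j : - (A Un B)" for j using that by (simp add: base_def)
 have "Tv p unit_weights (lam0 p A B) (base p A B) $ i = 0" for i
 proof -
 have "(SUM j:UNIV. Phi p (base p A B $ i - base p A B $ j)) =
 card A * Phi p (base p A B $ i - ?al) + card B * Phi p (base p A B $ i + ?be)
 + card (- (A Un B)) * Phi p (base p A B $ i)"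
 unfolding sum_UNIV_split[OF ok(3)] using bA bB bZ by simp
 also have "... = lam0 p A B * Phi p (base p A B $ i)"
 proof -
 consider "i : A" | "i : B" | "i : - (A Un B)" by blast
 thus ?thesis
 using P3 by cases (simp_all add: bA bB bZ P P2(1,2) lam0_def S_def[symmetric] distrib_left distrib_right mult_ac)
 qed
 finally show ?thesis by (simp add: Tv_def)
 qed
 thus ?thesis using base_nonzero[OF assms] by (simp add: eigenpair_iff_Tv vec_eq_iff)
qed

text \<open>For an eigenvector \<open>x\<close> and an entry \<open>t = x\<^sub>i > 0\<close>, adding the relation
  \<open>\<Sum> \<Phi>(x\<^sub>j) = 0\<close> to the eigenvalue equation and dividing by \<open>\<Phi>(t)\<close> gives
  \<open>\<Sum>\<^sub>j mfun(x\<^sub>j / t) = \<lambda>\<close>. Comparing the smallest with the largest positive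
  entry shows that all positive entries agree.\<close>

definition mfun :: "real => real => real" where
 "mfun p c = Phi p (1 - c) + Phi p c"

lemma mfun_0 [simp]: "mfun p 0 = 1"
 by (simp add: mfun_def Phi_def)

text \<open>For negative \<open>c\<close> one has \<open>|c| < |1 - c|\<close>, so the two summands
  of the derivative compare strictly. The factor \<open>sgn (p - 2)\<close> treats both directions
  at once.\<close>

lemma mfun_neg_mono:
 assumes "p > 1" "p ~= 2" "c < d" "d <= 0"
 shows "sgn (p - 2) * mfun p d < sgn (p - 2) * mfun p c"
proof (rule DERIV_neg_imp_decreasing_open[OF assms(3)])
 fix x assume x: "c < x" "x < d"
 have D: "((%c. sgn (p - 2) * mfun p c) has_real_derivative
 sgn (p - 2) * ((p - 1) * abs (1 - x) powr (p - 2) * (0 - 1) + (p - 1) * abs x powr (p - 2))) (at x)"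
 unfolding mfun_def[abs_def]
 by (intro DERIV_cmult DERIV_add DERIV_chain2[OF DERIV_Phi_nz] DERIV_diff DERIV_const DERIV_ident DERIV_Phi_nz)
 (use x assms in auto)
 have "sgn (p - 2) * (abs x powr (p - 2) - abs (1 - x) powr (p - 2)) < 0"
 proof (cases "p > 2")
 case True
 hence "abs x powr (p - 2) < abs (1 - x) powr (p - 2)"
 using x assms by (intro powr_less_mono2) auto
 thus ?thesis using True by simp
 next
 case False
 hence "abs (1 - x) powr (p - 2) < abs x powr (p - 2)"
 using x assms by (intro powr_less_mono2_neg) auto
 thus ?thesis using False assms by simp
 qed
 hence "(p - 1) * (sgn (p - 2) * (abs x powr (p - 2) - abs (1 - x) powr (p - 2))) < 0"
 using assms by (simp add: mult_pos_neg)
 hence "sgn (p - 2) * ((p - 1) * abs (1 - x) powr (p - 2) * (0 - 1) + (p - 1) * abs x powr (p - 2)) < 0"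
 by (simp add: algebra_simps)
 with D show "EX y. ((%c. sgn (p - 2) * mfun p c) has_real_derivative y) (at x) & y < 0" by blast
next
 show "continuous_on {c..d} (%c. sgn (p - 2) * mfun p c)"
 unfolding mfun_def[abs_def] by (intro continuous_intros) (use assms in auto)
qed

lemma mfun_ge1:
 assumes "p > 1" "p ~= 2" "c >= 1"
 shows "sgn (p - 2) <= sgn (p - 2) * mfun p c"
proof -
 have "mfun p c = mfun p (1 - c)" by (simp add: mfun_def)
 thus ?thesis
 using mfun_neg_mono[of p "1 - c" 0] assms by (cases "c = 1") (simp_all add: less_imp_le)
qed

lemma mfun_le1:
 assumes "p > 1" "p ~= 2" "0 <= c" "c <= 1"
 shows "sgn (p - 2) * mfun p c <= sgn (p - 2)"
proof (cases "c = 0 | c = 1")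
 case True
 thus ?thesis by (auto simp: mfun_def Phi_def)
next
 case False
 hence c: "0 < c" "c < 1" using assms by auto
 have m: "mfun p c = (1 - c) powr (p - 1) + c powr (p - 1)"
 using c by (simp add: mfun_def Phi_pos_eq)
 show ?thesis
 proof (cases "p > 2")
 case True
 have "u powr (p - 1) <= u" if "0 < u" "u < 1" for u
 using powr_mono'[of 1 "p - 1" u] that True by simp
 from this[of c] this[of "1 - c"] show ?thesis using c True m by simp
 next
 case False
 have "u <= u powr (p - 1)" if "0 < u" "u < 1" for u
 using powr_mono'[of "p - 1" 1 u] that False by simp
 from this[of c] this[of "1 - c"] show ?thesis using c False assms m by simp
 qed
qed

lemma uniform_positive_entries_eq:
 fixes x :: "real ^ 'n::finite"
 assumes p: "p > 1" "p ~= 2" and T: "Tv p unit_weights lam x = 0"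
 and s0: "(SUM i:UNIV. Phi p (x $ i)) = 0"
 and ik: "x $ i > 0" "x $ k > 0"
 shows "x $ i = x $ k"
proof -
 define s where "s = sgn (p - 2)"
 let ?P = "{i. x $ i > 0}"
 have eqn: "(SUM j:UNIV. mfun p (x $ j / x $ i)) = lam" if "x $ i > 0" for i
 proof -
 have "Tv p unit_weights lam x $ i = 0" using T by simp
 hence "(SUM j:UNIV. Phi p (x $ i - x $ j)) + (SUM j:UNIV. Phi p (x $ j)) = lam * Phi p (x $ i)"
 using s0 by (simp add: Tv_def)
 moreover have "Phi p (x $ i - x $ j) + Phi p (x $ j) = mfun p (x $ j / x $ i) * Phi p (x $ i)" for j
 unfolding mfun_def using that
 by (simp add: distrib_right Phi_mult[symmetric] left_diff_distrib)
 ultimately have "(SUM j:UNIV. mfun p (x $ j / x $ i)) * Phi p (x $ i) = lam * Phi p (x $ i)"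
 by (simp add: sum.distrib[symmetric] sum_distrib_right)
 thus ?thesis using that by auto
 qed
 define M where "M = Max ((%i. x $ i) ` ?P)"
 define mu where "mu = Min ((%i. x $ i) ` ?P)"
 have "M : (%i. x $ i) ` ?P" unfolding M_def by (rule Max_in) (use ik in auto)
 then obtain iM where iM: "x $ iM = M" "M > 0" by auto
 have "mu : (%i. x $ i) ` ?P" unfolding mu_def by (rule Min_in) (use ik in auto)
 then obtain im where im: "x $ im = mu" "mu > 0" by auto
 have bd: "mu <= x $ j & x $ j <= M" if "x $ j > 0" for j
 using that unfolding M_def mu_def by (auto intro: Max_ge Min_le)
 have "mu = M"
 proof (rule ccontr)
 assume "mu ~= M"
 hence lt: "mu < M" using bd[of im] im by auto
 \<comment> \<open>The balance \<open>s0\<close> forces a negative entry, and at such an index the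
   termwise comparison of the two sums is strict.\<close>
 have "EX j. x $ j < 0"
 proof (rule ccontr)
 assume "~ ?thesis"
 hence "!!j. Phi p (x $ j) >= 0" by (metis Phi_neg_iff not_le)
 moreover have "Phi p (x $ iM) > 0" using iM by simp
 ultimately have "(SUM i:UNIV. Phi p (x $ i)) > 0" by (intro sum_pos2[of _ iM]) auto
 thus False using s0 by simp
 qed
 then obtain n where n: "x $ n < 0" by blast
 have neg: "s * mfun p (x $ j / M) < s * mfun p (x $ j / mu)" if "x $ j < 0" for j
 unfolding s_def
 by (rule mfun_neg_mono[OF p]) (use that im iM lt in \<open>auto simp: field_simps\<close>)
 have all: "s * mfun p (x $ j / M) <= s * mfun p (x $ j / mu)" for j
 proof (cases "x $ j" "0::real" rule: linorder_cases)
 case less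
 thus ?thesis using neg by (simp add: less_imp_le)
 next
 case greater
 have "s * mfun p (x $ j / M) <= s"
 unfolding s_def by (rule mfun_le1[OF p]) (use greater bd[of j] iM in auto)
 moreover have "s <= s * mfun p (x $ j / mu)"
 unfolding s_def by (rule mfun_ge1[OF p]) (use greater bd[of j] im in auto)
 ultimately show ?thesis by simp
 qed simp
 have "(SUM j:UNIV. s * mfun p (x $ j / M)) < (SUM j:UNIV. s * mfun p (x $ j / mu))"
 by (rule sum_strict_mono_ex1) (use all neg n in auto)
 moreover have "(SUM j:UNIV. s * mfun p (x $ j / M)) = s * lam" "(SUM j:UNIV. s * mfun p (x $ j / mu)) = s * lam"
 using eqn[of iM] eqn[of im] im iM by (simp_all add: sum_distrib_left[symmetric])
 ultimately show False by simp
 qed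
 thus ?thesis using bd[of i] bd[of k] ik by simp
qed

text \<open>\<open>uniform_positive_entries_eq\<close> for \<open>x\<close> and for
  \<open>- x\<close> leaves one positive and one negative value. The balance
  \<open>card A * Phi p al = card B * Phi p be\<close> then fixes their ratio, so the vector is a
  multiple of a base vector.\<close>

lemma uniform_eigenvector:
 fixes x :: "real ^ 'n::finite"
 assumes p: "p > 1" "p ~= 2" and e: "eigenpair p unit_weights lam x" and nc: "\<nexists>c. x = c *\<^sub>R 1"
 obtains A B s where "pair_ok A B" "s > 0" "x = s *\<^sub>R base p A B" "lam = lam0 p A B"
proof -
 have T: "Tv p unit_weights lam x = 0" and x0: "x ~= 0" using e by (auto simp: eigenpair_iff_Tv)
 have s0: "(SUM i:UNIV. Phi p (x $ i)) = 0"
 using eigenpair_sum_Phi(2)[OF sym_unit_weights _ _ e nc] by simp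
 have e': "eigenpair p unit_weights lam (- x)" using eigenpair_scale[of "-1" p unit_weights lam x] e by simp
 hence T': "Tv p unit_weights lam (- x) = 0" by (simp add: eigenpair_iff_Tv)
 have s0': "(SUM i:UNIV. Phi p ((- x) $ i)) = 0" using s0 by (simp add: sum_negf)
 define A where "A = {i. x $ i > 0}"
 define B where "B = {i. x $ i < 0}"
 have disj: "A Int B = {}" by (auto simp: A_def B_def)
 have sp: "sum (%i. Phi p (x $ i)) A + sum (%i. Phi p (x $ i)) B = 0"
 using s0 unfolding sum_UNIV_split[OF disj]
 by (simp add: sum.neutral A_def B_def)
 have "A ~= {} | B ~= {}" using x0 by (auto simp: A_def B_def vec_eq_iff neq_iff)
 moreover have "sum (%i. Phi p (x $ i)) A > 0" if "A ~= {}"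
 by (rule sum_pos) (use that in \<open>auto simp: A_def\<close>)
 moreover have "sum (%i. Phi p (x $ i)) B < 0" if "B ~= {}"
 using sum_strict_mono[of B "%i. Phi p (x $ i)" "%_. 0"] that by (auto simp: B_def)
 ultimately have ok: "pair_ok A B" using sp disj unfolding pair_ok_def
 by (metis add.commute add.right_neutral less_irrefl sum.empty)
 then obtain i0 j0 where i0: "i0 : A" and j0: "j0 : B" by (auto simp: pair_ok_def)
 note okD = pair_okD[OF ok]
 define al where "al = x $ i0"
 define be where "be = - x $ j0"
 have pos: "al > 0" "be > 0" using i0 j0 by (auto simp: al_def be_def A_def B_def)
 have xA: "x $ i = al" if "i : A" for i
 using uniform_positive_entries_eq[OF p T s0, of i i0] that i0 by (auto simp: A_def al_def)
 have xB: "x $ i = - be" if "i : B" for i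
 using uniform_positive_entries_eq[OF p T' s0', of i j0] that j0 by (auto simp: B_def be_def)
 have xZ: "x $ i = 0" if "i ~: A" "i ~: B" for i using that by (auto simp: A_def B_def)
 have bal: "card A * Phi p al = card B * Phi p be"
 using sp xA xB by simp
 define s where "s = al / cr p (card B)"
 have c1: "cr p (card B) >= 1" "cr p (card A) >= 1" using okD p by (auto intro: cr_ge_1)
 have s: "s > 0" using pos c1 by (simp add: s_def)
 have al: "al = s * cr p (card B)" using c1 by (simp add: s_def)
 have "card B * Phi p be = card B * Phi p (s * cr p (card A))"
 using bal okD p unfolding al by (auto simp: Phi_mult Phi_cr mult_ac)
 hence "Phi p be = Phi p (s * cr p (card A))" using okD by (metis mult_cancel_left not_one_le_zero of_nat_eq_0_iff)
 hence "be = s * cr p (card A)" using p by (simp add: Phi_inject)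
 with al xA xB xZ have xb: "x = s *\<^sub>R base p A B"
 using disj by (auto simp: vec_eq_iff base_def)
 have "eigenpair p unit_weights (lam0 p A B) x"
 unfolding xb using s eigenpair_base[OF p(1) ok] by (subst eigenpair_scale) auto
 hence "lam = lam0 p A B" using e eigenpair_Rq[OF sym_unit_weights] by metis
 with that ok s xb show thesis by blast
qed

lemma powr_add_le_sum:
 fixes x y q :: real
 assumes "x > 0" "y > 0" "0 < q" "q <= 1"
 shows "(x + y) powr q <= x powr q + y powr q"
proof -
 have *: "u / (x + y) <= u powr q / (x + y) powr q" if "0 < u" "u <= x + y" for u
 using powr_mono'[of q 1 "u / (x + y)"] that assms by (simp add: powr_divide)
 have "1 = x / (x + y) + y / (x + y)" using assms by (simp add: add_divide_distrib[symmetric])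
 also have "... <= x powr q / (x + y) powr q + y powr q / (x + y) powr q"
 using assms by (intro add_mono *) auto
 finally show ?thesis using assms by (simp add: add_divide_distrib[symmetric] field_simps)
qed

lemma card_blocks:
 fixes A B :: "'n::finite set"
 assumes "A Int B = {}"
 shows "card A + card B + card (- (A Un B)) = CARD('n)"
 using sum_UNIV_split[OF assms, of "%_. 1::nat"] by simp

lemma lam0_ge:
 assumes "p > 1" "pair_ok A B"
 shows "lam0 p A B >= card (- (A Un B)) + 1"
proof -
 have "cr p (card A) >= 1" "cr p (card B) >= 1" using assms pair_okD[OF assms(2)] by (auto intro: cr_ge_1)
 hence "(cr p (card A) + cr p (card B)) powr (p - 1) >= 1"
 using assms by (intro ge_one_powr_ge_zero) auto
 thus ?thesis by (simp add: lam0_def)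
qed

text \<open>The quotient attains its maximum at an eigenvector, and all eigenvalues are explicit;
  for \<open>p < 2\<close> subadditivity of \<open>t powr (p - 1)\<close> bounds each of them by the
  number of vertices. The sharp constant is what later makes the singular part on the zero block
  negative.\<close>

lemma Ew_unit_le:
 fixes x :: "real ^ 'n::finite"
 assumes p: "1 < p" "p < 2"
 shows "Ew p unit_weights x <= real CARD('n) * Nn p x"
proof -
 obtain i0 :: 'n where True by blast
 let ?S = "sphere (0 :: real ^ 'n) 1"
 have "?S ~= {}" using norm_axis_1[of i0] by (metis dist_0_norm empty_iff mem_sphere)
 moreover have "continuous_on ?S (Rq p unit_weights)" using p by (intro continuous_on_Rq) auto
 ultimately obtain z where z: "z : ?S" "!!y. y : ?S ==> Rq p unit_weights y <= Rq p unit_weights z"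
 using continuous_attains_sup[of ?S "Rq p (unit_weights :: 'n => _)"] compact_sphere by blast
 have z0: "z ~= 0" using z by auto
 have glob: "Rq p unit_weights y <= Rq p unit_weights z" if "y ~= 0" for y :: "real ^ 'n"
 using z(2)[of "(1 / norm y) *\<^sub>R y"] Rq_scale[of "1 / norm y" p unit_weights y] that by simp
 have "(%d. gR p unit_weights z \<bullet> d) = (%d. 0)"
 by (rule differential_zero_maxmin[of z "- {0}" "Rq p unit_weights"])
 (use z0 glob p in \<open>auto intro!: has_derivative_Rq\<close>)
 hence "gR p unit_weights z \<bullet> gR p unit_weights z = 0" by metis
 hence e: "eigenpair p unit_weights (Rq p unit_weights z) z"
 using gR_eq_0_imp_eigenpair[of p z unit_weights] p z0 by simp
 have "Rq p unit_weights z <= CARD('n)"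
 proof (cases "EX c. z = c *\<^sub>R 1")
 case True
 hence "Ew p unit_weights z = 0" by (auto simp: Ew_def)
 thus ?thesis by (simp add: Rq_def)
 next
 case False
 obtain A B :: "'n set" and s where AB: "pair_ok A B" "Rq p unit_weights z = lam0 p A B"
 by (rule uniform_eigenvector[OF p(1) _ e False]) (use p in blast)+
 note okD = pair_okD[OF AB(1)]
 have c1: "cr p (card B) >= 1" "cr p (card A) >= 1" using okD p by (auto intro: cr_ge_1)
 have "(cr p (card A) + cr p (card B)) powr (p - 1) <= real (card A) + card B"
 using powr_add_le_sum[of "cr p (card A)" "cr p (card B)" "p - 1"] c1 p okD by (simp add: cr_powr)
 thus ?thesis using AB card_blocks[OF okD(3)] by (simp add: lam0_def)
 qed
 hence "x ~= 0 ==> Rq p unit_weights x <= CARD('n)" using glob[of x] by linarith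
 thus ?thesis
 using Nn_pos[of x p] by (cases "x = 0") (auto simp: Rq_def field_simps Ew_def)
qed

section \<open>Second order expansion at the eigenvectors of the uniform graph\<close>

text \<open>The remainder has to be uniform in \<open>p\<close> and in the gap \<open>y\<close>,
  which is bounded away from 0 and from above. Negative \<open>y\<close> follow from positive ones
  by reflection.\<close>

lemma taylor_abs_powr:
 fixes l r Y eta :: real
 assumes "1 < l" "0 < eta"
 shows "EX dl>0. ALL p:{l..r}. ALL y t. 1 <= abs y --> abs y <= Y --> abs t <= dl -->
 abs (abs (y + t) powr p - abs y powr p - p * Phi p y * t - p * (p - 1) / 2 * abs y powr (p - 2) * t^2) <= eta * t^2"
proof -
 \<comment> \<open>The margin 1/2 below and the room up to \<open>Y + 1\<close> keep the
   intermediate point of Taylor's formula in a compact set, on which the second derivative is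
   uniformly continuous jointly with \<open>p\<close>.\<close>
 define K where "K = {l..r} \<times> {1/2..Y+1}"
 define k where "k = (%(p, u). p * (p - 1) * u powr (p - 2) :: real)"
 have "uniformly_continuous_on K k"
 unfolding K_def k_def case_prod_beta
 by (intro compact_uniformly_continuous compact_Times compact_Icc continuous_intros) auto
 then obtain dl0 where dl0: "dl0 > 0" "!!u v. u : K ==> v : K ==> dist v u < dl0 ==> dist (k v) (k u) < 2 * eta"
 using assms unfolding uniformly_continuous_on_def by (metis mult_pos_pos zero_less_numeral)
 define dl where "dl = min (1/2) (dl0 / 2)"
 have pos: "abs ((y + t) powr p - y powr p - p * y powr (p - 1) * t - p * (p - 1) / 2 * y powr (p - 2) * t^2) <= eta * t^2"
 if p: "p : {l..r}" and y: "1 <= y" "y <= Y" and t: "abs t <= dl" for p y t :: real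
 proof (cases "t = 0")
 case False
 define D where "D = (%(m::nat) u. if m = 0 then u powr p else if m = 1 then p * u powr (p - 1) else p * (p - 1) * u powr (p - 2) :: real)"
 have t': "abs t <= 1/2" "abs t < dl0" using t dl0 by (auto simp: dl_def)
 have "EX s. (if y + t < y then y + t < s & s < y else y < s & s < y + t) &
 (y + t) powr p = (SUM m<2. D m y / fact m * (y + t - y) ^ m) + D 2 s / fact 2 * (y + t - y) ^ 2"
 proof (rule Taylor[where a = "y - 1/2" and b = "y + 1/2"])
 show "D 0 = (%u. u powr p)" by (simp add: D_def)
 show "ALL m s. m < 2 & y - 1/2 <= s & s <= y + 1/2 --> DERIV (D m) s :> D (Suc m) s"
 proof (intro allI impI)
 fix m :: nat and s :: real assume as: "m < 2 & y - 1/2 <= s & s <= y + 1/2"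
 hence s: "s > 0" using y by auto
 have "m = 0 | m = 1" using as by auto
 thus "DERIV (D m) s :> D (Suc m) s"
 using s by (auto simp: D_def diff_diff_eq2 intro!: derivative_eq_intros)
 qed
 qed (use t' False in auto)
 then obtain s where s1: "if y + t < y then y + t < s & s < y else y < s & s < y + t"
 and s2: "(y + t) powr p = (SUM m<2. D m y / fact m * (y + t - y) ^ m) + D 2 s / fact 2 * (y + t - y) ^ 2"
 by blast
 have s: "abs (s - y) <= abs t" using s1 by (auto split: if_splits)
 have eq: "(y + t) powr p = y powr p + p * y powr (p - 1) * t + p * (p - 1) * s powr (p - 2) / 2 * t^2"
 unfolding s2 by (simp add: D_def numeral_2_eq_2)
 have "dist (k (p, s)) (k (p, y)) < 2 * eta"
 by (rule dl0(2)) (use p y s t' in \<open>auto simp: K_def dist_Pair_Pair dist_real_def\<close>)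
 hence kk: "abs (k (p, s) - k (p, y)) <= 2 * eta" by (simp add: dist_real_def)
 have D: "(y + t) powr p - y powr p - p * y powr (p - 1) * t - p * (p - 1) / 2 * y powr (p - 2) * t^2
 = (k (p, s) - k (p, y)) / 2 * t^2"
 unfolding eq k_def by (simp add: field_simps)
 show ?thesis unfolding D using mult_right_mono[OF kk, of "t^2 / 2"] by (simp add: abs_mult)
 qed simp
 show ?thesis
 proof (intro exI[of _ dl] conjI ballI allI impI)
 show "dl > 0" using dl0 by (simp add: dl_def)
 fix p y t :: real
 assume as: "p : {l..r}" "1 <= abs y" "abs y <= Y" "abs t <= dl"
 have t': "abs t <= 1/2" using as by (auto simp: dl_def)
 show "abs (abs (y + t) powr p - abs y powr p - p * Phi p y * t - p * (p - 1) / 2 * abs y powr (p - 2) * t^2) <= eta * t^2"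
 proof (cases "y > 0")
 case True
 thus ?thesis using pos[of p y t] as t' by (simp add: Phi_pos_eq)
 next
 case False
 have *: "Phi p y = - ((- y) powr (p - 1))"
 using Phi_pos_eq[of "- y" p] as False by simp
 have "abs (y + t) = - y + - t" "abs y = - y" using False as t' by auto
 thus ?thesis using pos[of p "- y" "- t"] as False
 unfolding * by simp
 qed
 qed
qed

text \<open>The second derivative of \<open>Ew - lam * Nn\<close> is \<open>p * (p - 1)\<close> times this form. Here
  \<open>0 powr (p - 2) = 0\<close> also for \<open>p < 2\<close>, so only the smooth terms contribute.\<close>

definition hb :: "real => ('n::finite => 'n => real) => real => real ^ 'n => real ^ 'n => real ^ 'n => real" where
 "hb p w lam x d e = (SUM i:UNIV. SUM j:UNIV. w i j * abs (x $ i - x $ j) powr (p - 2) * (d $ i - d $ j) * (e $ i - e $ j)) / 2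
 - lam * (SUM i:UNIV. abs (x $ i) powr (p - 2) * d $ i * e $ i)"

text \<open>The numerator of \<open>Rq - lam0\<close> for unit weights. For \<open>p > 1\<close> it
  vanishes at the base eigenvector together with its derivative, so the shape of the quotient there
  is a second order question.\<close>

definition Pb :: "real => 'n::finite set => 'n set => real ^ 'n => real" where
 "Pb p A B x = Ew p unit_weights x - lam0 p A B * Nn p x"

text \<open>Collects the terms whose gap or entry vanishes at the base vector: pairs within one of
  the three blocks, and entries of the zero block. They are kept exactly, since \<open>|t|^p\<close>
  has no quadratic expansion at 0 for \<open>p < 2\<close>.\<close>

definition Sb :: "real => 'n::finite set => 'n set => real ^ 'n => real" where
 "Sb p A B d = (SUM i:A. SUM j:A. abs (d $ i - d $ j) powr p) / 2 + (SUM i:B. SUM j:B. abs (d $ i - d $ j) powr p) / 2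
 + (SUM i:- (A Un B). SUM j:- (A Un B). abs (d $ i - d $ j) powr p) / 2
 - lam0 p A B * (SUM i:- (A Un B). abs (d $ i) powr p)"

lemma base_simps:
 assumes "A Int B = {}"
 shows "i : A ==> base p A B $ i = cr p (card B)"
 and "i : B ==> base p A B $ i = - cr p (card A)"
 and "i : - (A Un B) ==> base p A B $ i = 0"
 and "i ~: A ==> i ~: B ==> base p A B $ i = 0"
 using assms by (auto simp: base_def)

lemma base_entry_cases:
 assumes "p > 1" "pair_ok A B"
 shows "base p A B $ i = 0 | 1 <= abs (base p A B $ i)"
 and "base p A B $ i - base p A B $ j = 0 | 1 <= abs (base p A B $ i - base p A B $ j)"
 using cr_ge_1[OF assms(1) pair_okD(1)[OF assms(2)]] cr_ge_1[OF assms(1) pair_okD(2)[OF assms(2)]]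
 by (auto simp: base_def)

lemma cr_le:
 assumes "1 < l" "p : {l..r}" "1 <= k" "k <= n"
 shows "cr p k <= real n powr (1 / (l - 1))"
proof -
 have "cr p k <= real n powr (1 / (p - 1))"
 unfolding cr_def using assms by (intro powr_mono2) auto
 also have "... <= real n powr (1 / (l - 1))"
 using assms by (intro powr_mono) (auto simp: field_simps)
 finally show ?thesis .
qed

lemma base_bounds:
 fixes A B :: "'n::finite set"
 assumes "1 < l" "pair_ok A B"
 shows "EX Y>=1. ALL p:{l..r}. ALL i j. abs (base p A B $ i) <= Y & abs (base p A B $ i - base p A B $ j) <= Y"
proof -
 define Y where "Y = real CARD('n) powr (1 / (l - 1))"
 note okD = pair_okD[OF assms(2)]
 have b: "abs (base p A B $ i) <= Y" if "p : {l..r}" for p i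
 proof -
 have "cr p (card A) <= Y" "cr p (card B) <= Y"
 unfolding Y_def by (rule cr_le[OF assms(1) that]; use okD card_mono[of UNIV A] card_mono[of UNIV B] in simp)+
 moreover have "cr p (card A) >= 1" "cr p (card B) >= 1"
 using okD that assms by (auto intro: cr_ge_1)
 ultimately show ?thesis by (auto simp: base_def)
 qed
 have "Y >= 1" unfolding Y_def using assms by (intro ge_one_powr_ge_zero) (auto simp: Suc_leI)
 moreover have "abs (base p A B $ i - base p A B $ j) <= 2 * Y" if "p : {l..r}" for p i j
 using b[OF that, of i] b[OF that, of j] by linarith
 moreover have "Y <= 2 * Y" using \<open>Y >= 1\<close> by simp
 ultimately show ?thesis using b
 by (intro exI[of _ "2 * Y"]) (fastforce intro: order_trans)
qed

lemma continuous_on_cr [continuous_intros]: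
 assumes "1 < l" "1 <= k"
 shows "continuous_on {l..r} (%p. cr p k)"
 unfolding cr_def by (intro continuous_intros) (use assms in auto)

lemma continuous_on_lam0:
 assumes "1 < l" "pair_ok A B"
 shows "continuous_on {l..r} (%p. lam0 p A B)"
proof -
 note okD = pair_okD[OF assms(2)]
 have "cr p (card A) + cr p (card B) ~= 0" if "p : {l..r}" for p
 using cr_ge_1[of p "card A"] cr_ge_1[of p "card B"] okD that assms by auto
 thus ?thesis
 unfolding lam0_def by (intro continuous_intros) (use assms okD in auto)
qed

lemma sum_sq_diff_le:
 fixes d :: "real ^ 'n::finite"
 shows "(SUM i:UNIV. SUM j:UNIV. (d $ i - d $ j)^2) <= 4 * real CARD('n) * (d \<bullet> d)"
proof -
 have "(d $ i - d $ j)^2 <= 2 * (d $ i)^2 + 2 * (d $ j)^2" for i j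
 using zero_le_power2[of "d $ i + d $ j"] by (simp add: power2_eq_square algebra_simps)
 hence "(SUM i:UNIV. SUM j:UNIV. (d $ i - d $ j)^2) <= (SUM i:UNIV. SUM j:UNIV. 2 * (d $ i)^2 + 2 * (d $ j)^2)"
 by (intro sum_mono) auto
 also have "... = 4 * real CARD('n) * (d \<bullet> d)"
 by (simp add: sum.distrib inner_vec_def power2_eq_square sum_distrib_left sum_distrib_right algebra_simps)
 finally show ?thesis .
qed

text \<open>Nonzero gaps have size at least 1 and obey Taylor's formula uniformly; vanishing gaps go
  to \<open>Sb\<close>. The terms of order zero and one cancel by the eigenvalue equation.\<close>

lemma Pb_expansion:
 fixes A B :: "'n::finite set"
 assumes l: "1 < l" and ok: "pair_ok A B" and eta: "0 < eta"
 shows "EX dl>0. ALL p:{l..r}. ALL d. (ALL i. abs (d $ i) <= dl) -->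
 abs (Pb p A B (base p A B + d) - p * (p - 1) / 2 * hb p unit_weights (lam0 p A B) (base p A B) d d - Sb p A B d) <= eta * (d \<bullet> d)"
proof -
 obtain Y where Y: "Y >= 1" "!!p i j. p : {l..r} ==> abs (base p A B $ i) <= Y & abs (base p A B $ i - base p A B $ j) <= Y"
 using base_bounds[OF l ok, of r] by auto
 obtain L where L: "L > 0" "!!p. p : {l..r} ==> abs (lam0 p A B) <= L"
 using continuous_upper_bound[OF compact_Icc continuous_on_lam0[OF l ok]] by blast
 \<comment> \<open>Error budget per term: by \<open>sum_sq_diff_le\<close> the halved double sum
   costs at most \<open>2 * CARD('n)\<close> times the squared norm, and the norm part costs
   \<open>L\<close> times it.\<close>
 define eta' where "eta' = eta / (2 * real CARD('n) + L)"
 have eta': "eta' > 0" unfolding eta'_def using eta L by (simp add: add_nonneg_pos)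
 obtain dl where dl: "dl > 0" "!!p y t. p : {l..r} ==> 1 <= abs y ==> abs y <= Y ==> abs t <= dl ==>
 abs (abs (y + t) powr p - abs y powr p - p * Phi p y * t - p * (p - 1) / 2 * abs y powr (p - 2) * t^2) <= eta' * t^2"
 using taylor_abs_powr[OF l eta', of r Y] by blast
 show ?thesis
 proof (intro exI[of _ "dl / 2"] conjI ballI allI impI)
 show "dl / 2 > 0" using dl by simp
 fix p and d :: "real ^ 'n"
 assume p: "p : {l..r}" and d: "ALL i. abs (d $ i) <= dl / 2"
 have p1: "p > 1" using p l by auto
 note okD = pair_okD[OF ok]
 let ?x = "base p A B" and ?lam = "lam0 p A B" and ?Q = "p * (p - 1) / 2"
 have e: "eigenpair p unit_weights ?lam ?x" by (rule eigenpair_base[OF p1 ok])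
 hence T: "Tv p unit_weights ?lam ?x = 0" by (simp add: eigenpair_iff_Tv)
 define err where "err = (%y t :: real. abs (y + t) powr p - (if y = 0 then abs t powr p else 0) - abs y powr p - p * Phi p y * t - ?Q * abs y powr (p - 2) * t^2)"
 have err: "abs (err y t) <= eta' * t^2" if "y = 0 | 1 <= abs y" "abs y <= Y" "abs t <= dl" for y t
 using dl(2)[OF p, of y t] that eta' by (cases "y = 0") (auto simp: err_def)
 have powr_eq: "abs (y + t) powr p = err y t + (if y = 0 then abs t powr p else 0) + abs y powr p + p * (Phi p y * t) + ?Q * (abs y powr (p - 2) * t * t)" for y t
 by (simp add: err_def power2_eq_square)
 let ?y = "%i j. ?x $ i - ?x $ j" and ?t = "%i j. d $ i - d $ j"
 have E: "Ew p unit_weights (?x + d) = (SUM i:UNIV. SUM j:UNIV. err (?y i j) (?t i j)) / 2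
 + (SUM i:UNIV. SUM j:UNIV. if ?y i j = 0 then abs (?t i j) powr p else 0) / 2
 + Ew p unit_weights ?x + p * ((SUM i:UNIV. SUM j:UNIV. Phi p (?y i j) * ?t i j) / 2)
 + ?Q * ((SUM i:UNIV. SUM j:UNIV. abs (?y i j) powr (p - 2) * ?t i j * ?t i j) / 2)"
 proof -
 have "Ew p unit_weights (?x + d) = (SUM i:UNIV. SUM j:UNIV. abs (?y i j + ?t i j) powr p) / 2"
 by (simp add: Ew_def algebra_simps)
 also have "... = (SUM i:UNIV. SUM j:UNIV. err (?y i j) (?t i j) + (if ?y i j = 0 then abs (?t i j) powr p else 0)
 + abs (?y i j) powr p + p * (Phi p (?y i j) * ?t i j) + ?Q * (abs (?y i j) powr (p - 2) * ?t i j * ?t i j)) / 2"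
 unfolding powr_eq ..
 finally show ?thesis
 by (simp only: sum.distrib sum_distrib_left[symmetric] Ew_def) (simp add: field_simps)
 qed
 have N: "Nn p (?x + d) = (SUM i:UNIV. err (?x $ i) (d $ i)) + (SUM i:UNIV. if ?x $ i = 0 then abs (d $ i) powr p else 0)
 + Nn p ?x + p * (SUM i:UNIV. Phi p (?x $ i) * d $ i) + ?Q * (SUM i:UNIV. abs (?x $ i) powr (p - 2) * d $ i * d $ i)"
 unfolding Nn_def vector_add_component powr_eq by (simp only: sum.distrib sum_distrib_left[symmetric])
 have P0: "Ew p unit_weights ?x = ?lam * Nn p ?x"
 using Tv_inner_self[OF sym_unit_weights, of p ?lam ?x] T by simp
 have P1: "(SUM i:UNIV. SUM j:UNIV. Phi p (?y i j) * ?t i j) / 2 = ?lam * (SUM i:UNIV. Phi p (?x $ i) * d $ i)"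
 using Tv_inner[OF sym_unit_weights, of p ?lam ?x d] T by simp
 have c1: "cr p (card A) >= 1" "cr p (card B) >= 1" using okD p1 by (auto intro: cr_ge_1)
 have disj: "!!i. i : A ==> i ~: B" using okD by auto
 have inner: "(SUM j:UNIV. if ?y i j = 0 then abs (?t i j) powr p else 0) =
 (if i : A then SUM j:A. abs (?t i j) powr p else if i : B then SUM j:B. abs (?t i j) powr p else SUM j:- (A Un B). abs (?t i j) powr p)" for i
 proof -
 have "(SUM j:UNIV. if ?y i j = 0 then abs (?t i j) powr p else 0) = sum (%j. abs (?t i j) powr p) {j. ?y i j = 0}"
 by (simp add: sum.If_cases)
 also have "{j. ?y i j = 0} = (if i : A then A else if i : B then B else - (A Un B))"
 using c1 disj by (auto simp: base_def split: if_splits)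
 finally show ?thesis by (simp split: if_splits)
 qed
 have S1: "(SUM i:UNIV. SUM j:UNIV. if ?y i j = 0 then abs (?t i j) powr p else 0) =
 (SUM i:A. SUM j:A. abs (?t i j) powr p) + (SUM i:B. SUM j:B. abs (?t i j) powr p)
 + (SUM i:- (A Un B). SUM j:- (A Un B). abs (?t i j) powr p)"
 unfolding inner sum_UNIV_split[OF okD(3)]
 by (intro arg_cong2[of _ _ _ _ "(+)"] sum.cong) (use disj in auto)
 have S2: "(SUM i:UNIV. if ?x $ i = 0 then abs (d $ i) powr p else 0) = (SUM i:- (A Un B). abs (d $ i) powr p)"
 proof -
 have "{i. ?x $ i = 0} = - (A Un B)" using c1 by (auto simp: base_def split: if_splits)
 thus ?thesis by (simp add: sum.If_cases)
 qed
 have "Pb p A B (?x + d) - ?Q * hb p unit_weights ?lam ?x d d - Sb p A B d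
 = (SUM i:UNIV. SUM j:UNIV. err (?y i j) (?t i j)) / 2 - ?lam * (SUM i:UNIV. err (?x $ i) (d $ i))"
 unfolding Pb_def E N hb_def Sb_def S1 S2 P0 P1 mult_1 by (simp add: algebra_simps add_divide_distrib)
 also have "abs (...) <= (SUM i:UNIV. SUM j:UNIV. abs (err (?y i j) (?t i j))) / 2 + L * (SUM i:UNIV. abs (err (?x $ i) (d $ i)))"
 proof -
 have "abs ((SUM i:UNIV. SUM j:UNIV. err (?y i j) (?t i j))) <= (SUM i:UNIV. SUM j:UNIV. abs (err (?y i j) (?t i j)))"
 by (rule order_trans[OF sum_abs]) (intro sum_mono sum_abs)
 moreover have "abs (?lam * (SUM i:UNIV. err (?x $ i) (d $ i))) <= L * (SUM i:UNIV. abs (err (?x $ i) (d $ i)))"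
 unfolding abs_mult by (intro mult_mono L p sum_abs) (use L in auto)
 ultimately show ?thesis by linarith
 qed
 also have "... <= (SUM i:UNIV. SUM j:UNIV. eta' * (?t i j)^2) / 2 + L * (SUM i:UNIV. eta' * (d $ i)^2)"
 proof -
 have "abs (err (?y i j) (?t i j)) <= eta' * (?t i j)^2" for i j
 proof (rule err)
 show "abs (?t i j) <= dl" using d[rule_format, of i] d[rule_format, of j] by linarith
 qed (use base_entry_cases[OF p1 ok] Y(2)[OF p] in auto)
 moreover have "abs (err (?x $ i) (d $ i)) <= eta' * (d $ i)^2" for i
 proof (rule err)
 show "abs (d $ i) <= dl" using d[rule_format, of i] dl by linarith
 qed (use base_entry_cases[OF p1 ok] Y(2)[OF p] in auto)
 ultimately show ?thesis
 using L by (intro add_mono divide_right_mono mult_left_mono sum_mono) auto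
 qed
 also have "... <= eta' * (2 * real CARD('n) + L) * (d \<bullet> d)"
 proof -
 have "(SUM i:UNIV. (d $ i)^2) = d \<bullet> d" by (simp add: inner_vec_def power2_eq_square)
 thus ?thesis
 using mult_left_mono[OF sum_sq_diff_le[of d], of "eta' / 2"] eta'
 by (simp add: sum_distrib_left[symmetric] algebra_simps)
 qed
 also have "... = eta * (d \<bullet> d)"
 proof -
 have "2 * real CARD('n) + L ~= 0" using L by (simp add: add_nonneg_eq_0_iff)
 thus ?thesis by (simp add: eta'_def)
 qed
 finally show "abs (Pb p A B (?x + d) - ?Q * hb p unit_weights ?lam ?x d d - Sb p A B d) <= eta * (d \<bullet> d)" .
 qed
qed

text \<open>On displacements of \<open>A\<close> with mean 0 the form \<open>hb\<close> at the base
  equals \<open>- kA p A B\<close> times the sum of squares; \<open>kA p B A\<close> serves for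
  \<open>B\<close>. The coefficient arises as the difference in \<open>kA_eq\<close>, and the
  product form shows that it is positive.\<close>

definition kA :: "real => 'n::finite set => 'n set => real" where
 "kA p A B = (cr p (card A) + cr p (card B)) powr (p - 2) * cr p (card A) * cr p (card B) powr (p - 2)"

definition gc :: "real => 'n::finite set => 'n set => real" where
 "gc p A B = card A * cr p (card B) powr (p - 2) + card B * cr p (card A) powr (p - 2)"

lemma lam0_commute: "lam0 p A B = lam0 p B A"
 by (simp add: lam0_def Un_commute add.commute)

lemma base_swap: "A Int B = {} ==> base p B A = - base p A B"
 by (auto simp: base_def vec_eq_iff)

lemma pair_ok_swap: "pair_ok A B ==> pair_ok B A"
 by (auto simp: pair_ok_def)

lemma kA_eq:
 assumes "p > 1" "pair_ok A B"
 shows "kA p A B = (lam0 p A B - card (- (A Un B))) * cr p (card B) powr (p - 2)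
 - card B * (cr p (card A) + cr p (card B)) powr (p - 2)"
proof -
 let ?be = "cr p (card A)" and ?al = "cr p (card B)"
 have c: "?al >= 1" "?be >= 1" using assms pair_okD[OF assms(2)] by (auto intro: cr_ge_1)
 have 1: "(?be + ?al) powr (p - 1) = (?be + ?al) * (?be + ?al) powr (p - 2)"
 using powr_mult_base[of "?be + ?al" "p - 2"] c by (simp add: algebra_simps)
 have 2: "real (card B) = ?al * ?al powr (p - 2)"
 using powr_mult_base[of "?al" "p - 2"] c cr_powr[of p "card B"] assms pair_okD[OF assms(2)]
 by (simp add: algebra_simps)
 have "(lam0 p A B - card (- (A Un B))) * ?al powr (p - 2) - card B * (?be + ?al) powr (p - 2)
 = (?be + ?al) * (?be + ?al) powr (p - 2) * ?al powr (p - 2) - ?al * ?al powr (p - 2) * (?be + ?al) powr (p - 2)"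
 unfolding lam0_def using 1 2 by simp
 also have "... = kA p A B" by (simp add: kA_def algebra_simps)
 finally show ?thesis by simp
qed

text \<open>Slice displacements have the same mean \<open>tau\<close> on \<open>A\<close> and on
  \<open>B\<close>. Subtracting it decouples the rows of the form: a row in the zero block is a
  multiple of \<open>d_i - tau\<close>, and a row in \<open>A\<close> or \<open>B\<close> has in
  addition a term that is constant on the block.\<close>

lemma hb_base:
 fixes d e :: "real ^ 'n::finite" and tau sg :: real
 assumes p: "p > 1" and ok: "pair_ok A B"
 and d: "sum (%i. d $ i) A = card A * tau" "sum (%i. d $ i) B = card B * tau"
 and e: "sum (%i. e $ i) A = card A * sg" "sum (%i. e $ i) B = card B * sg"
 shows "hb p unit_weights (lam0 p A B) (base p A B) d e =
 - kA p A B * (SUM i:A. (d $ i - tau) * e $ i) - kA p B A * (SUM i:B. (d $ i - tau) * e $ i)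
 + gc p A B * (sg * ((real (card (- (A Un B))) - lam0 p A B) * tau - (SUM i:- (A Un B). d $ i))
 + (SUM i:- (A Un B). (d $ i - tau) * e $ i))"
proof -
 note okD = pair_okD[OF ok]
 let ?x = "base p A B" and ?be = "cr p (card A)" and ?al = "cr p (card B)" and ?lam = "lam0 p A B"
 let ?Z = "- (A Un B)"
 define m where "m = real (card ?Z)"
 define SZ where "SZ = (SUM i:?Z. d $ i)"
 define ga where "ga = (?be + ?al) powr (p - 2)"
 define al' where "al' = ?al powr (p - 2)"
 define be' where "be' = ?be powr (p - 2)"
 have c: "?al >= 1" "?be >= 1" using p okD by (auto intro: cr_ge_1)
 have disj: "i ~: A" if "i : B" for i using that okD by auto
 have xs: "?x $ i = ?al" if "i : A" for i using that by (simp add: base_def)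
 have xs2: "?x $ i = - ?be" if "i : B" for i using that disj by (simp add: base_def)
 have xs3: "?x $ i = 0" if "i : ?Z" for i using that by (simp add: base_def)
 \<comment> \<open>Row \<open>i\<close> of the form: by antisymmetry the halved double sum in
   \<open>e_i - e_j\<close> collapses to a single sum against \<open>e_i\<close>.\<close>
 define H where "H = (%i. (SUM j:UNIV. abs (?x $ i - ?x $ j) powr (p - 2) * (d $ i - d $ j)) - ?lam * abs (?x $ i) powr (p - 2) * d $ i)"
 have hbH: "hb p unit_weights ?lam ?x d e = (SUM i:UNIV. H i * e $ i)"
 proof -
 let ?c = "%i j. abs (?x $ i - ?x $ j) powr (p - 2) * (d $ i - d $ j)"
 have "(SUM i:UNIV. SUM j:UNIV. ?c i j * e $ j) = (SUM j:UNIV. SUM i:UNIV. ?c i j * e $ j)"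
 by (rule sum.swap)
 also have "... = - (SUM i:UNIV. SUM j:UNIV. ?c i j * e $ i)"
 unfolding sum_negf[symmetric] by (intro sum.cong refl) (simp add: abs_minus_commute algebra_simps)
 finally have sw: "(SUM i:UNIV. SUM j:UNIV. ?c i j * e $ j) = - (SUM i:UNIV. SUM j:UNIV. ?c i j * e $ i)" .
 have "(SUM i:UNIV. SUM j:UNIV. 1 * abs (?x $ i - ?x $ j) powr (p - 2) * (d $ i - d $ j) * (e $ i - e $ j))
 = (SUM i:UNIV. SUM j:UNIV. ?c i j * e $ i - ?c i j * e $ j)"
 by (intro sum.cong refl) (simp add: right_diff_distrib)
 also have "... = 2 * (SUM i:UNIV. SUM j:UNIV. ?c i j * e $ i)"
 using sw by (simp add: sum_subtractf)
 finally have db: "(SUM i:UNIV. SUM j:UNIV. 1 * abs (?x $ i - ?x $ j) powr (p - 2) * (d $ i - d $ j) * (e $ i - e $ j)) / 2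
 = (SUM i:UNIV. SUM j:UNIV. ?c i j * e $ i)" by simp
 have "(SUM i:UNIV. H i * e $ i) = (SUM i:UNIV. SUM j:UNIV. ?c i j * e $ i)
 - ?lam * (SUM i:UNIV. abs (?x $ i) powr (p - 2) * d $ i * e $ i)"
 unfolding H_def left_diff_distrib sum_subtractf sum_distrib_right sum_distrib_left
 by (simp add: mult.assoc)
 thus ?thesis unfolding hb_def db by simp
 qed
 have HA: "H i = - kA p A B * (d $ i - tau) + al' * ((m - ?lam) * tau - SZ)" if "i : A" for i
 proof -
 have "H i = ga * (card B * d $ i - card B * tau) + al' * (m * d $ i - SZ) - ?lam * al' * d $ i"
 unfolding H_def sum_UNIV_split[OF okD(3)] using that c
 by (simp add: xs xs2 xs3 ga_def al'_def sum_distrib_left[symmetric] sum_subtractf d m_def SZ_def add.commute)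
 thus ?thesis
 unfolding kA_eq[OF p ok] ga_def[symmetric] al'_def[symmetric] m_def[symmetric] by (simp add: algebra_simps)
 qed
 have HB: "H i = - kA p B A * (d $ i - tau) + be' * ((m - ?lam) * tau - SZ)" if "i : B" for i
 proof -
 have "H i = ga * (card A * d $ i - card A * tau) + be' * (m * d $ i - SZ) - ?lam * be' * d $ i"
 unfolding H_def sum_UNIV_split[OF okD(3)] using that c
 by (simp add: xs xs2 xs3 ga_def be'_def sum_distrib_left[symmetric] sum_subtractf d m_def SZ_def add.commute)
 moreover have K: "kA p B A = (?lam - m) * be' - card A * ga"
 unfolding kA_eq[OF p pair_ok_swap[OF ok]] lam0_commute[of p B A] ga_def be'_def m_def
 by (simp add: add.commute Un_commute)
 ultimately show ?thesis unfolding K by (simp add: algebra_simps)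
 qed
 have g: "gc p A B = card A * al' + card B * be'" by (simp add: gc_def al'_def be'_def)
 have HZ: "H i = gc p A B * (d $ i - tau)" if "i : ?Z" for i
 proof -
 have "H i = al' * (card A * d $ i - card A * tau) + be' * (card B * d $ i - card B * tau)"
 unfolding H_def sum_UNIV_split[OF okD(3)] using that c
 by (simp add: xs xs2 xs3 al'_def be'_def sum_distrib_left[symmetric] sum_subtractf d)
 thus ?thesis by (simp add: g algebra_simps)
 qed
 have "(SUM i:UNIV. H i * e $ i) =
 (SUM i:A. - kA p A B * ((d $ i - tau) * e $ i) + al' * ((m - ?lam) * tau - SZ) * e $ i)
 + (SUM i:B. - kA p B A * ((d $ i - tau) * e $ i) + be' * ((m - ?lam) * tau - SZ) * e $ i)
 + (SUM i:?Z. gc p A B * ((d $ i - tau) * e $ i))"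
 unfolding sum_UNIV_split[OF okD(3)]
 by (intro arg_cong2[of _ _ _ _ "(+)"] sum.cong refl)
 (simp_all add: HA HB HZ distrib_right left_diff_distrib mult.assoc)
 also have "... = - kA p A B * (SUM i:A. (d $ i - tau) * e $ i) + al' * ((m - ?lam) * tau - SZ) * (card A * sg)
 + (- kA p B A * (SUM i:B. (d $ i - tau) * e $ i) + be' * ((m - ?lam) * tau - SZ) * (card B * sg))
 + gc p A B * (SUM i:?Z. (d $ i - tau) * e $ i)"
 by (simp only: sum.distrib sum_distrib_left[symmetric] e)
 finally show ?thesis unfolding hbH by (simp add: g m_def SZ_def algebra_simps)
qed

text \<open>Admissible displacements \<open>d\<close> are orthogonal to \<open>\<Phi>(x)\<close> for the base eigenvector \<open>x\<close>.
  They split into a direction \<open>U\<close> of minimisation and a direction \<open>V\<close> of maximisation of the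
  Rayleigh quotient, whose roles depend on the sign of \<open>p - 2\<close>.\<close>

definition Zsp :: "'n::finite set => 'n set => (real ^ 'n) set" where
 "Zsp A B = {d. ALL i:A Un B. d $ i = 0}"

definition Wsp :: "'n::finite set => 'n set => (real ^ 'n) set" where
 "Wsp A B = {d. (SUM i:A. d $ i) = 0 & (SUM i:B. d $ i) = 0 & (ALL i:- (A Un B). d $ i = 0)}"

text \<open>For \<open>p > 2\<close> the slice is split into \<open>Zsp\<close>, where the quotient
  is minimised, and \<open>Vw\<close>, where it is maximised; for \<open>p < 2\<close> into
  \<open>Wsp\<close> and \<open>Vz\<close> in the same roles.\<close>

definition Vw :: "'n::finite set => 'n set => (real ^ 'n) set" where
 "Vw A B = {d. card B * (SUM i:A. d $ i) = card A * (SUM i:B. d $ i) & (ALL i:- (A Un B). d $ i = 0)}"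

definition Vz :: "'n::finite set => 'n set => (real ^ 'n) set" where
 "Vz A B = {d. EX tau. ALL i:A Un B. d $ i = tau}"

definition slice :: "'n::finite set => 'n set => (real ^ 'n) set" where
 "slice A B = {d. card B * (SUM i:A. d $ i) = card A * (SUM i:B. d $ i)}"

lemma subspace_Zsp: "subspace (Zsp A B)"
 by (auto simp: subspace_def Zsp_def)

lemma subspace_Wsp: "subspace (Wsp A B)"
 by (auto simp: subspace_def Wsp_def sum.distrib sum_distrib_left[symmetric])

lemma subspace_Vw: "subspace (Vw A B)"
 by (auto simp: subspace_def Vw_def sum.distrib sum_distrib_left[symmetric] distrib_left)

lemma Vz_D: "x : Vz A B ==> EX tau. ALL i:A Un B. x $ i = tau"
 by (simp add: Vz_def)

lemma Vz_I: "(!!i. i : A Un B ==> x $ i = tau) ==> x : Vz A B"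
 unfolding Vz_def by (rule CollectI, rule exI[of _ tau]) simp

lemma subspace_Vz: "subspace (Vz A B)"
 unfolding subspace_def
proof (intro conjI ballI allI)
 show "0 : Vz A B" by (rule Vz_I[of _ _ _ 0]) simp
next
 fix x y assume "x : Vz A B" "y : Vz A B"
 then obtain s t where s: "ALL i:A Un B. x $ i = s" and t: "ALL i:A Un B. y $ i = t"
 using Vz_D by metis
 show "x + y : Vz A B" by (rule Vz_I[of _ _ _ "s + t"]) (use s t in simp)
next
 fix c x assume "x : Vz A B"
 then obtain s where s: "ALL i:A Un B. x $ i = s" using Vz_D by metis
 show "c *\<^sub>R x : Vz A B" by (rule Vz_I[of _ _ _ "c * s"]) (use s in simp)
qed

lemma Phi_base_inner:
 fixes d :: "real ^ 'n::finite"
 assumes "p > 1" "pair_ok A B"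
 shows "(SUM i:UNIV. Phi p (base p A B $ i) * d $ i) = card B * (SUM i:A. d $ i) - card A * (SUM i:B. d $ i)"
proof -
 note okD = pair_okD[OF assms(2)]
 have "i ~: A" if "i : B" for i using okD that by auto
 thus ?thesis
 unfolding Phi_base[OF assms] sum_UNIV_split[OF okD(3)]
 by (simp add: sum_distrib_left sum_negf)
qed

lemma slice_mean:
 assumes "pair_ok A B" "d : slice A B"
 obtains tau :: real where "(SUM i:A. d $ i) = card A * tau" "(SUM i:B. d $ i) = card B * tau"
proof
 have c: "real (card A) ~= 0" "real (card B) ~= 0" using pair_okD[OF assms(1)] by auto
 thus "(SUM i:A. d $ i) = card A * ((SUM i:A. d $ i) / card A)" by simp
 show "(SUM i:B. d $ i) = card B * ((SUM i:A. d $ i) / card A)"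
 using assms(2) c by (simp add: slice_def field_simps)
qed

lemma Vw_subset_slice: "Vw A B <= slice A B"
 by (auto simp: Vw_def slice_def)

lemma Zsp_Vw_slice:
 assumes "d : slice A B"
 shows "EX u:Zsp A B. EX v:Vw A B. d = u + v"
proof -
 define u :: "real ^ 'a" where "u = (\<chi> i. if i : A Un B then 0 else d $ i)"
 define v :: "real ^ 'a" where "v = (\<chi> i. if i : A Un B then d $ i else 0)"
 have "(SUM i:A. v $ i) = (SUM i:A. d $ i)" "(SUM i:B. v $ i) = (SUM i:B. d $ i)"
 by (auto intro!: sum.cong simp: v_def)
 hence "v : Vw A B" using assms by (auto simp: Vw_def slice_def) (auto simp: v_def)
 moreover have "u : Zsp A B" by (simp add: u_def Zsp_def)
 moreover have "d = u + v" by (auto simp: u_def v_def vec_eq_iff)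
 ultimately show ?thesis by blast
qed

lemma Wsp_Vz_slice:
 assumes "pair_ok A B" "d : slice A B"
 shows "EX u:Wsp A B. EX v:Vz A B. d = u + v"
proof -
 obtain tau :: real where t: "(SUM i:A. d $ i) = card A * tau" "(SUM i:B. d $ i) = card B * tau"
 by (rule slice_mean[OF assms])
 define u :: "real ^ 'a" where "u = (\<chi> i. if i : A Un B then d $ i - tau else 0)"
 define v :: "real ^ 'a" where "v = (\<chi> i. if i : A Un B then tau else d $ i)"
 have "(SUM i:A. u $ i) = (SUM i:A. d $ i - tau)" "(SUM i:B. u $ i) = (SUM i:B. d $ i - tau)"
 by (auto intro!: sum.cong simp: u_def)
 hence "u : Wsp A B" using t by (auto simp: Wsp_def sum_subtractf) (auto simp: u_def)
 moreover have "v : Vz A B" by (rule Vz_I[of _ _ _ tau]) (simp add: v_def)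
 moreover have "d = u + v" by (auto simp: u_def v_def vec_eq_iff)
 ultimately show ?thesis by blast
qed

lemma coefficient_bounds:
 fixes A B :: "'n::finite set"
 assumes l: "1 < l" and ok: "pair_ok A B"
 shows "EX k0>0. EX K0>0. ALL p:{l..r}. k0 <= kA p A B & k0 <= kA p B A & k0 <= gc p A B
 & kA p A B <= K0 & kA p B A <= K0 & gc p A B <= K0 & lam0 p A B <= K0"
proof -
 note okD = pair_okD[OF ok]
 have c: "cr p (card A) >= 1 & cr p (card B) >= 1" if "p : {l..r}" for p
 using okD that l by (auto intro: cr_ge_1)
 hence c0: "cr p (card A) + cr p (card B) ~= 0 & cr p (card A) ~= 0 & cr p (card B) ~= 0" if "p : {l..r}" for p
 using that by fastforce
 have k1: "continuous_on {l..r} (%p. kA p A B)" and k2: "continuous_on {l..r} (%p. kA p B A)"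
 and k3: "continuous_on {l..r} (%p. gc p A B)"
 unfolding kA_def gc_def
 by (intro continuous_intros l okD; use c0 in \<open>auto simp: add.commute\<close>)+
 have pos: "kA p A B > 0 & kA p B A > 0 & gc p A B > 0" if "p : {l..r}" for p
 proof -
 have "cr p (card A) > 0" "cr p (card B) > 0" "real (card A) > 0" "real (card B) > 0"
 using c[OF that] okD by auto
 thus ?thesis by (auto simp: kA_def gc_def intro!: mult_pos_pos add_pos_pos)
 qed
 obtain a1 a2 a3 where a: "a1 > 0" "a2 > 0" "a3 > 0"
 "!!p. p : {l..r} ==> a1 <= kA p A B" "!!p. p : {l..r} ==> a2 <= kA p B A" "!!p. p : {l..r} ==> a3 <= gc p A B"
 using continuous_pos_lower_bound[OF k1] continuous_pos_lower_bound[OF k2] continuous_pos_lower_bound[OF k3] pos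
 by metis
 obtain b1 b2 b3 b4 where b: "b1 > 0" "b2 > 0" "b3 > 0" "b4 > 0"
 "!!p. p : {l..r} ==> abs (kA p A B) <= b1" "!!p. p : {l..r} ==> abs (kA p B A) <= b2" "!!p. p : {l..r} ==> abs (gc p A B) <= b3"
 "!!p. p : {l..r} ==> abs (lam0 p A B) <= b4"
 using continuous_upper_bound[OF compact_Icc k1] continuous_upper_bound[OF compact_Icc k2]
 continuous_upper_bound[OF compact_Icc k3] continuous_upper_bound[OF compact_Icc continuous_on_lam0[OF l ok]]
 by metis
 define k0 where "k0 = min a1 (min a2 a3)"
 define K0 where "K0 = b1 + b2 + b3 + b4"
 have "k0 > 0" "K0 > 0" using a b by (auto simp: k0_def K0_def)
 moreover have "ALL p:{l..r}. k0 <= kA p A B & k0 <= kA p B A & k0 <= gc p A B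
 & kA p A B <= K0 & kA p B A <= K0 & gc p A B <= K0 & lam0 p A B <= K0"
 proof (intro ballI)
 fix p assume p: "p : {l..r}"
 have "k0 <= kA p A B" "k0 <= kA p B A" "k0 <= gc p A B"
 using a(4-)[OF p] by (auto simp: k0_def)
 moreover have "kA p A B <= K0" "kA p B A <= K0" "gc p A B <= K0" "lam0 p A B <= K0"
 using b(5-)[OF p] b(1-4) unfolding K0_def by linarith+
 ultimately show "k0 <= kA p A B & k0 <= kA p B A & k0 <= gc p A B
 & kA p A B <= K0 & kA p B A <= K0 & gc p A B <= K0 & lam0 p A B <= K0" by blast
 qed
 ultimately show ?thesis by blast
qed

lemma sum_shift_sq:
 fixes f :: "'a => real" and tau :: real
 assumes "(SUM i:A. f i) = card A * tau"
 shows "(SUM i:A. (f i - tau) * f i) = (SUM i:A. (f i - tau)^2)"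
 and "(SUM i:A. (f i)^2) = (SUM i:A. (f i - tau)^2) + card A * tau^2"
proof -
 have z: "(SUM i:A. (f i - tau)) = 0" using assms by (simp add: sum_subtractf)
 have "(SUM i:A. (f i - tau) * f i) = (SUM i:A. (f i - tau)^2 + (f i - tau) * tau)"
 by (intro sum.cong refl) (simp add: power2_eq_square algebra_simps)
 also have "... = (SUM i:A. (f i - tau)^2)"
 using z by (simp add: sum.distrib sum_distrib_right[symmetric])
 finally show "(SUM i:A. (f i - tau) * f i) = (SUM i:A. (f i - tau)^2)" .
 have "(SUM i:A. (f i)^2) = (SUM i:A. (f i - tau)^2 + 2 * tau * (f i - tau) + tau^2)"
 by (intro sum.cong refl) (simp add: power2_eq_square algebra_simps)
 also have "... = (SUM i:A. (f i - tau)^2) + card A * tau^2"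
 using z by (simp add: sum.distrib sum_distrib_left[symmetric])
 finally show "(SUM i:A. (f i)^2) = (SUM i:A. (f i - tau)^2) + card A * tau^2" .
qed

lemma inner_blocks:
 fixes d :: "real ^ 'n::finite"
 assumes "A Int B = {}"
 shows "d \<bullet> d = (SUM i:A. (d $ i)^2) + (SUM i:B. (d $ i)^2) + (SUM i:- (A Un B). (d $ i)^2)"
 unfolding inner_vec_def sum_UNIV_split[OF assms] by (simp add: power2_eq_square)

text \<open>Near 0 the power is a small multiple of \<open>t^2\<close>, uniformly in
  \<open>p >= l > 2\<close>. This makes the terms of \<open>Sb\<close> negligible.\<close>

lemma abs_powr_le_sq:
 fixes t :: real
 assumes "2 < l" "l <= p" "abs t <= dl" "dl <= 1"
 shows "abs t powr p <= dl powr (l - 2) * t^2"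
proof (cases "t = 0")
 case False
 have "abs t powr p = abs t powr (p - 2) * abs t powr 2" unfolding powr_add[symmetric] by simp
 also have "abs t powr 2 = t^2" using False by (simp add: powr_numeral)
 also have "abs t powr (p - 2) <= abs t powr (l - 2)" using assms False by (intro powr_mono') auto
 also have "abs t powr (l - 2) <= dl powr (l - 2)" using assms by (intro powr_mono2) auto
 finally show ?thesis by (simp add: mult_right_mono)
qed simp

text \<open>The opposite regime \<open>p <= r < 2\<close>: since \<open>dl powr (r - 2)\<close> is
  as large as desired for small \<open>dl\<close>, a vanishing gap outweighs any given quadratic
  term.\<close>

lemma abs_powr_ge_sq:
 fixes t :: real
 assumes "p <= r" "r < 2" "abs t <= dl" "dl <= 1"
 shows "abs t powr p >= dl powr (r - 2) * t^2"
proof (cases "t = 0")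
 case False
 have "dl powr (r - 2) <= abs t powr (r - 2)" using assms False by (intro powr_mono2') auto
 also have "abs t powr (r - 2) <= abs t powr (p - 2)" using assms False by (intro powr_mono') auto
 finally have "dl powr (r - 2) * t^2 <= abs t powr (p - 2) * t^2" by (rule mult_right_mono) simp
 also have "t^2 = abs t powr 2" using False by (simp add: powr_numeral)
 also have "abs t powr (p - 2) * abs t powr 2 = abs t powr p" unfolding powr_add[symmetric] by simp
 finally show ?thesis using False by (simp add: powr_numeral)
qed simp

lemma ex_delta_small:
 assumes "l > (2::real)" "eps > 0"
 shows "EX dl>0. dl <= 1 & dl powr (l - 2) <= eps"
proof (intro exI[of _ "min 1 (eps powr (1 / (l - 2)))"] conjI)
 have "min 1 (eps powr (1 / (l - 2))) powr (l - 2) <= (eps powr (1 / (l - 2))) powr (l - 2)"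
 using assms by (intro powr_mono2) auto
 thus "min 1 (eps powr (1 / (l - 2))) powr (l - 2) <= eps"
 using assms by (simp add: powr_powr)
qed (use assms in auto)

lemma ex_delta_large:
 assumes "r < (2::real)" "K > 0"
 shows "EX dl>0. dl <= 1 & dl powr (r - 2) >= K"
proof (intro exI[of _ "min 1 (K powr (1 / (r - 2)))"] conjI)
 have "min 1 (K powr (1 / (r - 2))) powr (r - 2) >= (K powr (1 / (r - 2))) powr (r - 2)"
 using assms by (intro powr_mono2') auto
 thus "K <= min 1 (K powr (1 / (r - 2))) powr (r - 2)"
 using assms by (simp add: powr_powr)
qed (use assms in auto)

lemma Sb_small:
 fixes A B :: "'n::finite set"
 assumes l: "2 < l" and ok: "pair_ok A B" and eta: "0 < eta"
 shows "EX dl>0. ALL p:{l..r}. ALL d. (ALL i. abs (d $ i) <= dl) --> abs (Sb p A B d) <= eta * (d \<bullet> d)"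
proof -
 have l1: "1 < l" using l by simp
 obtain L where L: "L > 0" "!!p. p : {l..r} ==> abs (lam0 p A B) <= L"
 using continuous_upper_bound[OF compact_Icc continuous_on_lam0[OF l1 ok]] by blast
 \<comment> \<open>Each of the three halved block sums costs \<open>2 * CARD('n)\<close>, and the
   norm term costs \<open>L\<close>.\<close>
 define K where "K = 6 * real CARD('n) + L"
 have K: "K > 0" using L by (simp add: K_def add_nonneg_pos)
 obtain dl where dl: "dl > 0" "dl <= 1" "dl powr (l - 2) <= eta / K"
 using ex_delta_small[OF l, of "eta / K"] eta K by auto
 show ?thesis
 proof (intro exI[of _ "dl / 2"] conjI ballI allI impI)
 fix p and d :: "real ^ 'n"
 assume p: "p : {l..r}" and d: "ALL i. abs (d $ i) <= dl / 2"
 have q: "abs t powr p <= eta / K * t^2" if "abs t <= dl" for t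
 using abs_powr_le_sq[OF l, of p t dl] p that dl mult_right_mono[OF dl(3), of "t^2"] by force
 have blk: "(SUM i:C. SUM j:C. abs (d $ i - d $ j) powr p) <= 4 * (real CARD('n) * (eta / K * (d \<bullet> d)))" for C
 proof -
 have "(SUM i:C. SUM j:C. abs (d $ i - d $ j) powr p) <= (SUM i:C. SUM j:UNIV. abs (d $ i - d $ j) powr p)"
 by (intro sum_mono sum_mono2) auto
 also have "... <= (SUM i:UNIV. SUM j:UNIV. abs (d $ i - d $ j) powr p)"
 by (rule sum_mono2) (auto intro: sum_nonneg)
 also have "... <= (SUM i:UNIV. SUM j:UNIV. eta / K * (d $ i - d $ j)^2)"
 proof (intro sum_mono q)
 fix i j show "abs (d $ i - d $ j) <= dl" using d[rule_format, of i] d[rule_format, of j] by linarith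
 qed
 also have "... <= eta / K * (4 * real CARD('n) * (d \<bullet> d))"
 unfolding sum_distrib_left[symmetric] using eta K by (intro mult_left_mono sum_sq_diff_le) auto
 finally show ?thesis by (simp add: mult_ac)
 qed
 have nn: "(SUM i:C. SUM j:C. abs (d $ i - d $ j) powr p) >= 0" for C by (intro sum_nonneg) auto
 have N: "(SUM i:- (A Un B). abs (d $ i) powr p) <= eta / K * (d \<bullet> d)"
 proof -
 have "(SUM i:- (A Un B). abs (d $ i) powr p) <= (SUM i:UNIV. abs (d $ i) powr p)"
 by (rule sum_mono2) auto
 also have "... <= (SUM i:UNIV. eta / K * (d $ i)^2)"
 proof (intro sum_mono q)
 fix i show "abs (d $ i) <= dl" using d[rule_format, of i] dl by linarith
 qed
 finally show ?thesis
 unfolding sum_distrib_left[symmetric] by (simp only: inner_vec_def power2_eq_square inner_real_def)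
 qed
 have "abs (lam0 p A B * (SUM i:- (A Un B). abs (d $ i) powr p)) <= L * (eta / K * (d \<bullet> d))"
 unfolding abs_mult using N L p by (intro mult_mono) (auto simp: sum_nonneg)
 hence "abs (Sb p A B d) <= 6 * (real CARD('n) * (eta / K * (d \<bullet> d))) + L * (eta / K * (d \<bullet> d))"
 unfolding Sb_def using blk[of A] blk[of B] blk[of "- (A Un B)"] nn[of A] nn[of B] nn[of "- (A Un B)"]
 by linarith
 also have "... = eta * (d \<bullet> d)"
 proof -
 have E: "6 * (real CARD('n) * X) + L * X = K * X" for X
 by (simp add: K_def distrib_right mult.assoc)
 show ?thesis unfolding E using K by simp
 qed
 finally show "abs (Sb p A B d) <= eta * (d \<bullet> d)" .
 qed (use dl in auto)
qed

text \<open>For \<open>p > 2\<close> the quadratic form alone decides. It is negative on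
  \<open>Vw\<close>, where the common mean enters with the factor \<open>lam0 - m >= 1\<close>, and
  positive on \<open>Zsp\<close>. The mixed term between the mean of \<open>v\<close> and
  \<open>u\<close> is split by Young's inequality, which produces the loss
  \<open>C * (norm v)^2\<close>.\<close>

lemma saddle_large:
 fixes A B :: "'n::finite set"
 assumes l: "2 < l" and ok: "pair_ok A B"
 shows "EX c>0. EX C>0. EX dl>0. ALL p:{l..r}. ALL u:Zsp A B. ALL v:Vw A B. norm u <= dl --> norm v <= dl -->
 Pb p A B (base p A B + v) <= - c * (norm v)^2 &
 c * (norm u)^2 - C * (norm v)^2 <= Pb p A B (base p A B + u + v) - Pb p A B (base p A B + v)"
proof -
 have l1: "1 < l" using l by simp
 note okD = pair_okD[OF ok]
 let ?Z = "- (A Un B)"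
 define a where "a = real (card A)"
 define b where "b = real (card B)"
 define m where "m = real (card ?Z)"
 have ab: "a >= 1" "b >= 1" "m >= 0" using okD by (auto simp: a_def b_def m_def)
 obtain k0 K0 where k: "k0 > 0" "K0 > 0" "!!p. p : {l..r} ==> k0 <= kA p A B & k0 <= kA p B A & k0 <= gc p A B
 & kA p A B <= K0 & kA p B A <= K0 & gc p A B <= K0 & lam0 p A B <= K0"
 using coefficient_bounds[OF l1 ok, of r] by metis
 \<comment> \<open>The mean counts as \<open>(a + b) * tau^2\<close> in the squared norm of
   \<open>v\<close>, while the form controls it only through \<open>k0 * tau^2\<close>.\<close>
 define k1 where "k1 = k0 / (a + b)"
 have k1: "k1 > 0" "k1 <= k0" "k1 * (a + b) = k0"
 using k ab mult_right_mono[of 1 "a + b" k0] by (auto simp: k1_def divide_le_eq mult.commute)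
 \<comment> \<open>The Taylor remainder and the singular part cost \<open>eta\<close> each, together
   a quarter of \<open>k1\<close>.\<close>
 define eta where "eta = k1 / 8"
 have eta: "eta > 0" using k1 by (simp add: eta_def)
 obtain dl1 where dl1: "dl1 > 0" "!!p d. p : {l..r} ==> (ALL i. abs (d $ i) <= dl1) ==>
 abs (Pb p A B (base p A B + d) - p * (p - 1) / 2 * hb p unit_weights (lam0 p A B) (base p A B) d d - Sb p A B d) <= eta * (d \<bullet> d)"
 using Pb_expansion[OF l1 ok eta, of r] by metis
 obtain dl2 where dl2: "dl2 > 0" "!!p d. p : {l..r} ==> (ALL i. abs (d $ i) <= dl2) ==> abs (Sb p A B d) <= eta * (d \<bullet> d)"
 using Sb_small[OF l ok eta, of r] by metis
 define Q0 where "Q0 = abs r * (abs r + 1) / 2"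
 define C1 where "C1 = 2 * K0 + K0 * K0 + 2 * K0 * (m + 1)"
 have Q0n: "Q0 >= 0" by (simp add: Q0_def)
 have C1n: "C1 > 0" using k ab by (auto simp: C1_def intro!: add_pos_nonneg)
 define C where "C = Q0 * C1 + 1 + k1"
 have Cpos: "C > 0"
 proof -
 have "Q0 * C1 >= 0" using Q0n C1n by simp
 thus ?thesis using k1 unfolding C_def by linarith
 qed
 have pos3: "k1 / 4 > 0" "min dl1 dl2 / 2 > 0" using k1 dl1 dl2 by auto
 show ?thesis
 proof (rule exI[of _ "k1 / 4"], rule conjI[OF pos3(1)], rule exI[of _ C], rule conjI[OF Cpos],
 rule exI[of _ "min dl1 dl2 / 2"], rule conjI[OF pos3(2)], intro ballI impI conjI)
 fix p :: real and u v :: "real ^ 'n"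
 assume p: "p : {l..r}" and u: "u : Zsp A B" and v: "v : Vw A B"
 and nu: "norm u <= min dl1 dl2 / 2" and nv: "norm v <= min dl1 dl2 / 2"
 define Q where "Q = p * (p - 1) / 2"
 have p2: "p > 2" using p l by auto
 have "p * (p - 1) >= 2 * 1" using p2 by (intro mult_mono) auto
 hence Q1: "Q >= 1" by (simp add: Q_def)
 have QQ: "Q <= Q0" unfolding Q_def Q0_def using p p2 by (intro divide_right_mono mult_mono) auto
 note kp = k(3)[OF p]
 let ?g = "gc p A B" and ?lam = "lam0 p A B" and ?h = "hb p unit_weights (lam0 p A B) (base p A B)"
 obtain tau :: real where tau: "(SUM i:A. v $ i) = card A * tau" "(SUM i:B. v $ i) = card B * tau"
 using slice_mean[OF ok] Vw_subset_slice v by (metis subsetD)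
 have v0: "v $ i = 0" if "i : ?Z" for i using v that by (auto simp: Vw_def)
 have u0: "u $ i = 0" if "i : A Un B" for i using u that by (auto simp: Zsp_def)
 define wA where "wA = (SUM i:A. (v $ i - tau)^2)"
 define wB where "wB = (SUM i:B. (v $ i - tau)^2)"
 have w: "wA >= 0" "wB >= 0" by (auto simp: wA_def wB_def sum_nonneg)
 have vv: "v \<bullet> v = wA + wB + (a + b) * tau^2"
 unfolding inner_blocks[OF okD(3)] using sum_shift_sq(2)[OF tau(1)] sum_shift_sq(2)[OF tau(2)] v0
 by (simp add: wA_def wB_def a_def b_def algebra_simps)
 define UU where "UU = (SUM i:?Z. (u $ i)^2)"
 have uu: "u \<bullet> u = UU"
 unfolding inner_blocks[OF okD(3)] using u0 by (simp add: UU_def)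
 have uvuv: "(u + v) \<bullet> (u + v) = UU + v \<bullet> v"
 proof -
 have "u \<bullet> v = 0" unfolding inner_vec_def by (rule sum.neutral) (use u0 v0 in fastforce)
 thus ?thesis using uu by (simp add: inner_add_left inner_add_right inner_commute)
 qed
 have lm: "?lam - m >= 1" using lam0_ge[of p A B] ok p2 by (simp add: m_def)
 have hv: "?h v v = - kA p A B * wA - kA p B A * wB - ?g * (?lam - m) * tau^2"
 using hb_base[OF _ ok tau tau] p2 sum_shift_sq(1)[OF tau(1)] sum_shift_sq(1)[OF tau(2)] v0
 by (simp add: wA_def wB_def m_def power2_eq_square algebra_simps)
 have huv: "?h (u + v) (u + v) = ?h v v - 2 * ?g * tau * (SUM i:?Z. u $ i) + ?g * UU"
 proof -
 have t: "(SUM i:A. (u + v) $ i) = card A * tau" "(SUM i:B. (u + v) $ i) = card B * tau"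
 using tau u0 by (simp_all add: sum.distrib)
 have sA: "(SUM i:A. ((u + v) $ i - tau) * (u + v) $ i) = wA"
 using sum_shift_sq(1)[OF tau(1)] u0 by (simp add: wA_def)
 have sB: "(SUM i:B. ((u + v) $ i - tau) * (u + v) $ i) = wB"
 using sum_shift_sq(1)[OF tau(2)] u0 by (simp add: wB_def)
 have sZ: "(SUM i:?Z. (u + v) $ i) = (SUM i:?Z. u $ i)" using v0 by simp
 have sZ2: "(SUM i:?Z. ((u + v) $ i - tau) * (u + v) $ i) = UU - tau * (SUM i:?Z. u $ i)"
 using v0 by (simp add: UU_def power2_eq_square left_diff_distrib sum_subtractf sum_distrib_left)
 have H: "?h (u + v) (u + v) = - kA p A B * (SUM i:A. ((u + v) $ i - tau) * (u + v) $ i)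
 - kA p B A * (SUM i:B. ((u + v) $ i - tau) * (u + v) $ i)
 + ?g * (tau * ((real (card ?Z) - ?lam) * tau - (SUM i:?Z. (u + v) $ i))
 + (SUM i:?Z. ((u + v) $ i - tau) * (u + v) $ i))"
 by (rule hb_base[OF _ ok t t]) (use p2 in simp)
 show ?thesis
 unfolding H sA sB sZ sZ2 hv m_def by (simp add: power2_eq_square algebra_simps)
 qed
 have hv_up: "?h v v <= - k1 * (v \<bullet> v)"
 proof -
 have "k1 <= kA p A B" "k1 <= kA p B A" using kp k1(2) by linarith+
 hence "k1 * wA <= kA p A B * wA" "k1 * wB <= kA p B A * wB"
 using w by (auto intro!: mult_right_mono)
 moreover have "k0 * 1 <= ?g * (?lam - m)" using kp k lm by (intro mult_mono) auto
 hence "k0 * tau^2 <= ?g * (?lam - m) * tau^2" by (intro mult_right_mono) auto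
 moreover have "k1 * (v \<bullet> v) = k1 * wA + k1 * wB + k0 * tau^2"
 unfolding vv using k1(3) by (simp add: distrib_left mult.assoc[symmetric])
 ultimately show ?thesis unfolding hv by linarith
 qed
 have hv_low: "?h v v >= - (2 * K0 + K0 * K0) * (v \<bullet> v)"
 proof -
 have "kA p A B * wA <= K0 * wA" "kA p B A * wB <= K0 * wB"
 using kp w by (auto intro!: mult_right_mono)
 moreover have "?g * (?lam - m) <= K0 * K0" using kp k lm ab by (intro mult_mono) auto
 hence "?g * (?lam - m) * tau^2 <= K0 * K0 * tau^2" by (intro mult_right_mono) auto
 moreover have "wA <= v \<bullet> v" "wB <= v \<bullet> v" "tau^2 <= v \<bullet> v"
 proof -
 have "1 * tau^2 <= (a + b) * tau^2" using ab by (intro mult_right_mono) auto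
 thus "wA <= v \<bullet> v" "wB <= v \<bullet> v" "tau^2 <= v \<bullet> v" using w ab unfolding vv by auto
 qed
 hence "K0 * wA <= K0 * (v \<bullet> v)" "K0 * wB <= K0 * (v \<bullet> v)" "K0 * K0 * tau^2 <= K0 * K0 * (v \<bullet> v)"
 using k by (auto intro!: mult_left_mono)
 ultimately show ?thesis unfolding hv by (simp add: algebra_simps)
 qed
 have huv_low: "?h (u + v) (u + v) >= k0 / 2 * UU - C1 * (v \<bullet> v)"
 proof -
 \<comment> \<open>Young's inequality with weight 1/2 on the squares of \<open>u\<close>, so that
   half of the positive term \<open>gc * UU\<close> survives.\<close>
 have "2 * tau * (SUM i:?Z. u $ i) <= (SUM i:?Z. (u $ i)^2 / 2 + 2 * tau^2)"
 unfolding sum_distrib_left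
 proof (rule sum_mono)
 fix i show "2 * tau * u $ i <= (u $ i)^2 / 2 + 2 * tau^2"
 using zero_le_power2[of "u $ i - 2 * tau"] by (simp add: power2_eq_square algebra_simps)
 qed
 also have "... = UU / 2 + 2 * m * tau^2" by (simp add: sum.distrib UU_def m_def sum_divide_distrib)
 finally have "?g * (2 * tau * (SUM i:?Z. u $ i)) <= ?g * (UU / 2 + 2 * m * tau^2)"
 using kp k by (intro mult_left_mono) auto
 hence 1: "- (2 * ?g * tau * (SUM i:?Z. u $ i)) + ?g * UU >= ?g * UU / 2 - ?g * (2 * m * tau^2)"
 by (simp add: algebra_simps)
 have "tau^2 <= v \<bullet> v"
 proof -
 have "1 * tau^2 <= (a + b) * tau^2" using ab by (intro mult_right_mono) auto
 thus ?thesis using w ab unfolding vv by auto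
 qed
 hence "?g * (2 * m * tau^2) <= K0 * (2 * (m + 1) * (v \<bullet> v))"
 using kp k ab by (intro mult_mono) auto
 moreover have "k0 * UU <= ?g * UU" using kp by (intro mult_right_mono) (auto simp: UU_def sum_nonneg)
 ultimately show ?thesis using 1 hv_low unfolding huv C1_def by (simp add: algebra_simps)
 qed
 define dl where "dl = min dl1 dl2 / 2"
 have vi: "abs (v $ i) <= dl" and ui: "abs (u $ i) <= dl" for i
 using component_le_norm_cart[of v i] component_le_norm_cart[of u i] nu nv unfolding dl_def by linarith+
 have uvi: "abs ((u + v) $ i) <= 2 * dl" for i
 using vi[of i] ui[of i] by simp
 have dl: "2 * dl <= dl1" "2 * dl <= dl2" "dl >= 0" using dl1(1) dl2(1) by (auto simp: dl_def)
 have small: "ALL i. abs (v $ i) <= dl1" "ALL i. abs (v $ i) <= dl2" "ALL i. abs ((u + v) $ i) <= dl1" "ALL i. abs ((u + v) $ i) <= dl2"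
 proof (intro allI)
 fix i show "abs (v $ i) <= dl1" using vi[of i] dl by linarith
 next
 show "ALL i. abs (v $ i) <= dl2" using vi dl by (intro allI) (rule order_trans[OF vi], linarith)
 show "ALL i. abs ((u + v) $ i) <= dl1" by (intro allI) (rule order_trans[OF uvi dl(1)])
 show "ALL i. abs ((u + v) $ i) <= dl2" by (intro allI) (rule order_trans[OF uvi dl(2)])
 qed
 have Pv: "Pb p A B (base p A B + v) <= Q * ?h v v + 2 * eta * (v \<bullet> v)"
 using dl1(2)[OF p small(1)] dl2(2)[OF p small(2)] unfolding Q_def[symmetric] by linarith
 have Puv: "Pb p A B (base p A B + (u + v)) >= Q * ?h (u + v) (u + v) - 2 * eta * (UU + v \<bullet> v)"
 using dl1(2)[OF p small(3)] dl2(2)[OF p small(4)] unfolding Q_def[symmetric] uvuv by linarith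
 have "Q * ?h v v <= Q * (- k1 * (v \<bullet> v))" using hv_up Q1 by (intro mult_left_mono) auto
 also have "... <= - k1 * (v \<bullet> v)"
 using mult_right_mono[OF Q1, of "k1 * (v \<bullet> v)"] k1 by simp
 finally have le: "Pb p A B (base p A B + v) <= - (k1 / 4) * (v \<bullet> v)"
 proof -
 assume *: "Q * ?h v v <= - k1 * (v \<bullet> v)"
 have "0 <= k1 * (v \<bullet> v)" using k1 by simp
 moreover have "2 * eta * (v \<bullet> v) = k1 * (v \<bullet> v) / 4" by (simp add: eta_def)
 moreover have "- k1 * (v \<bullet> v) = - (k1 * (v \<bullet> v))" "- (k1 / 4) * (v \<bullet> v) = - (k1 * (v \<bullet> v) / 4)" by simp_all
 ultimately show ?thesis using Pv * by linarith
 qed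
 thus "Pb p A B (base p A B + v) <= - (k1 / 4) * (norm v)^2" by (simp add: power2_norm_eq_inner)
 have "Q * ?h (u + v) (u + v) >= Q * (k0 / 2 * UU - C1 * (v \<bullet> v))"
 using huv_low Q1 by (intro mult_left_mono) auto
 moreover have "Q * (k0 / 2 * UU) >= 1 * (k0 / 2 * UU)"
 using Q1 k by (intro mult_right_mono) (auto simp: UU_def sum_nonneg)
 moreover have "Q * (C1 * (v \<bullet> v)) <= Q0 * (C1 * (v \<bullet> v))"
 using QQ C1n by (intro mult_right_mono) auto
 ultimately have "Pb p A B (base p A B + (u + v)) >= k0 / 2 * UU - Q0 * C1 * (v \<bullet> v) - 2 * eta * (UU + v \<bullet> v)"
 using Puv by (simp add: algebra_simps)
 moreover have "k0 / 2 * UU - Q0 * C1 * (v \<bullet> v) - 2 * eta * (UU + v \<bullet> v) >= k1 / 4 * UU - C * (v \<bullet> v)"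
 proof -
 have "k1 * UU <= k0 * UU" using k1 by (intro mult_right_mono) (auto simp: UU_def sum_nonneg)
 moreover have "0 <= k1 * (v \<bullet> v)" using k1 by simp
 moreover have "0 <= v \<bullet> v" by simp
 moreover have "k0 / 2 * U - Q0 * C1 * X - 2 * eta * (U + X) >= k1 / 4 * U - C * X"
 if "k1 * U <= k0 * U" "0 <= k1 * X" "0 <= X" for U X
 proof -
 have e: "k0 / 2 * U = (k0 * U) / 2" "2 * eta * (U + X) = (k1 * U + k1 * X) / 4"
 "k1 / 4 * U = (k1 * U) / 4" "C * X = Q0 * C1 * X + X + k1 * X"
 by (simp_all add: eta_def C_def algebra_simps)
 have lin: "s / 4 - (e' + y + z) <= t / 2 - e' - (s + z) / 4"
 if "s <= t" "0 <= z" "0 <= y" for s t z e' y :: real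
 proof -
 have "s / 2 <= t / 2" using that(1) by simp
 moreover have "(s + z) / 4 = s / 4 + z / 4" by (rule add_divide_distrib)
 moreover have "z / 4 <= z" using that(2) by simp
 moreover have "s / 4 + s / 4 = s / 2" by simp
 ultimately show ?thesis using that(3) by linarith
 qed
 show ?thesis unfolding e by (rule lin[OF that])
 qed
 ultimately show ?thesis by blast
 qed
 moreover have "Pb p A B (base p A B + v) <= 0"
 proof -
 have "(k1 / 4) * (v \<bullet> v) >= 0" using k1 by simp
 thus ?thesis using le by linarith
 qed
 ultimately show "k1 / 4 * (norm u)^2 - C * (norm v)^2 <= Pb p A B (base p A B + u + v) - Pb p A B (base p A B + v)"
 unfolding power2_norm_eq_inner uu add.assoc by linarith
 qed
qed

text \<open>Extend the restriction of \<open>d\<close> to the zero block by 0 and apply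
  \<open>Ew_unit_le\<close>: the edges leaving the block contribute exactly
  \<open>card A + card B\<close> times the norm, and subtracting them leaves
  \<open>card (- (A Un B))\<close>.\<close>

lemma block_energy_le:
 fixes A B :: "'n::finite set"
 assumes p: "1 < p" "p < 2" and disj: "A Int B = {}"
 shows "(SUM i:- (A Un B). SUM j:- (A Un B). abs (d $ i - d $ j) powr p) / 2
 <= card (- (A Un B)) * (SUM i:- (A Un B). abs (d $ i) powr p)"
proof -
 let ?Z = "- (A Un B)"
 define z :: "real ^ 'n" where "z = (\<chi> i. if i : ?Z then d $ i else 0)"
 have zZ: "z $ i = d $ i" if "i : ?Z" for i using that by (simp add: z_def)
 have z0: "z $ i = 0" if "i : A" for i using that by (simp add: z_def)
 have z1: "z $ i = 0" if "i : B" for i using that by (simp add: z_def)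
 define S where "S = (SUM i:?Z. abs (d $ i) powr p)"
 define m where "m = real (card ?Z)"
 have N: "Nn p z = S"
 unfolding Nn_def sum_UNIV_split[OF disj] S_def
 using z0 z1 zZ by simp
 have "Ew p unit_weights z = ((SUM i:?Z. SUM j:?Z. abs (d $ i - d $ j) powr p) + 2 * (real (card A) + card B) * S) / 2"
 unfolding Ew_def sum_UNIV_split[OF disj]
 using z0 z1 zZ by (simp add: sum.distrib S_def sum_distrib_left algebra_simps)
 moreover have "Ew p unit_weights z <= real CARD('n) * S"
 using Ew_unit_le[OF p, of z] N by simp
 moreover have "real CARD('n) = real (card A) + real (card B) + m"
 using card_blocks[OF disj] unfolding m_def by linarith
 ultimately show ?thesis unfolding S_def[symmetric] m_def[symmetric] by (simp add: algebra_simps)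
qed

lemma sum_sq_block:
 fixes d :: "'a => real"
 assumes "(SUM i:A. d i) = 0"
 shows "(SUM i:A. SUM j:A. (d i - d j)^2) = 2 * card A * (SUM i:A. (d i)^2)"
proof -
 have "(SUM i:A. SUM j:A. (d i - d j)^2) = (SUM i:A. SUM j:A. (d i)^2 + (d j)^2 - 2 * d i * d j)"
 by (intro sum.cong refl) (simp add: power2_eq_square algebra_simps)
 also have "... = 2 * card A * (SUM i:A. (d i)^2)"
 by (simp add: sum.distrib sum_subtractf sum_distrib_left[symmetric] assms)
 finally show ?thesis .
qed

text \<open>For \<open>p < 2\<close> the singular terms dominate. Gaps of \<open>u\<close> inside
  the blocks give at least \<open>K\<close> times its squared norm, and the zero-block part of
  \<open>v\<close> enters with the factor \<open>m - lam0 <= - 1\<close> by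
  \<open>block_energy_le\<close>. Only the common value \<open>tau\<close> of \<open>v\<close> on
  \<open>A Un B\<close> is left to the quadratic form, which is negative in that direction.\<close>

lemma saddle_small:
 fixes A B :: "'n::finite set"
 assumes l: "1 < l" and r: "r < 2" and ok: "pair_ok A B"
 shows "EX c>0. EX C>0. EX dl>0. ALL p:{l..r}. ALL u:Wsp A B. ALL v:Vz A B. norm u <= dl --> norm v <= dl -->
 Pb p A B (base p A B + v) <= - c * (norm v)^2 &
 c * (norm u)^2 - C * (norm v)^2 <= Pb p A B (base p A B + u + v) - Pb p A B (base p A B + v)"
proof -
 note okD = pair_okD[OF ok]
 let ?Z = "- (A Un B)"
 define a where "a = real (card A)"
 define b where "b = real (card B)"
 define m where "m = real (card ?Z)"
 have ab: "a >= 1" "b >= 1" "m >= 0" using okD by (auto simp: a_def b_def m_def)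
 obtain k0 K0 where k: "k0 > 0" "K0 > 0" "!!p. p : {l..r} ==> k0 <= kA p A B & k0 <= kA p B A & k0 <= gc p A B
 & kA p A B <= K0 & kA p B A <= K0 & gc p A B <= K0 & lam0 p A B <= K0"
 using coefficient_bounds[OF l ok, of r] by metis
 define q0 where "q0 = l * (l - 1) / 2"
 have q0: "q0 > 0" using l by (simp add: q0_def)
 \<comment> \<open>Makes the available bound \<open>q0 * k0 * tau^2 / 2\<close> equal to
   \<open>2 * c * (a + b) * tau^2\<close>: one half is the claim, the other half pays for the Taylor
   remainder.\<close>
 define c where "c = q0 * k0 / (4 * (a + b))"
 define s where "s = a + b"
 have s: "s > 0" using ab by (simp add: s_def)
 have "c = q0 * k0 / (4 * s)" by (simp add: c_def s_def)
 hence c: "c > 0" "q0 * k0 = 4 * (c * (a + b))"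
 unfolding s_def[symmetric] using q0 k s by simp_all
 \<comment> \<open>Absorbs the positive zero-block part \<open>K0 * (2 * m + 3)\<close> of the
   quadratic form, with one \<open>c\<close> left for the claim and one for the Taylor
   remainder.\<close>
 define K where "K = K0 * (2 * m + 3) + 2 * c"
 have Kg: "K > 0" "K >= K0 + 2 * c"
 proof -
 have "K0 * 1 <= K0 * (2 * m + 3)" using k ab by (intro mult_left_mono) auto
 thus 1: "K >= K0 + 2 * c" by (simp add: K_def)
 show "K > 0" using 1 k(2) c(1) by linarith
 qed
 obtain dl1 where dl1: "dl1 > 0" "!!p d. p : {l..r} ==> (ALL i. abs (d $ i) <= dl1) ==>
 abs (Pb p A B (base p A B + d) - p * (p - 1) / 2 * hb p unit_weights (lam0 p A B) (base p A B) d d - Sb p A B d) <= c * (d \<bullet> d)"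
 using Pb_expansion[OF l ok c(1), of r] by metis
 obtain dl2 where dl2: "dl2 > 0" "dl2 <= 1" "dl2 powr (r - 2) >= K"
 using ex_delta_large[OF r Kg(1)] by blast
 have pos3: "min dl1 dl2 / 2 > 0" "2 * c > 0" using c dl1 dl2 by auto
 show ?thesis
 proof (rule exI[of _ c], rule conjI[OF c(1)], rule exI[of _ "2 * c"], rule conjI[OF pos3(2)],
 rule exI[of _ "min dl1 dl2 / 2"], rule conjI[OF pos3(1)], intro ballI impI conjI)
 fix p :: real and u v :: "real ^ 'n"
 assume p: "p : {l..r}" and u: "u : Wsp A B" and v: "v : Vz A B"
 and nu: "norm u <= min dl1 dl2 / 2" and nv: "norm v <= min dl1 dl2 / 2"
 define Q where "Q = p * (p - 1) / 2"
 have p12: "1 < p" "p < 2" using p l r by auto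
 have Ql: "q0 <= Q" unfolding q0_def Q_def using p l by (intro divide_right_mono mult_mono) auto
 have "p * (p - 1) <= 2 * 1" using p12 by (intro mult_mono) auto
 hence Qu: "Q <= 1" by (simp add: Q_def)
 note kp = k(3)[OF p]
 let ?g = "gc p A B" and ?lam = "lam0 p A B" and ?h = "hb p unit_weights (lam0 p A B) (base p A B)"
 obtain tau where tau: "ALL i:A Un B. v $ i = tau" using Vz_D[OF v] by blast
 have vs: "(SUM i:A. v $ i) = card A * tau" "(SUM i:B. v $ i) = card B * tau"
 using tau by simp_all
 have us: "(SUM i:A. u $ i) = 0" "(SUM i:B. u $ i) = 0" and u0: "!!i. i : ?Z ==> u $ i = 0"
 using u by (auto simp: Wsp_def)
 define ZZ where "ZZ = (SUM i:?Z. (v $ i)^2)"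
 have ZZ: "ZZ >= 0" by (simp add: ZZ_def sum_nonneg)
 have vv: "v \<bullet> v = (a + b) * tau^2 + ZZ"
 unfolding inner_blocks[OF okD(3)] using tau by (simp add: ZZ_def a_def b_def algebra_simps)
 define UA where "UA = (SUM i:A. (u $ i)^2)"
 define UB where "UB = (SUM i:B. (u $ i)^2)"
 have U: "UA >= 0" "UB >= 0" by (auto simp: UA_def UB_def sum_nonneg)
 have uu: "u \<bullet> u = UA + UB"
 unfolding inner_blocks[OF okD(3)] using u0 by (simp add: UA_def UB_def)
 have uv: "u \<bullet> v = 0"
 proof -
 have "u \<bullet> v = (SUM i:A. u $ i * tau) + (SUM i:B. u $ i * tau) + 0"
 unfolding inner_vec_def sum_UNIV_split[OF okD(3)] using tau u0 by simp
 thus ?thesis using us by (simp add: sum_distrib_right[symmetric])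
 qed
 have uvuv: "(u + v) \<bullet> (u + v) = u \<bullet> u + v \<bullet> v"
 using uv by (simp add: inner_add_left inner_add_right inner_commute)
 have lm: "?lam >= m + 1" using lam0_ge[OF p12(1) ok] by (simp add: m_def)
 define SZ where "SZ = (SUM i:?Z. v $ i)"
 have sZ: "(SUM i:?Z. (v $ i - tau) * v $ i) = ZZ - tau * SZ"
 by (simp add: ZZ_def SZ_def power2_eq_square left_diff_distrib sum_subtractf sum_distrib_left)
 have hv: "?h v v = ?g * ((m - ?lam) * tau^2 - 2 * tau * SZ + ZZ)"
 proof -
 have "?h v v = - kA p A B * (SUM i:A. (v $ i - tau) * v $ i) - kA p B A * (SUM i:B. (v $ i - tau) * v $ i)
 + ?g * (tau * ((real (card ?Z) - ?lam) * tau - (SUM i:?Z. v $ i)) + (SUM i:?Z. (v $ i - tau) * v $ i))"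
 by (rule hb_base[OF p12(1) ok vs vs])
 moreover have "(SUM i:A. (v $ i - tau) * v $ i) = 0" "(SUM i:B. (v $ i - tau) * v $ i) = 0" using tau by simp_all
 ultimately show ?thesis unfolding sZ m_def[symmetric] SZ_def[symmetric]
 by (simp add: power2_eq_square algebra_simps)
 qed
 have huv: "?h (u + v) (u + v) = ?h v v - kA p A B * UA - kA p B A * UB"
 proof -
 have t: "(SUM i:A. (u + v) $ i) = card A * tau" "(SUM i:B. (u + v) $ i) = card B * tau"
 using vs us by (simp_all add: sum.distrib)
 have H: "?h (u + v) (u + v) = - kA p A B * (SUM i:A. ((u + v) $ i - tau) * (u + v) $ i)
 - kA p B A * (SUM i:B. ((u + v) $ i - tau) * (u + v) $ i)
 + ?g * (tau * ((real (card ?Z) - ?lam) * tau - (SUM i:?Z. (u + v) $ i))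
 + (SUM i:?Z. ((u + v) $ i - tau) * (u + v) $ i))"
 by (rule hb_base[OF p12(1) ok t t])
 have sA: "(SUM i:A. ((u + v) $ i - tau) * (u + v) $ i) = UA"
 unfolding sum_shift_sq(1)[OF t(1)] UA_def using tau by (intro sum.cong) auto
 have sB: "(SUM i:B. ((u + v) $ i - tau) * (u + v) $ i) = UB"
 unfolding sum_shift_sq(1)[OF t(2)] UB_def using tau by (intro sum.cong) auto
 have sZ1: "(SUM i:?Z. (u + v) $ i) = SZ" using u0 by (simp add: SZ_def)
 have sZ2: "(SUM i:?Z. ((u + v) $ i - tau) * (u + v) $ i) = ZZ - tau * SZ"
 unfolding sZ[symmetric] using u0 by (intro sum.cong) auto
 show ?thesis
 unfolding H sA sB sZ1 sZ2 hv m_def[symmetric] by (simp add: power2_eq_square algebra_simps)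
 qed
 have hv_up: "?h v v <= ?g * (- (tau^2) / 2 + (2 * m + 3) * ZZ)"
 proof -
 \<comment> \<open>Weight for Young's inequality: summed over the \<open>m\<close> entries of the
   zero block, \<open>tau^2 / t\<close> costs at most \<open>tau^2 / 2\<close>.\<close>
 define t where "t = 2 * (m + 1)"
 have t: "t > 0" using ab by (simp add: t_def)
 have "- (2 * tau * SZ) = (SUM i:?Z. - (2 * tau * v $ i))"
 by (simp add: SZ_def sum_distrib_left sum_negf)
 also have "... <= (SUM i:?Z. tau^2 / t + t * (v $ i)^2)"
 proof (rule sum_mono)
 fix i
 have "t * (- (2 * tau * v $ i)) <= tau^2 + t * (t * (v $ i)^2)"
 using zero_le_power2[of "tau + t * v $ i"] by (simp add: power2_eq_square algebra_simps)
 thus "- (2 * tau * v $ i) <= tau^2 / t + t * (v $ i)^2"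
 using t by (simp add: field_simps)
 qed
 also have "... = m * tau^2 / t + t * ZZ"
 by (simp add: sum.distrib ZZ_def m_def sum_distrib_left)
 also have "m * tau^2 / t <= tau^2 / 2"
 proof -
 have "2 * (m * tau^2) <= t * tau^2" by (simp add: t_def algebra_simps)
 thus ?thesis using t by (simp add: field_simps)
 qed
 finally have "- (2 * tau * SZ) <= tau^2 / 2 + t * ZZ" by simp
 moreover have "(m - ?lam) * tau^2 <= (- 1) * tau^2" using lm by (intro mult_right_mono) auto
 ultimately have "(m - ?lam) * tau^2 - 2 * tau * SZ + ZZ <= - (tau^2) / 2 + (2 * m + 3) * ZZ"
 by (simp add: t_def algebra_simps)
 thus ?thesis unfolding hv using kp k by (intro mult_left_mono) auto
 qed
 define dl where "dl = min dl1 dl2 / 2"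
 have vi: "abs (v $ i) <= dl" and ui: "abs (u $ i) <= dl" for i
 using component_le_norm_cart[of v i] component_le_norm_cart[of u i] nu nv unfolding dl_def by linarith+
 have uvi: "abs ((u + v) $ i) <= 2 * dl" for i
 using vi[of i] ui[of i] by simp
 have dl: "2 * dl <= dl1" "2 * dl <= dl2" "dl >= 0" using dl1(1) dl2(1) by (auto simp: dl_def)
 have small: "ALL i. abs (v $ i) <= dl1" "ALL i. abs ((u + v) $ i) <= dl1"
 proof -
 show "ALL i. abs (v $ i) <= dl1" using dl by (intro allI) (rule order_trans[OF vi], linarith)
 show "ALL i. abs ((u + v) $ i) <= dl1" by (intro allI) (rule order_trans[OF uvi dl(1)])
 qed
 have pw: "K * t^2 <= abs t powr p" if "abs t <= dl2" for t
 proof -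
 have "K * t^2 <= dl2 powr (r - 2) * t^2" using dl2(3) by (intro mult_right_mono) auto
 also have "... <= abs t powr p" using abs_powr_ge_sq[of p r t dl2] p r that dl2 by simp
 finally show ?thesis .
 qed
 define NZ where "NZ = (SUM i:?Z. abs (v $ i) powr p)"
 have NZ: "NZ >= K * ZZ"
 proof -
 have "K * ZZ = (SUM i:?Z. K * (v $ i)^2)" by (simp add: ZZ_def sum_distrib_left)
 also have "... <= NZ" unfolding NZ_def
 proof (intro sum_mono pw)
 fix i show "abs (v $ i) <= dl2" using vi[of i] dl by linarith
 qed
 finally show ?thesis .
 qed
 have Sv: "Sb p A B v <= - NZ"
 proof -
 have "(SUM i:A. SUM j:A. abs (v $ i - v $ j) powr p) = 0" "(SUM i:B. SUM j:B. abs (v $ i - v $ j) powr p) = 0"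
 using tau by simp_all
 hence "Sb p A B v <= m * NZ - ?lam * NZ"
 using block_energy_le[OF p12 okD(3), of v] unfolding Sb_def NZ_def m_def by simp
 also have "... = (m - ?lam) * NZ" by (simp add: left_diff_distrib)
 also have "... <= (- 1) * NZ" using lm by (intro mult_right_mono) (auto simp: NZ_def sum_nonneg)
 finally show ?thesis by simp
 qed
 have Suv: "Sb p A B (u + v) - Sb p A B v >= K * (UA + UB)"
 proof -
 have blk: "(SUM i:D. SUM j:D. abs (u $ i - u $ j) powr p) >= 2 * (K * (SUM i:D. (u $ i)^2))"
 if D: "(SUM i:D. u $ i) = 0" "card D >= 1" for D
 proof -
 have "2 * (K * (SUM i:D. (u $ i)^2)) <= real (card D) * (2 * (K * (SUM i:D. (u $ i)^2)))"
 using mult_right_mono[of 1 "real (card D)" "2 * (K * (SUM i:D. (u $ i)^2))"] D Kg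
 by (simp add: sum_nonneg)
 also have "... = K * (2 * card D * (SUM i:D. (u $ i)^2))" by simp
 also have "... = (SUM i:D. SUM j:D. K * (u $ i - u $ j)^2)"
 unfolding sum_sq_block[OF D(1), symmetric] by (simp add: sum_distrib_left)
 also have "... <= (SUM i:D. SUM j:D. abs (u $ i - u $ j) powr p)"
 proof (intro sum_mono pw)
 fix i j show "abs (u $ i - u $ j) <= dl2" using ui[of i] ui[of j] dl by linarith
 qed
 finally show ?thesis .
 qed
 have q1: "(SUM i:A. SUM j:A. abs ((u + v) $ i - (u + v) $ j) powr p) = (SUM i:A. SUM j:A. abs (u $ i - u $ j) powr p)"
 "(SUM i:B. SUM j:B. abs ((u + v) $ i - (u + v) $ j) powr p) = (SUM i:B. SUM j:B. abs (u $ i - u $ j) powr p)"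
 using tau by simp_all
 have q2: "(SUM i:A. SUM j:A. abs (v $ i - v $ j) powr p) = 0" "(SUM i:B. SUM j:B. abs (v $ i - v $ j) powr p) = 0"
 using tau by simp_all
 have q3: "(SUM i:?Z. SUM j:?Z. abs ((u + v) $ i - (u + v) $ j) powr p) = (SUM i:?Z. SUM j:?Z. abs (v $ i - v $ j) powr p)"
 "(SUM i:?Z. abs ((u + v) $ i) powr p) = (SUM i:?Z. abs (v $ i) powr p)"
 using u0 by simp_all
 have "Sb p A B (u + v) - Sb p A B v =
 (SUM i:A. SUM j:A. abs (u $ i - u $ j) powr p) / 2 + (SUM i:B. SUM j:B. abs (u $ i - u $ j) powr p) / 2"
 unfolding Sb_def q1 q2 q3 by simp
 thus ?thesis using blk[OF us(1) okD(1)] blk[OF us(2) okD(2)]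
 unfolding UA_def[symmetric] UB_def[symmetric] by (simp add: distrib_left)
 qed
 have Pv: "Pb p A B (base p A B + v) <= Q * ?h v v + Sb p A B v + c * (v \<bullet> v)"
 "Pb p A B (base p A B + v) <= Q * ?h v v + Sb p A B v + c * (v \<bullet> v)"
 using dl1(2)[OF p small(1)] unfolding Q_def[symmetric] by linarith+
 have Puv: "Pb p A B (base p A B + (u + v)) >= Q * ?h (u + v) (u + v) + Sb p A B (u + v) - c * (u \<bullet> u + v \<bullet> v)"
 using dl1(2)[OF p small(2)] unfolding Q_def[symmetric] uvuv by linarith
 have "Q * ?h v v <= Q * (?g * (- (tau^2) / 2 + (2 * m + 3) * ZZ))"
 using hv_up Ql q0 by (intro mult_left_mono) auto
 also have "... = - (Q * ?g) * tau^2 / 2 + (Q * ?g) * ((2 * m + 3) * ZZ)" by (simp add: algebra_simps)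
 also have "... <= - (q0 * k0) * tau^2 / 2 + (1 * K0) * ((2 * m + 3) * ZZ)"
 proof -
 have "q0 * k0 <= Q * ?g" using Ql q0 kp k by (intro mult_mono) auto
 hence "(q0 * k0) * tau^2 <= (Q * ?g) * tau^2" by (intro mult_right_mono) auto
 moreover have "Q * ?g <= 1 * K0" using Qu Ql q0 kp k by (intro mult_mono) auto
 hence "(Q * ?g) * ((2 * m + 3) * ZZ) <= (1 * K0) * ((2 * m + 3) * ZZ)"
 using ab ZZ by (intro mult_right_mono) auto
 ultimately show ?thesis by simp
 qed
 finally have "Q * ?h v v <= - 2 * (c * (a + b) * tau^2) + K0 * (2 * m + 3) * ZZ"
 unfolding c(2) by simp
 moreover have "K * ZZ = K0 * (2 * m + 3) * ZZ + 2 * (c * ZZ)" by (simp add: K_def algebra_simps)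
 moreover have "c * (v \<bullet> v) = c * (a + b) * tau^2 + c * ZZ" by (simp add: vv algebra_simps)
 ultimately show "Pb p A B (base p A B + v) <= - c * (norm v)^2"
 using Pv Sv NZ unfolding power2_norm_eq_inner by simp
 have "kA p A B * UA <= K0 * UA" "kA p B A * UB <= K0 * UB"
 using kp U by (auto intro!: mult_right_mono)
 hence "Q * (kA p A B * UA + kA p B A * UB) <= 1 * (K0 * UA + K0 * UB)"
 using Qu Ql q0 U kp k by (intro mult_mono add_mono add_nonneg_nonneg mult_nonneg_nonneg) auto
 hence "Q * ?h (u + v) (u + v) >= Q * ?h v v - K0 * (u \<bullet> u)"
 unfolding huv uu by (simp add: algebra_simps)
 moreover have "K * (u \<bullet> u) >= (K0 + 2 * c) * (u \<bullet> u)" using Kg by (intro mult_right_mono) auto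
 moreover have "(K0 + 2 * c) * (u \<bullet> u) = K0 * (u \<bullet> u) + 2 * (c * (u \<bullet> u))" by (simp add: algebra_simps)
 moreover have "c * (u \<bullet> u + v \<bullet> v) = c * (u \<bullet> u) + c * (v \<bullet> v)" by (simp add: algebra_simps)
 moreover have "2 * c * (v \<bullet> v) = 2 * (c * (v \<bullet> v))" by simp
 ultimately show "c * (norm u)^2 - 2 * c * (norm v)^2 <= Pb p A B (base p A B + u + v) - Pb p A B (base p A B + v)"
 using Puv Pv(2) Suv unfolding uu[symmetric] power2_norm_eq_inner add.assoc by linarith
 qed
qed

lemma double_sum_ge_blocks:
 fixes f :: "'n::finite => 'n => real"
 assumes "A Int B = {}" "!!i j. f i j >= 0"
 shows "(SUM i:A. SUM j:A. f i j) + (SUM i:B. SUM j:B. f i j) <= (SUM i:UNIV. SUM j:UNIV. f i j)"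
proof -
 have *: "(SUM i:C. SUM j:C. f i j) <= (SUM i:C. SUM j:UNIV. f i j)" for C
 by (intro sum_mono sum_mono2) (use assms in auto)
 have "(SUM i:- (A Un B). SUM j:UNIV. f i j) >= 0" by (intro sum_nonneg assms)
 thus ?thesis unfolding sum_UNIV_split[OF assms(1), of "%i. SUM j:UNIV. f i j"]
 using *[of A] *[of B] by linarith
qed

lemma entry_far:
 assumes p: "p > 1" and ok: "pair_ok A B" and "abs (x - base p A B $ i) <= 1 / 8"
 shows "i : A ==> x >= 7/8" "i : B ==> x <= - 7/8"
proof -
 have "cr p (card A) >= 1" "cr p (card B) >= 1" using pair_okD[OF ok] p by (auto intro: cr_ge_1)
 thus "i : A ==> x >= 7/8" "i : B ==> x <= - 7/8"
 using assms(3) pair_okD[OF ok] by (auto simp: base_def split: if_splits)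
qed

text \<open>Yields uniqueness of the inner minimiser, because two stationary points over the same
  \<open>v\<close> with a common multiplier would give equality. The entries that move are near 0,
  where \<open>Phi\<close> is flat for \<open>p > 2\<close>, whereas their gaps to an entry of
  \<open>A\<close> exceed 1/2, where its slope is bounded below.\<close>

lemma mono_U_large:
 fixes A B :: "'n::finite set"
 assumes l: "2 < l" and ok: "pair_ok A B" and L: "L > 0"
 shows "EX dl>0. ALL p:{l..r}. ALL w mu x y. (ALL i j. 1/2 <= w i j) --> 0 <= mu --> mu <= L -->
 (ALL i. abs (x $ i - base p A B $ i) <= dl) --> (ALL i. abs (y $ i - base p A B $ i) <= dl) --> x - y : Zsp A B --> x ~= y -->
 mu * (SUM i:UNIV. (Phi p (x $ i) - Phi p (y $ i)) * (x $ i - y $ i)) <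
 (SUM i:UNIV. SUM j:UNIV. w i j * ((Phi p (x $ i - x $ j) - Phi p (y $ i - y $ j)) * ((x $ i - x $ j) - (y $ i - y $ j)))) / 2"
proof -
 define ka where "ka = (1/2 :: real) powr (r - 2)"
 have ka: "ka > 0" by (simp add: ka_def)
 obtain dl0 where dl0: "dl0 > 0" "dl0 <= 1" "dl0 powr (l - 2) <= ka / (8 * L)"
 using ex_delta_small[OF l, of "ka / (8 * L)"] ka L by auto
 define dl where "dl = min (1/8) dl0"
 have dl: "dl > 0" "dl <= 1/8" "dl <= dl0" using dl0 by (auto simp: dl_def)
 \<comment> \<open>A single row of the energy suffices: \<open>x\<close> and \<open>y\<close> agree
   at \<open>i0\<close>, so the gaps from \<open>i0\<close> see the whole difference.\<close>
 obtain i0 where i0: "i0 : A" using ok by (auto simp: pair_ok_def)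
 show ?thesis
 proof (rule exI[of _ dl], rule conjI[OF dl(1)], intro ballI allI impI)
 fix p mu :: real and w :: "'n => 'n => real" and x y :: "real ^ 'n"
 assume p: "p : {l..r}" and w: "ALL i j. 1/2 <= w i j" and mu: "0 <= mu" "mu <= L"
 and x: "ALL i. abs (x $ i - base p A B $ i) <= dl" and y: "ALL i. abs (y $ i - base p A B $ i) <= dl"
 and d: "x - y : Zsp A B" and ne: "x ~= y"
 have p2: "p > 2" "p > 1" using p l by auto
 note okD = pair_okD[OF ok]
 have dAB: "x $ i = y $ i" if "i : A Un B" for i using d that unfolding Zsp_def by fastforce
 let ?f = "%i j. w i j * ((Phi p (x $ i - x $ j) - Phi p (y $ i - y $ j)) * ((x $ i - x $ j) - (y $ i - y $ j)))"
 define D where "D = (SUM i:UNIV. (x $ i - y $ i)^2)"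
 have Dpos: "D > 0"
 proof -
 obtain i where "x $ i ~= y $ i" using ne by (auto simp: vec_eq_iff)
 thus ?thesis unfolding D_def by (intro sum_pos2[of _ i]) auto
 qed
 have wp: "w i j >= 0" for i j using w[rule_format, of i j] by simp
 have f0: "?f i j >= 0" for i j
 by (intro mult_nonneg_nonneg wp Phi_mono_mult p2)
 have row: "?f i0 j >= (p - 1) * ka / 2 * (x $ j - y $ j)^2" for j
 proof (cases "j : A Un B")
 case True
 thus ?thesis using dAB[OF True] f0[of i0 j] by simp
 next
 case False
 hence bj: "base p A B $ j = 0" by (simp add: base_def)
 have xi: "x $ i0 >= 7/8" using entry_far(1)[OF p2(2) ok _ i0, of "x $ i0"] x[rule_format, of i0] dl by linarith
 have eq: "y $ i0 = x $ i0" using dAB[of i0] i0 by simp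
 have xj: "abs (x $ j) <= 1/8" "abs (y $ j) <= 1/8" using x[rule_format, of j] y[rule_format, of j] dl bj by auto
 have "(p - 1) * ka * ((x $ i0 - x $ j) - (y $ i0 - y $ j))^2 <=
 (Phi p (x $ i0 - x $ j) - Phi p (y $ i0 - y $ j)) * ((x $ i0 - x $ j) - (y $ i0 - y $ j))"
 proof (rule Phi_diff_lower_mult[OF p2(2)])
 fix xi assume "min (x $ i0 - x $ j) (y $ i0 - y $ j) < xi"
 hence xi: "xi >= 1/2" using xi xj eq by auto
 have "ka <= (1/2) powr (p - 2)" unfolding ka_def using p by (intro powr_mono') auto
 also have "... <= abs (xi) powr (p - 2)" using xi p2 by (intro powr_mono2) auto
 finally show "ka <= abs (xi) powr (p - 2)" .
 qed
 also have "((x $ i0 - x $ j) - (y $ i0 - y $ j))^2 = (x $ j - y $ j)^2"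
 unfolding eq by (simp add: power2_commute)
 finally have *: "(p - 1) * ka * (x $ j - y $ j)^2 <=
 (Phi p (x $ i0 - x $ j) - Phi p (y $ i0 - y $ j)) * ((x $ i0 - x $ j) - (y $ i0 - y $ j))" .
 have "1/2 * ((p - 1) * ka * (x $ j - y $ j)^2) <= ?f i0 j"
 by (rule mult_mono[OF w[rule_format] *]) (use wp ka p2 in auto)
 thus ?thesis by simp
 qed
 have "(p - 1) * ka / 2 * D <= (SUM j:UNIV. ?f i0 j)"
 unfolding D_def sum_distrib_left by (intro sum_mono row)
 also have "... <= (SUM i:UNIV. SUM j:UNIV. ?f i j)"
 by (rule member_le_sum[of i0 UNIV "%i. SUM j:UNIV. ?f i j"]) (auto intro!: sum_nonneg f0)
 finally have low0: "(p - 1) * ka / 2 * D <= (SUM i:UNIV. SUM j:UNIV. ?f i j)" .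
 have low: "(p - 1) * ka * D / 4 <= (SUM i:UNIV. SUM j:UNIV. ?f i j) / 2"
 using divide_right_mono[OF low0, of 2] by simp
 have up: "(Phi p (x $ i) - Phi p (y $ i)) * (x $ i - y $ i) <= (p - 1) * (ka / (8 * L)) * (x $ i - y $ i)^2" for i
 proof (cases "i : A Un B")
 case True
 thus ?thesis using dAB[OF True] by simp
 next
 case False
 hence bj: "base p A B $ i = 0" by (simp add: base_def)
 have xj: "abs (x $ i) <= dl" "abs (y $ i) <= dl" using x[rule_format, of i] y[rule_format, of i] bj by auto
 show ?thesis
 proof (rule Phi_diff_upper_mult[OF p2(2)])
 fix xi assume "min (x $ i) (y $ i) < xi" "xi < max (x $ i) (y $ i)" "xi ~= 0"
 hence xi: "abs (xi) <= dl" "xi ~= 0" using xj by auto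
 have "abs (xi) powr (p - 2) <= abs (xi) powr (l - 2)" using xi dl p by (intro powr_mono') auto
 also have "... <= dl0 powr (l - 2)" using xi dl l by (intro powr_mono2) auto
 finally show "abs (xi) powr (p - 2) <= ka / (8 * L)" using dl0 by simp
 qed (use p2 ka L in auto)
 qed
 have "mu * (SUM i:UNIV. (Phi p (x $ i) - Phi p (y $ i)) * (x $ i - y $ i)) <= L * ((p - 1) * (ka / (8 * L)) * D)"
 proof (rule mult_mono[OF mu(2)])
 show "(SUM i:UNIV. (Phi p (x $ i) - Phi p (y $ i)) * (x $ i - y $ i)) <= (p - 1) * (ka / (8 * L)) * D"
 unfolding D_def sum_distrib_left by (intro sum_mono up)
 qed (use L in \<open>auto intro!: sum_nonneg Phi_mono_mult p2\<close>)
 also have "... = (p - 1) * ka * D / 8" using L by simp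
 also have "... < (p - 1) * ka * D / 4" using Dpos ka p2 by simp
 finally have fin: "mu * (SUM i:UNIV. (Phi p (x $ i) - Phi p (y $ i)) * (x $ i - y $ i)) < LL" if "LL = (SUM i:UNIV. SUM j:UNIV. ?f i j) / 2" for LL
 using low that by linarith
 show "mu * (SUM i:UNIV. (Phi p (x $ i) - Phi p (y $ i)) * (x $ i - y $ i)) < (SUM i:UNIV. SUM j:UNIV. ?f i j) / 2"
 by (rule fin) (rule refl)
 qed
qed

text \<open>Here the gaps inside a block are near 0, where the slope of \<open>Phi\<close> is huge
  for \<open>p < 2\<close>, and the entries that move stay away from 0, where it is bounded. Since
  the differences have mean 0 on each block, \<open>sum_sq_block\<close> turns squared gaps into the
  squared norm.\<close>

lemma mono_U_small:
 fixes A B :: "'n::finite set"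
 assumes l: "1 < l" and r: "r < 2" and ok: "pair_ok A B" and L: "L > 0"
 shows "EX dl>0. ALL p:{l..r}. ALL w mu x y. (ALL i j. 1/2 <= w i j) --> 0 <= mu --> mu <= L -->
 (ALL i. abs (x $ i - base p A B $ i) <= dl) --> (ALL i. abs (y $ i - base p A B $ i) <= dl) --> x - y : Wsp A B --> x ~= y -->
 mu * (SUM i:UNIV. (Phi p (x $ i) - Phi p (y $ i)) * (x $ i - y $ i)) <
 (SUM i:UNIV. SUM j:UNIV. w i j * ((Phi p (x $ i - x $ j) - Phi p (y $ i - y $ j)) * ((x $ i - x $ j) - (y $ i - y $ j)))) / 2"
proof -
 define K where "K = 8 * L"
 have K: "K > 0" using L by (simp add: K_def)
 obtain dl0 where dl0: "dl0 > 0" "dl0 <= 1" "dl0 powr (r - 2) >= K"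
 using ex_delta_large[OF r K] by blast
 define dl where "dl = min (1/8) (dl0 / 2)"
 have dl: "dl > 0" "dl <= 1/8" "2 * dl <= dl0" using dl0 by (auto simp: dl_def)
 show ?thesis
 proof (rule exI[of _ dl], rule conjI[OF dl(1)], intro ballI allI impI)
 fix p mu :: real and w :: "'n => 'n => real" and x y :: "real ^ 'n"
 assume p: "p : {l..r}" and w: "ALL i j. 1/2 <= w i j" and mu: "0 <= mu" "mu <= L"
 and x: "ALL i. abs (x $ i - base p A B $ i) <= dl" and y: "ALL i. abs (y $ i - base p A B $ i) <= dl"
 and d: "x - y : Wsp A B" and ne: "x ~= y"
 have p2: "p < 2" "p > 1" using p l r by auto
 note okD = pair_okD[OF ok]
 have dZ: "x $ i = y $ i" if "i : - (A Un B)" for i using d that unfolding Wsp_def by fastforce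
 have dA: "(SUM i:A. x $ i - y $ i) = 0" and dB: "(SUM i:B. x $ i - y $ i) = 0"
 using d by (simp_all add: Wsp_def)
 let ?f = "%i j. w i j * ((Phi p (x $ i - x $ j) - Phi p (y $ i - y $ j)) * ((x $ i - x $ j) - (y $ i - y $ j)))"
 define D where "D = (SUM i:UNIV. (x $ i - y $ i)^2)"
 have Dpos: "D > 0"
 proof -
 obtain i where "x $ i ~= y $ i" using ne by (auto simp: vec_eq_iff)
 thus ?thesis unfolding D_def by (intro sum_pos2[of _ i]) auto
 qed
 have D: "D = (SUM i:A. (x $ i - y $ i)^2) + (SUM i:B. (x $ i - y $ i)^2)"
 unfolding D_def sum_UNIV_split[OF okD(3)] using dZ by simp
 have wp: "w i j >= 0" for i j using w[rule_format, of i j] by simp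
 have f0: "?f i j >= 0" for i j
 by (intro mult_nonneg_nonneg wp Phi_mono_mult p2)
 have blk: "(p - 1) * K * (SUM i:C. (x $ i - y $ i)^2) <= (SUM i:C. SUM j:C. ?f i j)"
 if C: "C = A | C = B" for C
 proof -
 have s0: "(SUM i:C. x $ i - y $ i) = 0" and c1: "real (card C) >= 1" using C dA dB okD by auto
 have ent: "?f i j >= (p - 1) * K / 2 * ((x $ i - y $ i) - (x $ j - y $ j))^2" if ij: "i : C" "j : C" for i j
 proof -
 have "base p A B $ i = base p A B $ j" using ij C okD by (auto simp: base_def)
 hence b: "abs (x $ i - x $ j) <= dl0" "abs (y $ i - y $ j) <= dl0"
 using x[rule_format, of i] x[rule_format, of j] y[rule_format, of i] y[rule_format, of j] dl(3) by linarith+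
 have "(p - 1) * K * ((x $ i - x $ j) - (y $ i - y $ j))^2 <=
 (Phi p (x $ i - x $ j) - Phi p (y $ i - y $ j)) * ((x $ i - x $ j) - (y $ i - y $ j))"
 proof (rule Phi_diff_lower_mult[OF p2(2)])
 fix xi assume "min (x $ i - x $ j) (y $ i - y $ j) < xi" "xi < max (x $ i - x $ j) (y $ i - y $ j)" "xi ~= 0"
 hence xi: "abs (xi) <= dl0" "xi ~= 0" using b by auto
 have "K <= dl0 powr (r - 2)" by (rule dl0)
 also have "... <= abs (xi) powr (r - 2)" using xi r by (intro powr_mono2') auto
 also have "... <= abs (xi) powr (p - 2)" using xi dl0 p by (intro powr_mono') auto
 finally show "K <= abs (xi) powr (p - 2)" .
 qed
 hence "1/2 * ((p - 1) * K * ((x $ i - x $ j) - (y $ i - y $ j))^2) <= ?f i j"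
 by (rule mult_mono[OF w[rule_format]]) (use wp K p2 in auto)
 hence e1: "(p - 1) * K / 2 * ((x $ i - x $ j) - (y $ i - y $ j))^2 <= ?f i j"
 by (simp only: mult_1 times_divide_eq_left)
 have e2: "((x $ i - y $ i) - (x $ j - y $ j)) = ((x $ i - x $ j) - (y $ i - y $ j))" by simp
 show ?thesis unfolding e2 by (rule e1)
 qed
 have "(p - 1) * K * (SUM i:C. (x $ i - y $ i)^2) <= (p - 1) * K * (card C * (SUM i:C. (x $ i - y $ i)^2))"
 using mult_right_mono[OF c1, of "(SUM i:C. (x $ i - y $ i)^2)"] K p2
 by (intro mult_left_mono) (auto simp: sum_nonneg)
 also have "... = (p - 1) * K / 2 * (SUM i:C. SUM j:C. ((x $ i - y $ i) - (x $ j - y $ j))^2)"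
 unfolding sum_sq_block[OF s0] by simp
 also have "... <= (SUM i:C. SUM j:C. ?f i j)"
 unfolding sum_distrib_left by (intro sum_mono ent)
 finally show ?thesis .
 qed
 have low0: "(p - 1) * K * D <= (SUM i:UNIV. SUM j:UNIV. ?f i j)"
 using blk[OF disjI1[OF refl]] blk[OF disjI2[OF refl]] double_sum_ge_blocks[OF okD(3), of ?f, OF f0] unfolding D distrib_left by linarith
 have low: "(p - 1) * K * D / 2 <= (SUM i:UNIV. SUM j:UNIV. ?f i j) / 2"
 using low0 by (rule divide_right_mono) simp
 have up: "(Phi p (x $ i) - Phi p (y $ i)) * (x $ i - y $ i) <= (p - 1) * 2 * (x $ i - y $ i)^2" for i
 proof (cases "i : A Un B")
 case False
 thus ?thesis using dZ[of i] by simp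
 next
 case True
 have "x $ i >= 7/8 & y $ i >= 7/8 | x $ i <= -7/8 & y $ i <= -7/8"
 using entry_far[OF p2(2) ok order_trans[OF x[rule_format] dl(2)], of i]
 entry_far[OF p2(2) ok order_trans[OF y[rule_format] dl(2)], of i] True by blast
 note xy = this
 show ?thesis
 proof (rule Phi_diff_upper_mult[OF p2(2)])
 fix xi assume "min (x $ i) (y $ i) < xi" "xi < max (x $ i) (y $ i)" "xi ~= 0"
 hence xi: "1/2 <= abs (xi)" using xy by auto
 have "abs (xi) powr (p - 2) <= (1/2) powr (p - 2)" using xi p2 by (intro powr_mono2') auto
 also have "... <= (1/2) powr (- 1)" using p2 by (intro powr_mono') auto
 also have "... = 2" by (simp add: powr_minus)
 finally show "abs (xi) powr (p - 2) <= 2" .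
 qed (use xy in auto)
 qed
 have "mu * (SUM i:UNIV. (Phi p (x $ i) - Phi p (y $ i)) * (x $ i - y $ i)) <= L * ((p - 1) * 2 * D)"
 proof (rule mult_mono[OF mu(2)])
 show "(SUM i:UNIV. (Phi p (x $ i) - Phi p (y $ i)) * (x $ i - y $ i)) <= (p - 1) * 2 * D"
 unfolding D_def sum_distrib_left by (intro sum_mono up)
 qed (use L in \<open>auto intro!: sum_nonneg Phi_mono_mult p2\<close>)
 also have "... = (p - 1) * K * D / 4" by (simp add: K_def)
 also have "... < (p - 1) * K * D / 2" using Dpos K p2 by simp
 finally have fin: "mu * (SUM i:UNIV. (Phi p (x $ i) - Phi p (y $ i)) * (x $ i - y $ i)) < LL" if "LL = (SUM i:UNIV. SUM j:UNIV. ?f i j) / 2" for LL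
 using low that by linarith
 show "mu * (SUM i:UNIV. (Phi p (x $ i) - Phi p (y $ i)) * (x $ i - y $ i)) < (SUM i:UNIV. SUM j:UNIV. ?f i j) / 2"
 by (rule fin) (rule refl)
 qed
qed

section \<open>Functions with Lipschitz mixed differences\<close>

text \<open>Bounded, Lipschitz in the point and in the exponent, with a mixed difference of order
  \<open>norm xi * |p - q|\<close>. The last clause says that moving from the centre to
  \<open>xi\<close> changes the dependence on \<open>p\<close> only in proportion to
  \<open>norm xi\<close>, which later becomes the factor \<open>eps\<close> in the Lipschitz bound
  of a branch.\<close>

definition lipmix :: "real set => real => (real => 'a::real_normed_vector => real) => bool" where
 "lipmix I dl f \<longleftrightarrow> (EX C>=0. ALL p:I. ALL q:I. ALL xi zeta. norm xi <= dl --> norm zeta <= dl -->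
 abs (f p xi) <= C & abs (f p xi - f p zeta) <= C * norm (xi - zeta) & abs (f p xi - f q xi) <= C * abs (p - q)
 & abs (f p xi - f q xi - (f p 0 - f q 0)) <= C * norm xi * abs (p - q))"

lemma lipmixI:
 assumes "C >= 0"
 and "!!p xi. p : I ==> norm xi <= dl ==> abs (f p xi) <= C"
 and "!!p xi zeta. p : I ==> norm xi <= dl ==> norm zeta <= dl ==> abs (f p xi - f p zeta) <= C * norm (xi - zeta)"
 and "!!p q xi. p : I ==> q : I ==> norm xi <= dl ==> abs (f p xi - f q xi) <= C * abs (p - q)"
 and "!!p q xi. p : I ==> q : I ==> norm xi <= dl ==> abs (f p xi - f q xi - (f p 0 - f q 0)) <= C * (norm xi * abs (p - q))"
 shows "lipmix I dl f"
 unfolding lipmix_def using assms by (intro exI[of _ C]) (auto simp: mult.assoc)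

lemma lipmixE:
 assumes "lipmix I dl f"
 obtains C where "C > 0"
 and "!!p xi. p : I ==> norm xi <= dl ==> abs (f p xi) <= C"
 and "!!p xi zeta. p : I ==> norm xi <= dl ==> norm zeta <= dl ==> abs (f p xi - f p zeta) <= C * norm (xi - zeta)"
 and "!!p q xi. p : I ==> q : I ==> norm xi <= dl ==> abs (f p xi - f q xi) <= C * abs (p - q)"
 and "!!p q xi. p : I ==> q : I ==> norm xi <= dl ==> abs (f p xi - f q xi - (f p 0 - f q 0)) <= C * (norm xi * abs (p - q))"
proof -
 obtain C where C: "C >= 0" "ALL p:I. ALL q:I. ALL xi zeta. norm xi <= dl --> norm zeta <= dl -->
 abs (f p xi) <= C & abs (f p xi - f p zeta) <= C * norm (xi - zeta) & abs (f p xi - f q xi) <= C * abs (p - q)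
 & abs (f p xi - f q xi - (f p 0 - f q 0)) <= C * norm xi * abs (p - q)"
 using assms unfolding lipmix_def by blast
 have up: "C * s <= (C + 1) * s" if "s >= 0" for s using that by (simp add: mult_right_mono)
 show ?thesis
 proof (rule that[of "C + 1"])
 show "C + 1 > 0" using C by simp
 show "abs (f p xi) <= C + 1" if "p : I" "norm xi <= dl" for p xi
 using C(2)[rule_format, OF that(1,1) that(2,2)] by linarith
 show "abs (f p xi - f p zeta) <= (C + 1) * norm (xi - zeta)" if "p : I" "norm xi <= dl" "norm zeta <= dl" for p xi zeta
 using C(2)[rule_format, OF that(1,1) that(2,3)] up[of "norm (xi - zeta)"] by simp
 show "abs (f p xi - f q xi) <= (C + 1) * abs (p - q)" if "p : I" "q : I" "norm xi <= dl" for p q xi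
 using C(2)[rule_format, OF that(1,2) that(3,3)] up[of "abs (p - q)"] by simp
 show "abs (f p xi - f q xi - (f p 0 - f q 0)) <= (C + 1) * (norm xi * abs (p - q))" if "p : I" "q : I" "norm xi <= dl" for p q xi
 using C(2)[rule_format, OF that(1,2) that(3,3)] up[of "norm xi * abs (p - q)"] by (simp add: mult.assoc)
 qed
qed

lemma abs_mult_le: "abs x <= X ==> abs y <= Y ==> abs (x * y) <= X * (Y::real)"
 unfolding abs_mult by (intro mult_mono) auto

lemma lipmix_const [simp]: "lipmix I dl (%p xi. c)"
 by (rule lipmixI[of "abs c"]) auto

lemma lipmix_add:
 assumes "lipmix I dl f" "lipmix I dl g"
 shows "lipmix I dl (%p xi. f p xi + g p xi)"
proof -
 obtain C where C: "C > 0"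
 "!!p xi. p : I ==> norm xi <= dl ==> abs (f p xi) <= C"
 "!!p xi zeta. p : I ==> norm xi <= dl ==> norm zeta <= dl ==> abs (f p xi - f p zeta) <= C * norm (xi - zeta)"
 "!!p q xi. p : I ==> q : I ==> norm xi <= dl ==> abs (f p xi - f q xi) <= C * abs (p - q)"
 "!!p q xi. p : I ==> q : I ==> norm xi <= dl ==> abs (f p xi - f q xi - (f p 0 - f q 0)) <= C * (norm xi * abs (p - q))"
 by (rule lipmixE[OF assms(1)]) blast
 obtain D where D: "D > 0"
 "!!p xi. p : I ==> norm xi <= dl ==> abs (g p xi) <= D"
 "!!p xi zeta. p : I ==> norm xi <= dl ==> norm zeta <= dl ==> abs (g p xi - g p zeta) <= D * norm (xi - zeta)"
 "!!p q xi. p : I ==> q : I ==> norm xi <= dl ==> abs (g p xi - g q xi) <= D * abs (p - q)"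
 "!!p q xi. p : I ==> q : I ==> norm xi <= dl ==> abs (g p xi - g q xi - (g p 0 - g q 0)) <= D * (norm xi * abs (p - q))"
 by (rule lipmixE[OF assms(2)]) blast
 show ?thesis
 proof (rule lipmixI[of "C + D"])
 show "C + D >= 0" using C D by simp
 show "abs (f p xi + g p xi) <= C + D" if "p : I" "norm xi <= dl" for p xi
 using C(2)[OF that] D(2)[OF that] by linarith
 show "abs (f p xi + g p xi - (f p zeta + g p zeta)) <= (C + D) * norm (xi - zeta)"
 if "p : I" "norm xi <= dl" "norm zeta <= dl" for p xi zeta
 using C(3)[OF that] D(3)[OF that] unfolding distrib_right by linarith
 show "abs (f p xi + g p xi - (f q xi + g q xi)) <= (C + D) * abs (p - q)"
 if "p : I" "q : I" "norm xi <= dl" for p q xi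
 using C(4)[OF that] D(4)[OF that] unfolding distrib_right by linarith
 show "abs (f p xi + g p xi - (f q xi + g q xi) - (f p 0 + g p 0 - (f q 0 + g q 0))) <= (C + D) * (norm xi * abs (p - q))"
 if "p : I" "q : I" "norm xi <= dl" for p q xi
 using C(5)[OF that] D(5)[OF that] unfolding distrib_right by linarith
 qed
qed

lemma lipmix_sum:
 assumes "!!i. i : A ==> lipmix I dl (f i)"
 shows "lipmix I dl (%p xi. SUM i:A. f i p xi)"
 using assms by (induction A rule: infinite_finite_induct) (auto intro!: lipmix_add)

lemma lipmix_mult:
 assumes "lipmix I dl f" "lipmix I dl g" "dl >= 0"
 shows "lipmix I dl (%p xi. f p xi * g p xi)"
proof -
 obtain C where C: "C > 0"
 "!!p xi. p : I ==> norm xi <= dl ==> abs (f p xi) <= C"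
 "!!p xi zeta. p : I ==> norm xi <= dl ==> norm zeta <= dl ==> abs (f p xi - f p zeta) <= C * norm (xi - zeta)"
 "!!p q xi. p : I ==> q : I ==> norm xi <= dl ==> abs (f p xi - f q xi) <= C * abs (p - q)"
 "!!p q xi. p : I ==> q : I ==> norm xi <= dl ==> abs (f p xi - f q xi - (f p 0 - f q 0)) <= C * (norm xi * abs (p - q))"
 by (rule lipmixE[OF assms(1)]) blast
 obtain D where D: "D > 0"
 "!!p xi. p : I ==> norm xi <= dl ==> abs (g p xi) <= D"
 "!!p xi zeta. p : I ==> norm xi <= dl ==> norm zeta <= dl ==> abs (g p xi - g p zeta) <= D * norm (xi - zeta)"
 "!!p q xi. p : I ==> q : I ==> norm xi <= dl ==> abs (g p xi - g q xi) <= D * abs (p - q)"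
 "!!p q xi. p : I ==> q : I ==> norm xi <= dl ==> abs (g p xi - g q xi - (g p 0 - g q 0)) <= D * (norm xi * abs (p - q))"
 by (rule lipmixE[OF assms(2)]) blast
 have CD: "C * D >= 0" using C D by simp
 have two: "abs (s * t - s' * t') <= 4 * (C * D) * X"
 if "abs s <= C" "abs t' <= D" "abs (s - s') <= C * X" "abs (t - t') <= D * X" "X >= 0" for s t s' t' X
 proof -
 have "s * t - s' * t' = s * (t - t') + (s - s') * t'" by (simp add: algebra_simps)
 moreover have "abs (s * (t - t')) <= C * (D * X)" "abs ((s - s') * t') <= C * X * D"
 using that by (auto intro!: abs_mult_le)
 moreover have "C * (D * X) = C * D * X" "C * X * D = C * D * X" by simp_all
 moreover have "C * D * X >= 0" using CD that by simp
 ultimately show ?thesis by linarith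
 qed
 show ?thesis
 proof (rule lipmixI[of "4 * (C * D)"])
 show "4 * (C * D) >= 0" using CD by simp
 show "abs (f p xi * g p xi) <= 4 * (C * D)" if "p : I" "norm xi <= dl" for p xi
 using abs_mult_le[OF C(2)[OF that] D(2)[OF that]] CD by linarith
 show "abs (f p xi * g p xi - f p zeta * g p zeta) <= 4 * (C * D) * norm (xi - zeta)"
 if "p : I" "norm xi <= dl" "norm zeta <= dl" for p xi zeta
 by (rule two) (use that C D in auto)
 show "abs (f p xi * g p xi - f q xi * g q xi) <= 4 * (C * D) * abs (p - q)"
 if "p : I" "q : I" "norm xi <= dl" for p q xi
 by (rule two) (use that C D in auto)
 show "abs (f p xi * g p xi - f q xi * g q xi - (f p 0 * g p 0 - f q 0 * g q 0)) <= 4 * (C * D) * (norm xi * abs (p - q))"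
 if pq: "p : I" "q : I" and x: "norm xi <= dl" for p q xi
 proof -
 have z: "norm (0 :: 'a) <= dl" using assms by simp
 define X where "X = C * D * (norm xi * abs (p - q))"
 \<comment> \<open>Discrete Leibniz rule: each summand is a mixed difference times a value, or a
   difference in the point times a difference in the exponent.\<close>
 have e: "f p xi * g p xi - f q xi * g q xi - (f p 0 * g p 0 - f q 0 * g q 0)
 = (f p xi - f q xi - (f p 0 - f q 0)) * g p xi + (f q xi - f q 0) * (g p xi - g q xi)
 + (f p 0 - f q 0) * (g p xi - g p 0) + f q 0 * (g p xi - g q xi - (g p 0 - g q 0))"
 by (simp add: algebra_simps)
 have b1: "abs ((f p xi - f q xi - (f p 0 - f q 0)) * g p xi) <= X"
 using abs_mult_le[OF C(5)[OF pq x] D(2)[OF pq(1) x]] by (simp only: X_def mult_ac)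
 have b2: "abs ((f q xi - f q 0) * (g p xi - g q xi)) <= X"
 using abs_mult_le[OF C(3)[OF pq(2) x z] D(4)[OF pq x]] by (simp only: X_def mult_ac diff_zero)
 have b3: "abs ((f p 0 - f q 0) * (g p xi - g p 0)) <= X"
 using abs_mult_le[OF C(4)[OF pq z] D(3)[OF pq(1) x z]] by (simp only: X_def mult_ac diff_zero)
 have b4: "abs (f q 0 * (g p xi - g q xi - (g p 0 - g q 0))) <= X"
 using abs_mult_le[OF C(2)[OF pq(2) z] D(5)[OF pq x]] by (simp only: X_def mult_ac)
 have four: "abs (a + b + c + d) <= 4 * Y" if "abs a <= Y" "abs b <= Y" "abs c <= Y" "abs d <= Y" for a b c d Y :: real
 using that by linarith
 show ?thesis using four[OF b1 b2 b3 b4] unfolding e X_def by (simp only: mult.assoc)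
 qed
 qed
qed

lemma lipmix_cmult: "lipmix I dl f ==> dl >= 0 ==> lipmix I dl (%p xi. c * f p xi)"
 by (rule lipmix_mult) auto

lemma lipmix_inverse:
 assumes "lipmix I dl f" "dl >= 0" and k: "k > 0" "!!p xi. p : I ==> norm xi <= dl ==> f p xi >= k"
 shows "lipmix I dl (%p xi. 1 / f p xi)"
proof -
 obtain C where C: "C > 0"
 "!!p xi. p : I ==> norm xi <= dl ==> abs (f p xi) <= C"
 "!!p xi zeta. p : I ==> norm xi <= dl ==> norm zeta <= dl ==> abs (f p xi - f p zeta) <= C * norm (xi - zeta)"
 "!!p q xi. p : I ==> q : I ==> norm xi <= dl ==> abs (f p xi - f q xi) <= C * abs (p - q)"
 "!!p q xi. p : I ==> q : I ==> norm xi <= dl ==> abs (f p xi - f q xi - (f p 0 - f q 0)) <= C * (norm xi * abs (p - q))"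
 by (rule lipmixE[OF assms(1)]) blast
 define h where "h = 1 / k"
 have h: "h > 0" using k by (simp add: h_def)
 have inv: "abs (1 / s) <= h" if "s >= k" for s
 using that k by (simp add: h_def frac_le)
 have two: "abs (1 / s - 1 / t) <= C * h * h * X" if "s >= k" "t >= k" "abs (s - t) <= C * X" for s t X
 proof -
 have "1 / s - 1 / t = (1 / s) * (1 / t) * (t - s)" using that k by (simp add: field_simps)
 also have "abs (...) <= h * h * (C * X)"
 using that by (intro abs_mult_le inv) (auto simp: abs_minus_commute)
 finally show ?thesis by (simp add: mult_ac)
 qed
 define K where "K = h + C * h * h + 2 * (C * h * h * C * h) + h * h * C"
 have K: "h <= K" "C * h * h <= K" "2 * (C * h * h * C * h) + h * h * C <= K" "K >= 0"
 using C h by (auto simp: K_def intro!: add_nonneg_nonneg mult_nonneg_nonneg)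
 show ?thesis
 proof (rule lipmixI[OF K(4)])
 show "abs (1 / f p xi) <= K" if "p : I" "norm xi <= dl" for p xi
 using inv[OF k(2)[OF that]] K(1) by linarith
 show "abs (1 / f p xi - 1 / f p zeta) <= K * norm (xi - zeta)"
 if "p : I" "norm xi <= dl" "norm zeta <= dl" for p xi zeta
 by (rule order_trans[OF two mult_right_mono[OF K(2)]]) (use that k C in auto)
 show "abs (1 / f p xi - 1 / f q xi) <= K * abs (p - q)"
 if "p : I" "q : I" "norm xi <= dl" for p q xi
 by (rule order_trans[OF two mult_right_mono[OF K(2)]]) (use that k C in auto)
 show "abs (1 / f p xi - 1 / f q xi - (1 / f p 0 - 1 / f q 0)) <= K * (norm xi * abs (p - q))"
 if pq: "p : I" "q : I" and x: "norm xi <= dl" for p q xi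
 proof -
 have z: "norm (0 :: 'a) <= dl" using assms by simp
 have nz: "f p xi ~= 0" "f q xi ~= 0" "f p 0 ~= 0" "f q 0 ~= 0"
 using k(2)[OF pq(1) x] k(2)[OF pq(2) x] k(2)[OF pq(1) z] k(2)[OF pq(2) z] k(1) by auto
 have id: "1 / a - 1 / b - (1 / c - 1 / d) = 1 / a * ((1 / d - 1 / b) * (a - b) + (1 / d - 1 / c) * (a - c) - 1 / d * (a - b - (c - d)))"
 if "a ~= 0" "b ~= 0" "c ~= 0" "d ~= 0" for a b c d :: real
 using that by (simp add: field_simps)
 have t1: "abs ((1 / f q 0 - 1 / f q xi) * (f p xi - f q xi)) <= C * h * h * norm xi * (C * abs (p - q))"
 using C(3)[OF pq(2) z x] by (intro abs_mult_le two k C pq x z) auto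
 have t2: "abs ((1 / f q 0 - 1 / f p 0) * (f p xi - f p 0)) <= C * h * h * abs (p - q) * (C * norm xi)"
 using C(3)[OF pq(1) x z] C(4)[OF pq z] by (intro abs_mult_le two k pq z) (auto simp: abs_minus_commute)
 have t3: "abs (1 / f q 0 * (f p xi - f q xi - (f p 0 - f q 0))) <= h * (C * (norm xi * abs (p - q)))"
 by (intro abs_mult_le inv k C pq x z)
 have "abs ((1 / f q 0 - 1 / f q xi) * (f p xi - f q xi) + (1 / f q 0 - 1 / f p 0) * (f p xi - f p 0)
 - 1 / f q 0 * (f p xi - f q xi - (f p 0 - f q 0))) <= (2 * (C * h * h * C) + h * C) * (norm xi * abs (p - q))"
 using t1 t2 t3 by (simp add: algebra_simps)
 hence "abs (1 / f p xi * ((1 / f q 0 - 1 / f q xi) * (f p xi - f q xi) + (1 / f q 0 - 1 / f p 0) * (f p xi - f p 0)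
 - 1 / f q 0 * (f p xi - f q xi - (f p 0 - f q 0)))) <= h * ((2 * (C * h * h * C) + h * C) * (norm xi * abs (p - q)))"
 by (intro abs_mult_le inv k pq x)
 also have "... = (2 * (C * h * h * C * h) + h * h * C) * (norm xi * abs (p - q))" by (simp add: algebra_simps)
 also have "... <= K * (norm xi * abs (p - q))" by (rule mult_right_mono[OF K(3)]) simp
 finally show ?thesis unfolding id[OF nz] .
 qed
 qed
qed

lemma mvt_abs_bound:
 fixes g g' :: "real => real"
 assumes "convex S" "!!t. t : S ==> (g has_real_derivative g' t) (at t)" "!!t. t : S ==> abs (g' t) <= C" "s : S" "t : S"
 shows "abs (g s - g t) <= C * abs (s - t)"
 using field_differentiable_bound[of S g g' C s t] assms by (auto intro: has_field_derivative_at_within)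

text \<open>The factor \<open>p * Phi p\<close> is the derivative of \<open>|y + t| powr p\<close>
  in \<open>t\<close>. Controlling how it varies with \<open>p\<close> gives the mixed differences
  of \<open>lipmix\<close> through the mean value theorem in \<open>t\<close>.\<close>

definition scal :: "real => real => (real => real) => bool" where
 "scal l r y \<longleftrightarrow> (EX C>=0. ALL p:{l..r}. ALL q:{l..r}. ALL t:{-1/2..1/2}.
 abs (abs (y p + t) powr p) <= C & abs (p * Phi p (y p + t)) <= C & abs (abs (y p + t) powr p - abs (y q + t) powr q) <= C * abs (p - q)
 & abs (p * Phi p (y p + t) - q * Phi q (y q + t)) <= C * abs (p - q))"

lemma scal_minus: "scal l r y ==> scal l r (%p. - y p)"
proof -
 assume "scal l r y"
 then obtain C where C: "C >= 0" "!!p q t. p : {l..r} ==> q : {l..r} ==> t : {-1/2..1/2} ==>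
 abs (abs (y p + t) powr p) <= C & abs (p * Phi p (y p + t)) <= C & abs (abs (y p + t) powr p - abs (y q + t) powr q) <= C * abs (p - q)
 & abs (p * Phi p (y p + t) - q * Phi q (y q + t)) <= C * abs (p - q)"
 unfolding scal_def by blast
 have e: "abs (- y p + t) = abs (y p + - t)" "Phi p (- y p + t) = - Phi p (y p + - t)" for p t
 using Phi_minus[of p "y p + - t"] by auto
 show ?thesis
 unfolding scal_def e
 proof (intro exI[of _ C] conjI ballI C(1))
 fix p q t :: real assume a: "p : {l..r}" "q : {l..r}" "t : {-1/2..1/2}"
 hence t: "- t : {-1/2..1/2}" by auto
 note c = C(2)[OF a(1,2) t]
 show "abs (abs (y p + - t) powr p) <= C" "abs (p * - Phi p (y p + - t)) <= C"
 "abs (abs (y p + - t) powr p - abs (y q + - t) powr q) <= C * abs (p - q)" using c by simp_all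
 show "abs (p * - Phi p (y p + - t) - q * - Phi q (y q + - t)) <= C * abs (p - q)"
 using c by (simp add: abs_minus_commute)
 qed
qed

text \<open>Differentiating \<open>u powr (p - 1)\<close> in \<open>p\<close> produces a logarithm.
  The inequality \<open>ln x <= x - 1\<close> at \<open>x = u powr (- (l - 1))\<close> shows that
  the positive exponent absorbs its singularity at 0, uniformly in \<open>p >= l\<close>.\<close>

lemma powr_ln_bound:
 assumes "0 < u" "u <= 1" "1 < l" "l <= (p::real)"
 shows "u powr (p - 1) * abs (ln u) <= 1 / (l - 1)"
proof -
 have "ln (u powr (- (l - 1))) <= u powr (- (l - 1)) - 1" using assms by (intro ln_le_minus_one) simp
 moreover have "ln (u powr (- (l - 1))) = (l - 1) * abs (ln u)"
 using assms by (simp add: ln_powr abs_of_nonpos algebra_simps)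
 ultimately have "(l - 1) * abs (ln u) <= u powr (- (l - 1))" by linarith
 hence "abs (ln u) <= u powr (- (l - 1)) / (l - 1)" using assms by (simp add: field_simps)
 hence "u powr (l - 1) * abs (ln u) <= u powr (l - 1) * (u powr (- (l - 1)) / (l - 1))"
 by (intro mult_left_mono) auto
 also have "... = 1 / (l - 1)" using assms by (simp add: powr_add[symmetric])
 finally have *: "u powr (l - 1) * abs (ln u) <= 1 / (l - 1)" .
 have "u powr (p - 1) * abs (ln u) <= u powr (l - 1) * abs (ln u)"
 using assms by (intro mult_right_mono powr_mono') auto
 thus ?thesis using * by linarith
qed

text \<open>The case of a gap that vanishes at the base vector: the argument \<open>t\<close> comes
  arbitrarily close to 0, and \<open>powr_ln_bound\<close> keeps the derivatives in \<open>p\<close>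
  bounded there.\<close>

lemma scal_zero:
 assumes l: "1 < l" and y: "!!p. p : {l..r} ==> y p = 0"
 shows "scal l r y"
proof -
 define C where "C = 1 + abs r + abs r / (l - 1) + 1 / (l - 1)"
 have C0: "abs r / (l - 1) >= 0" "1 / (l - 1) >= 0" using l by auto
 have C: "C >= 1" "C >= 1 / (l - 1)" "C >= 1 + abs r / (l - 1)" "C >= abs r" "C >= 0"
 unfolding C_def using C0 by linarith+
 have le1: "abs t powr s <= 1" if "abs t <= 1" "s >= 0" for t s :: real
 using that powr_mono2[of s "abs t" 1] by simp
 have A1: "abs (abs t powr p) <= C" if "p : {l..r}" "t : {-1/2..1/2}" for p t
 proof -
 have "abs t powr p <= 1" by (rule le1) (use that l in auto)
 thus ?thesis using C by simp
 qed
 have A2: "abs (p * Phi p t) <= C" if "p : {l..r}" "t : {-1/2..1/2}" for p t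
 proof -
 have "abs (p * Phi p t) <= abs r * 1" unfolding abs_mult abs_Phi
 using that l by (intro mult_mono le1) auto
 thus ?thesis using C by simp
 qed
 have A3: "abs (abs t powr p - abs t powr q) <= C * abs (p - q)" if "p : {l..r}" "q : {l..r}" "t : {-1/2..1/2}" for p q t
 proof (cases "t = 0")
 case True
 thus ?thesis using C by simp
 next
 case False
 have t: "0 < abs t" "abs t <= 1" using that False by auto
 show ?thesis
 proof (rule mvt_abs_bound[of "{l..r}" _ "%s. abs t powr s * ln (abs t)"])
 fix s assume s: "s : {l..r}"
 show "((%s. abs t powr s) has_real_derivative abs t powr s * ln (abs t)) (at s)"
 using t by (auto intro!: derivative_eq_intros)
 have "abs t powr s * abs (ln (abs t)) <= abs t powr (s - 1) * abs (ln (abs t))"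
 using t s by (intro mult_right_mono powr_mono') auto
 also have "... <= 1 / (l - 1)" using t s l by (intro powr_ln_bound) auto
 finally show "abs (abs t powr s * ln (abs t)) <= C" using C by (simp add: abs_mult)
 qed (use that in auto)
 qed
 have A4: "abs (p * Phi p t - q * Phi q t) <= C * abs (p - q)" if "p : {l..r}" "q : {l..r}" "t : {-1/2..1/2}" for p q t
 proof (cases "t = 0")
 case True
 thus ?thesis using C by simp
 next
 case False
 have t: "0 < abs t" "abs t <= 1" using that False by auto
 have Phi_eq: "Phi s t = sgn t * abs t powr (s - 1)" for s
 using False by (cases "t > 0") (auto simp: Phi_pos_eq Phi_eq_pos_neg max_def)
 show ?thesis
 proof (rule mvt_abs_bound[of "{l..r}" _ "%s. sgn t * (abs t powr (s - 1) + s * (abs t powr (s - 1) * ln (abs t)))"])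
 fix s assume s: "s : {l..r}"
 show "((%s. s * Phi s t) has_real_derivative sgn t * (abs t powr (s - 1) + s * (abs t powr (s - 1) * ln (abs t)))) (at s)"
 unfolding Phi_eq using t by (auto intro!: derivative_eq_intros simp: algebra_simps)
 have "abs (s * (abs t powr (s - 1) * ln (abs t))) <= abs r * (1 / (l - 1))"
 using powr_ln_bound[OF t l, of s] s l by (intro abs_mult_le) (auto simp: abs_mult)
 moreover have "abs t powr (s - 1) <= 1" using t s l by (intro le1) auto
 moreover have "0 <= abs t powr (s - 1)" by simp
 moreover have "1 + abs r * (1 / (l - 1)) <= C" using C(3) by simp
 ultimately have "abs (abs t powr (s - 1) + s * (abs t powr (s - 1) * ln (abs t))) <= C" by linarith
 thus "abs (sgn t * (abs t powr (s - 1) + s * (abs t powr (s - 1) * ln (abs t)))) <= C"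
 using False by (simp add: abs_mult abs_sgn_eq)
 qed (use that in auto)
 qed
 show ?thesis
 unfolding scal_def
 proof (intro exI[of _ C] conjI ballI C(5))
 fix p q t :: real assume a: "p : {l..r}" "q : {l..r}" "t : {-1/2..1/2}"
 show "abs (abs (y p + t) powr p) <= C" "abs (p * Phi p (y p + t)) <= C"
 "abs (abs (y p + t) powr p - abs (y q + t) powr q) <= C * abs (p - q)"
 "abs (p * Phi p (y p + t) - q * Phi q (y q + t)) <= C * abs (p - q)"
 using A1[OF a(1,3)] A2[OF a(1,3)] A3[OF a] A4[OF a] by (simp_all add: y[OF a(1)] y[OF a(2)])
 qed
qed

lemma scal_ge1:
 assumes l: "1 < l" and y: "!!p. p : {l..r} ==> y p >= 1"
 and y': "!!p. p : {l..r} ==> (y has_real_derivative y' p) (at p)" "continuous_on {l..r} y'"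
 shows "scal l r y"
proof -
 let ?S = "{l..r} \<times> {-1/2..1/2 :: real}"
 have cy: "continuous_on {l..r} y"
 using y'(1) by (meson DERIV_continuous_on has_field_derivative_at_within)
 have c1: "continuous_on ?S (%z. y (fst z))" and c2: "continuous_on ?S (%z. y' (fst z))"
 by (rule continuous_on_compose2[OF cy continuous_on_fst[OF continuous_on_id]] continuous_on_compose2[OF y'(2) continuous_on_fst[OF continuous_on_id]]; auto)+
 have pos: "y (fst z) + snd z > 0" if "z : ?S" for z using y[of "fst z"] that by auto
 let ?u = "%z. y (fst z) + snd z"
 define F1 where "F1 = (%z. ?u z powr fst z)"
 define F2 where "F2 = (%z. fst z * ?u z powr (fst z - 1))"
 define F3 where "F3 = (%z. ?u z powr fst z * (1 * ln (?u z) + y' (fst z) * fst z / ?u z))"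
 define F4 where "F4 = (%z. 1 * ?u z powr (fst z - 1) + ?u z powr (fst z - 1) * (1 * ln (?u z) + y' (fst z) * (fst z - 1) / ?u z) * fst z)"
 have cpt: "compact ?S" by (intro compact_Times compact_Icc)
 have nz: "?u z ~= 0" if "z : ?S" for z using pos[OF that] by simp
 have "continuous_on ?S F1" "continuous_on ?S F2" "continuous_on ?S F3" "continuous_on ?S F4"
 unfolding F1_def F2_def F3_def F4_def
 by (intro continuous_intros c1 c2; use nz in blast)+
 then obtain C1 C2 C3 C4 where C: "C1 > 0" "ALL z:?S. abs (F1 z) <= C1" "C2 > 0" "ALL z:?S. abs (F2 z) <= C2"
 "C3 > 0" "ALL z:?S. abs (F3 z) <= C3" "C4 > 0" "ALL z:?S. abs (F4 z) <= C4"
 using continuous_upper_bound[OF cpt] by metis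
 define C where "C = C1 + C2 + C3 + C4"
 have Cge: "C1 <= C" "C2 <= C" "C3 <= C" "C4 <= C" "C >= 0" using C by (auto simp: C_def)
 have eq1: "abs (y p + t) powr p = F1 (p, t)" and eq2: "p * Phi p (y p + t) = F2 (p, t)"
 if "p : {l..r}" "t : {-1/2..1/2}" for p t
 using pos[of "(p, t)"] that by (auto simp: F1_def F2_def Phi_pos_eq)
 have D1: "((%p. F1 (p, t)) has_real_derivative F3 (p, t)) (at p)"
 and D2: "((%p. F2 (p, t)) has_real_derivative F4 (p, t)) (at p)"
 if "p : {l..r}" "t : {-1/2..1/2}" for p t
 proof -
 have dy: "((%p. y p + t) has_real_derivative y' p) (at p)"
 using DERIV_add[OF y'(1)[OF that(1)] DERIV_const[of t]] by simp
 have up: "y p + t > 0" using pos[of "(p, t)"] that by simp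
 show "((%p. F1 (p, t)) has_real_derivative F3 (p, t)) (at p)"
 unfolding F1_def F3_def fst_conv snd_conv
 by (rule DERIV_powr[OF dy up DERIV_ident])
 have d1: "((%p. p - 1) has_real_derivative 1) (at p)" by (auto intro!: derivative_eq_intros)
 show "((%p. F2 (p, t)) has_real_derivative F4 (p, t)) (at p)"
 unfolding F2_def F4_def fst_conv snd_conv
 by (rule DERIV_mult[OF DERIV_ident DERIV_powr[OF dy up d1]])
 qed
 show ?thesis
 unfolding scal_def
 proof (intro exI[of _ C] conjI ballI Cge(5))
 fix p q t :: real assume a: "p : {l..r}" "q : {l..r}" "t : {-1/2..1/2}"
 note e = eq1[OF a(1,3)] eq1[OF a(2,3)] eq2[OF a(1,3)] eq2[OF a(2,3)]
 have pt: "(p, t) : ?S" using a by auto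
 have b: "abs (F1 (p, t)) <= C" "abs (F2 (p, t)) <= C"
 using order_trans[OF C(2)[rule_format, OF pt] Cge(1)] order_trans[OF C(4)[rule_format, OF pt] Cge(2)] by blast+
 thus "abs (abs (y p + t) powr p) <= C" "abs (p * Phi p (y p + t)) <= C" unfolding e .
 have "abs (F1 (p, t) - F1 (q, t)) <= C * abs (p - q)"
 by (rule mvt_abs_bound[of "{l..r}" _ "%p. F3 (p, t)"])
 (use a D1 order_trans[OF C(6)[rule_format] Cge(3)] in auto)
 thus "abs (abs (y p + t) powr p - abs (y q + t) powr q) <= C * abs (p - q)" unfolding e .
 have "abs (F2 (p, t) - F2 (q, t)) <= C * abs (p - q)"
 by (rule mvt_abs_bound[of "{l..r}" _ "%p. F4 (p, t)"])
 (use a D2 order_trans[OF C(8)[rule_format] Cge(4)] in auto)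
 thus "abs (p * Phi p (y p + t) - q * Phi q (y q + t)) <= C * abs (p - q)" unfolding e .
 qed
qed

text \<open>The radius 1/4 keeps \<open>L xi\<close> in the window of \<open>scal\<close>; the
  factor 2 in the bound for \<open>L\<close> accommodates a difference of two coordinates.\<close>

lemma scal_lipmix:
 fixes L :: "'a::real_normed_vector => real"
 assumes l: "1 < l" and y: "scal l r y" and L: "linear L" "!!xi. abs (L xi) <= 2 * norm xi"
 shows "lipmix {l..r} (1/4) (%p xi. abs (y p + L xi) powr p)"
proof -
 obtain C where C: "C >= 0" "!!p q t. p : {l..r} ==> q : {l..r} ==> t : {-1/2..1/2} ==>
 abs (abs (y p + t) powr p) <= C & abs (p * Phi p (y p + t)) <= C & abs (abs (y p + t) powr p - abs (y q + t) powr q) <= C * abs (p - q)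
 & abs (p * Phi p (y p + t) - q * Phi q (y q + t)) <= C * abs (p - q)"
 using y unfolding scal_def by blast
 have Lin: "L xi : {-1/2..1/2}" if "norm xi <= 1/4" for xi using L(2)[of xi] that by auto
 have L0: "L 0 = 0" using L linear_0 by blast
 have Ld: "L (xi - zeta) = L xi - L zeta" for xi zeta using L linear_diff by blast
 have D: "((%t. abs (y p + t) powr p) has_real_derivative p * Phi p (y p + t)) (at t)" if "p : {l..r}" for p t
 using DERIV_chain2[OF DERIV_abs_powr[of p "y p + t"] DERIV_add[OF DERIV_const DERIV_ident]] that l by simp
 show ?thesis
 proof (rule lipmixI[of "2 * C"])
 show "2 * C >= 0" using C by simp
 show "abs (abs (y p + L xi) powr p) <= 2 * C" if "p : {l..r}" "norm xi <= 1/4" for p xi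
 using C(2)[OF that(1) that(1) Lin[OF that(2)]] C(1) by linarith
 show "abs (abs (y p + L xi) powr p - abs (y q + L xi) powr q) <= 2 * C * abs (p - q)"
 if "p : {l..r}" "q : {l..r}" "norm xi <= 1/4" for p q xi
 proof -
 have "C * abs (p - q) >= 0" using C(1) by simp
 thus ?thesis using C(2)[OF that(1,2) Lin[OF that(3)]] by linarith
 qed
 show "abs (abs (y p + L xi) powr p - abs (y p + L zeta) powr p) <= 2 * C * norm (xi - zeta)"
 if "p : {l..r}" "norm xi <= 1/4" "norm zeta <= 1/4" for p xi zeta
 proof -
 have "abs (abs (y p + L xi) powr p - abs (y p + L zeta) powr p) <= C * abs (L xi - L zeta)"
 by (rule mvt_abs_bound[of "{-1/2..1/2}" _ "%t. p * Phi p (y p + t)"])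
 (use that Lin D C(2) in auto)
 also have "... <= C * (2 * norm (xi - zeta))" unfolding Ld[symmetric] using C(1) L(2) by (intro mult_left_mono)
 finally show ?thesis by simp
 qed
 show "abs (abs (y p + L xi) powr p - abs (y q + L xi) powr q - (abs (y p + L 0) powr p - abs (y q + L 0) powr q)) <= 2 * C * (norm xi * abs (p - q))"
 if "p : {l..r}" "q : {l..r}" "norm xi <= 1/4" for p q xi
 proof -
 let ?g = "%t. abs (y p + t) powr p - abs (y q + t) powr q"
 have "abs (?g (L xi) - ?g 0) <= C * abs (p - q) * abs (L xi - 0)"
 by (rule mvt_abs_bound[of "{-1/2..1/2}" _ "%t. p * Phi p (y p + t) - q * Phi q (y q + t)"])
 (use that Lin C(2) in \<open>auto intro!: DERIV_diff D\<close>)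
 also have "... <= C * abs (p - q) * (2 * norm xi)" using L(2)[of xi] C(1) by (intro mult_left_mono) auto
 finally show ?thesis unfolding L0 by (simp add: mult_ac)
 qed
 qed
qed

text \<open>Continuously differentiable and bounded below by 1. The class is closed under sums and
  so contains, up to sign, every nonzero entry and gap of a base vector.\<close>

definition good :: "real => real => (real => real) => bool" where
 "good l r y \<longleftrightarrow> (EX y'. continuous_on {l..r} y' & (ALL p:{l..r}. y p >= 1 & (y has_real_derivative y' p) (at p)))"

lemma good_scal: "1 < l ==> good l r y ==> scal l r y"
 unfolding good_def using scal_ge1[of l r y] by blast

lemma good_add: "good l r y ==> good l r z ==> good l r (%p. y p + z p)"
 unfolding good_def
 by (elim exE conjE, rule exI, rule conjI, rule continuous_on_add, assumption, assumption)
 (fastforce intro!: DERIV_add)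

lemma good_cr:
 assumes "1 < l" "k >= 1"
 shows "good l r (%p. cr p k)"
proof -
 define c' where "c' = (%p. real k powr (1 / (p - 1)) * (- (1 / (p - 1)^2) * ln (real k) + 0 * (1 / (p - 1)) / real k))"
 have "continuous_on {l..r} c'" unfolding c'_def
 by (intro continuous_intros) (use assms in auto)
 moreover have "((%p. cr p k) has_real_derivative c' p) (at p)" if "p : {l..r}" for p
 unfolding cr_def c'_def
 proof (rule DERIV_powr[OF DERIV_const])
 show "((%p. 1 / (p - 1)) has_real_derivative - (1 / (p - 1)^2)) (at p)"
 using that assms by (auto intro!: derivative_eq_intros simp: power2_eq_square)
 qed (use assms in auto)
 moreover have "cr p k >= 1" if "p : {l..r}" for p using that assms by (intro cr_ge_1) auto
 ultimately show ?thesis unfolding good_def by blast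
qed

lemma scal_base:
 assumes l: "1 < l" and ok: "pair_ok A B"
 shows "scal l r (%p. base p A B $ i)" "scal l r (%p. base p A B $ i - base p A B $ j)"
proof -
 note okD = pair_okD[OF ok]
 have gA: "good l r (%p. cr p (card A))" and gB: "good l r (%p. cr p (card B))"
 using okD l by (auto intro: good_cr)
 note sA = good_scal[OF l gA] and sB = good_scal[OF l gB] and sAB = good_scal[OF l good_add[OF gA gB]]
 have s0: "scal l r (%p. 0)" by (rule scal_zero[OF l]) simp
 have disj: "!!i. i : B ==> i ~: A" using okD by auto
 show "scal l r (%p. base p A B $ i)"
 unfolding base_def using sA sB s0 scal_minus[OF sA] by (cases "i : A"; cases "i : B"; simp)
 have m: "scal l r (%p. - cr p (card A) - cr p (card B))" using scal_minus[OF sAB] by simp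
 have m2: "scal l r (%p. cr p (card B) + cr p (card A))" using sAB by (simp add: add.commute)
 show "scal l r (%p. base p A B $ i - base p A B $ j)"
 unfolding base_def using sA sB s0 scal_minus[OF sA] scal_minus[OF sB] m m2
 by (cases "i : A"; cases "i : B"; cases "j : A"; cases "j : B"; simp)
qed

lemma lipmix_Ew:
 assumes l: "1 < l" and ok: "pair_ok A B"
 shows "lipmix {l..r} (1/4) (%p xi. Ew p w (base p A B + xi))"
proof -
 have "lipmix {l..r} (1/4) (%p xi. 1/2 * (SUM i:UNIV. SUM j:UNIV. w i j * abs ((base p A B $ i - base p A B $ j) + (xi $ i - xi $ j)) powr p))"
 proof (intro lipmix_cmult lipmix_sum scal_lipmix l scal_base ok)
 fix i j
 show "linear (%xi :: real ^ 'a. xi $ i - xi $ j)" by (auto simp: linear_iff algebra_simps)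
 show "abs (xi $ i - xi $ j) <= 2 * norm xi" for xi :: "real ^ 'a"
 using component_le_norm_cart[of xi i] component_le_norm_cart[of xi j] by linarith
 qed auto
 thus ?thesis unfolding Ew_def by (simp add: algebra_simps)
qed

lemma lipmix_Nn:
 assumes l: "1 < l" and ok: "pair_ok A B"
 shows "lipmix {l..r} (1/4) (%p xi. Nn p (base p A B + xi))"
proof -
 have "lipmix {l..r} (1/4) (%p xi. SUM i:UNIV. abs (base p A B $ i + xi $ i) powr p)"
 proof (intro lipmix_sum scal_lipmix l scal_base ok)
 fix i
 show "linear (%xi :: real ^ 'a. xi $ i)" by (auto simp: linear_iff algebra_simps)
 show "abs (xi $ i) <= 2 * norm xi" for xi :: "real ^ 'a"
 using component_le_norm_cart[of xi i] by (smt (verit) norm_ge_zero)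
 qed
 thus ?thesis unfolding Nn_def by simp
qed

lemma Nn_base_ge:
 assumes p: "1 < p" "p <= r" and ok: "pair_ok A B" and x: "norm xi <= 1/4"
 shows "(3/4) powr r <= Nn p (base p A B + xi)"
proof -
 obtain i where i: "i : A" using ok by (auto simp: pair_ok_def)
 have "base p A B $ i >= 1" using i pair_okD[OF ok] p by (simp add: base_def cr_ge_1)
 moreover have "abs (xi $ i) <= 1/4" using component_le_norm_cart[of xi i] x by linarith
 ultimately have b: "abs ((base p A B + xi) $ i) >= 3/4" by simp
 have "(3/4 :: real) powr r <= (3/4) powr p" using p by (intro powr_mono') auto
 also have "... <= abs ((base p A B + xi) $ i) powr p" using b p by (intro powr_mono2) auto
 also have "... <= Nn p (base p A B + xi)" unfolding Nn_def
 by (rule member_le_sum[of i UNIV "%i. abs ((base p A B + xi) $ i) powr p"]) auto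
 finally show ?thesis .
qed

lemma base_near_nonzero:
 assumes "1 < p" "pair_ok A B" "norm xi <= 1/4"
 shows "base p A B + xi ~= 0"
proof
 assume "base p A B + xi = 0"
 hence "Nn p (base p A B + xi) = 0" by (simp add: Nn_def)
 moreover have "(3/4 :: real) powr p > 0" by simp
 ultimately show False using Nn_base_ge[OF assms(1) order_refl assms(2,3)] by linarith
qed

lemma lipmix_Rq:
 assumes l: "1 < l" and ok: "pair_ok A B"
 shows "lipmix {l..r} (1/4) (%p xi. Rq p w (base p A B + xi))"
proof -
 have "lipmix {l..r} (1/4) (%p xi. Ew p w (base p A B + xi) * (1 / Nn p (base p A B + xi)))"
 by (intro lipmix_mult lipmix_Ew lipmix_inverse[where k = "(3/4) powr r"] lipmix_Nn l ok Nn_base_ge)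
 (use l in auto)
 thus ?thesis by (simp add: Rq_def)
qed

section \<open>Max-min critical points\<close>

definition mm :: "('a => 'b => real) => 'a set => 'b set => real" where
 "mm F U V = (SUP v\<in>V. INF u\<in>U. F u v)"

lemma mm_le:
 assumes "U ~= {}" "V ~= {}" "!!u v. u : U ==> v : V ==> F u v <= G u v + k"
 and bF: "!!u v. u : U ==> v : V ==> abs (F u v) <= B" and bG: "!!u v. u : U ==> v : V ==> abs (G u v) <= B"
 shows "mm F U V <= mm G U V + k"
 unfolding mm_def
proof (rule cSUP_least[OF assms(2)])
 fix v assume v: "v : V"
 obtain u0 where u0: "u0 : U" using assms(1) by blast
 have bddF: "bdd_below ((%u. F u v) ` U)" by (rule bdd_belowI2[of _ "- B"]) (use bF v in force)
 have bddG: "bdd_below ((%u. G u v) ` U)" if "v : V" for v by (rule bdd_belowI2[of _ "- B"]) (use bG that in force)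
 have "(INF u\<in>U. F u v) - k <= (INF u\<in>U. G u v)"
 proof (rule cINF_greatest[OF assms(1)])
 fix u assume u: "u : U"
 have "(INF u\<in>U. F u v) <= F u v" by (rule cINF_lower[OF bddF u])
 thus "(INF u\<in>U. F u v) - k <= G u v" using assms(3)[OF u v] by linarith
 qed
 also have "(INF u\<in>U. G u v) <= (SUP v\<in>V. INF u\<in>U. G u v)"
 proof (rule cSUP_upper[OF v])
 show "bdd_above ((%v. INF u\<in>U. G u v) ` V)"
 proof (rule bdd_aboveI2[of _ _ B])
 fix v assume v: "v : V"
 have "(INF u\<in>U. G u v) <= G u0 v" by (rule cINF_lower[OF bddG[OF v] u0])
 thus "(INF u\<in>U. G u v) <= B" using bG[OF u0 v] by linarith
 qed
 qed
 finally show "(INF u\<in>U. F u v) <= (SUP v\<in>V. INF u\<in>U. G u v) + k" by linarith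
qed

text \<open>A max-min value moves by at most the uniform distance of the two functions, also after
  removing a constant \<open>k\<close>. This transfers estimates on the quotient to the eigenvalue
  without following the critical point.\<close>

lemma mm_diff:
 assumes "U ~= {}" "V ~= {}" "!!u v. u : U ==> v : V ==> abs (F u v - G u v - k) <= e"
 and "!!u v. u : U ==> v : V ==> abs (F u v) <= B" "!!u v. u : U ==> v : V ==> abs (G u v) <= B"
 shows "abs (mm F U V - mm G U V - k) <= e"
proof -
 have a: "F u v <= G u v + (k + e)" "G u v <= F u v + (e - k)" if "u : U" "v : V" for u v
 using assms(3)[OF that] by linarith+
 have "mm F U V <= mm G U V + (k + e)" by (rule mm_le[OF assms(1,2) a(1) assms(4,5)])
 moreover have "mm G U V <= mm F U V + (e - k)" by (rule mm_le[OF assms(1,2) a(2) assms(5,4)])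
 ultimately show ?thesis by linarith
qed

text \<open>Applied to the unperturbed quotient it identifies \<open>lam0\<close> as a max-min value
  over the same two balls, so that the perturbed eigenvalue can be compared with it by
  \<open>mm_diff\<close>.\<close>

lemma mm_saddle:
 assumes "u0 : U" "v0 : V" "!!v. v : V ==> F u0 v <= k" "!!u. u : U ==> k <= F u v0"
 and B: "!!u v. u : U ==> v : V ==> abs (F u v) <= B"
 shows "mm F U V = k"
 unfolding mm_def
proof (rule antisym)
 have bdd: "bdd_below ((%u. F u v) ` U)" if "v : V" for v
 by (rule bdd_belowI2[of _ "- B"]) (use B that in force)
 have inf: "(INF u\<in>U. F u v) <= k" if "v : V" for v
 using cINF_lower[OF bdd[OF that] assms(1)] assms(3)[OF that] by linarith
 show "(SUP v\<in>V. INF u\<in>U. F u v) <= k"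
 by (rule cSUP_least) (use inf assms(2) in auto)
 have "k <= (INF u\<in>U. F u v0)" by (rule cINF_greatest) (use assms in auto)
 also have "... <= (SUP v\<in>V. INF u\<in>U. F u v)"
 by (rule cSUP_upper[OF assms(2)]) (use inf in \<open>auto intro: bdd_aboveI2[of _ _ k]\<close>)
 finally show "k <= (SUP v\<in>V. INF u\<in>U. F u v)" .
qed

lemma interior_min_gradient:
 fixes f :: "'a::euclidean_space => real"
 assumes S: "subspace S" and d: "d : S" and u: "u : S" "norm u < r"
 and f: "(f has_derivative (%d. g \<bullet> d)) (at (y + u))"
 and mn: "!!u'. u' : S ==> norm u' <= r ==> f (y + u) <= f (y + u')"
 shows "g \<bullet> d = 0"
proof -
 have "((%t. y + u + t *\<^sub>R d) has_derivative (%t. t *\<^sub>R d)) (at (0::real))"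
 by (auto intro!: derivative_eq_intros)
 moreover have "(f has_derivative (%d. g \<bullet> d)) (at (y + u + 0 *\<^sub>R d))" using f by simp
 ultimately have "((%t. f (y + u + t *\<^sub>R d)) has_derivative (%t. g \<bullet> (t *\<^sub>R d))) (at (0::real))"
 using has_derivative_compose by blast
 moreover have "(%t. g \<bullet> (t *\<^sub>R d)) = (*) (g \<bullet> d)" by (auto simp: mult.commute)
 ultimately have D: "((%t. f (y + u + t *\<^sub>R d)) has_real_derivative g \<bullet> d) (at 0)"
 by (simp add: has_field_derivative_def)
 define e where "e = (r - norm u) / (norm d + 1)"
 have e: "e > 0" using u by (simp add: e_def add_nonneg_pos)
 show ?thesis
 proof (rule DERIV_local_min[OF D e], intro allI impI)
 fix t :: real assume t: "abs (0 - t) < e"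
 have "norm (u + t *\<^sub>R d) <= norm u + abs t * norm d" using norm_triangle_ineq[of u "t *\<^sub>R d"] by simp
 also have "abs t * norm d <= e * (norm d + 1)" using t by (intro mult_mono) auto
 also have "e * (norm d + 1) = r - norm u"
 proof -
 have "norm d + 1 ~= 0" by (metis add_nonneg_pos less_irrefl norm_ge_zero zero_less_one)
 thus ?thesis by (simp add: e_def)
 qed
 finally have "norm (u + t *\<^sub>R d) <= r" by simp
 moreover have "u + t *\<^sub>R d : S" using S u d by (simp add: subspace_add subspace_scale)
 ultimately show "f (y + u + 0 *\<^sub>R d) <= f (y + u + t *\<^sub>R d)" using mn by (simp add: add.assoc)
 qed
qed

text \<open>Uniqueness of the inner minimiser makes the outer function differentiable in the sense
  of Danskin, so that its interior maximiser is a critical point of \<open>f\<close> in all directions.\<close>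

lemma maxmin_critical:
 fixes f :: "'a::euclidean_space => real" and g :: "'a => 'a"
 assumes U: "subspace U" and V: "subspace V" and ru: "ru > 0" and rv: "rv > 0"
 and der: "!!x. norm (x - x0) <= ru + rv ==> (f has_derivative (%d. g x \<bullet> d)) (at x)"
 and cg: "continuous_on (cball x0 (ru + rv)) g"
 and E2: "!!u v. u : U ==> v : V ==> norm u = ru ==> norm v <= rv ==> f (x0 + v) < f (x0 + u + v)"
 and E1: "!!u v. u : U ==> v : V ==> norm u <= ru ==> norm v = rv ==> f (x0 + v) < f (x0 + u)"
 and uniq: "!!u1 u2 v. u1 : U ==> u2 : U ==> v : V ==> norm u1 <= ru ==> norm u2 <= ru ==> norm v <= rv ==>
 f (x0 + u1 + v) = f (x0 + u2 + v) ==> (!!d. d : U ==> g (x0 + u1 + v) \<bullet> d = 0) ==>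
 (!!d. d : U ==> g (x0 + u2 + v) \<bullet> d = 0) ==> u1 = u2"
 obtains u v where "u : U" "v : V" "norm u <= ru" "norm v <= rv"
 "!!d. d : U ==> g (x0 + u + v) \<bullet> d = 0" "!!d. d : V ==> g (x0 + u + v) \<bullet> d = 0"
 "f (x0 + u + v) = mm (%u v. f (x0 + u + v)) (U Int cball 0 ru) (V Int cball 0 rv)"
proof -
 let ?U = "U Int cball 0 ru" and ?V = "V Int cball 0 rv"
 have cU: "compact ?U" and cV: "compact ?V"
 using closed_subspace[OF U] closed_subspace[OF V] by (auto intro: closed_Int_compact)
 have zU: "0 : ?U" and zV: "0 : ?V" using U V ru rv by (auto simp: subspace_0)
 have inS: "norm (x0 + u + v - x0) <= ru + rv" if "u : ?U" "v : ?V" for u v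
 using that norm_triangle_ineq[of u v] by auto
 have cf: "continuous_on (cball x0 (ru + rv)) f"
 by (intro has_derivative_continuous_on[where f' = "%x d. g x \<bullet> d"] has_derivative_at_withinI[OF der])
 (simp add: dist_norm norm_minus_commute)
 have memS: "x0 + u + v : cball x0 (ru + rv)" if "u : ?U" "v : ?V" for u v
 using inS[OF that] unfolding mem_cball dist_norm norm_minus_commute[of x0] .
 have "EX u:?U. ALL u':?U. f (x0 + u + v) <= f (x0 + u' + v)" if "v : ?V" for v
 proof (rule continuous_attains_inf[OF cU])
 show "continuous_on ?U (%u. f (x0 + u + v))"
 by (rule continuous_on_compose2[OF cf]) (use memS that in \<open>auto intro!: continuous_intros\<close>)
 qed (use zU in blast)
 then obtain m where m: "!!v. v : ?V ==> m v : ?U"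
 "!!v u'. v : ?V ==> u' : ?U ==> f (x0 + m v + v) <= f (x0 + u' + v)"
 by metis
 define psi where "psi = (%v. f (x0 + m v + v))"
 have cpsi: "continuous_on ?V psi"
 proof (rule continuous_onI)
 fix v e assume v: "v : ?V" and e: "e > (0::real)"
 have "uniformly_continuous_on (cball x0 (ru + rv)) f"
 using compact_uniformly_continuous[OF cf] by simp
 then obtain dl where dl: "dl > 0" "!!x x'. x : cball x0 (ru + rv) ==> x' : cball x0 (ru + rv) ==> dist x' x < dl ==> dist (f x') (f x) < e"
 using e unfolding uniformly_continuous_on_def by metis
 have "dist (psi v') (psi v) <= e" if v': "v' : ?V" "dist v' v < dl" for v'
 proof -
 have cl: "abs (f (x0 + u + v') - f (x0 + u + v)) < e" if "u : ?U" for u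
 using dl(2)[OF memS[OF that v] memS[OF that v'(1)]] v'(2) by (simp add: dist_norm)
 have "psi v' <= f (x0 + m v + v')" "psi v <= f (x0 + m v' + v)"
 unfolding psi_def using m v v'(1) by blast+
 thus ?thesis using cl[OF m(1)[OF v]] cl[OF m(1)[OF v'(1)]] unfolding psi_def by (simp add: dist_real_def)
 qed
 thus "EX dl>0. ALL v':?V. dist v' v < dl --> dist (psi v') (psi v) <= e" using dl(1) by blast
 qed
 obtain v where v: "v : ?V" "!!v'. v' : ?V ==> psi v' <= psi v"
 using continuous_attains_sup[OF cV _ cpsi] zV by blast
 \<comment> \<open>By \<open>E2\<close> a boundary point loses against \<open>u = 0\<close>, so
   inner minimisers are interior and the gradient vanishes along \<open>U\<close>.\<close>
 have mint: "norm u < ru" if "v : ?V" "u : ?U" "!!u'. u' : ?U ==> f (x0 + u + v) <= f (x0 + u' + v)" for u v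
 proof (rule ccontr)
 assume "~ norm u < ru"
 hence "norm u = ru" using that by auto
 hence "f (x0 + v) < f (x0 + u + v)" using E2 that by auto
 moreover have "f (x0 + u + v) <= f (x0 + 0 + v)" using that(3) zU by blast
 ultimately show False by simp
 qed
 have gU: "g (x0 + u + v) \<bullet> d = 0"
 if "v : ?V" "u : ?U" "!!u'. u' : ?U ==> f (x0 + u + v) <= f (x0 + u' + v)" "d : U" for u v d
 proof (rule interior_min_gradient[OF U that(4), of u ru f _ "x0 + v"])
 show "u : U" "norm u < ru" using that mint by auto
 have c: "x0 + v + w = x0 + w + v" for w by simp
 show "(f has_derivative (%d. g (x0 + u + v) \<bullet> d)) (at (x0 + v + u))"
 unfolding c by (rule der[OF inS[OF that(2,1)]])
 show "f (x0 + v + u) <= f (x0 + v + u')" if "u' : U" "norm u' <= ru" for u'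
 unfolding c using that \<open>!!u'. u' : ?U ==> f (x0 + u + v) <= f (x0 + u' + v)\<close> by auto
 qed
 define u where "u = m v"
 have u: "u : ?U" "!!u'. u' : ?U ==> f (x0 + u + v) <= f (x0 + u' + v)" using m v by (auto simp: u_def)
 have vint: "norm v < rv"
 proof (rule ccontr)
 assume "~ norm v < rv"
 hence n: "norm v = rv" using v by auto
 have "psi v <= f (x0 + 0 + v)" unfolding psi_def using m(2)[OF v(1) zU] .
 also have "... < f (x0 + m 0 + 0)" using E1[of "m 0" v] m(1)[OF zV] v n by auto
 also have "... = psi 0" by (simp add: psi_def)
 finally show False using v(2)[OF zV] by simp
 qed
 \<comment> \<open>Since \<open>v\<close> maximises \<open>psi\<close>, going from \<open>v\<close>
   to \<open>vn n\<close> while keeping the inner minimiser \<open>un n\<close> of the target does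
   not increase \<open>f\<close>. The mean value theorem then gives a nonpositive slope at a nearby
   point, and these slopes converge along a subsequence on which the minimisers converge.\<close>
 have dirle: "g (x0 + u + v) \<bullet> d <= 0" if d: "d : V" for d
 proof -
 define e where "e = (rv - norm v) / (norm d + 1)"
 have nd: "norm d + 1 > 0" by (simp add: add_nonneg_pos)
 have e: "e > 0" using vint nd by (simp add: e_def)
 define t where "t = (%n. e / real (Suc n))"
 have t: "0 < t n" "t n <= e" for n using e by (auto simp: t_def field_simps)
 have tlim: "t \<longlonglongrightarrow> 0" unfolding t_def by (rule LIMSEQ_Suc) (rule lim_const_over_n)
 have vs: "v + s *\<^sub>R d : ?V" if "0 <= s" "s <= e" for s
 proof -
 have "norm (v + s *\<^sub>R d) <= norm v + s * norm d" using norm_triangle_ineq[of v "s *\<^sub>R d"] that by simp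
 also have "s * norm d <= e * (norm d + 1)" using that by (intro mult_mono) auto
 also have "e * (norm d + 1) = rv - norm v" using nd by (simp add: e_def)
 finally show ?thesis using V v d by (simp add: subspace_add subspace_scale)
 qed
 define vn where "vn = (%n. v + t n *\<^sub>R d)"
 define un where "un = (%n. m (vn n))"
 have vn: "vn n : ?V" for n unfolding vn_def by (rule vs) (use t[of n] in auto)
 have un: "un n : ?U" for n unfolding un_def by (rule m(1)[OF vn])
 have "EX s. 0 < s & s < t n & g (x0 + un n + (v + s *\<^sub>R d)) \<bullet> d <= 0" for n
 proof -
 let ?h = "%s. f (x0 + un n + (v + s *\<^sub>R d))"
 have D: "(?h has_real_derivative g (x0 + un n + (v + s *\<^sub>R d)) \<bullet> d) (at s)" if "0 <= s" "s <= t n" for s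
 proof -
 have "((%s. x0 + un n + (v + s *\<^sub>R d)) has_derivative (%s. s *\<^sub>R d)) (at s)"
 by (auto intro!: derivative_eq_intros)
 moreover have "(f has_derivative (%d'. g (x0 + un n + (v + s *\<^sub>R d)) \<bullet> d')) (at (x0 + un n + (v + s *\<^sub>R d)))"
 by (rule der[OF inS[OF un vs]]) (use that t(2)[of n] in auto)
 ultimately have "(?h has_derivative (%s'. g (x0 + un n + (v + s *\<^sub>R d)) \<bullet> (s' *\<^sub>R d))) (at s)"
 using has_derivative_compose by blast
 moreover have "(%s'. g (x0 + un n + (v + s *\<^sub>R d)) \<bullet> (s' *\<^sub>R d)) = (*) (g (x0 + un n + (v + s *\<^sub>R d)) \<bullet> d)"
 by (auto simp: mult.commute)
 ultimately show ?thesis by (simp add: has_field_derivative_def)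
 qed
 obtain s where s: "0 < s" "s < t n" "?h (t n) - ?h 0 = (t n - 0) * (g (x0 + un n + (v + s *\<^sub>R d)) \<bullet> d)"
 using MVT2[OF t(1)[of n], of ?h "%s. g (x0 + un n + (v + s *\<^sub>R d)) \<bullet> d"] D by auto
 have "?h (t n) = psi (vn n)" by (simp add: psi_def un_def vn_def)
 also have "... <= psi v" by (rule v(2)[OF vn])
 also have "... <= ?h 0" unfolding psi_def using m(2)[OF v(1) un[of n]] by simp
 finally have "(t n - 0) * (g (x0 + un n + (v + s *\<^sub>R d)) \<bullet> d) <= 0" using s(3) by linarith
 hence "g (x0 + un n + (v + s *\<^sub>R d)) \<bullet> d <= 0" using t(1)[of n] by (simp add: mult_le_0_iff)
 thus ?thesis using s by blast
 qed
 then obtain s where s: "!!n. 0 < s n" "!!n. s n < t n" "!!n. g (x0 + un n + (v + s n *\<^sub>R d)) \<bullet> d <= 0" by metis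
 obtain u' ro where u': "u' : ?U" "strict_mono ro" "(un \<circ> ro) \<longlonglongrightarrow> u'"
 using cU un unfolding compact_def by metis
 have slim: "s \<longlonglongrightarrow> 0"
 by (rule tendsto_sandwich[OF _ _ tendsto_const tlim]) (use s in \<open>auto simp: less_imp_le\<close>)
 have sr: "(s \<circ> ro) \<longlonglongrightarrow> 0" "(t \<circ> ro) \<longlonglongrightarrow> 0"
 using LIMSEQ_subseq_LIMSEQ[OF slim u'(2)] LIMSEQ_subseq_LIMSEQ[OF tlim u'(2)] by auto
 have vnl: "(%n. vn (ro n)) \<longlonglongrightarrow> v"
 unfolding vn_def using tendsto_add[OF tendsto_const[of v] tendsto_scaleR[OF sr(2) tendsto_const[of d]]] by (simp add: o_def)
 have unl: "(%n. un (ro n)) \<longlonglongrightarrow> u'" using u'(3) by (simp add: o_def)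
 have "(%n. f (x0 + un (ro n) + vn (ro n))) \<longlonglongrightarrow> f (x0 + u' + v)"
 by (rule continuous_on_tendsto_compose[OF cf tendsto_add[OF tendsto_add[OF tendsto_const unl] vnl]])
 (use memS un vn u' v in auto)
 moreover have "(%n. psi (vn (ro n))) \<longlonglongrightarrow> psi v"
 by (rule continuous_on_tendsto_compose[OF cpsi vnl v(1)]) (use vn in auto)
 ultimately have "f (x0 + u' + v) = psi v"
 unfolding psi_def un_def by (rule LIMSEQ_unique)
 hence eq: "f (x0 + u' + v) = f (x0 + u + v)" by (simp add: psi_def u_def)
 \<comment> \<open>A limit of inner minimisers is an inner minimiser; uniqueness identifies the
   point at which the limiting slope is taken.\<close>
 have "u' = u"
 proof (rule uniq[of u' u v])
 show "g (x0 + u' + v) \<bullet> d = 0" if "d : U" for d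
 by (rule gU[OF v(1) u'(1) _ that]) (use eq u in auto)
 show "g (x0 + u + v) \<bullet> d = 0" if "d : U" for d
 by (rule gU[OF v(1) u(1) _ that]) (use u in auto)
 qed (use u u' v eq in auto)
 have arg: "(%n. x0 + un (ro n) + (v + s (ro n) *\<^sub>R d)) \<longlonglongrightarrow> x0 + u + v"
 using tendsto_add[OF tendsto_add[OF tendsto_const[of x0] unl]
 tendsto_add[OF tendsto_const[of v] tendsto_scaleR[OF sr(1) tendsto_const[of d]]]] \<open>u' = u\<close> by (simp add: o_def)
 have "(%n. g (x0 + un (ro n) + (v + s (ro n) *\<^sub>R d))) \<longlonglongrightarrow> g (x0 + u + v)"
 proof (rule continuous_on_tendsto_compose[OF cg arg])
 show "\<forall>\<^sub>F n in sequentially. x0 + un (ro n) + (v + s (ro n) *\<^sub>R d) : cball x0 (ru + rv)"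
 by (intro always_eventually allI memS un vs)
 (use s(1) order_trans[OF less_imp_le[OF s(2)] t(2)] in \<open>auto simp: less_imp_le\<close>)
 qed (use memS u v in auto)
 hence "(%n. g (x0 + un (ro n) + (v + s (ro n) *\<^sub>R d)) \<bullet> d) \<longlonglongrightarrow> g (x0 + u + v) \<bullet> d"
 by (intro tendsto_intros)
 thus ?thesis by (rule LIMSEQ_le_const2) (use s(3) in auto)
 qed
 have gV: "g (x0 + u + v) \<bullet> d = 0" if "d : V" for d
 using dirle[OF that] dirle[of "- d"] that V by (simp add: subspace_neg)
 have val: "f (x0 + u + v) = mm (%u v. f (x0 + u + v)) ?U ?V"
 proof -
 have inf: "(INF u\<in>?U. f (x0 + u + v)) = psi v" if "v : ?V" for v
 proof (rule antisym)
 have bdd: "bdd_below ((%u. f (x0 + u + v)) ` ?U)"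
 by (rule bdd_belowI2[of _ "psi v"]) (use m that in \<open>auto simp: psi_def\<close>)
 show "(INF u\<in>?U. f (x0 + u + v)) <= psi v" unfolding psi_def by (rule cINF_lower[OF bdd m(1)[OF that]])
 show "psi v <= (INF u\<in>?U. f (x0 + u + v))"
 by (rule cINF_greatest) (use zU m that in \<open>auto simp: psi_def\<close>)
 qed
 have "mm (%u v. f (x0 + u + v)) ?U ?V = (SUP v\<in>?V. psi v)"
 unfolding mm_def by (rule SUP_cong) (use inf in auto)
 also have "... = psi v"
 proof (rule antisym)
 show "(SUP v\<in>?V. psi v) <= psi v" by (rule cSUP_least) (use zV v in auto)
 show "psi v <= (SUP v\<in>?V. psi v)"
 by (rule cSUP_upper[OF v(1)]) (use v in \<open>auto intro!: bdd_aboveI2[of _ _ "psi v"]\<close>)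
 qed
 finally show ?thesis by (simp add: psi_def u_def)
 qed
 show thesis
 by (rule that[of u v]) (use u v gV gU[OF v(1) u(1) u(2)] val in auto)
qed

section \<open>Eigenvalue branches for perturbed weights\<close>

text \<open>Uses \<open>(P2 - P1) / N2 - P1 * (N2 - N1) / (N1 * N2)\<close>: passing from numerators
  to quotients costs only a product of two small quantities.\<close>

lemma quotient_diff_ge:
 fixes P1 P2 N1 N2 :: real
 assumes "a - b <= P2 - P1" "a >= 0" "b >= 0" "k > 0" "k <= N1" "k <= N2" "N2 <= K" "abs P1 <= s" "abs (N2 - N1) <= t"
 shows "a / K - b / k - s * t / (k * k) <= P2 / N2 - P1 / N1"
proof -
 have pos: "N1 > 0" "N2 > 0" using assms by auto
 have "P2 / N2 - P1 / N1 = (P2 - P1) / N2 - P1 * (N2 - N1) / (N1 * N2)"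
 using pos by (simp add: field_simps)
 moreover have "(a - b) / N2 <= (P2 - P1) / N2" using assms pos by (intro divide_right_mono) auto
 moreover have "a / K <= a / N2" "b / N2 <= b / k"
 using assms pos by (auto intro!: divide_left_mono mult_pos_pos)
 moreover have "P1 * (N2 - N1) / (N1 * N2) <= s * t / (k * k)"
 proof -
 have "P1 * (N2 - N1) <= s * t" using abs_mult_le[OF assms(8,9)] by linarith
 hence "P1 * (N2 - N1) / (N1 * N2) <= s * t / (N1 * N2)" using pos by (intro divide_right_mono) auto
 also have "... <= s * t / (k * k)"
 using assms pos by (intro divide_left_mono mult_mono mult_pos_pos mult_nonneg_nonneg) auto
 finally show ?thesis .
 qed
 ultimately show ?thesis by (simp add: diff_divide_distrib)
qed

lemma Rq_perturb:
 "Rq p (%i j. 1 + eps * b i j) x = Rq p unit_weights x + eps * Rq p b x"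
 unfolding Rq_def Ew_def
 by (simp add: distrib_right sum.distrib add_divide_distrib sum_distrib_left mult.assoc)

lemma base_inner_pos:
 assumes "p > 1" "pair_ok A B"
 shows "(SUM i:UNIV. Phi p (base p A B $ i) * base p A B $ i) > 0"
 using Nn_pos[OF base_nonzero[OF assms], of p] by (simp add: Nn_def Phi_times_self)

lemma slice_iff:
 assumes "p > 1" "pair_ok A B"
 shows "d : slice A B \<longleftrightarrow> (SUM i:UNIV. Phi p (base p A B $ i) * d $ i) = 0"
 unfolding Phi_base_inner[OF assms] by (auto simp: slice_def)

text \<open>Orthogonality to the slice leaves only the direction of the base vector. Homogeneity
  supplies it: the residual is orthogonal to the point itself, which differs from the base vector by
  an element of the slice.\<close>

lemma Tv_zero_of_slice:
 fixes T :: "real ^ 'n::finite"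
 assumes p: "p > 1" and ok: "pair_ok A B" and sl: "!!d. d : slice A B ==> T \<bullet> d = 0"
 and xi: "xi : slice A B" and x: "T \<bullet> (base p A B + xi) = 0"
 shows "T = 0"
proof -
 let ?phi = "%d :: real ^ 'n. SUM i:UNIV. Phi p (base p A B $ i) * d $ i"
 have Tb: "T \<bullet> base p A B = 0" using x sl[OF xi] by (simp add: inner_add_right)
 define t where "t = ?phi T / ?phi (base p A B)"
 define d where "d = T - t *\<^sub>R base p A B"
 have "?phi d = ?phi T - t * ?phi (base p A B)"
 unfolding d_def by (simp add: right_diff_distrib sum_subtractf sum_distrib_left mult.left_commute)
 also have "... = 0" using base_inner_pos[OF p ok] by (simp add: t_def)
 finally have "d : slice A B" using slice_iff[OF p ok] by blast
 hence "T \<bullet> d = 0" by (rule sl)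
 hence "T \<bullet> T = 0" using Tb unfolding d_def by (simp add: inner_diff_right)
 thus ?thesis by simp
qed

text \<open>Both radii are multiples of \<open>eps\<close>. On such balls the perturbation
  \<open>eps * bb\<close> varies by order \<open>eps\<close> times the radius, the saddle by the
  square of the radius, so large enough multiples confine the max-min point to the interior. The
  eigenvalue is the max-min value, and its expansion and Lipschitz bound come from
  \<open>mm_diff\<close> together with the \<open>lipmix\<close> estimates.\<close>

lemma eigen_branch_saddle:
 fixes A B :: "'n::finite set" and bw :: "'n => 'n => real"
 assumes l: "1 < l" and ok: "pair_ok A B" and bs: "sym_weights bw"
 and U: "subspace U" and V: "subspace V" and US: "U <= slice A B" and VS: "V <= slice A B"
 and UV: "!!d. d : slice A B ==> EX u:U. EX v:V. d = u + v"
 and sad: "EX c>0. EX C>0. EX dl>0. ALL p:{l..r}. ALL u:U. ALL v:V. norm u <= dl --> norm v <= dl -->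
 Pb p A B (base p A B + v) <= - c * (norm v)^2 &
 c * (norm u)^2 - C * (norm v)^2 <= Pb p A B (base p A B + u + v) - Pb p A B (base p A B + v)"
 and mono: "!!L. L > 0 ==> EX dl>0. ALL p:{l..r}. ALL w mu x y. (ALL i j. 1/2 <= w i j) --> 0 <= mu --> mu <= L -->
 (ALL i. abs (x $ i - base p A B $ i) <= dl) --> (ALL i. abs (y $ i - base p A B $ i) <= dl) --> x - y : U --> x ~= y -->
 mu * (SUM i:UNIV. (Phi p (x $ i) - Phi p (y $ i)) * (x $ i - y $ i)) <
 (SUM i:UNIV. SUM j:UNIV. w i j * ((Phi p (x $ i - x $ j) - Phi p (y $ i - y $ j)) * ((x $ i - x $ j) - (y $ i - y $ j)))) / 2"
 shows "EX K>0. EX eps0>0. ALL eps. 0 < eps --> eps <= eps0 --> (EX La. ALL p:{l..r}.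
 (EX xi:slice A B. norm xi <= K * eps & eigenpair p (%i j. 1 + eps * bw i j) (La p) (base p A B + xi)) &
 abs (La p - lam0 p A B - eps * Rq p bw (base p A B)) <= K * eps^2 &
 (ALL q:{l..r}. abs (La p - lam0 p A B - (La q - lam0 q A B)) <= K * eps * abs (p - q)))"
proof -
 let ?I = "{l..r}"
 define R0 where "R0 = (%p xi. Rq p unit_weights (base p A B + xi))"
 define bb where "bb = (%p xi. Rq p bw (base p A B + xi))"
 obtain CR where CR: "CR > 0"
 "!!p xi. p : ?I ==> norm xi <= 1/4 ==> abs (R0 p xi) <= CR"
 "!!p q xi. p : ?I ==> q : ?I ==> norm xi <= 1/4 ==> abs (R0 p xi - R0 q xi - (R0 p 0 - R0 q 0)) <= CR * (norm xi * abs (p - q))"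
 by (rule lipmixE[OF lipmix_Rq[OF l ok, where r = r and w = unit_weights]]) (auto simp: R0_def)
 obtain Cb where Cb: "Cb > 0"
 "!!p xi. p : ?I ==> norm xi <= 1/4 ==> abs (bb p xi) <= Cb"
 "!!p xi zeta. p : ?I ==> norm xi <= 1/4 ==> norm zeta <= 1/4 ==> abs (bb p xi - bb p zeta) <= Cb * norm (xi - zeta)"
 "!!p q xi. p : ?I ==> q : ?I ==> norm xi <= 1/4 ==> abs (bb p xi - bb q xi) <= Cb * abs (p - q)"
 by (rule lipmixE[OF lipmix_Rq[OF l ok, where r = r and w = bw]]) (auto simp: bb_def)
 obtain CE where CE: "CE > 0"
 "!!p xi zeta. p : ?I ==> norm xi <= 1/4 ==> norm zeta <= 1/4 ==>
 abs (Ew p unit_weights (base p A B + xi) - Ew p unit_weights (base p A B + zeta)) <= CE * norm (xi - zeta)"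
 by (rule lipmixE[OF lipmix_Ew[OF l ok, where r = r and w = unit_weights]]) auto
 obtain CN where CN: "CN > 0"
 "!!p xi. p : ?I ==> norm xi <= 1/4 ==> abs (Nn p (base p A B + xi)) <= CN"
 "!!p xi zeta. p : ?I ==> norm xi <= 1/4 ==> norm zeta <= 1/4 ==>
 abs (Nn p (base p A B + xi) - Nn p (base p A B + zeta)) <= CN * norm (xi - zeta)"
 by (rule lipmixE[OF lipmix_Nn[OF l ok, where r = r]]) auto
 define k where "k = (3/4 :: real) powr r"
 have k: "k > 0" by (simp add: k_def)
 have Nk: "k <= Nn p (base p A B + xi)" "Nn p (base p A B + xi) <= CN" if "p : ?I" "norm xi <= 1/4" for p xi
 using Nn_base_ge[of p r A B xi] that l ok CN(2)[OF that] by (auto simp: k_def)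
 obtain c C dls where sd: "c > 0" "C > 0" "dls > 0"
 "!!p u v. p : ?I ==> u : U ==> v : V ==> norm u <= dls ==> norm v <= dls ==>
 Pb p A B (base p A B + v) <= - c * (norm v)^2 &
 c * (norm u)^2 - C * (norm v)^2 <= Pb p A B (base p A B + u + v) - Pb p A B (base p A B + v)"
 using sad by metis
 define L where "L = CR + Cb"
 have L: "L > 0" using CR Cb by (simp add: L_def)
 obtain dlm where dlm: "dlm > 0" "ALL p:?I. ALL w mu x y. (ALL i j. 1/2 <= w i j) --> 0 <= mu --> mu <= L -->
 (ALL i. abs (x $ i - base p A B $ i) <= dlm) --> (ALL i. abs (y $ i - base p A B $ i) <= dlm) --> x - y : U --> x ~= y -->
 mu * (SUM i:UNIV. (Phi p (x $ i) - Phi p (y $ i)) * (x $ i - y $ i)) <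
 (SUM i:UNIV. SUM j:UNIV. w i j * ((Phi p (x $ i - x $ j) - Phi p (y $ i - y $ j)) * ((x $ i - x $ j) - (y $ i - y $ j)))) / 2"
 using mono[OF L] by (elim exE conjE)
 define dl where "dl = min (1/4) (min dls dlm)"
 have dl: "dl > 0" "dl <= 1/4" "dl <= dls" "dl <= dlm" using sd dlm by (auto simp: dl_def)
 have zU: "0 : U" and zV: "0 : V" using U V subspace_0 by auto
 have lam: "R0 p 0 = lam0 p A B" if "p : ?I" for p
 using eigenpair_Rq[OF sym_unit_weights eigenpair_base[of p A B]] that l ok by (simp add: R0_def)
 have Rlam: "R0 p xi - lam0 p A B = Pb p A B (base p A B + xi) / Nn p (base p A B + xi)" if "p : ?I" "norm xi <= 1/4" for p xi
 proof -
 have "Nn p (base p A B + xi) > 0" using Nk(1)[OF that] k by linarith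
 thus ?thesis by (simp add: R0_def Rq_def Pb_def field_simps)
 qed
 obtain CL where CL: "CL > 0" "!!p. p : ?I ==> abs (lam0 p A B) <= CL"
 using continuous_upper_bound[OF compact_Icc continuous_on_lam0[OF l ok]] by blast
 define CP where "CP = CE + CL * CN"
 have Pb0: "Pb p A B (base p A B) = 0" if "p : ?I" for p
 using Rlam[OF that, of 0] lam[OF that] Nk(1)[OF that, of 0] k by simp
 have CP: "abs (Pb p A B (base p A B + xi)) <= CP * norm xi" if "p : ?I" "norm xi <= 1/4" for p xi
 proof -
 have "Pb p A B (base p A B + xi) = (Ew p unit_weights (base p A B + xi) - Ew p unit_weights (base p A B + 0))
 - lam0 p A B * (Nn p (base p A B + xi) - Nn p (base p A B + 0))"
 using Pb0[OF that(1)] by (simp add: Pb_def algebra_simps)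
 moreover have "abs (lam0 p A B * (Nn p (base p A B + xi) - Nn p (base p A B + 0))) <= CL * (CN * norm (xi - 0))"
 by (intro abs_mult_le CL CN that) auto
 moreover have "abs (Ew p unit_weights (base p A B + xi) - Ew p unit_weights (base p A B + 0)) <= CE * norm (xi - 0)"
 by (intro CE that) auto
 moreover have "CP * norm xi = CE * norm xi + CL * (CN * norm xi)" by (simp add: CP_def algebra_simps)
 ultimately show ?thesis unfolding diff_zero by linarith
 qed
 define c1 where "c1 = c / CN"
 define c2 where "c2 = c1 / 2"
 have c1: "c1 > 0" and c2: "c2 > 0" using sd CN by (auto simp: c1_def c2_def)
 define K1 where "K1 = CP * CN / (k * k)"
 define C2 where "C2 = C / k + K1^2 / (2 * c1)"
 have C2: "C2 > 0" using sd k c1 by (auto simp: C2_def intro!: add_pos_nonneg)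
 have H1: "R0 p v <= lam0 p A B - c2 * (norm v)^2" if p: "p : ?I" and v: "v : V" "norm v <= dl" for p v
 proof -
 have v4: "norm v <= 1/4" using v dl by linarith
 have "Pb p A B (base p A B + v) <= - c * (norm v)^2" using sd(4)[OF p zU v(1)] v dl sd(3) by simp
 hence "R0 p v - lam0 p A B <= - c * (norm v)^2 / Nn p (base p A B + v)"
 unfolding Rlam[OF p v4] using Nk(1)[OF p v4] k by (intro divide_right_mono) auto
 also have "c * (norm v)^2 / CN <= c * (norm v)^2 / Nn p (base p A B + v)"
 using Nk[OF p v4] k sd(1) CN(1) by (intro divide_left_mono mult_pos_pos) auto
 hence "- c * (norm v)^2 / Nn p (base p A B + v) <= - (c1 * (norm v)^2)"
 by (simp add: c1_def)
 also have "... <= - (c2 * (norm v)^2)" using c1 by (simp add: c2_def)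
 finally show ?thesis by linarith
 qed
 have H2: "c2 * (norm u)^2 - C2 * (norm v)^2 <= R0 p (u + v) - R0 p v"
 if p: "p : ?I" and u: "u : U" "norm u <= dl" and v: "v : V" "norm v <= dl" and uv: "norm (u + v) <= 1/4" for p u v
 proof -
 have v4: "norm v <= 1/4" using v dl by linarith
 have d: "c * (norm u)^2 - C * (norm v)^2 <= Pb p A B (base p A B + (u + v)) - Pb p A B (base p A B + v)"
 using sd(4)[OF p u(1) v(1)] u v dl by (simp add: add.assoc)
 have Nd: "abs (Nn p (base p A B + (u + v)) - Nn p (base p A B + v)) <= CN * norm u"
 using CN(3)[OF p uv v4] by simp
 have "c * (norm u)^2 / CN - C * (norm v)^2 / k - CP * norm v * (CN * norm u) / (k * k)
 <= Pb p A B (base p A B + (u + v)) / Nn p (base p A B + (u + v)) - Pb p A B (base p A B + v) / Nn p (base p A B + v)"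
 by (rule quotient_diff_ge[OF d]) (use sd k Nk[OF p uv] Nk[OF p v4] CP[OF p v4] Nd in auto)
 also have "... = R0 p (u + v) - R0 p v"
 unfolding Rlam[OF p uv, symmetric] Rlam[OF p v4, symmetric] by simp
 finally have 1: "c1 * (norm u)^2 - C / k * (norm v)^2 - K1 * norm v * norm u <= R0 p (u + v) - R0 p v"
 by (simp add: c1_def K1_def mult_ac)
 have "2 * c1 * (K1 * norm v * norm u) <= (c1 * norm u)^2 + (K1 * norm v)^2"
 using zero_le_power2[of "c1 * norm u - K1 * norm v"] by (simp add: power2_eq_square algebra_simps)
 hence "K1 * norm v * norm u <= ((c1 * norm u)^2 + (K1 * norm v)^2) / (2 * c1)"
 using c1 by (simp add: pos_le_divide_eq mult.commute)
 also have "... = c2 * (norm u)^2 + K1^2 / (2 * c1) * (norm v)^2"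
 using c1 by (simp add: c2_def add_divide_distrib power_mult_distrib power2_eq_square mult_ac)
 finally have 2: "K1 * norm v * norm u <= c2 * (norm u)^2 + K1^2 / (2 * c1) * (norm v)^2" .
 have 3: "c1 * (norm u)^2 = 2 * (c2 * (norm u)^2)" by (simp add: c2_def)
 have 4: "C2 * (norm v)^2 = C / k * (norm v)^2 + K1^2 / (2 * c1) * (norm v)^2"
 by (simp add: C2_def distrib_right)
 show ?thesis using 1 2 unfolding 3 4 by linarith
 qed
 \<comment> \<open>The outer radius comes first because \<open>E1\<close> is free of the loss
   constant \<open>C2\<close>. The inner radius has to beat the loss \<open>C2 * rv^2\<close> as
   well, hence \<open>Cv\<close> inside \<open>Cu\<close>.\<close>
 define Cv where "Cv = 2 * (Cb + 1) / c2"
 define Cu where "Cu = (Cb + C2 * Cv^2 + 1) / c2 + 1"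
 have c2Cv: "c2 * Cv = 2 * (Cb + 1)" using c2 by (simp add: Cv_def)
 have Cv: "Cv > 0" using c2 Cb by (simp add: Cv_def)
 have "(Cb + C2 * Cv^2 + 1) / c2 > 0" using c2 Cb C2 by (intro divide_pos_pos add_pos_nonneg add_nonneg_pos mult_nonneg_nonneg) auto
 hence Cu: "Cu >= 1" "Cu > 0" by (auto simp: Cu_def)
 have c2Cu: "c2 * Cu = Cb + C2 * Cv^2 + 1 + c2" using c2 by (simp add: Cu_def field_simps)
 define Bw where "Bw = 1 + (SUM i:UNIV. SUM j:UNIV. abs (bw i j))"
 have Bw1: "abs (bw i j) <= Bw" for i j
 proof -
 have "abs (bw i j) <= (SUM j:UNIV. abs (bw i j))" by (rule member_le_sum) auto
 also have "... <= (SUM i:UNIV. SUM j:UNIV. abs (bw i j))"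
 by (rule member_le_sum[of i UNIV "%i. SUM j:UNIV. abs (bw i j)"]) (auto intro: sum_nonneg)
 finally show ?thesis by (simp add: Bw_def)
 qed
 have Bw: "Bw > 0" unfolding Bw_def by (intro add_pos_nonneg sum_nonneg) auto
 \<comment> \<open>The bound \<open>1 / (2 * Bw)\<close> keeps the perturbed weights at least 1/2,
   and the last entry keeps both balls within the radius \<open>dl\<close> of the saddle
   estimates.\<close>
 define eps0 where "eps0 = min 1 (min (1 / (2 * Bw)) (dl / (Cu + Cv)))"
 have eps0: "eps0 > 0" using Bw dl Cu Cv by (simp add: eps0_def)
 define K where "K = (Cu + Cv) * (1 + CR + Cb) + Cb"
 have Kpos: "K > 0" "Cu + Cv <= K" "Cb * (Cu + Cv) <= K" "CR * (Cu + Cv) + Cb <= K"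
 proof -
 have "0 <= (Cu + Cv) * CR" "0 <= (Cu + Cv) * Cb" "Cu + Cv > 0" using Cu Cv CR Cb by auto
 thus "K > 0" "Cu + Cv <= K" "Cb * (Cu + Cv) <= K" "CR * (Cu + Cv) + Cb <= K"
 using Cb(1) unfolding K_def by (simp_all add: algebra_simps)
 qed
 have "EX La. ALL p:?I.
 (EX xi:slice A B. norm xi <= K * eps & eigenpair p (%i j. 1 + eps * bw i j) (La p) (base p A B + xi)) &
 abs (La p - lam0 p A B - eps * Rq p bw (base p A B)) <= K * eps^2 &
 (ALL q:?I. abs (La p - lam0 p A B - (La q - lam0 q A B)) <= K * eps * abs (p - q))"
 if eps: "0 < eps" "eps <= eps0" for eps
 proof -
 define w where "w = (%i j. 1 + eps * bw i j)"
 have sw: "sym_weights w" using bs by (simp add: sym_weights_def w_def)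
 have eps1: "eps <= 1" using eps by (simp add: eps0_def)
 have "eps <= 1 / (2 * Bw)" using eps by (simp add: eps0_def)
 hence eB: "eps * Bw <= 1/2" using Bw by (simp add: field_simps)
 have w12: "1/2 <= w i j" for i j
 proof -
 have "abs (eps * bw i j) <= eps * Bw" by (rule abs_mult_le) (use eps Bw1 in auto)
 thus ?thesis using eB by (simp add: w_def)
 qed
 define ru where "ru = Cu * eps"
 define rv where "rv = Cv * eps"
 have ru: "ru > 0" and rv: "rv > 0" using eps Cu Cv by (auto simp: ru_def rv_def)
 have "eps <= dl / (Cu + Cv)" using eps by (simp add: eps0_def)
 hence ruv: "ru + rv <= dl" using Cu Cv by (simp add: ru_def rv_def field_simps)
 have ruv4: "ru + rv <= 1/4" using ruv dl by linarith
 let ?U = "U Int cball 0 ru" and ?V = "V Int cball 0 rv"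
 have nuv: "norm (u + v) <= ru + rv" if "norm u <= ru" "norm v <= rv" for u v :: "real ^ 'n"
 using norm_triangle_ineq[of u v] that by linarith
 have Rw: "Rq p w (base p A B + xi) = R0 p xi + eps * bb p xi" for p xi
 unfolding w_def Rq_perturb R0_def bb_def ..
 have bl: "bb p xi <= bb p zeta + Cb * norm (xi - zeta)" if "p : ?I" "norm xi <= 1/4" "norm zeta <= 1/4" for p xi zeta
 using Cb(3)[OF that] by linarith
 define F where "F = (%p u v. Rq p w (base p A B + u + v))"
 define La where "La = (%p. mm (F p) ?U ?V)"
 have branch: "EX xi:slice A B. norm xi <= K * eps & eigenpair p w (La p) (base p A B + xi)" if p: "p : ?I" for p
 proof -
 have p1: "p > 1" using p l by auto
 have nz: "x ~= 0" if "norm (x - base p A B) <= ru + rv" for x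
 using base_near_nonzero[OF p1 ok, of "x - base p A B"] that ruv4 by auto
 have E2: "Rq p w (base p A B + v) < Rq p w (base p A B + u + v)"
 if uv: "u : U" "v : V" "norm u = ru" "norm v <= rv" for u v
 proof -
 have n: "norm u <= dl" "norm v <= dl" "norm (u + v) <= 1/4" "norm v <= 1/4"
 using uv ruv ru rv ruv4 nuv[of u v] by auto
 have "c2 * ru^2 - C2 * (norm v)^2 <= R0 p (u + v) - R0 p v"
 using H2[OF p uv(1) n(1) uv(2) n(2) n(3)] uv(3) by simp
 moreover have "C2 * (norm v)^2 <= C2 * rv^2" using uv(4) C2 by (intro mult_left_mono power_mono) auto
 moreover have "bb p v <= bb p (u + v) + Cb * ru"
 using bl[OF p n(4) n(3)] uv(3) by (simp add: norm_minus_commute)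
 hence "eps * bb p v <= eps * (bb p (u + v) + Cb * ru)" using eps by (intro mult_left_mono) auto
 moreover have "C2 * rv^2 + eps * (Cb * ru) < c2 * ru^2"
 proof -
 have "C2 * Cv^2 + Cb * Cu < c2 * Cu^2"
 proof -
 have "c2 * Cu^2 = (Cb + C2 * Cv^2 + 1 + c2) * Cu" using c2Cu by (simp add: power2_eq_square mult.assoc[symmetric])
 also have "... = Cb * Cu + C2 * Cv^2 * Cu + (1 + c2) * Cu" by (simp add: algebra_simps)
 finally have e: "c2 * Cu^2 = Cb * Cu + C2 * Cv^2 * Cu + (1 + c2) * Cu" .
 have "C2 * Cv^2 * 1 <= C2 * Cv^2 * Cu" using Cu C2 by (intro mult_left_mono) auto
 moreover have "(1 + c2) * Cu > 0" using c2 Cu by simp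
 ultimately show ?thesis unfolding e by linarith
 qed
 hence "(C2 * Cv^2 + Cb * Cu) * eps^2 < c2 * Cu^2 * eps^2" using eps by (intro mult_strict_right_mono) auto
 thus ?thesis by (simp add: ru_def rv_def power2_eq_square algebra_simps)
 qed
 ultimately show ?thesis unfolding add.assoc Rw by (simp add: distrib_left)
 qed
 have E1: "Rq p w (base p A B + v) < Rq p w (base p A B + u)"
 if uv: "u : U" "v : V" "norm u <= ru" "norm v = rv" for u v
 proof -
 define s where "s = norm u"
 have n: "norm u <= dl" "norm v <= dl" "norm u <= 1/4" "norm v <= 1/4" "norm (0 :: real ^ 'n) <= dl" "norm (u + 0) <= 1/4" "norm (0 :: real ^ 'n) <= 1/4"
 using uv ruv ru rv ruv4 dl by auto
 have "R0 p v <= lam0 p A B - c2 * rv^2" using H1[OF p uv(2) n(2)] uv(4) by simp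
 moreover have "c2 * s^2 <= R0 p u - lam0 p A B"
 using H2[OF p uv(1) n(1) zV n(5,6)] lam[OF p] by (simp add: s_def)
 moreover have "eps * bb p v <= eps * (bb p 0 + Cb * rv)"
 using bl[OF p n(4) n(7)] uv(4) eps by (intro mult_left_mono) auto
 moreover have "eps * bb p 0 <= eps * (bb p u + Cb * s)"
 using bl[OF p n(7) n(3)] eps by (intro mult_left_mono) (auto simp: s_def)
 moreover have "eps * (Cb * rv) + eps * (Cb * s) < c2 * rv^2 + c2 * s^2"
 proof -
 \<comment> \<open>Completing the square in \<open>s\<close>; the value of \<open>c2 * Cv\<close>
   makes the remainder positive.\<close>
 have "4 * c2 * (c2 * rv^2 + c2 * s^2 - eps * (Cb * rv) - eps * (Cb * s))
 = (2 * c2 * s - eps * Cb)^2 + eps^2 * (4 * (c2 * Cv)^2 - 4 * Cb * (c2 * Cv) - Cb^2)"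
 by (simp add: rv_def power2_eq_square algebra_simps)
 also have "4 * (c2 * Cv)^2 - 4 * Cb * (c2 * Cv) - Cb^2 = 16 + 24 * Cb + 7 * Cb^2"
 unfolding c2Cv by (simp add: power2_eq_square algebra_simps)
 finally have e: "4 * c2 * (c2 * rv^2 + c2 * s^2 - eps * (Cb * rv) - eps * (Cb * s))
 = (2 * c2 * s - eps * Cb)^2 + eps^2 * (16 + 24 * Cb + 7 * Cb^2)" .
 have "eps^2 * (16 + 24 * Cb + 7 * Cb^2) > 0" using eps Cb by (intro mult_pos_pos add_pos_nonneg) auto
 hence "4 * c2 * (c2 * rv^2 + c2 * s^2 - eps * (Cb * rv) - eps * (Cb * s)) > 0"
 unfolding e by (intro add_nonneg_pos) auto
 hence "c2 * rv^2 + c2 * s^2 - eps * (Cb * rv) - eps * (Cb * s) > 0"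
 using c2 by (simp add: zero_less_mult_iff)
 thus ?thesis by linarith
 qed
 ultimately show ?thesis unfolding Rw by (simp add: distrib_left)
 qed
 have Tv0: "Tv p w (Rq p w x) x \<bullet> d = 0" if "gR p w x \<bullet> d = 0" "x ~= 0" for x d
 using that Nn_pos[of x p] p1 by (simp add: gR_def)
 \<comment> \<open>Equal values mean a common multiplier \<open>mu\<close>, so subtracting the two
   stationarity conditions along \<open>u1 - u2\<close> gives equality in the strict inequality of
   \<open>mono\<close>.\<close>
 have uniq: "u1 = u2"
 if uu: "u1 : U" "u2 : U" "v : V" "norm u1 <= ru" "norm u2 <= ru" "norm v <= rv"
 and eq: "Rq p w (base p A B + u1 + v) = Rq p w (base p A B + u2 + v)"
 and g1: "!!d. d : U ==> gR p w (base p A B + u1 + v) \<bullet> d = 0"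
 and g2: "!!d. d : U ==> gR p w (base p A B + u2 + v) \<bullet> d = 0" for u1 u2 v
 proof (rule ccontr)
 assume ne: "u1 ~= u2"
 define x where "x = base p A B + u1 + v"
 define y where "y = base p A B + u2 + v"
 define mu where "mu = Rq p w x"
 have xy: "x - y = u1 - u2" "x ~= y" using ne by (auto simp: x_def y_def)
 have n4: "norm (u1 + v) <= 1/4" "norm (u2 + v) <= 1/4" using nuv[of u1 v] nuv[of u2 v] uu ruv4 by auto
 have xn: "x ~= 0" "y ~= 0"
 using base_near_nonzero[OF p1 ok n4(1)] base_near_nonzero[OF p1 ok n4(2)] by (auto simp: x_def y_def add.assoc)
 have d: "x - y : U" unfolding xy using U uu by (simp add: subspace_diff)
 have t1: "Tv p w mu x \<bullet> (x - y) = 0" and t2: "Tv p w mu y \<bullet> (x - y) = 0"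
 using Tv0[OF g1[OF d, folded x_def] xn(1)] Tv0[OF g2[OF d, folded y_def] xn(2)] eq
 by (simp_all add: mu_def x_def y_def)
 have "mu >= 0"
 proof -
 have "Ew p w x >= 0" unfolding Ew_def using w12
 by (intro divide_nonneg_nonneg sum_nonneg mult_nonneg_nonneg) (auto intro: order_trans[of 0 "1/2"])
 thus ?thesis by (simp add: mu_def Rq_def)
 qed
 moreover have "mu <= L"
 proof -
 have "abs (R0 p (u1 + v)) <= CR" "abs (eps * bb p (u1 + v)) <= 1 * Cb"
 using CR(2)[OF p n4(1)] abs_mult_le[of eps 1 "bb p (u1 + v)" Cb] Cb(2)[OF p n4(1)] eps eps1 by auto
 thus ?thesis unfolding mu_def x_def add.assoc Rw L_def by linarith
 qed
 moreover have "ALL i. abs (x $ i - base p A B $ i) <= dlm" "ALL i. abs (y $ i - base p A B $ i) <= dlm"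
 proof -
 have "abs ((u + v) $ i) <= dlm" if "norm u <= ru" for u i
 using component_le_norm_cart[of "u + v" i] nuv[OF that uu(6)] ruv dl(4) by linarith
 from this[OF uu(4)] this[OF uu(5)] show "ALL i. abs (x $ i - base p A B $ i) <= dlm" "ALL i. abs (y $ i - base p A B $ i) <= dlm"
 by (auto simp: x_def y_def)
 qed
 ultimately have lt: "mu * (SUM i:UNIV. (Phi p (x $ i) - Phi p (y $ i)) * (x $ i - y $ i)) <
 (SUM i:UNIV. SUM j:UNIV. w i j * ((Phi p (x $ i - x $ j) - Phi p (y $ i - y $ j)) * ((x $ i - x $ j) - (y $ i - y $ j)))) / 2"
 using dlm(2)[THEN bspec, OF p, THEN spec, of w, THEN spec, of mu, THEN spec, of x, THEN spec, of y] w12 d xy(2) by blast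
 have e1: "(SUM i:UNIV. SUM j:UNIV. w i j * Phi p (x $ i - x $ j) * ((x - y) $ i - (x - y) $ j)) / 2 = mu * (SUM i:UNIV. Phi p (x $ i) * (x - y) $ i)"
 using t1 unfolding Tv_inner[OF sw] by linarith
 have e2: "(SUM i:UNIV. SUM j:UNIV. w i j * Phi p (y $ i - y $ j) * ((x - y) $ i - (x - y) $ j)) / 2 = mu * (SUM i:UNIV. Phi p (y $ i) * (x - y) $ i)"
 using t2 unfolding Tv_inner[OF sw] by linarith
 have "(SUM i:UNIV. SUM j:UNIV. w i j * ((Phi p (x $ i - x $ j) - Phi p (y $ i - y $ j)) * ((x $ i - x $ j) - (y $ i - y $ j)))) / 2
 = (SUM i:UNIV. SUM j:UNIV. w i j * Phi p (x $ i - x $ j) * ((x - y) $ i - (x - y) $ j)) / 2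
 - (SUM i:UNIV. SUM j:UNIV. w i j * Phi p (y $ i - y $ j) * ((x - y) $ i - (x - y) $ j)) / 2"
 unfolding diff_divide_distrib[symmetric] sum_subtractf[symmetric]
 by (intro arg_cong[where f = "%s. s / 2"] sum.cong refl) (simp add: algebra_simps)
 also have "... = mu * (SUM i:UNIV. (Phi p (x $ i) - Phi p (y $ i)) * (x $ i - y $ i))"
 unfolding e1 e2 right_diff_distrib[symmetric] sum_subtractf[symmetric]
 by (intro arg_cong[where f = "%s. mu * s"] sum.cong refl) (simp add: algebra_simps)
 finally show False using lt by simp
 qed
 obtain u v where uv: "u : U" "v : V" "norm u <= ru" "norm v <= rv"
 "!!d. d : U ==> gR p w (base p A B + u + v) \<bullet> d = 0" "!!d. d : V ==> gR p w (base p A B + u + v) \<bullet> d = 0"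
 "Rq p w (base p A B + u + v) = mm (%u v. Rq p w (base p A B + u + v)) ?U ?V"
 proof (rule maxmin_critical[OF U V ru rv, of "base p A B" "Rq p w" "gR p w"])
 show "(Rq p w has_derivative (\<bullet>) (gR p w x)) (at x)" if "norm (x - base p A B) <= ru + rv" for x
 by (rule has_derivative_Rq[OF p1 sw nz[OF that]])
 show "continuous_on (cball (base p A B) (ru + rv)) (gR p w)"
 by (rule continuous_on_gR[OF p1]) (use nz[of 0] in auto)
 qed (use E1 E2 uniq in blast)+
 define xi where "xi = u + v"
 define x where "x = base p A B + xi"
 have xx: "base p A B + u + v = x" by (simp add: x_def xi_def add.assoc)
 have xin: "norm xi <= ru + rv" using nuv uv by (simp add: xi_def)
 have xn: "x ~= 0" using base_near_nonzero[OF p1 ok, of xi] xin ruv4 by (simp add: x_def)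
 have sub: "subspace (slice A B)"
 by (auto simp: subspace_def slice_def sum.distrib sum_distrib_left[symmetric] distrib_left)
 have xis: "xi : slice A B" unfolding xi_def using uv US VS sub subspace_add by blast
 let ?T = "Tv p w (Rq p w x) x"
 have "?T = 0"
 proof (rule Tv_zero_of_slice[OF p1 ok _ xis])
 fix d assume "d : slice A B"
 then obtain d1 d2 where d: "d1 : U" "d2 : V" "d = d1 + d2" using UV by blast
 show "?T \<bullet> d = 0"
 using Tv0[OF uv(5)[OF d(1), unfolded xx] xn] Tv0[OF uv(6)[OF d(2), unfolded xx] xn] by (simp add: d(3) inner_add_right)
 next
 show "?T \<bullet> (base p A B + xi) = 0"
 unfolding x_def[symmetric] Tv_inner_self[OF sw] using Nn_pos[OF xn, of p] by (simp add: Rq_def)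
 qed
 hence e: "eigenpair p w (Rq p w x) x" using xn by (simp add: eigenpair_iff_Tv)
 have "Rq p w x = La p" using uv(7) unfolding xx La_def F_def .
 moreover have "norm xi <= K * eps"
 proof -
 have "(Cu + Cv) * eps <= K * eps" using Kpos eps by (intro mult_right_mono) auto
 thus ?thesis using xin by (simp add: ru_def rv_def distrib_right)
 qed
 ultimately show ?thesis using e xis unfolding x_def by auto
 qed
 have zUV: "0 : ?U" "0 : ?V" using zU zV ru rv by auto
 hence neUV: "?U ~= {}" "?V ~= {}" by auto
 have nr: "norm (u + v) <= 1/4" "norm (u + v) <= (Cu + Cv) * eps" "u + v - 0 = u + v" if "u : ?U" "v : ?V" for u v
 proof -
 have "norm (u + v) <= ru + rv" by (rule nuv) (use that in auto)
 thus "norm (u + v) <= 1/4" "norm (u + v) <= (Cu + Cv) * eps" "u + v - 0 = u + v"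
 using ruv4 by (auto simp: ru_def rv_def distrib_right)
 qed
 have bF: "abs (F p u v) <= L" if "p : ?I" "u : ?U" "v : ?V" for p u v
 proof -
 have "abs (R0 p (u + v)) <= CR" "abs (eps * bb p (u + v)) <= 1 * Cb"
 using CR(2)[OF that(1) nr(1)[OF that(2,3)]] abs_mult_le[of eps 1 "bb p (u + v)" Cb] Cb(2)[OF that(1) nr(1)[OF that(2,3)]] eps eps1 by auto
 thus ?thesis unfolding F_def add.assoc Rw L_def by linarith
 qed
 have bG: "abs (R0 p (u + v)) <= L" if "p : ?I" "u : ?U" "v : ?V" for p u v
 using CR(2)[OF that(1) nr(1)[OF that(2,3)]] Cb(1) by (simp add: L_def)
 have G: "mm (%u v. R0 p (u + v)) ?U ?V = lam0 p A B" if p: "p : ?I" for p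
 proof (rule mm_saddle[OF zUV _ _ bG[OF p]])
 show "R0 p (0 + v) <= lam0 p A B" if "v : ?V" for v
 proof -
 have "R0 p v <= lam0 p A B - c2 * (norm v)^2" by (rule H1[OF p]) (use that ruv ru in auto)
 moreover have "0 <= c2 * (norm v)^2" using c2 by simp
 ultimately show ?thesis by simp
 qed
 show "lam0 p A B <= R0 p (u + 0)" if "u : ?U" for u
 proof -
 have n: "norm u <= dl" "norm (0 :: real ^ 'n) <= dl" "norm (u + 0) <= 1/4" using that ruv ruv4 rv dl by auto
 have "c2 * (norm u)^2 - C2 * (norm (0 :: real ^ 'n))^2 <= R0 p (u + 0) - R0 p 0"
 by (rule H2[OF p _ n(1) zV n(2,3)]) (use that in auto)
 moreover have "0 <= c2 * (norm u)^2" using c2 by simp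
 ultimately show ?thesis using lam[OF p] by simp
 qed
 qed auto
 have first: "abs (La p - lam0 p A B - eps * Rq p bw (base p A B)) <= K * eps^2" if p: "p : ?I" for p
 unfolding La_def G[OF p, symmetric]
 proof (rule mm_diff[OF neUV _ bF[OF p] bG[OF p]])
 fix u v assume uv: "u : ?U" "v : ?V"
 have "F p u v - R0 p (u + v) - eps * Rq p bw (base p A B) = eps * (bb p (u + v) - bb p 0)"
 unfolding F_def add.assoc Rw by (simp add: bb_def algebra_simps)
 also have "abs (...) <= eps * (Cb * ((Cu + Cv) * eps))"
 proof (rule abs_mult_le)
 have "abs (bb p (u + v) - bb p 0) <= Cb * norm (u + v)" using Cb(3)[OF p nr(1)[OF uv], of 0] by simp
 also have "... <= Cb * ((Cu + Cv) * eps)" using nr(2)[OF uv] Cb(1) by (intro mult_left_mono) auto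
 finally show "abs (bb p (u + v) - bb p 0) <= Cb * ((Cu + Cv) * eps)" .
 qed (use eps in auto)
 also have "... = Cb * (Cu + Cv) * eps^2" by (simp add: power2_eq_square mult_ac)
 also have "... <= K * eps^2" by (rule mult_right_mono[OF Kpos(3)]) simp
 finally show "abs (F p u v - R0 p (u + v) - eps * Rq p bw (base p A B)) <= K * eps^2" .
 qed auto
 have second: "abs (La p - lam0 p A B - (La q - lam0 q A B)) <= K * eps * abs (p - q)" if p: "p : ?I" and q: "q : ?I" for p q
 proof -
 have "abs (La p - La q - (lam0 p A B - lam0 q A B)) <= K * eps * abs (p - q)"
 unfolding La_def
 proof (rule mm_diff[OF neUV _ bF[OF p] bF[OF q]])
 fix u v assume uv: "u : ?U" "v : ?V"
 have e: "F p u v - F q u v - (lam0 p A B - lam0 q A B) =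
 (R0 p (u + v) - R0 q (u + v) - (R0 p 0 - R0 q 0)) + eps * (bb p (u + v) - bb q (u + v))"
 unfolding F_def add.assoc Rw lam[OF p] lam[OF q] by (simp add: algebra_simps)
 have b1: "abs (R0 p (u + v) - R0 q (u + v) - (R0 p 0 - R0 q 0)) <= CR * (Cu + Cv) * (eps * abs (p - q))"
 proof -
 have "abs (R0 p (u + v) - R0 q (u + v) - (R0 p 0 - R0 q 0)) <= CR * (norm (u + v) * abs (p - q))"
 by (rule CR(3)[OF p q nr(1)[OF uv]])
 also have "... <= CR * (((Cu + Cv) * eps) * abs (p - q))"
 using nr(2)[OF uv] CR(1) by (intro mult_left_mono mult_right_mono) auto
 finally show ?thesis by (simp add: mult_ac)
 qed
 have b2: "abs (eps * (bb p (u + v) - bb q (u + v))) <= Cb * (eps * abs (p - q))"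
 using abs_mult_le[OF _ Cb(4)[OF p q nr(1)[OF uv]], of eps eps] eps by (simp add: mult_ac)
 have "abs (F p u v - F q u v - (lam0 p A B - lam0 q A B)) <= (CR * (Cu + Cv) + Cb) * (eps * abs (p - q))"
 unfolding e distrib_right using b1 b2 by (rule order_trans[OF abs_triangle_ineq add_mono])
 also have "... <= K * (eps * abs (p - q))" using eps by (intro mult_right_mono[OF Kpos(4)]) auto
 finally show "abs (F p u v - F q u v - (lam0 p A B - lam0 q A B)) <= K * eps * abs (p - q)" by (simp add: mult.assoc)
 qed auto
 thus ?thesis by (simp add: algebra_simps)
 qed
 show ?thesis using branch first second unfolding w_def by blast
 qed
 thus ?thesis using Kpos(1) eps0 by blast
qed

lemma eigen_branch:
 fixes A B :: "'n::finite set" and bw :: "'n => 'n => real"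
 assumes l: "1 < l" and r: "r < 2 | 2 < l" and ok: "pair_ok A B" and bs: "sym_weights bw"
 shows "EX K>0. EX eps0>0. ALL eps. 0 < eps --> eps <= eps0 --> (EX La. ALL p:{l..r}.
 (EX xi:slice A B. norm xi <= K * eps & eigenpair p (%i j. 1 + eps * bw i j) (La p) (base p A B + xi)) &
 abs (La p - lam0 p A B - eps * Rq p bw (base p A B)) <= K * eps^2 &
 (ALL q:{l..r}. abs (La p - lam0 p A B - (La q - lam0 q A B)) <= K * eps * abs (p - q)))"
proof (cases "2 < l")
 case True
 have "Zsp A B <= slice A B" by (auto simp: Zsp_def slice_def)
 thus ?thesis
 by (intro eigen_branch_saddle[OF l ok bs subspace_Zsp subspace_Vw _ Vw_subset_slice Zsp_Vw_slice
 saddle_large[OF True ok] mono_U_large[OF True ok]])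
next
 case False
 hence r2: "r < 2" using r by simp
 have "Wsp A B <= slice A B" by (auto simp: Wsp_def slice_def)
 moreover have "Vz A B <= slice A B"
 proof
 fix d assume "d : Vz A B"
 then obtain tau where "ALL i:A Un B. d $ i = tau" using Vz_D by blast
 thus "d : slice A B" by (simp add: slice_def)
 qed
 ultimately show ?thesis
 by (intro eigen_branch_saddle[OF l ok bs subspace_Wsp subspace_Vz _ _ Wsp_Vz_slice[OF ok]
 saddle_small[OF l r2 ok] mono_U_small[OF l r2 ok]])
qed

section \<open>All eigenvectors for \<open>p > 2\<close>\<close>

lemma hb_add_right: "hb p w lam x d (e + f) = hb p w lam x d e + hb p w lam x d f"
proof -
 have E: "(e + f) $ i - (e + f) $ j = (e $ i - e $ j) + (f $ i - f $ j)" for i j by simp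
 show ?thesis
 unfolding hb_def unfolding E unfolding vector_add_component distrib_left sum.distrib add_divide_distrib by simp
qed

lemma tendsto_base [tendsto_intros]:
 fixes P :: "nat => real"
 assumes "P \<longlonglongrightarrow> p" "p > 1" "pair_ok A B"
 shows "(%k. base (P k) A B) \<longlonglongrightarrow> base p A B"
proof (rule vec_tendstoI)
 fix i
 note okD = pair_okD[OF assms(3)]
 have c: "(%k. cr (P k) m) \<longlonglongrightarrow> cr p m" if "m >= 1" for m
 unfolding cr_def using assms that by (intro tendsto_intros) auto
 show "(%k. base (P k) A B $ i) \<longlonglongrightarrow> base p A B $ i"
 unfolding base_def using c okD by (auto intro!: tendsto_intros)
qed

lemma Phi_mvt:
 assumes "p > 2"
 shows "EX tht. abs (tht - b) <= abs (a - b) & Phi p a - Phi p b = (p - 1) * abs (tht) powr (p - 2) * (a - b)"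
proof -
 have main: "EX tht. s <= tht & tht <= t & Phi p t - Phi p s = (p - 1) * abs (tht) powr (p - 2) * (t - s)" if "s < t" for s t
 using MVT2[OF that, of "Phi p" "%tht. (p - 1) * abs (tht) powr (p - 2)"] DERIV_Phi[OF assms]
 by (auto simp: mult.commute intro: less_imp_le)
 consider "a < b" | "a = b" | "b < a" by linarith
 thus ?thesis
 proof cases
 case 1
 from main[OF this] obtain tht where t: "a <= tht" "tht <= b" "Phi p b - Phi p a = (p - 1) * abs (tht) powr (p - 2) * (b - a)" by blast
 have "Phi p a - Phi p b = - ((p - 1) * abs (tht) powr (p - 2) * (b - a))" using t(3) by linarith
 also have "... = (p - 1) * abs (tht) powr (p - 2) * (a - b)" by (simp add: algebra_simps)
 finally show ?thesis using t by (intro exI[of _ tht]) auto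
 next
 case 3
 from main[OF this] obtain tht where "b <= tht" "tht <= a" "Phi p a - Phi p b = (p - 1) * abs (tht) powr (p - 2) * (a - b)" by blast
 thus ?thesis by (intro exI[of _ tht]) auto
 qed auto
qed

text \<open>Linearises \<open>Phi\<close> along moving exponents and points: the intermediate point
  of the mean value theorem is squeezed to \<open>c\<close>, and the derivative is jointly
  continuous because \<open>p > 2\<close>. The factor \<open>s\<close> is the blow-up scale.\<close>

lemma tendsto_Phi_slope:
 assumes P: "P \<longlonglongrightarrow> p" "p > 2" "!!k. P k > 2" and a: "a \<longlonglongrightarrow> c" and b: "b \<longlonglongrightarrow> c"
 and s: "(%k. (a k - b k) * s k) \<longlonglongrightarrow> t"
 shows "(%k. (Phi (P k) (a k) - Phi (P k) (b k)) * s k) \<longlonglongrightarrow> (p - 1) * abs c powr (p - 2) * t"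
proof -
 have "EX tht. ALL k. abs (tht k - b k) <= abs (a k - b k) & Phi (P k) (a k) - Phi (P k) (b k) = (P k - 1) * abs (tht k) powr (P k - 2) * (a k - b k)"
 by (intro choice allI Phi_mvt P(3))
 then obtain tht where th: "!!k. abs (tht k - b k) <= abs (a k - b k)"
 "!!k. Phi (P k) (a k) - Phi (P k) (b k) = (P k - 1) * abs (tht k) powr (P k - 2) * (a k - b k)"
 by blast
 have "(%k. a k - b k) \<longlonglongrightarrow> 0" using tendsto_diff[OF a b] by simp
 hence "(%k. tht k - b k) \<longlonglongrightarrow> 0"
 by (rule tendsto_0_le[where K = 1]) (use th(1) in auto)
 from tendsto_add[OF this b] have "tht \<longlonglongrightarrow> c" by simp
 hence "(%k. (P k - 1) * abs (tht k) powr (P k - 2) * ((a k - b k) * s k)) \<longlonglongrightarrow> (p - 1) * abs c powr (p - 2) * t"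
 by (intro tendsto_mult tendsto_abs_powr tendsto_diff P(1) tendsto_const s) (use P(2) in auto)
 thus ?thesis unfolding th(2) by (simp add: mult.assoc)
qed

text \<open>Tested against \<open>v - tau\<close> with the sign reversed on \<open>A Un B\<close>,
  the form is a positive combination of squares, so \<open>v\<close> is the constant
  \<open>tau\<close>. Tested against 1 it then leaves, up to sign,
  \<open>gc * lam0 * tau\<close>.\<close>

lemma hb_base_nondegenerate:
 fixes A B :: "'n::finite set"
 assumes p: "p > 1" and ok: "pair_ok A B" and v: "v : slice A B"
 and z: "!!d. d : slice A B ==> hb p unit_weights (lam0 p A B) (base p A B) v d = 0"
 shows "v = 0"
proof -
 note okD = pair_okD[OF ok]
 let ?Z = "- (A Un B)"
 obtain tau :: real where tau: "(SUM i:A. v $ i) = card A * tau" "(SUM i:B. v $ i) = card B * tau" by (rule slice_mean[OF ok v])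
 obtain k0 where k0: "k0 > 0" "k0 <= kA p A B" "k0 <= kA p B A" "k0 <= gc p A B"
 using coefficient_bounds[OF p ok, of p] by auto
 define e :: "real ^ 'n" where "e = (\<chi> i. if i : ?Z then v $ i - tau else tau - v $ i)"
 have eA: "(SUM i:A. e $ i) = 0" and eB: "(SUM i:B. e $ i) = 0" using tau by (simp_all add: e_def sum_subtractf)
 have "e : slice A B" using eA eB by (simp add: slice_def)
 have S: "(SUM i:A. (v $ i - tau) * e $ i) = - (SUM i:A. (v $ i - tau)^2)" "(SUM i:B. (v $ i - tau) * e $ i) = - (SUM i:B. (v $ i - tau)^2)"
 "(SUM i:?Z. (v $ i - tau) * e $ i) = (SUM i:?Z. (v $ i - tau)^2)"
 unfolding sum_negf[symmetric] by (intro sum.cong refl; simp add: e_def power2_eq_square algebra_simps)+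
 have "kA p A B * (SUM i:A. (v $ i - tau)^2) + kA p B A * (SUM i:B. (v $ i - tau)^2) + gc p A B * (SUM i:?Z. (v $ i - tau)^2) = 0"
 using z[OF \<open>e : slice A B\<close>] hb_base[OF p ok tau, of e 0] eA eB unfolding S by simp
 moreover have "0 <= c * (SUM i:S. (v $ i - tau)^2)" if "k0 <= c" for c S using that k0(1) by (intro mult_nonneg_nonneg sum_nonneg) auto
 ultimately have "kA p A B * (SUM i:A. (v $ i - tau)^2) = 0" "kA p B A * (SUM i:B. (v $ i - tau)^2) = 0" "gc p A B * (SUM i:?Z. (v $ i - tau)^2) = 0"
 using k0 by (smt (verit))+
 hence "(SUM i:A. (v $ i - tau)^2) = 0" "(SUM i:B. (v $ i - tau)^2) = 0" "(SUM i:?Z. (v $ i - tau)^2) = 0" using k0 by auto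
 hence vtau: "v $ i = tau" for i by (auto simp: sum_nonneg_eq_0_iff)
 have "1 : slice A B" by (simp add: slice_def mult.commute)
 from z[OF this] have "gc p A B * (lam0 p A B * tau) = 0"
 using hb_base[OF p ok tau, of 1 1] by (simp add: vtau algebra_simps)
 moreover have "lam0 p A B > 0" using lam0_ge[OF p ok] by linarith
 ultimately have "tau = 0" using k0 by auto
 thus ?thesis by (simp add: vec_eq_iff vtau)
qed

text \<open>Blow-up argument: normalised differences of two eigenvectors subconverge to a unit
  vector of the slice in the kernel of the linearised equation, which
  \<open>hb_base_nondegenerate\<close> excludes. Linearising at coinciding entries uses
  differentiability of \<open>Phi\<close> at 0, hence \<open>p > 2\<close>.\<close>

lemma eigenvector_unique_near:
 fixes A B :: "'n::finite set"
 assumes l: "2 < l" and ok: "pair_ok A B"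
 shows "EX dl>0. ALL p:{l..r}. ALL w lam mu. ALL xi:slice A B. ALL zeta:slice A B. sym_weights w --> (ALL i j. abs (w i j - 1) <= dl) -->
 norm xi <= dl --> norm zeta <= dl --> eigenpair p w lam (base p A B + xi) --> eigenpair p w mu (base p A B + zeta) --> xi = zeta"
proof (rule ccontr)
 assume neg: "~ ?thesis"
 have "EX p w lam mu xi zeta. p : {l..r} & xi : slice A B & zeta : slice A B & sym_weights w & (ALL i j. abs (w i j - 1) <= 1 / real (k + 2)) &
 norm xi <= 1 / real (k + 2) & norm zeta <= 1 / real (k + 2) & eigenpair p w lam (base p A B + xi) & eigenpair p w mu (base p A B + zeta) & xi ~= zeta" for k :: nat
 proof -
 have "(0::real) < 1 / real (k + 2)" by simp
 thus ?thesis using neg by blast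
 qed
 then obtain P W M M' xi zeta where H: "!!k. P k : {l..r}" "!!k. xi k : slice A B" "!!k. zeta k : slice A B" "!!k. sym_weights (W k)"
 "!!k i j. abs (W k i j - 1) <= 1 / real (k + 2)" "!!k. norm (xi k) <= 1 / real (k + 2)" "!!k. norm (zeta k) <= 1 / real (k + 2)"
 "!!k. eigenpair (P k) (W k) (M k) (base (P k) A B + xi k)" "!!k. eigenpair (P k) (W k) (M' k) (base (P k) A B + zeta k)" "!!k. xi k ~= zeta k"
 by metis
 define s where "s = (%k. 1 / norm (xi k - zeta k))"
 have sub: "subspace (slice A B)" by (auto simp: subspace_def slice_def sum.distrib algebra_simps sum_distrib_left[symmetric])
 have Vs: "s k *\<^sub>R (xi k - zeta k) : slice A B Int sphere 0 1" for k
 using subspace_scale[OF sub subspace_diff[OF sub H(2,3)]] H(10)[of k] by (simp add: s_def)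
 have "compact ({l..r} \<times> (slice A B Int sphere 0 1))"
 by (intro compact_Times compact_Icc closed_Int_compact closed_subspace[OF sub] compact_sphere)
 then obtain pv ro where pv: "pv : {l..r} \<times> (slice A B Int sphere 0 1)" "strict_mono ro" "((%k. (P k, s k *\<^sub>R (xi k - zeta k))) \<circ> ro) \<longlonglongrightarrow> pv"
 using H(1) Vs unfolding compact_def by (metis (no_types, lifting) mem_Sigma_iff)
 obtain p v where pv_eq: "pv = (p, v)" by force
 have p: "p : {l..r}" and v: "v : slice A B" "norm v = 1" using pv(1) by (auto simp: pv_eq)
 have p1: "p > 1" "p > 2" using p l by auto
 have Pl: "(%k. P (ro k)) \<longlonglongrightarrow> p" and Vl: "(%k. s (ro k) *\<^sub>R (xi (ro k) - zeta (ro k))) \<longlonglongrightarrow> v"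
 using tendsto_fst[OF pv(3)] tendsto_snd[OF pv(3)] by (simp_all add: pv_eq o_def)
 have P2: "P k > 2" for k using H(1)[of k] l by simp
 have "(%k. 1 / real (k + 2)) \<longlonglongrightarrow> 0"
 using LIMSEQ_ignore_initial_segment[OF lim_const_over_n[of 1], of 2] by simp
 from LIMSEQ_subseq_LIMSEQ[OF this pv(2)] have inv: "(%k. 1 / real (ro k + 2)) \<longlonglongrightarrow> 0" by (simp add: o_def)
 have Wl: "(%k. W (ro k) i j) \<longlonglongrightarrow> 1" for i j
 by (rule LIM_zero_cancel, rule tendsto_0_le[OF inv, where K = 1]) (use H(5) in \<open>auto intro!: always_eventually\<close>)
 define b where "b = base p A B"
 have bl: "(%k. base (P (ro k)) A B) \<longlonglongrightarrow> b" unfolding b_def by (rule tendsto_base[OF Pl p1(1) ok])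
 define x where "x = (%k. base (P (ro k)) A B + xi (ro k))"
 define y where "y = (%k. base (P (ro k)) A B + zeta (ro k))"
 have "(%k. xi (ro k)) \<longlonglongrightarrow> 0" "(%k. zeta (ro k)) \<longlonglongrightarrow> 0"
 by (rule tendsto_0_le[OF inv, where K = 1]; use H(6,7) in \<open>auto intro!: always_eventually\<close>)+
 hence "x \<longlonglongrightarrow> b" "y \<longlonglongrightarrow> b"
 unfolding x_def y_def using tendsto_add[OF bl, of "%k. xi (ro k)" 0] tendsto_add[OF bl, of "%k. zeta (ro k)" 0] by simp_all
 hence Xl: "(%k. x k $ i) \<longlonglongrightarrow> b $ i" and Yl: "(%k. y k $ i) \<longlonglongrightarrow> b $ i" for i
 by (auto intro: tendsto_vec_nth)
 have Vi: "(%k. (x k $ i - y k $ i) * s (ro k)) \<longlonglongrightarrow> v $ i" for i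
 using tendsto_vec_nth[OF Vl, of i] by (simp add: x_def y_def mult.commute)
 have b0: "Nn p b ~= 0" using Nn_pos[OF base_nonzero[OF p1(1) ok], of p] by (simp add: b_def)
 have Mx: "M (ro k) = Rq (P (ro k)) (W (ro k)) (x k)" for k unfolding x_def by (rule eigenpair_Rq[OF H(4) H(8)])
 have lam: "lam0 p A B = Rq p unit_weights b"
 unfolding b_def by (rule eigenpair_Rq[OF sym_unit_weights eigenpair_base[OF p1(1) ok]])
 have Ml: "(%k. M (ro k)) \<longlonglongrightarrow> lam0 p A B"
 unfolding lam Mx Rq_def Ew_def Nn_def
 by (intro tendsto_intros Pl Xl Wl) (use p1 b0 in \<open>auto simp: Nn_def\<close>)
 have "hb p unit_weights (lam0 p A B) (base p A B) v d = 0" if d: "d : slice A B" for d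
 proof -
 define N where "N = (%k e. SUM i:UNIV. Phi (P (ro k)) (y k $ i) * e $ i)"
 have Nl: "(%k. N k e) \<longlonglongrightarrow> (SUM i:UNIV. Phi p (b $ i) * e $ i)" for e
 unfolding N_def by (intro tendsto_sum tendsto_mult tendsto_Phi_param Pl Yl tendsto_const p1)
 have bb: "(SUM i:UNIV. Phi p (b $ i) * b $ i) > 0" unfolding b_def by (rule base_inner_pos[OF p1(1) ok])
 have bd: "(SUM i:UNIV. Phi p (b $ i) * d $ i) = 0" using d slice_iff[OF p1(1) ok] by (simp add: b_def)
 \<comment> \<open>The two eigenvalues may differ. Correcting \<open>d\<close> along the base vector
   makes the test vector orthogonal to \<open>Phi\<close> of \<open>y k\<close>, so
   \<open>M'\<close> drops out. The correction tends to 0 because \<open>d\<close> lies in the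
   slice.\<close>
 define t where "t = (%k. N k d / N k b)"
 have "t \<longlonglongrightarrow> (SUM i:UNIV. Phi p (b $ i) * d $ i) / (SUM i:UNIV. Phi p (b $ i) * b $ i)"
 unfolding t_def by (intro tendsto_divide Nl) (use bb in simp)
 hence tl: "t \<longlonglongrightarrow> 0" unfolding bd by simp
 define D where "D = (%k. d - t k *\<^sub>R b)"
 have Dl: "(%k. D k $ i) \<longlonglongrightarrow> d $ i" for i
 using tendsto_diff[OF tendsto_const[of "d $ i"] tendsto_mult[OF tl tendsto_const[of "b $ i"]]] by (simp add: D_def)
 let ?F = "%k. (SUM i:UNIV. SUM j:UNIV. W (ro k) i j * ((Phi (P (ro k)) (x k $ i - x k $ j) - Phi (P (ro k)) (y k $ i - y k $ j)) * s (ro k)) * (D k $ i - D k $ j)) / 2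
 - M (ro k) * (SUM i:UNIV. (Phi (P (ro k)) (x k $ i) - Phi (P (ro k)) (y k $ i)) * s (ro k) * D k $ i)"
 have F: "?F \<longlonglongrightarrow> (SUM i:UNIV. SUM j:UNIV. 1 * ((p - 1) * abs (b $ i - b $ j) powr (p - 2) * (v $ i - v $ j)) * (d $ i - d $ j)) / 2
 - lam0 p A B * (SUM i:UNIV. (p - 1) * abs (b $ i) powr (p - 2) * v $ i * d $ i)"
 proof -
 have 1: "(%k. (Phi (P (ro k)) (x k $ i) - Phi (P (ro k)) (y k $ i)) * s (ro k)) \<longlonglongrightarrow> (p - 1) * abs (b $ i) powr (p - 2) * v $ i" for i
 by (rule tendsto_Phi_slope[OF Pl p1(2) P2 Xl Yl Vi])
 have V2: "(%k. ((x k $ i - x k $ j) - (y k $ i - y k $ j)) * s (ro k)) \<longlonglongrightarrow> v $ i - v $ j" for i j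
 using tendsto_diff[OF Vi[of i] Vi[of j]] by (simp add: algebra_simps)
 have 2: "(%k. (Phi (P (ro k)) (x k $ i - x k $ j) - Phi (P (ro k)) (y k $ i - y k $ j)) * s (ro k)) \<longlonglongrightarrow> (p - 1) * abs (b $ i - b $ j) powr (p - 2) * (v $ i - v $ j)" for i j
 by (rule tendsto_Phi_slope[OF Pl p1(2) P2 tendsto_diff[OF Xl Xl] tendsto_diff[OF Yl Yl] V2])
 show ?thesis
 by (rule tendsto_diff, rule tendsto_divide, (intro tendsto_sum tendsto_mult tendsto_diff Wl Dl 2), rule tendsto_const, simp,
 (intro tendsto_mult tendsto_sum Ml Dl 1))
 qed
 have ev: "\<forall>\<^sub>F k in sequentially. ?F k = 0"
 proof -
 have "\<forall>\<^sub>F k in sequentially. N k b > 0" by (rule order_tendstoD(1)[OF Nl bb])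
 thus ?thesis
 proof eventually_elim
 case (elim k)
 have ND: "N k (D k) = 0"
 proof -
 have "N k (D k) = N k d - t k * N k b"
 by (simp add: N_def D_def algebra_simps sum_subtractf sum_distrib_left)
 thus ?thesis using elim by (simp add: t_def)
 qed
 have X: "Tv (P (ro k)) (W (ro k)) (M (ro k)) (x k) \<bullet> D k = 0" using H(8)[of "ro k"] by (simp add: eigenpair_iff_Tv x_def)
 have Y: "Tv (P (ro k)) (W (ro k)) (M' (ro k)) (y k) \<bullet> D k = 0" using H(9)[of "ro k"] by (simp add: eigenpair_iff_Tv y_def)
 have XY: "(SUM i:UNIV. SUM j:UNIV. W (ro k) i j * Phi (P (ro k)) (x k $ i - x k $ j) * (D k $ i - D k $ j)) / 2 - M (ro k) * (SUM i:UNIV. Phi (P (ro k)) (x k $ i) * D k $ i) = 0"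
 "(SUM i:UNIV. SUM j:UNIV. W (ro k) i j * Phi (P (ro k)) (y k $ i - y k $ j) * (D k $ i - D k $ j)) = 0"
 using X Y ND unfolding Tv_inner[OF H(4)] N_def by simp_all
 have e1: "(SUM i:UNIV. SUM j:UNIV. W (ro k) i j * ((Phi (P (ro k)) (x k $ i - x k $ j) - Phi (P (ro k)) (y k $ i - y k $ j)) * s (ro k)) * (D k $ i - D k $ j))
 = s (ro k) * ((SUM i:UNIV. SUM j:UNIV. W (ro k) i j * Phi (P (ro k)) (x k $ i - x k $ j) * (D k $ i - D k $ j)) - (SUM i:UNIV. SUM j:UNIV. W (ro k) i j * Phi (P (ro k)) (y k $ i - y k $ j) * (D k $ i - D k $ j)))"
 unfolding sum_subtractf[symmetric] sum_distrib_left by (intro sum.cong refl) (simp add: algebra_simps)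
 have e2: "(SUM i:UNIV. (Phi (P (ro k)) (x k $ i) - Phi (P (ro k)) (y k $ i)) * s (ro k) * D k $ i) = s (ro k) * ((SUM i:UNIV. Phi (P (ro k)) (x k $ i) * D k $ i) - N k (D k))"
 unfolding N_def sum_subtractf[symmetric] sum_distrib_left by (intro sum.cong refl) (simp add: algebra_simps)
 have alg: "s' * (a - 0) / 2 - m * (s' * (c - 0)) = s' * (a / 2 - m * c)" for s' a m c :: real by (simp add: algebra_simps)
 show ?case unfolding e1 e2 ND XY(2) alg XY(1) by simp
 qed
 qed
 have "(SUM i:UNIV. SUM j:UNIV. 1 * ((p - 1) * abs (b $ i - b $ j) powr (p - 2) * (v $ i - v $ j)) * (d $ i - d $ j)) / 2
 - lam0 p A B * (SUM i:UNIV. (p - 1) * abs (b $ i) powr (p - 2) * v $ i * d $ i) = 0"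
 by (rule LIMSEQ_unique[OF F tendsto_eventually[OF ev]])
 hence "(p - 1) * hb p unit_weights (lam0 p A B) b v d = 0"
 by (simp add: hb_def right_diff_distrib[of "p - 1"] sum_distrib_left mult_ac)
 thus ?thesis using p1 by (simp add: b_def)
 qed
 from hb_base_nondegenerate[OF p1(1) ok v(1) this] show False using v(2) by simp
qed

text \<open>Compactness: eigenvectors for weights near the uniform ones accumulate only at
  eigenvectors of the uniform graph.\<close>

lemma eigenvectors_near_base:
 fixes dl :: real
 assumes l: "1 < l" and r: "r < 2 | 2 < l" and dl: "dl > 0"
 shows "EX e>0. ALL p:{l..r}. ALL w lam. ALL x :: real ^ 'n::finite. sym_weights w --> (ALL i j. abs (w i j - 1) <= e) -->
 eigenpair p w lam x --> (\<nexists>c. x = c *\<^sub>R 1) -->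
 (EX A B. pair_ok A B & (EX xi:slice A B. norm xi <= dl & (EX s>0. s *\<^sub>R x = base p A B + xi)))"
proof (rule ccontr)
 assume neg: "~ ?thesis"
 define good where "good = (%p (x :: real ^ 'n). EX A B. pair_ok A B & (EX xi:slice A B. norm xi <= dl & (EX s>0. s *\<^sub>R x = base p A B + xi)))"
 \<comment> \<open>With \<open>k + 2\<close> in the denominator all weights are at least 1/2, so
   positivity holds along the entire sequence.\<close>
 have "EX p w lam x. p : {l..r} & sym_weights w & (ALL i j. abs (w i j - 1) <= 1 / real (k + 2)) &
 eigenpair p w lam x & (\<nexists>c. x = c *\<^sub>R 1) & ~ good p x" for k :: nat
 proof -
 have "(0::real) < 1 / real (k + 2)" by simp
 thus ?thesis using neg unfolding good_def by blast
 qed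
 then obtain P W M X where PX: "!!k. P k : {l..r}" "!!k. sym_weights (W k)" "!!k i j. abs (W k i j - 1) <= 1 / real (k + 2)"
 "!!k. eigenpair (P k) (W k) (M k) (X k)" "!!k. \<nexists>c. X k = c *\<^sub>R 1" "!!k. ~ good (P k) (X k)"
 by metis
 have X0: "X k ~= 0" for k using PX(4)[of k] by (simp add: eigenpair_iff_Tv)
 define Z where "Z = (%k. (1 / norm (X k)) *\<^sub>R X k)"
 have Zs: "Z k : sphere 0 1" for k using X0[of k] by (simp add: Z_def)
 have eZ: "eigenpair (P k) (W k) (M k) (Z k)" for k
 unfolding Z_def using X0[of k] PX(4)[of k] by (subst eigenpair_scale) auto
 have "compact ({l..r} \<times> sphere (0 :: real ^ 'n) 1)" by (intro compact_Times compact_Icc compact_sphere)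
 then obtain pz ro where pz: "pz : {l..r} \<times> sphere (0 :: real ^ 'n) 1" "strict_mono ro" "((%k. (P k, Z k)) \<circ> ro) \<longlonglongrightarrow> pz"
 using PX(1) Zs unfolding compact_def by (metis (no_types, lifting) mem_Sigma_iff)
 obtain p z where pz_eq: "pz = (p, z)" by force
 have p: "p : {l..r}" and z: "norm z = 1" using pz(1) by (auto simp: pz_eq)
 have p1: "p > 1" "p ~= 2" using p l r by auto
 have Pl: "(%k. P (ro k)) \<longlonglongrightarrow> p" and Zl: "(%k. Z (ro k)) \<longlonglongrightarrow> z"
 using tendsto_fst[OF pz(3)] tendsto_snd[OF pz(3)] by (simp_all add: pz_eq o_def)
 have Zi: "(%k. Z (ro k) $ i) \<longlonglongrightarrow> z $ i" for i by (rule tendsto_vec_nth[OF Zl])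
 have Wl: "(%k. W (ro k) i j) \<longlonglongrightarrow> 1" for i j
 proof -
 have "(%k. W k i j) \<longlonglongrightarrow> 1"
 proof (rule LIM_zero_cancel, rule tendsto_0_le[where K = 1])
 show "(%k. 1 / real (k + 2)) \<longlonglongrightarrow> 0"
 using LIMSEQ_ignore_initial_segment[OF lim_const_over_n[of 1], of 2] by simp
 show "\<forall>\<^sub>F k in sequentially. norm (W k i j - 1) <= norm (1 / real (k + 2)) * 1"
 using PX(3) by (intro always_eventually) auto
 qed
 thus ?thesis using LIMSEQ_subseq_LIMSEQ[OF _ pz(2)] by (simp add: o_def)
 qed
 have z0: "z ~= 0" using z by auto
 have lamk: "M k = Rq (P k) (W k) (Z k)" for k by (rule eigenpair_Rq[OF PX(2) eZ])
 have Rl: "(%k. M (ro k)) \<longlonglongrightarrow> Rq p unit_weights z"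
 unfolding lamk Rq_def Ew_def Nn_def
 by (intro tendsto_intros Pl Zi Wl) (use p1 Nn_pos[OF z0, of p] in \<open>auto simp: Nn_def\<close>)
 have "Tv p unit_weights (Rq p unit_weights z) z $ i = 0" for i
 proof (rule LIMSEQ_unique)
 show "(%k. Tv (P (ro k)) (W (ro k)) (M (ro k)) (Z (ro k)) $ i) \<longlonglongrightarrow> Tv p unit_weights (Rq p unit_weights z) z $ i"
 unfolding Tv_def vec_lambda_beta by (intro tendsto_intros Pl Zi Wl Rl) (use p1 in auto)
 show "(%k. Tv (P (ro k)) (W (ro k)) (M (ro k)) (Z (ro k)) $ i) \<longlonglongrightarrow> 0"
 using eZ by (simp add: eigenpair_iff_Tv)
 qed
 hence ez: "eigenpair p unit_weights (Rq p unit_weights z) z"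
 using z0 by (simp add: eigenpair_iff_Tv vec_eq_iff)
 have wpos: "W k i j > 0" for k i j
 proof -
 have "1 / real (k + 2) <= 1 / 2" by simp
 thus ?thesis using PX(3)[of k i j] by linarith
 qed
 have SZ: "(SUM i:UNIV. Phi (P k) (Z k $ i)) = 0" for k
 proof (rule eigenpair_sum_Phi(2)[OF PX(2) _ _ eZ])
 show "\<nexists>c. Z k = c *\<^sub>R 1"
 proof
 assume "EX c. Z k = c *\<^sub>R 1"
 then obtain c where c: "Z k = c *\<^sub>R 1" by blast
 have "X k = norm (X k) *\<^sub>R Z k" using X0[of k] by (simp add: Z_def)
 hence "X k = (norm (X k) * c) *\<^sub>R 1" unfolding c by simp
 thus False using PX(5) by blast
 qed
 qed (use wpos in \<open>auto intro: less_imp_le\<close>)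
 have Sz: "(SUM i:UNIV. Phi p (z $ i)) = 0"
 proof (rule LIMSEQ_unique)
 show "(%k. SUM i:UNIV. Phi (P (ro k)) (Z (ro k) $ i)) \<longlonglongrightarrow> (SUM i:UNIV. Phi p (z $ i))"
 by (intro tendsto_intros Pl Zi p1)
 show "(%k. SUM i:UNIV. Phi (P (ro k)) (Z (ro k) $ i)) \<longlonglongrightarrow> 0" using SZ by simp
 qed
 have nc: "\<nexists>c. z = c *\<^sub>R 1"
 proof
 assume "EX c. z = c *\<^sub>R 1"
 then obtain c where "z = c *\<^sub>R 1" by blast
 with Sz z0 show False by auto
 qed
 obtain A B :: "'n set" and s where AB: "pair_ok A B" "s > 0" "z = s *\<^sub>R base p A B"
 by (rule uniform_eigenvector[OF p1 ez nc])
 define y where "y = (%k. (1 / s) *\<^sub>R Z (ro k))"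
 have yl: "y \<longlonglongrightarrow> base p A B"
 using tendsto_scaleR[OF tendsto_const[of "1 / s"] Zl] AB by (simp add: y_def)
 have bl: "(%k. base (P (ro k)) A B) \<longlonglongrightarrow> base p A B" by (rule tendsto_base[OF Pl p1(1) AB(1)])
 define phi where "phi = (%d :: real ^ 'n. real (card B) * (SUM i:A. d $ i) - real (card A) * (SUM i:B. d $ i))"
 have phil: "(%k. phi (f k)) \<longlonglongrightarrow> phi v" if "f \<longlonglongrightarrow> v" for f :: "nat => real ^ 'n" and v
 unfolding phi_def by (intro tendsto_intros tendsto_vec_nth that)
 have phipos: "phi (base p A B) > 0" if "p : {l..r}" for p
 using base_inner_pos[of p A B] Phi_base_inner[of p A B] AB(1) that l unfolding phi_def by auto
 \<comment> \<open>Rescales \<open>y k\<close> onto the slice, which is the kernel of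
   \<open>phi\<close> translated to the base vector. The factor tends to 1 because both vectors have
   the same limit.\<close>
 define t where "t = (%k. phi (base (P (ro k)) A B) / phi (y k))"
 have tl: "t \<longlonglongrightarrow> 1"
 using tendsto_divide[OF phil[OF bl] phil[OF yl]] phipos[OF p] by (simp add: t_def)
 define xi where "xi = (%k. t k *\<^sub>R y k - base (P (ro k)) A B)"
 have "xi \<longlonglongrightarrow> 1 *\<^sub>R base p A B - base p A B"
 unfolding xi_def by (intro tendsto_intros tl yl bl)
 hence "xi \<longlonglongrightarrow> 0" by simp
 from tendstoD[OF this dl] have "\<forall>\<^sub>F k in sequentially. norm (xi k) < dl" by (simp add: dist_norm)
 moreover have "\<forall>\<^sub>F k in sequentially. t k > 0" by (rule order_tendstoD[OF tl]) simp
 ultimately have "\<forall>\<^sub>F k in sequentially. norm (xi k) < dl & t k > 0" by (rule eventually_conj)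
 then obtain k where k: "norm (xi k) < dl" "t k > 0"
 using eventually_happens'[OF sequentially_bot] by blast
 have yk: "phi (y k) ~= 0" using k(2) by (auto simp: t_def)
 have lin: "phi (c *\<^sub>R u - v) = c * phi u - phi v" for c u v
 unfolding phi_def by (simp add: sum_subtractf sum_distrib_left[symmetric] algebra_simps)
 have "phi (xi k) = 0" unfolding xi_def lin using yk by (simp add: t_def)
 hence "xi k : slice A B" by (simp add: phi_def slice_def)
 moreover have "(t k / s / norm (X (ro k))) *\<^sub>R X (ro k) = base (P (ro k)) A B + xi k"
 by (simp add: xi_def y_def Z_def)
 moreover have "t k / s / norm (X (ro k)) > 0" using k(2) AB(2) X0 by simp
 ultimately have "good (P (ro k)) (X (ro k))"
 unfolding good_def using AB(1) k(1) less_imp_le by blast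
 thus False using PX(6) by blast
qed

text \<open>Nonzero base entries have modulus at least 1, so errors of 1/4 leave the blocks visible.
  If \<open>i\<close> lies in \<open>A\<close> but not in \<open>A'\<close> and \<open>j\<close> in
  \<open>A'\<close>, the second representation makes entry \<open>j\<close> at least three times
  entry \<open>i\<close>; in the first they are at most \<open>al + 1/4\<close> and at least
  \<open>al - 1/4\<close>, which is impossible for \<open>al >= 1\<close>. Negating the vector
  exchanges the blocks.\<close>

lemma near_base_inj:
 assumes p: "p > 1" and ok: "pair_ok A B" "pair_ok A' B'"
 and s: "s > 0" "s' > 0" and x: "s *\<^sub>R x = base p A B + xi" "s' *\<^sub>R x = base p A' B' + xi'"
 and n: "norm xi <= 1/4" "norm xi' <= 1/4"
 shows "A = A' & B = B'"
proof -
 have main: "A <= A'"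
 if ok: "pair_ok A B" "pair_ok A' B'"
 and s: "s > 0" "s' > 0" and x: "s *\<^sub>R x = base p A B + xi" "s' *\<^sub>R x = base p A' B' + xi'"
 and n: "norm xi <= 1/4" "norm xi' <= 1/4" for A B A' B' s s' x xi xi'
 proof (rule subsetI, rule ccontr)
 fix i assume i: "i : A" "i ~: A'"
 obtain j where j: "j : A'" using ok by (auto simp: pair_ok_def)
 define al where "al = cr p (card B)"
 define al' where "al' = cr p (card B')"
 define be' where "be' = cr p (card A')"
 have c: "al >= 1" "al' >= 1" "be' >= 1"
 using pair_okD[OF ok(1)] pair_okD[OF ok(2)] p by (auto simp: al_def al'_def be'_def intro: cr_ge_1)
 have cmp: "abs (xi $ k) <= 1/4" "abs (xi' $ k) <= 1/4" for k
 using component_le_norm_cart[of xi k] component_le_norm_cart[of xi' k] n by auto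
 have e: "s * x $ k = base p A B $ k + xi $ k" "s' * x $ k = base p A' B' $ k + xi' $ k" for k
 using arg_cong[OF x(1), of "%v. v $ k"] arg_cong[OF x(2), of "%v. v $ k"] by simp_all
 have 1: "s * x $ i >= al - 1/4" using e(1)[of i] cmp(1)[of i] i by (simp add: base_def al_def)
 have 2: "s * x $ j <= al + 1/4" using e(1)[of j] cmp(1)[of j] c cr_ge_1[OF p pair_okD(1)[OF ok(1)]] by (auto simp: base_def al_def split: if_splits)
 have 3: "s' * x $ i <= 1/4" using e(2)[of i] cmp(2)[of i] i c by (auto simp: base_def be'_def split: if_splits)
 have 4: "s' * x $ j >= 3/4" using e(2)[of j] cmp(2)[of j] j c by (auto simp: base_def al'_def split: if_splits)
 have xj: "x $ j > 0"
 proof -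
 have "s' * x $ j > 0" using 4 by linarith
 thus ?thesis using s by (simp add: zero_less_mult_iff)
 qed
 have "3 * (s' * x $ i) <= s' * x $ j" using 3 4 by linarith
 hence "s' * (3 * x $ i) <= s' * x $ j" by simp
 hence a: "3 * x $ i <= x $ j" using s(2) by simp
 have "3 * (s * x $ i) <= s * x $ j"
 using mult_left_mono[OF a, of s] s(1) by simp
 moreover have "3 * al - 3/4 <= al + 1/4" if "3 * u <= v" "u >= al - 1/4" "v <= al + 1/4" for u v :: real
 proof -
 have "3 * al - 3/4 <= 3 * u" using that(2) by simp
 also have "... <= v" by (rule that)
 also have "... <= al + 1/4" by (rule that)
 finally show ?thesis .
 qed
 ultimately have "3 * al - 3/4 <= al + 1/4" using 1 2 by blast
 thus False using c by linarith
 qed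
 have neg: "s *\<^sub>R (- x) = base p B A + (- xi)" "s' *\<^sub>R (- x) = base p B' A' + (- xi')"
 using x base_swap[OF pair_okD(3)[OF ok(1)], of p] base_swap[OF pair_okD(3)[OF ok(2)], of p] by simp_all
 note sw = pair_ok_swap[OF ok(1)] pair_ok_swap[OF ok(2)]
 have "A <= A'" by (rule main[OF ok s x n])
 moreover have "A' <= A" by (rule main[OF ok(2,1) s(2,1) x(2,1) n(2,1)])
 moreover have "B <= B'" by (rule main[OF sw s neg]) (use n in auto)
 moreover have "B' <= B" by (rule main[OF sw(2,1) s(2,1) neg(2,1)]) (use n in auto)
 ultimately show ?thesis by blast
qed

text \<open>Selects one of \<open>(A, B)\<close> and \<open>(B, A)\<close>, whose base vectors are
  negatives of each other and span the same line. The order on the vertices provides the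
  choice.\<close>

definition half_pairs :: "('n::{finite,linorder} set \<times> 'n set) set" where
 "half_pairs = {(A, B). pair_ok A B & Min A < Min B}"

lemma half_pairs_cases:
 assumes "pair_ok A B"
 shows "(A, B) : half_pairs \<longleftrightarrow> (B, A) ~: half_pairs"
proof -
 have "Min A : A" "Min B : B" using assms by (auto simp: pair_ok_def intro!: Min_in)
 moreover have "A Int B = {}" using assms by (simp add: pair_ok_def)
 ultimately have "Min A ~= Min B" by (metis disjoint_iff)
 thus ?thesis using assms pair_ok_swap[OF assms] by (auto simp: half_pairs_def)
qed

lemma line_class_eqD:
 assumes "line_class x = line_class y"
 obtains c where "c ~= 0" "x = c *\<^sub>R y"
proof -
 have "x : line_class x" unfolding line_class_def by (rule CollectI, rule exI[of _ 1]) simp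
 thus thesis using that assms unfolding line_class_def by auto
qed

lemma line_class_scale:
 assumes "c ~= 0"
 shows "line_class (c *\<^sub>R x) = line_class x"
proof -
 have "EX t. s *\<^sub>R x = t *\<^sub>R c *\<^sub>R x & t ~= 0" if "s ~= 0" for s
 using that assms by (intro exI[of _ "s / c"]) auto
 thus ?thesis using assms unfolding line_class_def by (auto simp: scaleR_scaleR)
qed

text \<open>The eigenvectors of a perturbed weight, normalised to lie on the slices through the
  base eigenvectors and indexed by one pair from each \<open>{(A, B), (B, A)}\<close>.\<close>

definition eigen_system :: "real => ('n::{finite,linorder} => 'n => real) => real => ('n set \<times> 'n set => real ^ 'n::{finite,linorder}) => bool" where
 "eigen_system p w dl X \<longleftrightarrow>
 (ALL (A, B):half_pairs. (EX lam. eigenpair p w lam (X (A, B))) & norm (X (A, B) - base p A B) <= dl & (\<nexists>c. X (A, B) = c *\<^sub>R 1)) &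
 (ALL lam x. eigenpair p w lam x --> (\<nexists>c. x = c *\<^sub>R 1) --> (EX h:half_pairs. EX s. s ~= 0 & x = s *\<^sub>R X h)) &
 (ALL h:half_pairs. ALL h':half_pairs. ALL s. X h = s *\<^sub>R X h' --> h = h')"

lemma near_base_nonconst:
 assumes p: "p > 1" and ok: "pair_ok A B" and n: "norm (x - base p A B) <= 1/4"
 shows "\<nexists>c. x = c *\<^sub>R 1"
proof
 assume "EX c. x = c *\<^sub>R 1"
 then obtain c where c: "!!k. x $ k = c" by auto
 obtain i j where ij: "i : A" "j : B" using ok by (auto simp: pair_ok_def)
 hence "j ~: A" using ok by (auto simp: pair_ok_def)
 have b: "base p A B $ i >= 1" "base p A B $ j <= - 1"
 using ij \<open>j ~: A\<close> pair_okD[OF ok] p by (auto simp: base_def cr_ge_1)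
 have "abs (c - base p A B $ k) <= 1/4" for k
 using component_le_norm_cart[of "x - base p A B" k] n c[of k] by simp
 from this[of i] this[of j] show False using b by linarith
qed

lemma ex_common_delta:
 fixes Q :: "'a::finite => real => bool"
 assumes "!!z. EX d>0. Q z d" "!!z d d'. Q z d ==> 0 < d' ==> d' <= d ==> Q z d'"
 shows "EX d>0. ALL z. Q z d"
proof -
 obtain F where F: "!!z. F z > 0" "!!z. Q z (F z)" using assms(1) by metis
 have "Min (range F) > 0" using F(1) by (subst Min_gr_iff) auto
 moreover have "Min (range F) <= F z" for z by (rule Min_le) auto
 ultimately show ?thesis using assms(2)[OF F(2)] by blast
qed

text \<open>The branches give one eigenvector near each base vector, compactness shows that every
  nonconstant one lies near some base vector after scaling, and local uniqueness identifies the two;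
  \<open>near_base_inj\<close> keeps different pairs apart.\<close>

lemma eigen_system_exists:
 fixes bw :: "'n::{finite,linorder} => 'n => real"
 assumes l: "2 < l" and bs: "sym_weights bw" and dl: "dl > 0"
 shows "EX eps0>0. ALL eps. 0 < eps --> eps <= eps0 --> (ALL p:{l..r}. EX X. eigen_system p (%i j. 1 + eps * bw i j) dl X)"
proof -
 have l1: "1 < l" using l by simp
 let ?I = "{l..r}"
 define Q1 where "Q1 = (%(z :: 'n set \<times> 'n set) d. pair_ok (fst z) (snd z) --> (ALL p:?I. ALL w lam mu. ALL xi:slice (fst z) (snd z). ALL zeta:slice (fst z) (snd z).
 sym_weights w --> (ALL i j. abs (w i j - 1) <= d) --> norm xi <= d --> norm zeta <= d --> eigenpair p w lam (base p (fst z) (snd z) + xi) -->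
 eigenpair p w mu (base p (fst z) (snd z) + zeta) --> xi = zeta))"
 have "EX d>0. ALL z. Q1 z d"
 proof (rule ex_common_delta)
 fix z :: "'n set \<times> 'n set"
 show "EX d>0. Q1 z d"
 proof (cases "pair_ok (fst z) (snd z)")
 case True
 show ?thesis using eigenvector_unique_near[OF l True, of r] True unfolding Q1_def by simp
 next
 case False
 thus ?thesis unfolding Q1_def by (intro exI[of _ 1]) auto
 qed
 next
 fix z :: "'n set \<times> 'n set" and d d' :: real
 assume Q: "Q1 z d" and d: "0 < d'" "d' <= d"
 show "Q1 z d'"
 unfolding Q1_def
 proof (intro impI ballI allI)
 fix p w lam mu xi zeta
 assume as: "pair_ok (fst z) (snd z)" "p : ?I" "xi : slice (fst z) (snd z)" "zeta : slice (fst z) (snd z)" "sym_weights w"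
 "ALL i j. abs (w i j - 1) <= d'" "norm xi <= d'" "norm zeta <= d'" "eigenpair p w lam (base p (fst z) (snd z) + xi)"
 "eigenpair p w mu (base p (fst z) (snd z) + zeta)"
 have "ALL i j. abs (w i j - 1) <= d" "norm xi <= d" "norm zeta <= d" using as(6,7,8) d order_trans by blast+
 thus "xi = zeta" using Q as unfolding Q1_def by blast
 qed
 qed
 then obtain d1 where d1: "d1 > 0" "!!z. Q1 z d1" by blast
 \<comment> \<open>\<open>d1\<close> is the radius of local uniqueness; 1/4 is the tolerance of
   \<open>near_base_nonconst\<close> and \<open>near_base_inj\<close>.\<close>
 define d2 where "d2 = min d1 (min dl (1/4))"
 have d2: "d2 > 0" "d2 <= d1" "d2 <= dl" "d2 <= 1/4" using d1 dl by (auto simp: d2_def)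
 have "EX e>0. ALL p:?I. ALL w lam. ALL x :: real ^ 'n::{finite,linorder}. sym_weights w --> (ALL i j. abs (w i j - 1) <= e) -->
 eigenpair p w lam x --> (\<nexists>c. x = c *\<^sub>R 1) -->
 (EX A B. pair_ok A B & (EX xi:slice A B. norm xi <= d2 & (EX s>0. s *\<^sub>R x = base p A B + xi)))"
 by (rule eigenvectors_near_base[OF l1 _ d2(1)]) (use l in simp)
 then obtain e3 where e3: "e3 > 0" "ALL p:?I. ALL w lam. ALL x :: real ^ 'n::{finite,linorder}. sym_weights w --> (ALL i j. abs (w i j - 1) <= e3) -->
 eigenpair p w lam x --> (\<nexists>c. x = c *\<^sub>R 1) -->
 (EX A B. pair_ok A B & (EX xi:slice A B. norm xi <= d2 & (EX s>0. s *\<^sub>R x = base p A B + xi)))"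
 by (elim exE conjE) (rule that)
 define Q2 where "Q2 = (%(z :: 'n set \<times> 'n set) d. pair_ok (fst z) (snd z) --> (ALL eps. 0 < eps --> eps <= d --> (ALL p:?I.
 EX xi:slice (fst z) (snd z). norm xi <= d2 & (EX lam. eigenpair p (%i j. 1 + eps * bw i j) lam (base p (fst z) (snd z) + xi)))))"
 have "EX d>0. ALL z. Q2 z d"
 proof (rule ex_common_delta)
 fix z :: "'n set \<times> 'n set"
 show "EX d>0. Q2 z d"
 proof (cases "pair_ok (fst z) (snd z)")
 case True
 have "r < 2 | 2 < l" using l by simp
 from eigen_branch[OF l1 this True bs] obtain K eps0 where K: "K > 0" "eps0 > 0"
 and br: "ALL eps. 0 < eps --> eps <= eps0 --> (EX La. ALL p:?I.
 (EX xi:slice (fst z) (snd z). norm xi <= K * eps & eigenpair p (%i j. 1 + eps * bw i j) (La p) (base p (fst z) (snd z) + xi)) &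
 abs (La p - lam0 p (fst z) (snd z) - eps * Rq p bw (base p (fst z) (snd z))) <= K * eps^2 &
 (ALL q:?I. abs (La p - lam0 p (fst z) (snd z) - (La q - lam0 q (fst z) (snd z))) <= K * eps * abs (p - q)))"
 by (elim exE conjE) (rule that)
 show ?thesis
 proof (intro exI[of _ "min eps0 (d2 / K)"] conjI)
 show "0 < min eps0 (d2 / K)" using K d2 by simp
 show "Q2 z (min eps0 (d2 / K))"
 unfolding Q2_def
 proof (intro impI allI ballI)
 fix eps p assume eps: "0 < eps" "eps <= min eps0 (d2 / K)" and p: "p : ?I"
 have "K * eps <= d2" using eps K by (simp add: field_simps)
 moreover have "eps <= eps0" using eps by simp
 from br[THEN spec, THEN mp, OF eps(1), THEN mp, OF this] obtain La where "ALL p:?I.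
 (EX xi:slice (fst z) (snd z). norm xi <= K * eps & eigenpair p (%i j. 1 + eps * bw i j) (La p) (base p (fst z) (snd z) + xi)) &
 abs (La p - lam0 p (fst z) (snd z) - eps * Rq p bw (base p (fst z) (snd z))) <= K * eps^2 &
 (ALL q:?I. abs (La p - lam0 p (fst z) (snd z) - (La q - lam0 q (fst z) (snd z))) <= K * eps * abs (p - q))"
 by (elim exE) (rule that)
 from this[THEN bspec, OF p, THEN conjunct1] obtain xi where "xi : slice (fst z) (snd z)" "norm xi <= K * eps"
 "eigenpair p (%i j. 1 + eps * bw i j) (La p) (base p (fst z) (snd z) + xi)" by (elim bexE conjE) (rule that)
 ultimately show "EX xi:slice (fst z) (snd z). norm xi <= d2 & (EX lam. eigenpair p (%i j. 1 + eps * bw i j) lam (base p (fst z) (snd z) + xi))"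
 by (intro bexI[of _ xi] conjI exI[of _ "La p"]) auto
 qed
 qed
 next
 case False
 thus ?thesis unfolding Q2_def by (intro exI[of _ 1]) auto
 qed
 qed (auto simp: Q2_def)
 then obtain e4 where e4: "e4 > 0" "!!z. Q2 z e4" by blast
 define Bw where "Bw = 1 + (SUM i:UNIV. SUM j:UNIV. abs (bw i j))"
 have Bw1: "abs (bw i j) <= Bw" for i j
 proof -
 have "abs (bw i j) <= (SUM j:UNIV. abs (bw i j))" by (rule member_le_sum) auto
 also have "... <= (SUM i:UNIV. SUM j:UNIV. abs (bw i j))"
 by (rule member_le_sum[of i UNIV "%i. SUM j:UNIV. abs (bw i j)"]) (auto intro: sum_nonneg)
 finally show ?thesis by (simp add: Bw_def)
 qed
 have Bw: "Bw > 0" unfolding Bw_def by (intro add_pos_nonneg sum_nonneg) auto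
 define eps0 where "eps0 = min e4 (min d1 e3 / Bw)"
 have eps0: "eps0 > 0" using e4 d1 e3 Bw by (simp add: eps0_def)
 have "EX X. eigen_system p (%i j. 1 + eps * bw i j) dl X" if eps: "0 < eps" "eps <= eps0" and p: "p : ?I" for eps p
 proof -
 define w where "w = (%i j. 1 + eps * bw i j)"
 have sw: "sym_weights w" using bs by (simp add: sym_weights_def w_def)
 have p1: "p > 1" using p l by auto
 have eB: "eps * Bw <= min d1 e3" using eps Bw by (simp add: eps0_def field_simps)
 have w1: "abs (w i j - 1) <= min d1 e3" for i j
 proof -
 have "abs (eps * bw i j) <= eps * Bw" by (rule abs_mult_le) (use eps Bw1 in auto)
 thus ?thesis using eB by (simp add: w_def)
 qed
 have ex: "EX xi:slice A B. norm xi <= d2 & (EX lam. eigenpair p w lam (base p A B + xi))" if "pair_ok A B" for A B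
 using e4(2)[of "(A, B)"] that eps p unfolding Q2_def w_def eps0_def by simp
 define xi where "xi = (%(A, B). SOME xi. xi : slice A B & norm xi <= d2 & (EX lam. eigenpair p w lam (base p A B + xi)))"
 have xi: "xi (A, B) : slice A B & norm (xi (A, B)) <= d2 & (EX lam. eigenpair p w lam (base p A B + xi (A, B)))" if "pair_ok A B" for A B
 proof -
 have "EX xi. xi : slice A B & norm xi <= d2 & (EX lam. eigenpair p w lam (base p A B + xi))"
 using ex[OF that] by (simp only: Bex_def)
 from someI_ex[OF this] show ?thesis unfolding xi_def prod.case .
 qed
 define X where "X = (%(A, B). base p A B + xi (A, B))"
 have uniq: "zeta = xi (A, B)" if "pair_ok A B" "zeta : slice A B" "norm zeta <= d2" "eigenpair p w lam (base p A B + zeta)" for A B zeta lam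
 proof -
 have "ALL i j. abs (w i j - 1) <= d1" using w1 by simp
 note w1' = this
 note f = xi[OF that(1)]
 have n: "norm zeta <= d1" "norm (xi (A, B)) <= d1" using that(3) f d2(2) by auto
 obtain mu where mu: "eigenpair p w mu (base p A B + xi (A, B))" using f by (elim exE conjE) (rule that)
 show ?thesis
 by (rule d1(2)[of "(A, B)", unfolded Q1_def fst_conv snd_conv, THEN mp, OF that(1), THEN bspec, OF p, THEN spec, THEN spec, THEN spec,
 THEN bspec, OF that(2), THEN bspec, OF f[THEN conjunct1], THEN mp, OF sw, THEN mp, OF w1', THEN mp, OF n(1), THEN mp, OF n(2),
 THEN mp, OF that(4), THEN mp, OF mu])
 qed
 have hp: "pair_ok A B" if "(A, B) : half_pairs" for A B using that by (simp add: half_pairs_def)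
 have e3': "ALL i j. abs (w i j - 1) <= e3" using w1 by simp
 have "eigen_system p w dl X"
 unfolding eigen_system_def
 proof (intro conjI ballI allI impI)
 fix h :: "'n set \<times> 'n set" assume "h : half_pairs"
 then obtain A B where h: "h = (A, B)" "(A, B) : half_pairs" by (cases h) auto
 note f = xi[OF hp[OF h(2)]]
 have "norm (X (A, B) - base p A B) <= dl" using f d2 by (simp add: X_def)
 moreover have "\<nexists>c. X (A, B) = c *\<^sub>R 1"
 by (rule near_base_nonconst[OF p1 hp[OF h(2)]]) (use f d2 in \<open>simp add: X_def\<close>)
 ultimately show "case h of (A, B) => (EX lam. eigenpair p w lam (X (A, B))) & norm (X (A, B) - base p A B) <= dl & (\<nexists>c. X (A, B) = c *\<^sub>R 1)"
 using f unfolding h by (simp add: X_def)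
 next
 fix lam x assume e: "eigenpair p w lam x" and nc: "\<nexists>c. x = c *\<^sub>R 1"
 obtain A B zeta s where A: "pair_ok A B" "zeta : slice A B" "norm zeta <= d2" "s > 0" "s *\<^sub>R x = base p A B + zeta"
 using e3(2)[THEN bspec, OF p, THEN spec, THEN spec, THEN spec, THEN mp, OF sw, THEN mp, OF e3', THEN mp, OF e, THEN mp, OF nc] by (elim exE conjE bexE) (rule that)
 have ee: "eigenpair p w lam (s *\<^sub>R x)" using A(4) e by (subst eigenpair_scale) auto
 show "EX h:half_pairs. EX s. s ~= 0 & x = s *\<^sub>R X h"
 proof (cases "(A, B) : half_pairs")
 case True
 have "zeta = xi (A, B)" by (rule uniq[OF A(1-3)]) (use ee A(5) in auto)
 hence "x = (1 / s) *\<^sub>R X (A, B)" using A(4) A(5)[symmetric] by (simp add: X_def)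
 thus ?thesis using True A(4) by (intro bexI[of _ "(A, B)"] exI[of _ "1 / s"]) auto
 next
 case False
 \<comment> \<open>The vector lies near the base vector of the pair that was not selected, so its
   negative lies near that of \<open>(B, A)\<close>.\<close>
 hence BA: "(B, A) : half_pairs" using half_pairs_cases[OF A(1)] by blast
 have "eigenpair p w lam ((- 1) *\<^sub>R (s *\<^sub>R x))" using ee by (subst eigenpair_scale) auto
 moreover have neg: "(- 1) *\<^sub>R (s *\<^sub>R x) = base p B A + (- zeta)"
 unfolding A(5) base_swap[OF pair_okD(3)[OF A(1)], of p] by simp
 moreover have "- zeta : slice B A" using A(2) by (simp add: slice_def sum_negf)
 ultimately have "- zeta = xi (B, A)" using uniq[OF pair_ok_swap[OF A(1)], of "- zeta" lam] A(3) by simp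
 hence "X (B, A) = - (s *\<^sub>R x)" using neg by (simp add: X_def)
 hence "x = (- 1 / s) *\<^sub>R X (B, A)" using A(4) by simp
 thus ?thesis using BA A(4) by (intro bexI[of _ "(B, A)"] exI[of _ "- 1 / s"]) auto
 qed
 next
 fix h h' :: "'n set \<times> 'n set" and s assume h: "h : half_pairs" "h' : half_pairs" and eq: "X h = s *\<^sub>R X h'"
 obtain A B where hh: "h = (A, B)" by force
 obtain A' B' where hh': "h' = (A', B')" by force
 have ok: "pair_ok A B" "pair_ok A' B'" using h hp by (auto simp: hh hh')
 note f = xi[OF ok(1)] and f' = xi[OF ok(2)]
 have Xn: "X h ~= 0" using f by (auto simp: X_def hh eigenpair_iff_Tv)
 hence s0: "s ~= 0" using eq by auto
 show "h = h'"
 proof (cases "s > 0")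
 case True
 have "A = A' & B = B'"
 by (rule near_base_inj[OF p1 ok True zero_less_one, of "X h'" "xi h" "xi h'"])
 (use eq f f' d2 in \<open>auto simp: X_def hh hh'\<close>)
 thus ?thesis by (simp add: hh hh')
 next
 case False
 hence sm: "- s > 0" using s0 by simp
 have "B = A' & A = B'"
 proof (rule near_base_inj[OF p1 pair_ok_swap[OF ok(1)] ok(2), of "- s" 1 "X h'" "- xi h" "xi h'"])
 show "- s *\<^sub>R X h' = base p B A + - xi h"
 using eq[symmetric] base_swap[OF pair_okD(3)[OF ok(1)], of p] by (simp add: X_def hh)
 show "1 *\<^sub>R X h' = base p A' B' + xi h'" by (simp add: X_def hh')
 qed (use sm f f' d2 hh hh' in auto)
 thus ?thesis using half_pairs_cases[OF ok(1)] h by (simp add: hh hh')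
 qed
 qed
 thus ?thesis unfolding w_def by blast
 qed
 thus ?thesis using eps0 by blast
qed

section \<open>The reduced quotient through the optimal shift, and its derivatives for
  \<open>p > 2\<close>\<close>

definition mshift :: "real => real ^ 'n::finite => real" where
 "mshift p x = (THE c. (SUM i:UNIV. Phi p (x $ i + c)) = 0)"

definition centred :: "real => real ^ 'n::finite => real ^ 'n" where
 "centred p x = x + mshift p x *\<^sub>R 1"

lemma Phi_nonneg_iff: "0 <= Phi p t \<longleftrightarrow> 0 <= t"
 by (meson Phi_neg_iff not_less)

lemma Phi_nonpos_iff: "Phi p t <= 0 \<longleftrightarrow> t <= 0"
 by (meson Phi_pos_iff not_less)

lemma Phi_mono: "p > 1 ==> s <= t ==> Phi p s <= Phi p t"
 by (meson Phi_less_iff not_less)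

lemma sum_Phi_shift_strict_mono:
 fixes x :: "real ^ 'n::finite"
 assumes "p > 1" "c < d"
 shows "(SUM i:UNIV. Phi p (x $ i + c)) < (SUM i:UNIV. Phi p (x $ i + d))"
 by (rule sum_strict_mono) (use assms in \<open>auto intro: Phi_strict_mono\<close>)

lemma ex_shift:
 fixes x :: "real ^ 'n::finite"
 assumes "p > 1"
 shows "EX c. (SUM i:UNIV. Phi p (x $ i + c)) = 0"
proof -
 have n: "abs (x $ i) <= norm x" for i by (rule component_le_norm_cart)
 have "EX c>=- norm x. c <= norm x & (SUM i:UNIV. Phi p (x $ i + c)) = 0"
 proof (rule IVT')
 show "(SUM i:UNIV. Phi p (x $ i + - norm x)) <= 0"
 proof (rule sum_nonpos)
 fix i show "Phi p (x $ i + - norm x) <= 0" unfolding Phi_nonpos_iff using n[of i] by linarith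
 qed
 show "0 <= (SUM i:UNIV. Phi p (x $ i + norm x))"
 proof (rule sum_nonneg)
 fix i show "0 <= Phi p (x $ i + norm x)" unfolding Phi_nonneg_iff using n[of i] by linarith
 qed
 show "- norm x <= norm x" using norm_ge_zero[of x] by linarith
 show "continuous_on {- norm x..norm x} (%c. SUM i:UNIV. Phi p (x $ i + c))"
 using assms by (intro continuous_intros) auto
 qed
 thus ?thesis by blast
qed

lemma mshift_eqI:
 assumes "p > 1" "(SUM i:UNIV. Phi p (x $ i + c)) = 0"
 shows "mshift p x = c"
 unfolding mshift_def
proof (rule the_equality[of "%c. (SUM i:UNIV. Phi p (x $ i + c)) = 0", OF assms(2)])
 fix d assume "(SUM i:UNIV. Phi p (x $ i + d)) = 0"
 thus "d = c"
 using sum_Phi_shift_strict_mono[OF assms(1), of c d x] sum_Phi_shift_strict_mono[OF assms(1), of d c x] assms(2)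
 by (metis less_irrefl linorder_neqE_linordered_idom)
qed

lemma sum_Phi_mshift: "p > 1 ==> (SUM i:UNIV. Phi p (x $ i + mshift p x)) = 0"
 by (metis ex_shift mshift_eqI)

lemma sum_Phi_centred: "p > 1 ==> (SUM i:UNIV. Phi p (centred p x $ i)) = 0"
 using sum_Phi_mshift[of p x] by (simp add: centred_def)

text \<open>Monotonicity of \<open>Phi\<close> turns an entrywise comparison of vectors into one of
  balancing shifts. This gives a Lipschitz bound, and so the continuity from which the
  differentiation of the shift starts.\<close>

lemma mshift_le:
 fixes x :: "real ^ 'n::finite"
 assumes "p > 1" "!!i. x $ i <= x' $ i + D"
 shows "mshift p x' <= mshift p x + D"
proof (rule ccontr)
 assume "~ ?thesis"
 hence "(SUM i:UNIV. Phi p (x' $ i + (mshift p x + D))) < (SUM i:UNIV. Phi p (x' $ i + mshift p x'))"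
 by (intro sum_Phi_shift_strict_mono assms(1)) simp
 moreover have "(SUM i:UNIV. Phi p (x $ i + mshift p x)) <= (SUM i:UNIV. Phi p (x' $ i + (mshift p x + D)))"
 proof (intro sum_mono Phi_mono assms(1))
 fix i show "x $ i + mshift p x <= x' $ i + (mshift p x + D)" using assms(2)[of i] by linarith
 qed
 ultimately show False using sum_Phi_mshift[OF assms(1), of x] sum_Phi_mshift[OF assms(1), of x'] by linarith
qed

lemma mshift_lipschitz:
 fixes x :: "real ^ 'n::finite"
 assumes "p > 1"
 shows "abs (mshift p x' - mshift p x) <= norm (x' - x)"
proof -
 have n: "abs (x' $ i - x $ i) <= norm (x' - x)" for i
 using component_le_norm_cart[of "x' - x" i] by simp
 have "mshift p x' <= mshift p x + norm (x' - x)"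
 proof (rule mshift_le[OF assms])
 fix i show "x $ i <= x' $ i + norm (x' - x)" using n[of i] by linarith
 qed
 moreover have "mshift p x <= mshift p x' + norm (x' - x)"
 proof (rule mshift_le[OF assms])
 fix i show "x' $ i <= x $ i + norm (x' - x)" using n[of i] by linarith
 qed
 ultimately show ?thesis by linarith
qed

lemma isCont_mshift:
 assumes "p > 1"
 shows "isCont (mshift p) x"
proof -
 have "((%y. mshift p y - mshift p x) \<longlongrightarrow> 0) (at x)"
 proof (rule tendsto_0_le[where K = 1])
 show "((%y. norm (y - x)) \<longlongrightarrow> 0) (at x)"
 using tendsto_norm[OF LIM_zero[OF tendsto_ident_at[of x UNIV]]] by simp
 show "\<forall>\<^sub>F y in at x. norm (mshift p y - mshift p x) <= norm (norm (y - x)) * 1"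
 using mshift_lipschitz[OF assms] by (intro always_eventually) auto
 qed
 thus ?thesis unfolding isCont_def by (rule LIM_zero_cancel)
qed

lemma continuous_on_mshift [continuous_intros]: "p > 1 ==> continuous_on S (mshift p)"
 by (intro continuous_at_imp_continuous_on ballI isCont_mshift)

lemma centred_nonzero:
 assumes "\<nexists>c. x = c *\<^sub>R 1"
 shows "centred p x ~= 0"
proof
 assume "centred p x = 0"
 hence "x = (- mshift p x) *\<^sub>R 1" by (simp add: centred_def eq_neg_iff_add_eq_0)
 thus False using assms by blast
qed

text \<open>The derivative in \<open>c\<close> is \<open>p\<close> times a strictly increasing
  function that vanishes at \<open>mshift p x\<close>, so the infimum is attained there and the
  reduced quotient becomes a Rayleigh quotient at the centred vector.\<close>

lemma INF_shift:
 fixes x :: "real ^ 'n::finite"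
 assumes p: "p > 1"
 shows "(INF c. SUM i:UNIV. abs (x $ i + c) powr p) = Nn p (centred p x)"
proof (rule cInf_eq_minimum)
 let ?f = "%c. SUM i:UNIV. abs (x $ i + c) powr p"
 let ?m = "mshift p x"
 have N: "Nn p (centred p x) = ?f ?m" by (simp add: Nn_def centred_def)
 show "Nn p (centred p x) : range ?f" unfolding N by blast
 have D: "(?f has_real_derivative (SUM i:UNIV. p * Phi p (x $ i + c))) (at c)" for c
 proof (rule DERIV_sum)
 fix i
 have "((+) (x $ i) has_real_derivative 1) (at c)" by (auto intro!: derivative_eq_intros)
 from DERIV_chain2[where f = "%t. abs t powr p", OF DERIV_abs_powr[OF p] this]
 show "((%c. abs (x $ i + c) powr p) has_real_derivative p * Phi p (x $ i + c)) (at c)" by simp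
 qed
 have S: "(SUM i:UNIV. p * Phi p (x $ i + c)) = p * (SUM i:UNIV. Phi p (x $ i + c))" for c
 by (simp add: sum_distrib_left)
 have "?f ?m <= ?f c" for c
 proof (cases "?m <= c")
 case True
 show ?thesis
 proof (rule DERIV_nonneg_imp_nondecreasing[OF True])
 fix t assume t: "?m <= t"
 have "0 <= (SUM i:UNIV. Phi p (x $ i + t))"
 using sum_Phi_shift_strict_mono[OF p, of ?m t x] sum_Phi_mshift[OF p, of x] t by (cases "?m = t") auto
 thus "EX y. (?f has_real_derivative y) (at t) & 0 <= y" using D[of t] S p by force
 qed
 next
 case False
 hence "c <= ?m" by simp
 thus ?thesis
 proof (rule DERIV_nonpos_imp_nonincreasing)
 fix t assume t: "t <= ?m"
 have "(SUM i:UNIV. Phi p (x $ i + t)) <= 0"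
 using sum_Phi_shift_strict_mono[OF p, of t ?m x] sum_Phi_mshift[OF p, of x] t by (cases "?m = t") auto
 hence "p * (SUM i:UNIV. Phi p (x $ i + t)) <= 0" using p by (simp add: mult_nonneg_nonpos)
 thus "EX y. (?f has_real_derivative y) (at t) & y <= 0" using D[of t] unfolding S by blast
 qed
 qed
 thus "Nn p (centred p x) <= y" if "y : range ?f" for y using that unfolding N by auto
qed

lemma Ew_shift: "Ew p w (x + c *\<^sub>R 1) = Ew p w x"
 by (simp add: Ew_def)

lemma quotient_value_eq:
 fixes w :: "'n::{finite,linorder} => 'n => real"
 assumes "p > 1" "sym_weights w"
 shows "quotient_value p w x = Rq p w (centred p x)"
 unfolding quotient_value_def INF_shift[OF assms(1)] energy_eq_Ew[OF assms(2)] Rq_def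
 by (simp add: centred_def Ew_shift)

text \<open>The factor \<open>y_i - x_i\<close> vanishes at \<open>x\<close>, so continuity of
  \<open>G\<close> at \<open>x\<close> already yields the derivative. This is the multivariate side
  of differentiation by Caratheodory slopes.\<close>

lemma has_derivative_continuous_mult:
 fixes G :: "real ^ 'n => real"
 assumes "isCont G x"
 shows "((%y. G y * (y $ i - x $ i)) has_derivative (%d. G x * d $ i)) (at x)"
 unfolding has_derivative_iff_norm
proof
 show "bounded_linear (%d. G x * d $ i)"
 by (intro bounded_linear_const_mult bounded_linear_vec_nth)
 show "((%y. norm (G y * (y $ i - x $ i) - G x * (x $ i - x $ i) - G x * (y - x) $ i) / norm (y - x)) \<longlongrightarrow> 0) (at x)"
 proof (rule tendsto_0_le[where K = 1])
 show "((%y. G y - G x) \<longlongrightarrow> 0) (at x)" using assms unfolding isCont_def by (rule LIM_zero)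
 show "\<forall>\<^sub>F y in at x. norm (norm (G y * (y $ i - x $ i) - G x * (x $ i - x $ i) - G x * (y - x) $ i) / norm (y - x)) <= norm (G y - G x) * 1"
 proof (intro always_eventually allI)
 fix y
 have "G y * (y $ i - x $ i) - G x * (x $ i - x $ i) - G x * (y - x) $ i = (G y - G x) * (y - x) $ i"
 by (simp add: algebra_simps)
 moreover have "abs (G y - G x) * abs ((y - x) $ i) <= abs (G y - G x) * norm (y - x)"
 by (intro mult_left_mono component_le_norm_cart) auto
 ultimately show "norm (norm (G y * (y $ i - x $ i) - G x * (x $ i - x $ i) - G x * (y - x) $ i) / norm (y - x)) <= norm (G y - G x) * 1"
 by (cases "y = x") (auto simp: abs_mult divide_le_eq)
 qed
 qed
qed

definition rho :: "real => real ^ 'n => 'n => real" where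
 "rho p y i = abs (y $ i) powr (p - 2)"

lemma sum_rho_pos:
 fixes y :: "real ^ 'n::finite"
 assumes "y ~= 0"
 shows "(SUM i:UNIV. rho p y i) > 0"
proof -
 obtain i where "y $ i ~= 0" using assms by (auto simp: vec_eq_iff)
 thus ?thesis by (intro sum_pos2[of UNIV i]) (auto simp: rho_def)
qed

text \<open>Implicit differentiation with Caratheodory slopes of \<open>Phi\<close>: the difference
  of two balance equations is linear in the increments with continuous coefficients, and solving for
  the increment of the shift divides by \<open>S\<close>, which is positive near
  \<open>x\<close>.\<close>

lemma has_derivative_mshift:
 fixes x :: "real ^ 'n::finite"
 assumes p: "p > 2" and y0: "centred p x ~= 0"
 shows "(mshift p has_derivative (%d. - (SUM i:UNIV. rho p (centred p x) i * d $ i) / (SUM i:UNIV. rho p (centred p x) i))) (at x)"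
proof -
 have p1: "p > 1" using p by simp
 let ?y = "centred p x"
 have "EX g. (ALL z. Phi p z - Phi p (?y $ i) = g z * (z - ?y $ i)) & isCont g (?y $ i) & g (?y $ i) = (p - 1) * rho p ?y i" for i
 using DERIV_Phi[OF p, of "?y $ i"] unfolding CARAT_DERIV rho_def .
 then obtain g where g: "!!i z. Phi p z - Phi p (?y $ i) = g i z * (z - ?y $ i)" "!!i. isCont (g i) (?y $ i)"
 "!!i. g i (?y $ i) = (p - 1) * rho p ?y i" by metis
 define G where "G = (%i x'. g i (x' $ i + mshift p x'))"
 define S where "S = (%x'. SUM i:UNIV. G i x')"
 have yi: "?y $ i = x $ i + mshift p x" for i by (simp add: centred_def)
 have cG: "isCont (G i) x" for i
 unfolding G_def
 proof (rule isCont_o2[where g = "g i"])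
 show "isCont (%x'. x' $ i + mshift p x') x" by (intro continuous_intros isCont_mshift p1)
 show "isCont (g i) (x $ i + mshift p x)" using g(2)[of i] by (simp add: yi)
 qed
 have Gx: "G i x = (p - 1) * rho p ?y i" for i using g(3)[of i] by (simp add: G_def yi)
 have Sx: "S x = (p - 1) * (SUM i:UNIV. rho p ?y i)" by (simp add: S_def Gx sum_distrib_left)
 have Sx0: "S x > 0" unfolding Sx using sum_rho_pos[OF y0] p1 by simp
 have cS: "isCont S x" unfolding S_def by (intro continuous_intros cG)
 have "\<forall>\<^sub>F x' in at x. S x' > 0" using cS Sx0 unfolding isCont_def by (rule order_tendstoD)
 moreover have eq: "mshift p x' = mshift p x + (SUM i:UNIV. (- G i x' / S x') * (x' $ i - x $ i))" if "S x' > 0" for x'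
 proof -
 have "0 = (SUM i:UNIV. Phi p (x' $ i + mshift p x') - Phi p (?y $ i))"
 by (simp add: sum_subtractf sum_Phi_mshift[OF p1] sum_Phi_centred[OF p1])
 also have "... = (SUM i:UNIV. G i x' * (x' $ i - x $ i) + G i x' * (mshift p x' - mshift p x))"
 proof (intro sum.cong refl)
 fix i
 show "Phi p (x' $ i + mshift p x') - Phi p (?y $ i) = G i x' * (x' $ i - x $ i) + G i x' * (mshift p x' - mshift p x)"
 unfolding g(1) distrib_left[symmetric] G_def by (simp add: yi)
 qed
 also have "... = (SUM i:UNIV. G i x' * (x' $ i - x $ i)) + S x' * (mshift p x' - mshift p x)"
 by (simp add: sum.distrib S_def sum_distrib_right)
 finally have "mshift p x' - mshift p x = - (SUM i:UNIV. G i x' * (x' $ i - x $ i)) / S x'"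
 using that by (simp add: field_simps)
 also have "... = (SUM i:UNIV. (- G i x' / S x') * (x' $ i - x $ i))"
 by (simp add: sum_negf sum_divide_distrib)
 finally show ?thesis by simp
 qed
 ultimately have ev: "\<forall>\<^sub>F x' in at x. mshift p x + (SUM i:UNIV. (- G i x' / S x') * (x' $ i - x $ i)) = mshift p x'"
 by (auto elim!: eventually_mono)
 have "((%x'. mshift p x + (SUM i:UNIV. (- G i x' / S x') * (x' $ i - x $ i))) has_derivative
 (%d. 0 + (SUM i:UNIV. (- G i x / S x) * d $ i))) (at x)"
 by (intro has_derivative_add has_derivative_const has_derivative_sum has_derivative_continuous_mult continuous_intros cG cS)
 (use Sx0 in auto)
 from has_derivative_transform_eventually[OF this ev]
 have "(mshift p has_derivative (%d. 0 + (SUM i:UNIV. (- G i x / S x) * d $ i))) (at x)" by simp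
 moreover have "0 + (SUM i:UNIV. (- G i x / S x) * d $ i) = - (SUM i:UNIV. rho p ?y i * d $ i) / (SUM i:UNIV. rho p ?y i)" for d :: "real ^ 'n"
 unfolding Gx Sx using p1 by (simp add: sum_negf sum_divide_distrib)
 ultimately show ?thesis by simp
qed

definition dcen :: "real => real ^ 'n::finite => real ^ 'n => real ^ 'n" where
 "dcen p y d = d - ((SUM i:UNIV. rho p y i * d $ i) / (SUM i:UNIV. rho p y i)) *\<^sub>R 1"

lemma has_derivative_centred:
 assumes "p > 2" "centred p x ~= 0"
 shows "(centred p has_derivative dcen p (centred p x)) (at x)"
proof -
 have "((%x. x + mshift p x *\<^sub>R 1) has_derivative (%d. d + (- (SUM i:UNIV. rho p (centred p x) i * d $ i) / (SUM i:UNIV. rho p (centred p x) i)) *\<^sub>R 1)) (at x)"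
 by (intro has_derivative_add has_derivative_ident has_derivative_scaleR_left has_derivative_mshift assms)
 thus ?thesis unfolding centred_def[abs_def] dcen_def[abs_def] by simp
qed

lemma gR_inner_1:
 assumes "sym_weights w" "(SUM i:UNIV. Phi p (y $ i)) = 0"
 shows "gR p w y \<bullet> 1 = 0"
 by (simp add: gR_def Tv_inner[OF assms(1)] assms(2))

lemma gR_inner_self:
 assumes "sym_weights w" "y ~= 0"
 shows "gR p w y \<bullet> y = 0"
 using Nn_pos[OF assms(2), of p] by (simp add: gR_def Tv_inner_self[OF assms(1)] Rq_def)

text \<open>The moving shift displaces the centred vector along 1, and the gradient is orthogonal to
  1 at centred vectors, so the shift leaves no trace in the first derivative.\<close>

lemma has_derivative_Rq_centred:
 assumes p: "p > 2" and s: "sym_weights w" and y0: "centred p x ~= 0"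
 shows "((%x. Rq p w (centred p x)) has_derivative (%d. gR p w (centred p x) \<bullet> d)) (at x within S)"
proof -
 have "((%x. Rq p w (centred p x)) has_derivative (%d. gR p w (centred p x) \<bullet> dcen p (centred p x) d)) (at x)"
 using has_derivative_compose[OF has_derivative_centred[OF p y0] has_derivative_Rq[OF _ s y0, of p UNIV]] p by simp
 moreover have "gR p w (centred p x) \<bullet> 1 = 0" by (rule gR_inner_1[OF s sum_Phi_centred]) (use p in simp)
 ultimately show ?thesis by (auto simp: dcen_def inner_diff_right intro: has_derivative_at_withinI)
qed

text \<open>The derivative of \<open>gR\<close>, left in the raw shape that the product and quotient
  rules return, including the zero from the constant numerator. Its value is simplified only at
  critical points.\<close>

definition dgR :: "real => ('n::finite => 'n => real) => real ^ 'n => real ^ 'n => real ^ 'n" where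
 "dgR p w y e = (\<chi> i.
 p / Nn p y * ((SUM j:UNIV. w i j * ((p - 1) * rho p (\<chi> k. y $ i - y $ k) j * (e $ i - e $ j)))
 - (Rq p w y * ((p - 1) * rho p y i * e $ i) + (gR p w y \<bullet> e) * Phi p (y $ i)))
 + (0 * Nn p y - p * (SUM k:UNIV. p * Phi p (y $ k) * e $ k)) / (Nn p y * Nn p y) * Tv p w (Rq p w y) y $ i)"

lemma has_derivative_Phi:
 assumes "p > 2" "bounded_linear L"
 shows "((%x. Phi p (L x)) has_derivative (%d. (p - 1) * abs (L x) powr (p - 2) * L d)) (at x)"
proof -
 have "(Phi p has_derivative (%d. (p - 1) * abs (L x) powr (p - 2) * d)) (at (L x))"
 using DERIV_Phi[OF assms(1), of "L x"] by (simp add: has_field_derivative_def)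
 from has_derivative_compose[OF bounded_linear_imp_has_derivative[OF assms(2)] this]
 show ?thesis .
qed

lemma has_derivative_gR:
 fixes y :: "real ^ 'n::finite"
 assumes p: "p > 2" and s: "sym_weights w" and y0: "y ~= 0"
 shows "(gR p w has_derivative dgR p w y) (at y)"
proof -
 have p1: "p > 1" using p by simp
 have N: "Nn p y ~= 0" using Nn_pos[OF y0, of p] by simp
 have "((%x. gR p w x $ i) has_derivative (%d. dgR p w y d $ i)) (at y)" for i
 proof -
 have bl: "bounded_linear (%x :: real ^ 'n. x $ i - x $ j)" for j
 by (intro bounded_linear_sub bounded_linear_vec_nth)
 have 1: "((%x. p / Nn p x) has_derivative (%e. (0 * Nn p y - p * (SUM k:UNIV. p * Phi p (y $ k) * e $ k)) / (Nn p y * Nn p y))) (at y)"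
 by (rule has_derivative_divide'[OF has_derivative_const has_derivative_Nn[OF p1] N])
 have 2: "((%x. (SUM j:UNIV. w i j * Phi p (x $ i - x $ j)) - Rq p w x * Phi p (x $ i)) has_derivative
 (%e. (SUM j:UNIV. w i j * ((p - 1) * abs (y $ i - y $ j) powr (p - 2) * (e $ i - e $ j)))
 - (Rq p w y * ((p - 1) * abs (y $ i) powr (p - 2) * e $ i) + (gR p w y \<bullet> e) * Phi p (y $ i)))) (at y)"
 by (intro has_derivative_diff has_derivative_sum has_derivative_mult_right has_derivative_Phi[OF p] bl
 has_derivative_mult has_derivative_Rq[OF p1 s y0] bounded_linear_vec_nth)
 from has_derivative_mult[OF 1 2] show ?thesis
 by (simp add: gR_def[abs_def] Tv_def dgR_def rho_def)
 qed
 thus ?thesis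
 unfolding has_derivative_componentwise_within[of "gR p w"] by (auto simp: Basis_vec_def inner_axis)
qed

lemma has_derivative_gR_centred:
 assumes p: "p > 2" and s: "sym_weights w" and y0: "centred p x ~= 0"
 shows "((%x. gR p w (centred p x)) has_derivative (%d. dgR p w (centred p x) (dcen p (centred p x) d))) (at x)"
 by (rule has_derivative_compose[OF has_derivative_centred[OF p y0] has_derivative_gR[OF p s y0]])

lemma continuous_on_dgR_centred:
 fixes S :: "(real ^ 'n::finite) set"
 assumes p: "p > 2" and S: "!!x. x : S ==> centred p x ~= 0"
 shows "continuous_on S (%x. dgR p w (centred p x) (dcen p (centred p x) v))"
proof -
 have p1: "p > 1" and p0: "p > 0" "p - 2 > 0" using p by auto
 have c: "continuous_on S (%x. centred p x $ i)" for i
 unfolding centred_def by (intro continuous_intros p1)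
 have N: "continuous_on S (%x. Nn p (centred p x))" unfolding Nn_def by (intro continuous_intros c p0)
 have N0: "Nn p (centred p x) ~= 0" if "x : S" for x using Nn_pos[OF S[OF that], of p] by simp
 have E: "continuous_on S (%x. Ew p w (centred p x))" unfolding Ew_def by (intro continuous_intros c p0) auto
 have R: "continuous_on S (%x. Rq p w (centred p x))" unfolding Rq_def by (intro continuous_intros N E) (use N0 in auto)
 have T: "continuous_on S (%x. Tv p w (Rq p w (centred p x)) (centred p x) $ i)" for i
 unfolding Tv_def vec_lambda_beta by (intro continuous_intros c p1 R)
 have r: "continuous_on S (%x. rho p (centred p x) i)" for i
 unfolding rho_def by (intro continuous_intros c p0)
 have r2: "continuous_on S (%x. rho p (\<chi> k. centred p x $ i - centred p x $ k) j)" for i j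
 unfolding rho_def vec_lambda_beta by (intro continuous_intros c p0)
 have r0: "(SUM i:UNIV. rho p (centred p x) i) ~= 0" if "x : S" for x using sum_rho_pos[OF S[OF that], of p] by simp
 have d: "continuous_on S (%x. dcen p (centred p x) v $ i)" for i
 unfolding dcen_def vector_minus_component vector_scaleR_component by (intro continuous_intros r) (use r0 in auto)
 have g: "continuous_on S (%x. gR p w (centred p x) \<bullet> dcen p (centred p x) v)"
 unfolding inner_vec_def gR_def vector_scaleR_component real_scaleR_def inner_real_def by (intro continuous_intros N T d) (use N0 in auto)
 have ph: "continuous_on S (%x. Phi p (centred p x $ i))" for i
 by (rule continuous_on_Phi_param[OF continuous_on_const c p1])
 have 1: "continuous_on S (%x. p / Nn p (centred p x))"
 by (intro continuous_on_divide continuous_on_const N) (use N0 in auto)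
 have 2: "continuous_on S (%x. SUM j:UNIV. w i j * ((p - 1) * rho p (\<chi> k. centred p x $ i - centred p x $ k) j
 * (dcen p (centred p x) v $ i - dcen p (centred p x) v $ j)))" for i
 by (intro continuous_on_sum continuous_on_mult continuous_on_const continuous_on_diff r2 d)
 have 3: "continuous_on S (%x. Rq p w (centred p x) * ((p - 1) * rho p (centred p x) i * dcen p (centred p x) v $ i)
 + (gR p w (centred p x) \<bullet> dcen p (centred p x) v) * Phi p (centred p x $ i))" for i
 by (intro continuous_on_add continuous_on_mult continuous_on_const R r d g ph)
 have 4: "continuous_on S (%x. (0 * Nn p (centred p x) - p * (SUM k:UNIV. p * Phi p (centred p x $ k) * dcen p (centred p x) v $ k))
 / (Nn p (centred p x) * Nn p (centred p x)))"
 by (intro continuous_on_divide continuous_on_diff continuous_on_mult continuous_on_sum continuous_on_const N ph d) (use N0 in auto)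
 show ?thesis
 unfolding dgR_def by (intro continuous_on_vec_lambda continuous_on_add continuous_on_mult continuous_on_diff 1 2 3 4 T)
qed

section \<open>Dimension counts and the index of a quadratic form with null space\<close>

lemma dim_orthogonal_ge:
 fixes S :: "'a::euclidean_space set"
 assumes "finite S"
 shows "DIM('a) <= dim {y. ALL x:S. x \<bullet> y = 0} + card S"
proof -
 have "{y. ALL x:S. x \<bullet> y = 0} = {y : UNIV. ALL x:span S. orthogonal x y}"
 proof (intro set_eqI iffI)
 fix y assume "y : {y. ALL x:S. x \<bullet> y = 0}"
 hence "orthogonal y x" if "x : S" for x using that by (simp add: orthogonal_def inner_commute)
 hence "orthogonal y x" if "x : span S" for x using orthogonal_to_span[OF that] by blast
 thus "y : {y : UNIV. ALL x:span S. orthogonal x y}" by (simp add: orthogonal_commute)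
 next
 fix y assume "y : {y : UNIV. ALL x:span S. orthogonal x y}"
 thus "y : {y. ALL x:S. x \<bullet> y = 0}" using span_base by (auto simp: orthogonal_def)
 qed
 moreover have "dim {y : UNIV. ALL x:span S. orthogonal x y} + dim (span S) = dim (UNIV :: 'a set)"
 by (rule dim_subspace_orthogonal_to_vectors) auto
 moreover have "dim (span S) <= card S" using assms by (simp add: dim_le_card')
 ultimately show ?thesis by simp
qed

text \<open>The space is cut out by one coordinate functional per vertex of \<open>A Un B\<close>.
  Together with \<open>dim_Wsp_ge\<close> this lower bound is turned into exact dimensions by the
  definiteness of the form on both spaces, see \<open>dims_eq\<close>.\<close>

lemma dim_Zsp_ge:
 fixes A B :: "'n::finite set"
 assumes "A Int B = {}"
 shows "CARD('n) <= dim (Zsp A B) + (card A + card B)"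
proof -
 let ?S = "(%i. axis i (1::real)) ` (A Un B)"
 have "CARD('n) <= dim {y :: real ^ 'n. ALL x:?S. x \<bullet> y = 0} + card ?S"
 using dim_orthogonal_ge[of ?S] by simp
 moreover have "{y :: real ^ 'n. ALL x:?S. x \<bullet> y = 0} = Zsp A B"
 by (auto simp: Zsp_def inner_axis')
 moreover have "card ?S <= card A + card B"
 using card_image_le[of "A Un B" "%i. axis i (1::real)"] card_Un_disjoint[of A B] assms by simp
 ultimately show ?thesis by simp
qed

lemma dim_Wsp_ge:
 fixes A B :: "'n::finite set"
 assumes "A Int B = {}"
 shows "card A + card B <= dim (Wsp A B) + 2"
proof -
 let ?Z = "- (A Un B)"
 let ?I = "%C. (\<chi> i. if i : C then 1 else 0) :: real ^ 'n"
 let ?S = "insert (?I A) (insert (?I B) ((%i. axis i (1::real)) ` ?Z))"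
 have I: "?I C \<bullet> y = (SUM i:C. y $ i)" for C y
 by (simp add: inner_vec_def if_distrib[of "%t. t * _"] sum.If_cases)
 have eq: "{y :: real ^ 'n. ALL x:?S. x \<bullet> y = 0} = Wsp A B"
 by (auto simp: Wsp_def inner_axis' I)
 have "CARD('n) <= dim {y :: real ^ 'n. ALL x:?S. x \<bullet> y = 0} + card ?S"
 using dim_orthogonal_ge[of ?S] by simp
 hence "CARD('n) <= dim (Wsp A B) + card ?S" unfolding eq .
 moreover have "card ?S <= card ?Z + 2"
 proof -
 have ci: "card (insert x T) <= Suc (card T)" for x :: "real ^ 'n" and T by (cases "finite T") (auto simp: card_insert_if)
 have "card ?S <= Suc (card (insert (?I B) ((%i. axis i (1::real)) ` ?Z)))" by (rule ci)
 also have "... <= Suc (Suc (card ((%i. axis i (1::real)) ` ?Z)))" using ci by simp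
 also have "... <= Suc (Suc (card ?Z))" by (simp add: card_image_le)
 finally show ?thesis by simp
 qed
 moreover have "card A + card B + card ?Z = CARD('n)" by (rule card_blocks[OF assms])
 ultimately show ?thesis by linarith
qed

text \<open>A quadratic form with null space \<open>K\<close>, negative definite on \<open>W\<close> and positive definite on
  \<open>Z\<close>, of complementary dimensions: on the orthogonal complement of \<open>K\<close> it is nondegenerate of
  index \<open>dim W\<close>.\<close>

locale indefinite_form =
 fixes q :: "'a::euclidean_space => 'a => real" and K W Z :: "'a set"
 assumes q_add: "!!u v w. q (u + v) w = q u w + q v w"
 and q_sym: "!!u v. q u v = q v u"
 and sub: "subspace K" "subspace W" "subspace Z"
 and q_null: "!!k v. k : K ==> q k v = 0"
 and q_neg: "!!v. v : W ==> v ~= 0 ==> q v v < 0"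
 and q_pos: "!!v. v : Z ==> v ~= 0 ==> 0 < q v v"
 and dims: "DIM('a) <= dim W + dim Z + dim K"
begin

definition C where "C = {v. ALL k:K. v \<bullet> k = 0}"

lemma q_zero [simp]: "q 0 v = 0" "q v 0 = 0"
 using q_null[of 0 v] subspace_0[OF sub(1)] q_sym[of v 0] by auto

lemma q_add_right: "q w (u + v) = q w u + q w v"
 using q_add q_sym by metis

text \<open>The two vanishing pairings give \<open>q w w = q z z\<close>, where the left side is at
  most 0 and the right side at least 0.\<close>

lemma split_zero:
 assumes "w : W" "z : Z" "k : K" "q (w + z + k) w = 0" "q (w + z + k) z = 0"
 shows "w = 0 & z = 0"
proof -
 have "q w w + q z w = 0" "q w z + q z z = 0" using assms q_null by (simp_all add: q_add)
 hence "q w w = q z z" using q_sym[of w z] by linarith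
 thus ?thesis using q_neg[OF assms(1)] q_pos[OF assms(2)] q_zero(1) by (metis less_asym order_less_irrefl)
qed

lemma subspace_C: "subspace C"
 by (auto simp: subspace_def C_def inner_add_left)

lemma CK_zero: "v : C ==> v : K ==> v = 0"
 by (metis (mono_tags, lifting) C_def inner_eq_zero_iff mem_Collect_eq)

lemma dim_C: "dim C + dim K = DIM('a)"
proof -
 have "C = {y : UNIV. ALL x:K. orthogonal x y}" by (auto simp: C_def orthogonal_def inner_commute)
 thus ?thesis using dim_subspace_orthogonal_to_vectors[of K UNIV] sub by simp
qed

lemma dim_disjoint_sum:
 assumes "subspace S" "subspace T" "!!x. x : S ==> x : T ==> x = (0::'a)"
 shows "dim {x + y |x y. x : S & y : T} = dim S + dim T"
proof -
 have "S Int T = {0}" using assms(3) subspace_0[OF assms(1)] subspace_0[OF assms(2)] by auto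
 thus ?thesis using dim_sums_Int[OF assms(1,2)] by simp
qed

definition ZK where "ZK = {x + y |x y. x : Z & y : K}"
definition WZK where "WZK = {x + y |x y. x : W & y : ZK}"

lemma subspace_ZK: "subspace ZK" unfolding ZK_def by (rule subspace_sums[OF sub(3,1)])

lemma dim_ZK: "dim ZK = dim Z + dim K"
 unfolding ZK_def
proof (rule dim_disjoint_sum[OF sub(3,1)])
 fix x assume "x : Z" "x : K"
 thus "x = 0" using q_pos[of x] q_null[of x x] by force
qed

lemma ZK_nonneg: "x : ZK ==> 0 <= q x x"
proof -
 assume "x : ZK"
 then obtain z k where x: "x = z + k" "z : Z" "k : K" unfolding ZK_def by blast
 have "q x x = q z z" using q_null[OF x(3)] q_sym[of z k] unfolding x(1) q_add q_add_right by simp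
 thus "0 <= q x x" using q_pos[OF x(2)] by (cases "z = 0") auto
qed

lemma dim_WZK: "dim WZK = dim W + dim Z + dim K"
 unfolding WZK_def
proof (subst dim_disjoint_sum[OF sub(2) subspace_ZK])
 fix x assume "x : W" "x : ZK"
 thus "x = 0" using q_neg[of x] ZK_nonneg[of x] by force
qed (simp add: dim_ZK)

lemma dims_eq: "dim W + dim Z + dim K = DIM('a)"
 using dims dim_WZK dim_subset_UNIV[of WZK] by linarith

lemma decompose: obtains w z k where "v = w + z + k" "w : W" "z : Z" "k : K"
proof -
 have "subspace WZK" unfolding WZK_def by (rule subspace_sums[OF sub(2) subspace_ZK])
 hence "WZK = UNIV" using dim_WZK dims_eq by (metis dim_eq_full span_eq_iff)
 hence "v : WZK" by simp
 thus thesis unfolding WZK_def ZK_def using that by (auto simp: add.assoc)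
qed

text \<open>Since \<open>K\<close> is null, vanishing against \<open>C\<close> means vanishing
  against the whole space. Then \<open>split_zero\<close> removes the \<open>W\<close> and
  \<open>Z\<close> parts of \<open>u\<close>, and what is left lies in both \<open>K\<close> and its
  orthogonal complement.\<close>

lemma nondegenerate:
 assumes u: "u : C" and z: "!!v. v : C ==> q u v = 0"
 shows "u = 0"
proof -
 have all: "q u v = 0" for v
 proof -
 obtain k c where "k : span K" "!!x. x : span K ==> orthogonal c x" "v = k + c"
 by (rule orthogonal_subspace_decomp_exists[of K v]) (rule that; blast)
 hence "k : K" "c : C" using span_eq_iff[THEN iffD2, OF sub(1)] by (auto simp: C_def orthogonal_def)
 thus ?thesis using z[of c] q_null[of k u] q_sym[of u k] \<open>v = k + c\<close> by (simp add: q_add_right)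
 qed
 obtain w z k where d: "u = w + z + k" "w : W" "z : Z" "k : K" by (rule decompose)
 have "w = 0 & z = 0" by (rule split_zero[OF d(2-4)]) (use all d in auto)
 hence "u : K" using d by simp
 thus ?thesis using u CK_zero by blast
qed

text \<open>The form is nonnegative on \<open>Z + K\<close>, so a negative definite subspace meets
  it only in 0, which bounds the dimension by \<open>dim W\<close>. The bound is attained on
  \<open>C Int (W + K)\<close>, where the form only sees the \<open>W\<close> component and the
  dimension formula for sums applies.\<close>

lemma index: "Max {dim S | S. subspace S & S <= C & (ALL v:S - {0}. q v v < 0)} = dim W"
proof (rule Max_eqI)
 let ?M = "{dim S | S. subspace S & S <= C & (ALL v:S - {0}. q v v < 0)}"
 have "?M <= {..DIM('a)}" using dim_subset_UNIV by auto
 thus "finite ?M" by (rule finite_subset) simp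
 show "y <= dim W" if "y : ?M" for y
 proof -
 obtain S where S: "y = dim S" "subspace S" "!!v. v : S ==> v ~= 0 ==> q v v < 0"
 using \<open>y : ?M\<close> by auto
 have "dim {x + y |x y. x : S & y : ZK} = dim S + dim ZK"
 proof (rule dim_disjoint_sum[OF S(2) subspace_ZK])
 fix x assume "x : S" "x : ZK"
 thus "x = 0" using S(3)[of x] ZK_nonneg[of x] by force
 qed
 from this[symmetric] have "dim S + dim ZK <= DIM('a)" by (simp only: dim_subset_UNIV)
 thus ?thesis using dims_eq dim_ZK S(1) by linarith
 qed
 let ?T = "{x + y |x y. x : W & y : K}"
 have sT: "subspace ?T" by (rule subspace_sums[OF sub(2,1)])
 have dT: "dim ?T = dim W + dim K"
 proof (rule dim_disjoint_sum[OF sub(2,1)])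
 fix x assume "x : W" "x : K"
 thus "x = 0" using q_neg[of x] q_null[of x x] by force
 qed
 have neg: "q v v < 0" if "v : C Int ?T" "v ~= 0" for v
 proof -
 have "v : ?T" using that(1) by (rule IntD2)
 then obtain w k where wk: "v = w + k" "w : W" "k : K" by blast
 have "w ~= 0" using wk that CK_zero[of v] by auto
 hence "q w w < 0" by (rule q_neg[OF wk(2)])
 moreover have "q v v = q w w" using wk q_null q_sym[of w k] by (simp add: q_add q_add_right)
 ultimately show ?thesis by simp
 qed
 have sC: "subspace (C Int ?T)" by (rule subspace_inter[OF subspace_C sT])
 have mem: "dim (C Int ?T) : ?M" using sC neg by blast
 have ge: "dim W <= dim (C Int ?T)"
 proof -
 have "dim {x + y |x y. x : C & y : ?T} + dim (C Int ?T) = dim C + dim ?T" by (rule dim_sums_Int[OF subspace_C sT])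
 moreover have "dim {x + y |x y. x : C & y : ?T} <= DIM('a)" by (rule dim_subset_UNIV)
 ultimately show ?thesis using dT dim_C by linarith
 qed
 have "dim (C Int ?T) <= dim W"
 proof -
 have "dim {x + y |x y. x : C Int ?T & y : ZK} = dim (C Int ?T) + dim ZK"
 proof (rule dim_disjoint_sum[OF sC subspace_ZK])
 fix x assume "x : C Int ?T" "x : ZK"
 thus "x = 0" using neg[of x] ZK_nonneg[of x] by force
 qed
 from this[symmetric] have "dim (C Int ?T) + dim ZK <= DIM('a)" by (simp only: dim_subset_UNIV)
 thus ?thesis using dims_eq dim_ZK by linarith
 qed
 thus "dim W : ?M" using mem ge by simp
qed

end

text \<open>At a critical point this is the Hessian of the reduced quotient up to a positive factor
  (\<open>dgR_critical\<close>): \<open>hb\<close> accounts for a fixed shift, the second summand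
  for the motion of the optimal shift. The correction makes constants null vectors.\<close>

definition qf :: "real => ('n::finite => 'n => real) => real => real ^ 'n => real ^ 'n => real ^ 'n => real" where
 "qf p w lam y u v = hb p w lam y u v
 + lam * ((SUM i:UNIV. rho p y i * u $ i) * (SUM i:UNIV. rho p y i * v $ i) / (SUM i:UNIV. rho p y i))"

lemma hb_sym: "hb p w lam x d e = hb p w lam x e d"
 by (simp add: hb_def mult_ac)

lemma hb_add_left: "hb p w lam x (d + f) e = hb p w lam x d e + hb p w lam x f e"
 using hb_add_right[of p w lam x e d f] by (simp add: hb_sym[of p w lam x e])

lemma qf_sym: "qf p w lam y u v = qf p w lam y v u"
 by (simp add: qf_def hb_sym[of p w lam y u v] mult.commute)

lemma qf_add: "qf p w lam y (u + v) d = qf p w lam y u d + qf p w lam y v d"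
 by (simp add: qf_def hb_add_left algebra_simps sum.distrib add_divide_distrib)

lemma qf_scaleR_arg: "qf p w lam y (c *\<^sub>R u) d = c * qf p w lam y u d"
 by (simp add: qf_def hb_def sum_distrib_left algebra_simps)

lemma qf_one:
 assumes "y ~= 0"
 shows "qf p w lam y 1 v = 0"
proof -
 have "(SUM i:UNIV. rho p y i) ~= 0" using sum_rho_pos[OF assms, of p] by simp
 thus ?thesis by (simp add: qf_def hb_def rho_def)
qed

text \<open>Homogeneity: applied to the point itself, \<open>hb\<close> reproduces the residual
  \<open>Tv\<close>, which is 0, and the correction contains the sum of \<open>Phi\<close> over the
  entries, which is 0 too.\<close>

lemma qf_self:
 assumes "sym_weights w" "eigenpair p w lam y" "(SUM i:UNIV. Phi p (y $ i)) = 0"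
 shows "qf p w lam y y v = 0"
proof -
 have T: "Tv p w lam y = 0" using assms(2) by (simp add: eigenpair_iff_Tv)
 have "hb p w lam y y v = Tv p w lam y \<bullet> v"
 unfolding Tv_inner[OF assms(1)] hb_def by (simp add: powr_Phi mult.assoc)
 moreover have "(SUM i:UNIV. rho p y i * y $ i) = 0"
 unfolding rho_def powr_Phi by (rule assms(3))
 ultimately show ?thesis by (simp add: qf_def T)
qed

lemma qf_scale:
 assumes "s ~= 0"
 shows "qf p w lam (s *\<^sub>R y) u v = abs s powr (p - 2) * qf p w lam y u v"
proof -
 let ?k = "abs s powr (p - 2)"
 have k: "?k > 0" using assms by simp
 have D2: "abs (s * a) powr (p - 2) = ?k * abs a powr (p - 2)" for a
 by (simp add: abs_mult powr_mult)
 have D: "abs (s * a - s * b) powr (p - 2) = ?k * abs (a - b) powr (p - 2)" for a b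
 using D2[of "a - b"] by (simp add: right_diff_distrib)
 have 1: "hb p w lam (s *\<^sub>R y) u v = ?k * hb p w lam y u v"
 unfolding hb_def vector_scaleR_component real_scaleR_def D D2
 by (simp add: right_diff_distrib[of ?k] sum_distrib_left mult_ac)
 have r: "rho p (s *\<^sub>R y) i = ?k * rho p y i" for i by (simp add: rho_def abs_mult powr_mult)
 have S: "(SUM i:UNIV. ?k * rho p y i * d i) = ?k * (SUM i:UNIV. rho p y i * d i)" for d :: "'a => real"
 by (simp add: sum_distrib_left mult.assoc)
 have S1: "(SUM i:UNIV. ?k * rho p y i) = ?k * (SUM i:UNIV. rho p y i)" by (simp add: sum_distrib_left)
 have Q: "(?k * a) * (?k * b) / (?k * c) = ?k * (a * b / c)" for a b c :: real
 using k by simp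
 show ?thesis unfolding qf_def 1 r S S1 Q by (simp add: algebra_simps)
qed

text \<open>The shift correction vanishes on both spaces: \<open>rho\<close> is constant on
  \<open>A\<close> and on \<open>B\<close>, where elements of \<open>Wsp\<close> have sum 0, and it
  is 0 on the zero block, where elements of \<open>Zsp\<close> live. The coefficients of
  \<open>hb_base\<close> then give the signs.\<close>

lemma qf_base:
 assumes p: "p > 2" and ok: "pair_ok A B"
 shows "v : Wsp A B ==> v ~= 0 ==> qf p unit_weights (lam0 p A B) (base p A B) v v < 0"
 and "v : Zsp A B ==> v ~= 0 ==> qf p unit_weights (lam0 p A B) (base p A B) v v > 0"
proof -
 have p1: "p > 1" using p by simp
 note okD = pair_okD[OF ok]
 obtain k0 where k0: "k0 > 0" "k0 <= kA p A B" "k0 <= kA p B A" "k0 <= gc p A B"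
 using coefficient_bounds[OF p1 ok, of p] by auto
 have rs: "(SUM i:UNIV. rho p (base p A B) i * v $ i) =
 cr p (card B) powr (p - 2) * (SUM i:A. v $ i) + cr p (card A) powr (p - 2) * (SUM i:B. v $ i)"
 proof -
 have "rho p (base p A B) i = abs (cr p (card B)) powr (p - 2)" if "i : A" for i
 using that by (simp add: rho_def base_simps[OF okD(3)])
 moreover have "rho p (base p A B) i = abs (cr p (card A)) powr (p - 2)" if "i : B" for i
 using that by (simp add: rho_def base_simps[OF okD(3)])
 moreover have "rho p (base p A B) i = 0" if "i : - (A Un B)" for i
 using that by (simp add: rho_def base_simps(3)[OF okD(3)])
 moreover have "abs (cr p (card B)) = cr p (card B)" "abs (cr p (card A)) = cr p (card A)"
 by (simp_all add: cr_def)
 ultimately show ?thesis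
 by (subst sum_UNIV_split[OF okD(3)]) (simp add: sum_distrib_left)
 qed
 have bl: "v \<bullet> v = (SUM i:A. (v $ i)^2) + (SUM i:B. (v $ i)^2) + (SUM i:- (A Un B). (v $ i)^2)"
 by (rule inner_blocks[OF okD(3)])
 have sq: "x * x = x^2" for x :: real by (simp add: power2_eq_square)
 {
 assume v: "v : Wsp A B" "v ~= 0"
 hence vs: "(SUM i:A. v $ i) = 0" "(SUM i:B. v $ i) = 0" "!!i. i : - (A Un B) ==> v $ i = 0"
 by (auto simp: Wsp_def)
 have "hb p unit_weights (lam0 p A B) (base p A B) v v =
 - kA p A B * (SUM i:A. (v $ i)^2) - kA p B A * (SUM i:B. (v $ i)^2)"
 using hb_base[OF p1 ok, of v 0 v 0] vs by (simp add: sq)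
 moreover have "(SUM i:A. (v $ i)^2) + (SUM i:B. (v $ i)^2) > 0"
 using bl v(2) vs(3) by (metis (no_types, lifting) add.right_neutral inner_gt_zero_iff power_zero_numeral sum.neutral)
 moreover have "kA p A B * (SUM i:A. (v $ i)^2) >= k0 * (SUM i:A. (v $ i)^2)"
 by (intro mult_right_mono k0 sum_nonneg) auto
 moreover have "kA p B A * (SUM i:B. (v $ i)^2) >= k0 * (SUM i:B. (v $ i)^2)"
 by (intro mult_right_mono k0 sum_nonneg) auto
 moreover have "k0 * ((SUM i:A. (v $ i)^2) + (SUM i:B. (v $ i)^2)) > 0" using k0 calculation(2) by simp
 ultimately have "hb p unit_weights (lam0 p A B) (base p A B) v v < 0" unfolding distrib_left by linarith
 thus "qf p unit_weights (lam0 p A B) (base p A B) v v < 0"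
 unfolding qf_def rs vs by simp
 }
 {
 assume v: "v : Zsp A B" "v ~= 0"
 hence vs: "!!i. i : A ==> v $ i = 0" "!!i. i : B ==> v $ i = 0"
 by (auto simp: Zsp_def)
 have "hb p unit_weights (lam0 p A B) (base p A B) v v = gc p A B * (SUM i:- (A Un B). (v $ i)^2)"
 using hb_base[OF p1 ok, of v 0 v 0] vs by (simp add: sq)
 moreover have "(SUM i:- (A Un B). (v $ i)^2) > 0"
 using bl v(2) vs by (metis (no_types, lifting) add.left_neutral inner_gt_zero_iff power_zero_numeral sum.neutral)
 ultimately have "hb p unit_weights (lam0 p A B) (base p A B) v v > 0" using k0 by simp
 thus "qf p unit_weights (lam0 p A B) (base p A B) v v > 0"
 unfolding qf_def rs by (simp add: vs)
 }
qed

text \<open>Compactness of the interval and of the unit sphere of \<open>S\<close>; the form is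
  continuous in the exponent, weights and vectors because \<open>p - 2 > 0\<close>. The factor
  \<open>sg\<close> covers positive and negative definiteness together.\<close>

lemma form_sign:
 fixes A B :: "'n::finite set" and sg :: real
 assumes l: "2 < l" and ok: "pair_ok A B" and S: "subspace S"
 and pos: "!!p v. p : {l..r} ==> v : S ==> v ~= 0 ==> 0 < sg * qf p unit_weights (lam0 p A B) (base p A B) v v"
 shows "EX dl>0. ALL p:{l..r}. ALL w x v. (ALL i j. abs (w i j - 1) <= dl) --> norm (x - base p A B) <= dl --> v : S --> v ~= 0 -->
 0 < sg * qf p w (Rq p w x) x v v"
proof (rule ccontr)
 assume neg: "~ ?thesis"
 have "EX p w x v. p : {l..r} & (ALL i j. abs (w i j - 1) <= 1 / real (k + 2)) & norm (x - base p A B) <= 1 / real (k + 2) & v : S & v ~= 0 &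
 sg * qf p w (Rq p w x) x v v <= 0" for k :: nat
 proof -
 have "(0::real) < 1 / real (k + 2)" by simp
 thus ?thesis using neg by (meson not_less)
 qed
 then obtain P W X V where PX: "!!k. P k : {l..r}" "!!k i j. abs (W k i j - 1) <= 1 / real (k + 2)"
 "!!k. norm (X k - base (P k) A B) <= 1 / real (k + 2)" "!!k. V k : S" "!!k. V k ~= 0"
 "!!k. sg * qf (P k) (W k) (Rq (P k) (W k) (X k)) (X k) (V k) (V k) <= 0"
 by metis
 define U where "U = (%k. (1 / norm (V k)) *\<^sub>R V k)"
 have Us: "U k : S Int sphere 0 1" for k using PX(4,5)[of k] S by (simp add: U_def subspace_scale)
 have qU: "sg * qf (P k) (W k) (Rq (P k) (W k) (X k)) (X k) (U k) (U k) <= 0" for k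
 proof -
 let ?q = "qf (P k) (W k) (Rq (P k) (W k) (X k)) (X k)"
 have "?q (U k) (U k) = (1 / norm (V k)) * ((1 / norm (V k)) * ?q (V k) (V k))"
 unfolding U_def by (subst qf_scaleR_arg, subst qf_sym, subst qf_scaleR_arg) simp
 hence "sg * ?q (U k) (U k) = (1 / norm (V k))^2 * (sg * ?q (V k) (V k))" by (simp add: power2_eq_square)
 also have "... <= 0" using PX(6)[of k] by (rule mult_nonneg_nonpos[OF zero_le_power2])
 finally show ?thesis .
 qed
 have "compact ({l..r} \<times> (S Int sphere 0 1))"
 by (intro compact_Times compact_Icc closed_Int_compact closed_subspace[OF S] compact_sphere)
 then obtain pv ro where pv: "pv : {l..r} \<times> (S Int sphere 0 1)" "strict_mono ro" "((%k. (P k, U k)) \<circ> ro) \<longlonglongrightarrow> pv"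
 using PX(1) Us unfolding compact_def by (metis (no_types, lifting) mem_Sigma_iff)
 obtain p v where pv_eq: "pv = (p, v)" by force
 have p: "p : {l..r}" and v: "v : S" "norm v = 1" using pv(1) by (auto simp: pv_eq)
 have p1: "p > 1" "p - 2 > 0" using p l by auto
 have Pl: "(%k. P (ro k)) \<longlonglongrightarrow> p" and Ul: "(%k. U (ro k)) \<longlonglongrightarrow> v"
 using tendsto_fst[OF pv(3)] tendsto_snd[OF pv(3)] by (simp_all add: pv_eq o_def)
 have Ui: "(%k. U (ro k) $ i) \<longlonglongrightarrow> v $ i" for i by (rule tendsto_vec_nth[OF Ul])
 have inv: "(%k. 1 / real (k + 2)) \<longlonglongrightarrow> 0"
 using LIMSEQ_ignore_initial_segment[OF lim_const_over_n[of 1], of 2] by simp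
 have invro: "(%k. 1 / real (ro k + 2)) \<longlonglongrightarrow> 0"
 using LIMSEQ_subseq_LIMSEQ[OF inv pv(2)] by (simp add: o_def)
 have Wl: "(%k. W (ro k) i j) \<longlonglongrightarrow> 1" for i j
 proof (rule LIM_zero_cancel, rule tendsto_0_le[OF invro, where K = 1])
 show "\<forall>\<^sub>F k in sequentially. norm (W (ro k) i j - 1) <= norm (1 / real (ro k + 2)) * 1"
 using PX(2) by (intro always_eventually) auto
 qed
 have bl: "(%k. base (P (ro k)) A B) \<longlonglongrightarrow> base p A B" by (rule tendsto_base[OF Pl p1(1) ok])
 have "(%k. X (ro k) - base (P (ro k)) A B) \<longlonglongrightarrow> 0"
 proof (rule tendsto_0_le[OF invro, where K = 1])
 show "\<forall>\<^sub>F k in sequentially. norm (X (ro k) - base (P (ro k)) A B) <= norm (1 / real (ro k + 2)) * 1"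
 using PX(3) by (intro always_eventually) auto
 qed
 from tendsto_add[OF this bl] have Xl: "(%k. X (ro k)) \<longlonglongrightarrow> base p A B" by simp
 have Xi: "(%k. X (ro k) $ i) \<longlonglongrightarrow> base p A B $ i" for i by (rule tendsto_vec_nth[OF Xl])
 have b0: "base p A B ~= 0" by (rule base_nonzero[OF p1(1) ok])
 have Rl: "(%k. Rq (P (ro k)) (W (ro k)) (X (ro k))) \<longlonglongrightarrow> lam0 p A B"
 proof -
 have "lam0 p A B = Rq p unit_weights (base p A B)"
 by (rule eigenpair_Rq[OF sym_unit_weights eigenpair_base[OF p1(1) ok]])
 thus ?thesis unfolding Rq_def Ew_def Nn_def
 by (simp only:) (intro tendsto_intros Pl Xi Wl; use p1 Nn_pos[OF b0, of p] in \<open>auto simp: Nn_def\<close>)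
 qed
 have s0: "(SUM i:UNIV. abs (base p A B $ i) powr (p - 2)) ~= 0"
 using sum_rho_pos[OF b0, of p] by (simp add: rho_def)
 have ql: "(%k. sg * qf (P (ro k)) (W (ro k)) (Rq (P (ro k)) (W (ro k)) (X (ro k))) (X (ro k)) (U (ro k)) (U (ro k)))
 \<longlonglongrightarrow> sg * qf p unit_weights (lam0 p A B) (base p A B) v v"
 proof -
 note P2 = tendsto_diff[OF Pl tendsto_const[of 2]]
 have e1: "(%k. abs (X (ro k) $ i) powr (P (ro k) - 2)) \<longlonglongrightarrow> abs (base p A B $ i) powr (p - 2)" for i
 by (rule tendsto_abs_powr[OF P2 Xi p1(2)])
 have e2: "(%k. abs (X (ro k) $ i - X (ro k) $ j) powr (P (ro k) - 2)) \<longlonglongrightarrow> abs (base p A B $ i - base p A B $ j) powr (p - 2)" for i j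
 by (rule tendsto_abs_powr[OF P2 tendsto_diff[OF Xi Xi] p1(2)])
 show ?thesis
 unfolding qf_def hb_def rho_def
 by (rule tendsto_mult[OF tendsto_const], rule tendsto_add, rule tendsto_diff, rule tendsto_divide,
 (intro tendsto_sum tendsto_mult tendsto_diff Wl Ui e2), rule tendsto_const, simp,
 (intro tendsto_sum tendsto_mult Rl Ui e1), (intro tendsto_mult tendsto_divide tendsto_sum Rl Ui e1 s0))
 qed
 have "sg * qf p unit_weights (lam0 p A B) (base p A B) v v <= 0"
 by (rule LIMSEQ_le_const2[OF ql]) (use qU in auto)
 thus False using pos[OF p v(1)] v(2) by force
qed

lemma reduced_class_affine:
 assumes "s ~= 0"
 shows "reduced_class (s *\<^sub>R x + c *\<^sub>R 1) = reduced_class x"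
proof -
 have "EX s' c'. t *\<^sub>R (s *\<^sub>R x + c *\<^sub>R 1) + d *\<^sub>R 1 = s' *\<^sub>R x + c' *\<^sub>R 1 & s' ~= 0" if "t ~= 0" for t d
 by (rule exI[of _ "t * s"], rule exI[of _ "t * c + d"]) (use that assms in \<open>simp add: algebra_simps\<close>)
 moreover have "EX s' c'. t *\<^sub>R x + d *\<^sub>R 1 = s' *\<^sub>R (s *\<^sub>R x + c *\<^sub>R 1) + c' *\<^sub>R 1 & s' ~= 0" if "t ~= 0" for t d
 by (rule exI[of _ "t / s"], rule exI[of _ "d - t / s * c"]) (use that assms in \<open>simp add: algebra_simps\<close>)
 ultimately show ?thesis unfolding reduced_class_def by fast
qed

lemma rep_reduced_class:
 obtains s c where "s ~= 0" "rep (reduced_class x) = s *\<^sub>R x + c *\<^sub>R 1"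
proof -
 have "x : reduced_class x" unfolding reduced_class_def by (rule CollectI, rule exI[of _ 1], rule exI[of _ 0]) simp
 hence "rep (reduced_class x) : reduced_class x" unfolding rep_def by (rule someI)
 thus thesis using that unfolding reduced_class_def by blast
qed

lemma rep_reduced_space:
 assumes "z : reduced_space"
 shows "\<nexists>c. rep z = c *\<^sub>R 1" "reduced_class (rep z) = z"
proof -
 obtain x where x: "\<nexists>c. x = c *\<^sub>R 1" "z = reduced_class x" using assms by (auto simp: reduced_space_def)
 obtain s c where sc: "s ~= 0" "rep z = s *\<^sub>R x + c *\<^sub>R 1" unfolding x(2) by (rule rep_reduced_class)
 show "reduced_class (rep z) = z" using reduced_class_affine[OF sc(1), of x c] sc(2) x(2) by simp
 show "\<nexists>c. rep z = c *\<^sub>R 1"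
 proof
 assume "EX c. rep z = c *\<^sub>R 1"
 then obtain d where d: "s *\<^sub>R x + c *\<^sub>R 1 = d *\<^sub>R 1" using sc(2) by metis
 have "x = ((d - c) / s) *\<^sub>R 1"
 proof (rule vec_eq_iff[THEN iffD2, rule_format])
 fix i show "x $ i = (((d - c) / s) *\<^sub>R 1) $ i"
 using arg_cong[OF d, of "%v. v $ i"] sc(1) by (simp add: field_simps)
 qed
 thus False using x(1) by blast
 qed
qed

lemma chart_nonconst:
 assumes z: "z : reduced_space" and v: "v : chart_domain z"
 shows "\<nexists>c. rep z + v = c *\<^sub>R 1"
proof
 assume "EX c. rep z + v = c *\<^sub>R 1"
 then obtain c where c: "rep z + v = c *\<^sub>R 1" by blast
 hence "v = c *\<^sub>R 1 - rep z" by (simp add: algebra_simps)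
 hence "v \<bullet> v = v \<bullet> (c *\<^sub>R 1) - v \<bullet> rep z" by (metis inner_diff_right)
 hence "v = 0" using v by (simp add: chart_domain_def)
 thus False using c rep_reduced_space(1)[OF z] by auto
qed

lemma subspace_chart_domain: "subspace (chart_domain z)"
 by (auto simp: subspace_def chart_domain_def inner_add_left)

lemma in_chart_eq:
 fixes w :: "'n::{finite,linorder} => 'n => real"
 assumes "p > 1" "sym_weights w"
 shows "in_chart (reduced_quotient p w) z = (%v. Rq p w (centred p (rep z + v)))"
 by (rule ext) (simp add: in_chart_def reduced_quotient_reduced_class quotient_value_eq[OF assms])

lemma in_chart_has_derivative:
 fixes w :: "'n::{finite,linorder} => 'n => real"
 assumes p: "p > 2" and s: "sym_weights w" and z: "z : reduced_space" and v: "v : chart_domain z"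
 shows "(in_chart (reduced_quotient p w) z has_derivative (%d. gR p w (centred p (rep z + v)) \<bullet> d)) (at v within T)"
proof -
 have p1: "p > 1" using p by simp
 have y0: "centred p (rep z + v) ~= 0" by (rule centred_nonzero[OF chart_nonconst[OF z v]])
 have "((%v. rep z + v) has_derivative (%d. 0 + d)) (at v within T)"
 by (intro has_derivative_add has_derivative_const has_derivative_ident)
 from has_derivative_compose[OF this has_derivative_Rq_centred[OF p s y0, of UNIV]]
 show ?thesis unfolding in_chart_eq[OF p1 s] by simp
qed

lemma C2_reduced_quotient:
 fixes w :: "'n::{finite,linorder} => 'n => real"
 assumes p: "p > 2" and s: "sym_weights w" and z: "z : reduced_space"
 shows "C2_on_subspace (chart_domain z) (in_chart (reduced_quotient p w) z)"
 unfolding C2_on_subspace_def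
proof (rule exI[of _ "%v. gR p w (centred p (rep z + v))"],
 rule exI[of _ "%v d. dgR p w (centred p (rep z + v)) (dcen p (centred p (rep z + v)) d)"], intro conjI ballI)
 fix v assume v: "v : chart_domain z"
 show "(in_chart (reduced_quotient p w) z has_derivative (%d. gR p w (centred p (rep z + v)) \<bullet> d)) (at v within chart_domain z)"
 by (rule in_chart_has_derivative[OF p s z v])
 have y0: "centred p (rep z + v) ~= 0" by (rule centred_nonzero[OF chart_nonconst[OF z v]])
 have "((%v. rep z + v) has_derivative (%d. 0 + d)) (at v within chart_domain z)"
 by (intro has_derivative_add has_derivative_const has_derivative_ident)
 from has_derivative_compose[OF this has_derivative_gR_centred[OF p s y0]]
 show "((%v. gR p w (centred p (rep z + v))) has_derivative (%d. dgR p w (centred p (rep z + v)) (dcen p (centred p (rep z + v)) d))) (at v within chart_domain z)"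
 by simp
next
 fix d
 have "continuous_on ((%v. rep z + v) ` chart_domain z) (%x. dgR p w (centred p x) (dcen p (centred p x) d))"
 by (rule continuous_on_dgR_centred[OF p]) (use centred_nonzero[OF chart_nonconst[OF z]] in auto)
 thus "continuous_on (chart_domain z) (%v. dgR p w (centred p (rep z + v)) (dcen p (centred p (rep z + v)) d))"
 by (rule continuous_on_compose2) (auto intro!: continuous_intros)
qed

text \<open>At the centred vector the gradient is orthogonal to 1 by balance and to the vector
  itself by homogeneity. It therefore lies in the chart domain, and a vanishing derivative can be
  tested in the direction of the gradient.\<close>

lemma critical_iff:
 fixes w :: "'n::{finite,linorder} => 'n => real"
 assumes p: "p > 2" and s: "sym_weights w" and z: "z : reduced_space"
 shows "critical_point (reduced_quotient p w) z \<longleftrightarrow> gR p w (centred p (rep z)) = 0"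
proof
 have p1: "p > 1" using p by simp
 have z0: "0 : chart_domain z" by (simp add: chart_domain_def)
 let ?g = "gR p w (centred p (rep z))"
 have D: "(in_chart (reduced_quotient p w) z has_derivative (%d. ?g \<bullet> d)) (at 0 within chart_domain z)"
 using in_chart_has_derivative[OF p s z z0] by simp
 show "critical_point (reduced_quotient p w) z" if "?g = 0"
 using D z that by (simp add: critical_point_def)
 assume "critical_point (reduced_quotient p w) z"
 hence D0: "(in_chart (reduced_quotient p w) z has_derivative (%d. 0)) (at 0 within chart_domain z)"
 by (simp add: critical_point_def)
 have y0: "centred p (rep z) ~= 0" by (rule centred_nonzero[OF rep_reduced_space(1)[OF z]])
 have g1: "?g \<bullet> 1 = 0" by (rule gR_inner_1[OF s sum_Phi_centred[OF p1]])
 have "?g \<bullet> centred p (rep z) = 0" by (rule gR_inner_self[OF s y0])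
 hence "?g \<bullet> rep z = 0" using g1 by (simp add: centred_def inner_add_right)
 hence gC: "?g : chart_domain z" using g1 by (simp add: chart_domain_def)
 have line: "range (%t :: real. t *\<^sub>R ?g) <= chart_domain z"
 using subspace_scale[OF subspace_chart_domain gC] by auto
 have L: "((%t :: real. t *\<^sub>R ?g) has_derivative (%h. h *\<^sub>R ?g)) (at 0)"
 by (intro has_derivative_scaleR_left has_derivative_ident)
 have "((%t. in_chart (reduced_quotient p w) z (t *\<^sub>R ?g)) has_derivative (%h. ?g \<bullet> (h *\<^sub>R ?g))) (at 0)"
 by (rule has_derivative_in_compose[OF L]) (simp add: has_derivative_subset[OF D line])
 moreover have "((%t. in_chart (reduced_quotient p w) z (t *\<^sub>R ?g)) has_derivative (%h. 0)) (at 0)"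
 by (rule has_derivative_in_compose[OF L]) (simp add: has_derivative_subset[OF D0 line])
 ultimately have "(%h. ?g \<bullet> (h *\<^sub>R ?g)) = (%h. 0)" by (rule has_derivative_unique)
 from fun_cong[OF this, of 1] show "?g = 0" by simp
qed

lemma hessian_eq:
 fixes w :: "'n::{finite,linorder} => 'n => real"
 assumes p: "p > 2" and s: "sym_weights w" and z: "z : reduced_space"
 and u: "u : chart_domain z" and v: "v : chart_domain z"
 shows "hessian (reduced_quotient p w) z u v = dgR p w (centred p (rep z)) (dcen p (centred p (rep z)) u) \<bullet> v"
proof -
 let ?F = "in_chart (reduced_quotient p w) z"
 have inner: "deriv (%t. ?F (a *\<^sub>R u + t *\<^sub>R v)) 0 = gR p w (centred p (rep z + a *\<^sub>R u)) \<bullet> v" for a :: real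
 proof -
 have au: "a *\<^sub>R u : chart_domain z" by (rule subspace_scale[OF subspace_chart_domain u])
 have L: "((%t :: real. a *\<^sub>R u + t *\<^sub>R v) has_derivative (%h. 0 + h *\<^sub>R v)) (at 0)"
 by (intro has_derivative_add has_derivative_const has_derivative_scaleR_left has_derivative_ident)
 have "(?F has_derivative (%d. gR p w (centred p (rep z + a *\<^sub>R u)) \<bullet> d)) (at (a *\<^sub>R u + 0 *\<^sub>R v))"
 using in_chart_has_derivative[OF p s z au, of UNIV] by simp
 from has_derivative_compose[OF L this]
 have "((%t. ?F (a *\<^sub>R u + t *\<^sub>R v)) has_derivative (%h. (gR p w (centred p (rep z + a *\<^sub>R u)) \<bullet> v) * h)) (at 0)"
 by (simp add: mult.commute)
 thus ?thesis by (intro DERIV_imp_deriv) (simp add: has_field_derivative_def)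
 qed
 have y0: "centred p (rep z) ~= 0" by (rule centred_nonzero[OF rep_reduced_space(1)[OF z]])
 have L: "((%a :: real. rep z + a *\<^sub>R u) has_derivative (%h. 0 + h *\<^sub>R u)) (at 0)"
 by (intro has_derivative_add has_derivative_const has_derivative_scaleR_left has_derivative_ident)
 have G: "((%x. gR p w (centred p x)) has_derivative (%d. dgR p w (centred p (rep z)) (dcen p (centred p (rep z)) d))) (at (rep z + 0 *\<^sub>R u))"
 using has_derivative_gR_centred[OF p s y0] by simp
 note D = has_derivative_inner_left[OF has_derivative_compose[OF L G], of v]
 have lin: "bounded_linear (%d. dgR p w (centred p (rep z)) (dcen p (centred p (rep z)) d))"
 using has_derivative_gR_centred[OF p s y0] by (rule has_derivative_bounded_linear)
 have "((%a :: real. gR p w (centred p (rep z + a *\<^sub>R u)) \<bullet> v) has_derivative (%h. (dgR p w (centred p (rep z)) (dcen p (centred p (rep z)) u) \<bullet> v) * h)) (at 0)"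
 using D by (simp add: linear_scale[OF bounded_linear.linear[OF lin]] mult.commute)
 thus ?thesis
 unfolding hessian_def inner by (intro DERIV_imp_deriv) (simp add: has_field_derivative_def)
qed

lemma sum_antisym:
 fixes f :: "'n::finite => 'n => real"
 assumes "!!i j. f i j = - f j i"
 shows "(SUM i:UNIV. SUM j:UNIV. f i j * d i) = (SUM i:UNIV. SUM j:UNIV. f i j * (d i - d j)) / 2"
proof -
 have "(SUM i:UNIV. SUM j:UNIV. f i j * d j) = (SUM j:UNIV. SUM i:UNIV. f i j * d j)" by (rule sum.swap)
 also have "... = - (SUM i:UNIV. SUM j:UNIV. f i j * d i)"
 by (subst assms) (simp add: sum_negf)
 finally show ?thesis by (simp add: right_diff_distrib sum_subtractf)
qed

text \<open>At a critical point every term containing \<open>Tv\<close> or the derivative of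
  \<open>Rq\<close> disappears. The remaining linearised residual, paired with \<open>v\<close> and
  symmetrised, is \<open>hb\<close>, and \<open>dcen\<close> adds the shift correction.\<close>

lemma dgR_critical:
 assumes s: "sym_weights w" and T: "Tv p w (Rq p w y) y = 0"
 shows "dgR p w y (dcen p y u) \<bullet> v = p * (p - 1) / Nn p y * qf p w (Rq p w y) y u v"
proof -
 let ?R = "Rq p w y"
 have g: "gR p w y = 0" by (simp add: gR_def T)
 have hb: "dgR p w y e \<bullet> v = p * (p - 1) / Nn p y * hb p w ?R y e v" for e
 proof -
 let ?f = "%i j. w i j * abs (y $ i - y $ j) powr (p - 2) * (e $ i - e $ j)"
 have "?f i j = - ?f j i" for i j
 using s by (simp add: sym_weights_def abs_minus_commute[of "y $ i"] algebra_simps)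
 from sum_antisym[of ?f "%i. v $ i", OF this]
 have 1: "(SUM i:UNIV. SUM j:UNIV. ?f i j * v $ i) = (SUM i:UNIV. SUM j:UNIV. ?f i j * (v $ i - v $ j)) / 2" .
 have "dgR p w y e \<bullet> v = (SUM i:UNIV. p / Nn p y * ((SUM j:UNIV. w i j * ((p - 1) * rho p (\<chi> k. y $ i - y $ k) j * (e $ i - e $ j)))
 - ?R * ((p - 1) * rho p y i * e $ i)) * v $ i)"
 by (simp add: inner_vec_def dgR_def T g)
 also have "... = (SUM i:UNIV. p * (p - 1) / Nn p y * ((SUM j:UNIV. ?f i j * v $ i) - ?R * (abs (y $ i) powr (p - 2) * e $ i * v $ i)))"
 proof (intro sum.cong refl)
 fix i
 have F: "(SUM j:UNIV. w i j * ((p - 1) * rho p (\<chi> k. y $ i - y $ k) j * (e $ i - e $ j))) = (p - 1) * (SUM j:UNIV. ?f i j)"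
 unfolding sum_distrib_left by (intro sum.cong refl) (simp add: rho_def mult_ac)
 have alg: "c * ((p - 1) * F - R * ((p - 1) * r * e)) * v = c * (p - 1) * (F * v - R * (r * e * v))" for c F R r e v :: real
 by (simp add: algebra_simps)
 show "p / Nn p y * ((SUM j:UNIV. w i j * ((p - 1) * rho p (\<chi> k. y $ i - y $ k) j * (e $ i - e $ j))) - ?R * ((p - 1) * rho p y i * e $ i)) * v $ i
 = p * (p - 1) / Nn p y * ((SUM j:UNIV. ?f i j * v $ i) - ?R * (abs (y $ i) powr (p - 2) * e $ i * v $ i))"
 unfolding F sum_distrib_right[symmetric] alg by (simp add: rho_def)
 qed
 also have "... = p * (p - 1) / Nn p y * ((SUM i:UNIV. SUM j:UNIV. ?f i j * v $ i) - ?R * (SUM i:UNIV. abs (y $ i) powr (p - 2) * e $ i * v $ i))"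
 unfolding sum_distrib_left[symmetric] sum_subtractf ..
 finally show ?thesis unfolding 1 hb_def by (simp add: mult.assoc)
 qed
 let ?c = "(SUM i:UNIV. rho p y i * u $ i) / (SUM i:UNIV. rho p y i)"
 have "hb p w ?R y (dcen p y u) v = hb p w ?R y u v + ?R * ?c * (SUM i:UNIV. rho p y i * v $ i)"
 proof -
 have "hb p w ?R y (u - c *\<^sub>R 1) v = hb p w ?R y u v + ?R * c * (SUM i:UNIV. rho p y i * v $ i)" for c
 by (simp add: hb_def rho_def algebra_simps sum_subtractf sum_distrib_left)
 thus ?thesis unfolding dcen_def .
 qed
 thus ?thesis unfolding hb by (simp add: qf_def)
qed

lemma dim_span_rep:
 assumes "z : reduced_space"
 shows "dim (span {rep z, 1}) = 2"
proof -
 have "rep z ~: span {1}" using rep_reduced_space(1)[OF assms] by (auto simp: span_singleton)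
 moreover have "independent {1 :: real ^ 'a}" by (simp add: dependent_single)
 ultimately have "independent {rep z, 1}" by (rule independent_insertI)
 moreover have "rep z ~= 1" using \<open>rep z ~: span {1}\<close> span_base by blast
 ultimately show ?thesis by (simp add: dim_eq_card_independent)
qed

text \<open>The form has null vectors \<open>rep z\<close> and 1, and the chart domain is the
  orthogonal complement of their span, so \<open>indefinite_form\<close> applies with a null space
  of dimension 2.\<close>

lemma morse_at:
 fixes w :: "'n::{finite,linorder} => 'n => real"
 assumes p: "p > 2" and s: "sym_weights w" and z: "z : reduced_space"
 and e: "eigenpair p w lam (centred p (rep z))"
 and W: "subspace W" "!!v. v : W ==> v ~= 0 ==> qf p w lam (centred p (rep z)) v v < 0"
 and Z: "subspace Z" "!!v. v : Z ==> v ~= 0 ==> 0 < qf p w lam (centred p (rep z)) v v"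
 and d: "CARD('n) <= dim W + dim Z + 2"
 shows "!!u. u : chart_domain z ==> (ALL v:chart_domain z. hessian (reduced_quotient p w) z u v = 0) ==> u = 0"
 and "morse_index (reduced_quotient p w) z = dim W" "dim W + dim Z + 2 = CARD('n)"
proof -
 have p1: "p > 1" using p by simp
 let ?y = "centred p (rep z)"
 have y0: "?y ~= 0" using e by (simp add: eigenpair_iff_Tv)
 have lam: "lam = Rq p w ?y" by (rule eigenpair_Rq[OF s e])
 have T: "Tv p w (Rq p w ?y) ?y = 0" using e by (simp add: eigenpair_iff_Tv lam)
 define k where "k = p * (p - 1) / Nn p ?y"
 have k: "k > 0" unfolding k_def using Nn_pos[OF y0, of p] p by simp
 have H: "hessian (reduced_quotient p w) z u v = k * qf p w lam ?y u v" if "u : chart_domain z" "v : chart_domain z" for u v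
 unfolding hessian_eq[OF p s z that] dgR_critical[OF s T] lam k_def ..
 have null: "qf p w lam ?y u v = 0" if "u : span {rep z, 1}" for u v
 proof -
 have "EX a. u - a *\<^sub>R rep z : span {1}" using that by (simp add: span_insert)
 then obtain a b where "u - a *\<^sub>R rep z = b *\<^sub>R 1" by (auto simp: span_singleton)
 hence u: "u = a *\<^sub>R rep z + b *\<^sub>R 1" by (simp add: algebra_simps)
 have q1: "qf p w lam ?y 1 v = 0" by (rule qf_one[OF y0])
 have "qf p w lam ?y ?y v = 0" by (rule qf_self[OF s e sum_Phi_centred[OF p1]])
 hence "qf p w lam ?y (rep z) v + mshift p (rep z) * qf p w lam ?y 1 v = 0"
 unfolding centred_def[of p "rep z", THEN arg_cong, of "%x. qf p w lam ?y x v"] qf_add qf_scaleR_arg .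
 thus ?thesis unfolding u qf_add qf_scaleR_arg q1 by simp
 qed
 interpret indefinite_form "qf p w lam ?y" "span {rep z, 1}" W Z
 by unfold_locales (use qf_add qf_sym W Z null d dim_span_rep[OF z] in auto)
 have C: "chart_domain z = C"
 proof -
 have "v \<bullet> k = 0" if "v \<bullet> rep z = 0" "v \<bullet> 1 = 0" "k : span {rep z, 1}" for v k
 proof -
 have "EX a. k - a *\<^sub>R rep z : span {1}" using that(3) by (simp add: span_insert)
 then obtain a b where "k - a *\<^sub>R rep z = b *\<^sub>R 1" by (auto simp: span_singleton)
 hence "k = a *\<^sub>R rep z + b *\<^sub>R 1" by (simp add: algebra_simps)
 thus ?thesis using that(1,2) by (simp add: inner_add_right)
 qed
 thus ?thesis by (auto simp: chart_domain_def C_def intro: span_base)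
 qed
 show "u = 0" if u: "u : chart_domain z" and zero: "ALL v:chart_domain z. hessian (reduced_quotient p w) z u v = 0" for u
 proof (rule nondegenerate)
 show "u : C" using u C by simp
 show "qf p w lam ?y u v = 0" if "v : C" for v
 proof -
 have v: "v : chart_domain z" using that C by simp
 show ?thesis using zero v H[OF u v] k by simp
 qed
 qed
 have "(ALL v:S - {0}. hessian (reduced_quotient p w) z v v < 0) \<longleftrightarrow> (ALL v:S - {0}. qf p w lam ?y v v < 0)" if "S <= chart_domain z" for S
 proof (rule ball_cong[OF refl])
 fix v assume "v : S - {0}"
 hence "v : chart_domain z" using that by blast
 from H[OF this this] show "hessian (reduced_quotient p w) z v v < 0 \<longleftrightarrow> qf p w lam ?y v v < 0"
 using k by (simp add: mult_less_0_iff)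
 qed
 hence "{dim S | S. subspace S & S <= chart_domain z & (ALL v:S - {0}. hessian (reduced_quotient p w) z v v < 0)}
 = {dim S | S. subspace S & S <= C & (ALL v:S - {0}. qf p w lam ?y v v < 0)}"
 unfolding C by blast
 thus "morse_index (reduced_quotient p w) z = dim W" unfolding morse_index_def using index by simp
 show "dim W + dim Z + 2 = CARD('n)" using dims_eq dim_span_rep[OF z] by simp
qed

lemma eigen_system_scale:
 assumes "M ~= 0" "eigen_system p w dl X"
 shows "eigen_system p (%i j. M * w i j) dl X"
proof -
 note S = assms(2)[unfolded eigen_system_def]
 have E: "eigenpair p (%i j. M * w i j) lam x \<longleftrightarrow> eigenpair p w (lam / M) x" for lam x
 using eigenpair_weight_scale[OF assms(1), of p w "lam / M" x] assms(1) by simp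
 show ?thesis
 unfolding eigen_system_def
 proof (intro conjI)
 show "ALL (A, B):half_pairs. (EX lam. eigenpair p (%i j. M * w i j) lam (X (A, B))) & norm (X (A, B) - base p A B) <= dl & (\<nexists>c. X (A, B) = c *\<^sub>R 1)"
 proof (clarify)
 fix A B :: "'a set" assume h: "(A, B) : half_pairs"
 note f = S[THEN conjunct1, THEN bspec, OF h, unfolded prod.case]
 obtain lam where "eigenpair p w lam (X (A, B))" using f[THEN conjunct1] by (elim exE) (rule that)
 hence "eigenpair p (%i j. M * w i j) (M * lam) (X (A, B))" using assms(1) by (simp add: E)
 hence "EX lam. eigenpair p (%i j. M * w i j) lam (X (A, B))" by (rule exI)
 thus "(EX lam. eigenpair p (%i j. M * w i j) lam (X (A, B))) & norm (X (A, B) - base p A B) <= dl & (\<nexists>c. X (A, B) = c *\<^sub>R 1)"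
 using f[THEN conjunct2] by (rule conjI)
 qed
 show "ALL lam x. eigenpair p (%i j. M * w i j) lam x --> (\<nexists>c. x = c *\<^sub>R 1) --> (EX h:half_pairs. EX s. s ~= 0 & x = s *\<^sub>R X h)"
 unfolding E by (intro allI, rule S[THEN conjunct2, THEN conjunct1, THEN spec, THEN spec])
 show "ALL h:half_pairs. ALL h':half_pairs. ALL s. X h = s *\<^sub>R X h' --> h = h'"
 by (rule S[THEN conjunct2, THEN conjunct2])
 qed
qed

text \<open>The representative of a critical class may differ from \<open>X h\<close> by a factor
  and a shift; centring removes the shift because \<open>Phi\<close> sums to 0 over the entries of
  \<open>X h\<close>. The index at the pair \<open>(A, B)\<close> is the dimension of
  \<open>Wsp A B\<close>, and the constants supply the one additional eigenline.\<close>

lemma morse_of_eigen_system: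
 fixes w :: "'n::{finite,linorder} => 'n => real"
 assumes p: "p > 2" and s: "sym_weights w" and wp: "!!i j. w i j > 0" and X: "eigen_system p w dl X"
 and neg: "!!A B v. (A, B) : half_pairs ==> v : Wsp A B ==> v ~= 0 ==> qf p w (Rq p w (X (A, B))) (X (A, B)) v v < 0"
 and pos: "!!A B v. (A, B) : half_pairs ==> v : Zsp A B ==> v ~= 0 ==> 0 < qf p w (Rq p w (X (A, B))) (X (A, B)) v v"
 shows "morse_function (reduced_quotient p w)"
 and "morse_polynomial (reduced_quotient p w) = (SUM (A, B):half_pairs. monom 1 (card A + card (B :: 'n set) - 2))"
 and "finite (eigenlines p w)" "card (eigenlines p w) = Suc (card (half_pairs :: ('n set \<times> 'n set) set))"
proof -
 let ?f = "reduced_quotient p w"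
 let ?H = "half_pairs :: ('n set \<times> 'n set) set"
 have p1: "p > 1" using p by simp
 have X12: "(EX lam. eigenpair p w lam (X h)) & (\<nexists>c. X h = c *\<^sub>R 1)" if "h : ?H" for h
 using X[unfolded eigen_system_def, THEN conjunct1, THEN bspec, OF that] by (cases h; simp only: prod.case; blast)
 hence X1: "EX lam. eigenpair p w lam (X h)" and X2: "\<nexists>c. X h = c *\<^sub>R 1" if "h : ?H" for h
 using that by blast+
 have X3: "EX h:?H. EX s. s ~= 0 & x = s *\<^sub>R X h" if "eigenpair p w lam x" "\<nexists>c. x = c *\<^sub>R 1" for lam x
 using X[unfolded eigen_system_def, THEN conjunct2, THEN conjunct1, THEN spec, THEN spec, THEN mp, OF that(1), THEN mp, OF that(2)] .
 have X4: "h = h'" if "h : ?H" "h' : ?H" "X h = s *\<^sub>R X h'" for h h' s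
 using X[unfolded eigen_system_def, THEN conjunct2, THEN conjunct2, THEN bspec, OF that(1), THEN bspec, OF that(2), THEN spec, THEN mp, OF that(3)] .
 have SX: "(SUM i:UNIV. Phi p (X h $ i)) = 0" if "h : ?H" for h
 using eigenpair_sum_Phi(2)[OF s _ _ _ X2[OF that]] X1[OF that] wp less_imp_le by metis
 have zX: "reduced_class (X h) : reduced_space" if "h : ?H" for h using X2[OF that] by (auto simp: reduced_space_def)
 have cen: "EX s. s ~= 0 & centred p (rep (reduced_class (X h))) = s *\<^sub>R X h" if "h : ?H" for h
 proof -
 obtain s c where sc: "s ~= 0" "rep (reduced_class (X h)) = s *\<^sub>R X h + c *\<^sub>R 1" by (rule rep_reduced_class)
 have "mshift p (rep (reduced_class (X h))) = - c"
 by (rule mshift_eqI[OF p1]) (simp add: sc(2) Phi_mult sum_distrib_left[symmetric] SX[OF that])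
 hence "centred p (rep (reduced_class (X h))) = s *\<^sub>R X h" by (simp add: centred_def sc(2))
 thus ?thesis using sc(1) by blast
 qed
 have ecen: "EX lam. eigenpair p w lam (centred p (rep (reduced_class (X h))))" if h: "h : ?H" for h
 using cen[OF h] X1[OF h] by (metis eigenpair_scale)
 have crit: "critical_point ?f z \<longleftrightarrow> (EX h:?H. z = reduced_class (X h))" for z
 proof
 assume c: "critical_point ?f z"
 hence z: "z : reduced_space" by (simp add: critical_point_def)
 have g: "gR p w (centred p (rep z)) = 0" using c critical_iff[OF p s z] by simp
 have nc: "\<nexists>c. centred p (rep z) = c *\<^sub>R 1"
 proof
 assume "EX c. centred p (rep z) = c *\<^sub>R 1"
 then obtain c where "rep z + mshift p (rep z) *\<^sub>R 1 = c *\<^sub>R 1" by (auto simp: centred_def)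
 hence "rep z = (c - mshift p (rep z)) *\<^sub>R 1" by (simp add: algebra_simps)
 thus False using rep_reduced_space(1)[OF z] by blast
 qed
 have "eigenpair p w (Rq p w (centred p (rep z))) (centred p (rep z))"
 by (rule gR_eq_0_imp_eigenpair[OF p1 centred_nonzero[OF rep_reduced_space(1)[OF z]] g])
 from X3[OF this nc] obtain h t where h: "h : ?H" "t ~= 0" "centred p (rep z) = t *\<^sub>R X h" by blast
 hence "rep z = t *\<^sub>R X h + (- mshift p (rep z)) *\<^sub>R 1" by (simp add: centred_def algebra_simps)
 hence "z = reduced_class (X h)" using rep_reduced_space(2)[OF z] reduced_class_affine[OF h(2)] by metis
 thus "EX h:?H. z = reduced_class (X h)" using h(1) by blast
 next
 assume "EX h:?H. z = reduced_class (X h)"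
 then obtain h where h: "h : ?H" "z = reduced_class (X h)" by blast
 obtain lam where lam: "eigenpair p w lam (centred p (rep z))" using ecen[OF h(1)] h(2) by blast
 hence "lam = Rq p w (centred p (rep z))" by (rule eigenpair_Rq[OF s])
 hence "gR p w (centred p (rep z)) = 0" using lam by (simp add: gR_def eigenpair_iff_Tv)
 thus "critical_point ?f z" using critical_iff[OF p s] zX[OF h(1)] h(2) by blast
 qed
 have inj: "inj_on (%h. reduced_class (X h)) ?H"
 proof (rule inj_onI)
 fix h h' assume h: "h : ?H" "h' : ?H" and eq: "reduced_class (X h) = reduced_class (X h')"
 obtain a where a: "a ~= 0" "centred p (rep (reduced_class (X h))) = a *\<^sub>R X h" using cen[OF h(1)] by blast
 obtain b where b: "b ~= 0" "centred p (rep (reduced_class (X h'))) = b *\<^sub>R X h'" using cen[OF h(2)] by blast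
 have "a *\<^sub>R X h = b *\<^sub>R X h'" using a b eq by simp
 hence "X h = (b / a) *\<^sub>R X h'" using a(1) by (metis divide_inverse_commute scaleR_scaleR left_inverse scaleR_one)
 thus "h = h'" by (rule X4[OF h])
 qed
 have at: "(ALL u:chart_domain z. (ALL v:chart_domain z. hessian ?f z u v = 0) --> u = 0) & morse_index ?f z = card A + card B - 2"
 if h: "(A, B) : ?H" and z: "z = reduced_class (X (A, B))" for A B z
 proof -
 obtain t where t: "t ~= 0" "centred p (rep z) = t *\<^sub>R X (A, B)" using cen[OF h] z by blast
 obtain lam where lam: "eigenpair p w lam (centred p (rep z))" using ecen[OF h] z by blast
 have lamR: "lam = Rq p w (X (A, B))" using eigenpair_Rq[OF s lam] Rq_scale[OF t(1)] t(2) by metis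
 have ok: "A Int B = {}" using h pair_okD(3) by (auto simp: half_pairs_def)
 have zs: "z : reduced_space" using zX[OF h] z by simp
 have tp: "abs t powr (p - 2) > 0" using t(1) by simp
 have n: "qf p w lam (centred p (rep z)) v v < 0" if "v : Wsp A B" "v ~= 0" for v
 unfolding t(2) qf_scale[OF t(1)] lamR by (rule mult_pos_neg[OF tp neg[OF h that]])
 have q: "0 < qf p w lam (centred p (rep z)) v v" if "v : Zsp A B" "v ~= 0" for v
 unfolding t(2) qf_scale[OF t(1)] lamR by (rule mult_pos_pos[OF tp pos[OF h that]])
 have d: "CARD('n) <= dim (Wsp A B) + dim (Zsp A B) + 2"
 using dim_Wsp_ge[OF ok] dim_Zsp_ge[OF ok] by linarith
 note M = morse_at[OF p s zs lam subspace_Wsp n subspace_Zsp q d]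
 have "dim (Wsp A B) = card A + card B - 2" using M(3) dim_Wsp_ge[OF ok] dim_Zsp_ge[OF ok] by linarith
 thus ?thesis using M(1,2) by simp
 qed
 show "morse_function ?f"
 unfolding morse_function_def
 proof (intro conjI ballI allI impI)
 fix z :: "(real ^ 'n::{finite,linorder}) set" assume "z : reduced_space"
 thus "C2_on_subspace (chart_domain z) (in_chart ?f z)" by (rule C2_reduced_quotient[OF p s])
 next
 fix z u assume c: "critical_point ?f z" and u: "u : chart_domain z" "ALL v:chart_domain z. hessian ?f z u v = 0"
 obtain A B where "(A, B) : ?H" "z = reduced_class (X (A, B))" using c crit by force
 thus "u = 0" using at u by blast
 qed
 have cset: "{z. critical_point ?f z} = (%h. reduced_class (X h)) ` ?H" using crit by blast
 show "morse_polynomial ?f = (SUM (A, B):half_pairs. monom 1 (card A + card (B :: 'n set) - 2))"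
 unfolding morse_polynomial_def cset sum.reindex[OF inj] by (intro sum.cong refl) (auto simp: at)
 have el: "eigenlines p w = insert (line_class 1) ((%h. line_class (X h)) ` ?H)"
 proof (intro set_eqI iffI)
 fix L assume "L : eigenlines p w"
 then obtain x lam where x: "L = line_class x" "eigenpair p w lam x" by (auto simp: eigenlines_def)
 show "L : insert (line_class 1) ((%h. line_class (X h)) ` ?H)"
 proof (cases "EX c. x = c *\<^sub>R 1")
 case True
 then obtain c where c: "x = c *\<^sub>R 1" by blast
 have "c ~= 0" using x(2) c by (auto simp: eigenpair_iff_Tv)
 thus ?thesis using x(1) c line_class_scale by blast
 next
 case False
 from X3[OF x(2) this] show ?thesis using x(1) line_class_scale by blast
 qed
 next
 fix L assume "L : insert (line_class 1) ((%h. line_class (X h)) ` ?H)"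
 moreover have "eigenpair p w 0 1" by (simp add: eigenpair_def)
 ultimately show "L : eigenlines p w" using X1 by (auto simp: eigenlines_def)
 qed
 show "finite (eigenlines p w)" unfolding el by simp
 have inj2: "inj_on (%h. line_class (X h)) ?H"
 proof (rule inj_onI)
 fix h h' assume h: "h : ?H" "h' : ?H" and eq: "line_class (X h) = line_class (X h')"
 obtain c where "X h = c *\<^sub>R X h'" using line_class_eqD[OF eq] by blast
 thus "h = h'" by (rule X4[OF h])
 qed
 have "line_class 1 ~: (%h. line_class (X h)) ` ?H"
 proof
 assume "line_class 1 : (%h. line_class (X h)) ` ?H"
 then obtain h where h: "h : ?H" "line_class (X h) = line_class 1" by auto
 obtain c where "X h = c *\<^sub>R 1" using line_class_eqD[OF h(2)] by blast
 thus False using X2[OF h(1)] by blast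
 qed
 thus "card (eigenlines p w) = Suc (card ?H)" unfolding el by (simp add: card_image[OF inj2])
qed

section \<open>Counting the pairs: \<open>R_count\<close> and \<open>M_plus\<close>\<close>

lemma sum_power_card:
 fixes c :: "'a::comm_ring_1"
 shows "(SUM X:(UNIV :: 'n::finite set set). c ^ card X) = (1 + c) ^ CARD('n)"
 using prod_add[of "UNIV :: 'n set" "%_. c" "%_. 1"] by (simp add: add.commute)

text \<open>A disjoint pair is encoded by its union and the subset of the union that forms
  \<open>A\<close>, which turns \<open>t\<close> into \<open>2 * t\<close>.\<close>

lemma sum_disjoint_pairs:
 fixes t :: "'a::comm_ring_1"
 shows "(SUM (A, B):{(A :: 'n::finite set, B). A Int B = {}}. t ^ (card A + card B)) = (1 + 2 * t) ^ CARD('n)"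
proof -
 have "(SUM (A, B):{(A :: 'n set, B). A Int B = {}}. t ^ (card A + card B)) = (SUM (U, A):Sigma (UNIV :: 'n set set) Pow. t ^ card U)"
 by (rule sum.reindex_bij_witness[where i = "%(U :: 'n set, A). (A, U - A)" and j = "%(A :: 'n set, B). (A Un B, A)"])
 (auto simp: card_Un_disjoint)
 also have "... = (SUM U:(UNIV :: 'n set set). SUM A:Pow U. t ^ card U)" by (subst sum.Sigma) auto
 also have "... = (SUM U:(UNIV :: 'n set set). (2 * t) ^ card U)"
 by (intro sum.cong refl) (simp add: card_Pow power_mult_distrib)
 finally show ?thesis unfolding sum_power_card .
qed

lemma sum_pair_ok:
 fixes t :: "'a::comm_ring_1"
 shows "(SUM (A, B):{(A :: 'n::finite set, B). pair_ok A B}. t ^ (card A + card B)) = (1 + 2 * t) ^ CARD('n) - 2 * (1 + t) ^ CARD('n) + 1"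
proof -
 let ?f = "%(A :: 'n set, B :: 'n set). t ^ (card A + card B)"
 let ?O = "{(A :: 'n set, B). pair_ok A B}" and ?E = "(%B. ({} :: 'n set, B :: 'n set)) ` UNIV" and ?F = "(%A. (A :: 'n set, {} :: 'n set)) ` (UNIV - {{}})"
 have D: "{(A :: 'n set, B). A Int B = {}} = ?O Un (?E Un ?F)" by (auto simp: pair_ok_def)
 have "sum ?f {(A :: 'n set, B). A Int B = {}} = sum ?f ?O + sum ?f (?E Un ?F)"
 unfolding D by (rule sum.union_disjoint) (auto simp: pair_ok_def)
 moreover have "sum ?f (?E Un ?F) = sum ?f ?E + sum ?f ?F" by (rule sum.union_disjoint) auto
 moreover have "sum ?f ?E = (1 + t) ^ CARD('n)"
 by (subst sum.reindex) (auto simp: inj_on_def sum_power_card)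
 moreover have "sum ?f ?F = (1 + t) ^ CARD('n) - 1"
 proof -
 have "sum ?f ?F = (SUM A:UNIV - {{}}. t ^ card (A :: 'n set))"
 by (subst sum.reindex) (auto simp: inj_on_def)
 also have "... = (SUM A:UNIV. t ^ card (A :: 'n set)) - 1" by (subst sum_diff) auto
 finally show ?thesis unfolding sum_power_card .
 qed
 ultimately show ?thesis using sum_disjoint_pairs[of t, where 'n = 'n] by (simp add: algebra_simps)
qed

text \<open>Stated over a general ring: \<open>t = 1\<close> counts the pairs, and
  \<open>t = monom 1 1\<close> gives the Morse polynomial.\<close>

lemma sum_half_pairs:
 fixes t :: "'a::comm_ring_1"
 shows "2 * (SUM (A, B):half_pairs. t ^ (card A + card (B :: 'n::{finite,linorder} set))) = (1 + 2 * t) ^ CARD('n) - 2 * (1 + t) ^ CARD('n) + 1"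
proof -
 let ?f = "%(A :: 'n set, B :: 'n set). t ^ (card A + card B)"
 let ?O = "{(A :: 'n set, B). pair_ok A B}"
 have sub: "pair_ok A B" if "(A, B) : half_pairs" for A B :: "'n set" using that by (simp add: half_pairs_def)
 have O: "?O = half_pairs Un prod.swap ` half_pairs"
 proof (intro set_eqI iffI)
 fix h :: "'n set \<times> 'n set" assume h: "h : ?O"
 obtain A B where AB: "h = (A, B)" by force
 hence "pair_ok A B" using h by simp
 from half_pairs_cases[OF this] show "h : half_pairs Un prod.swap ` half_pairs"
 unfolding AB by (auto intro: image_eqI[of _ prod.swap "(B, A)"])
 next
 fix h :: "'n set \<times> 'n set" assume h: "h : half_pairs Un prod.swap ` half_pairs"
 obtain A B where AB: "h = (A, B)" by force
 hence "(A, B) : half_pairs | (B, A) : half_pairs" using h by auto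
 thus "h : ?O" using sub[of A B] pair_ok_swap[OF sub[of B A]] AB by auto
 qed
 have disj: "half_pairs Int prod.swap ` (half_pairs :: ('n set \<times> 'n set) set) = {}"
 using half_pairs_cases sub by fastforce
 have "sum ?f ?O = sum ?f half_pairs + sum ?f (prod.swap ` half_pairs)"
 unfolding O by (rule sum.union_disjoint) (use disj in auto)
 also have "sum ?f (prod.swap ` half_pairs) = sum ?f half_pairs"
 by (subst sum.reindex) (auto simp: add.commute case_prod_beta)
 finally show ?thesis using sum_pair_ok[of t, where 'n = 'n] by simp
qed

lemma card_half_pairs: "real (card (half_pairs :: ('n::{finite,linorder} set \<times> 'n set) set)) = R_count CARD('n) - 1"
 using sum_half_pairs[of "1 :: real", where 'n = 'n] by (simp add: R_count_def case_prod_beta field_simps)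

lemma sum_half_pairs_monom:
 "(SUM (A, B):half_pairs. monom 1 (card A + card (B :: 'n::{finite,linorder} set) - 2)) = M_plus CARD('n)"
proof -
 let ?t = "monom 1 1 :: real poly"
 have "monom 2 2 * (SUM (A, B):half_pairs. monom 1 (card A + card (B :: 'n set) - 2)) = 2 * (SUM (A, B):half_pairs. ?t ^ (card A + card (B :: 'n set)))"
 unfolding sum_distrib_left
 proof (intro sum.cong refl, clarify)
 fix A B :: "'n set" assume "(A, B) : half_pairs"
 hence "pair_ok A B" by (simp add: half_pairs_def)
 note pair_okD[OF this]
 hence "2 + (card A + card B - 2) = card A + card B" by linarith
 hence "monom 2 2 * monom (1::real) (card A + card B - 2) = monom 2 (card A + card B)"
 by (simp add: mult_monom)
 also have "... = 2 * ?t ^ (card A + card B)"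
 by (simp add: monom_power numeral_poly smult_monom)
 finally show "monom 2 2 * monom (1::real) (card A + card B - 2) = 2 * ?t ^ (card A + card B)" .
 qed
 also have "... = (1 + 2 * ?t) ^ CARD('n) - 2 * (1 + ?t) ^ CARD('n) + 1" by (rule sum_half_pairs)
 also have "1 + 2 * ?t = [:1, 2:]" by (simp add: monom_altdef numeral_poly one_pCons)
 also have "1 + ?t = [:1, 1:]" by (simp add: monom_altdef one_pCons)
 also have "[:1, 2:] ^ CARD('n) - 2 * [:1, 1:] ^ CARD('n) + 1 = monom 2 2 * M_plus CARD('n)" by (simp only: M_plus_exact)
 finally show ?thesis by (simp add: monom_eq_0_iff)
qed

section \<open>Analytic dependence of the base eigenvalues on the exponent\<close>

lemma holomorphic_Re_DERIV:
 assumes "H holomorphic_on S" "open S" "complex_of_real t : S"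
 shows "((%t. Re (H (of_real t))) has_real_derivative Re (deriv H (of_real t))) (at t)"
proof -
 have "(H has_field_derivative deriv H (of_real t)) (at (of_real t))" by (rule holomorphic_derivI[OF assms])
 hence "((%t. H (of_real t)) has_vector_derivative deriv H (of_real t)) (at t)"
 by (rule has_vector_derivative_real_field)
 from bounded_linear.has_vector_derivative[OF bounded_linear_Re this]
 show ?thesis by (simp add: has_real_derivative_iff_has_vector_derivative)
qed

text \<open>A nonconstant real-analytic function is dominated by its derivative near a zero:
  factor out the zero.\<close>

lemma holomorphic_zero_growth:
 assumes H: "H holomorphic_on S" "open S" "connected S" and nc: "~ H constant_on S"
 and re: "!!t. complex_of_real t : S ==> Im (H (of_real t)) = 0"
 and t0: "complex_of_real t0 : S" "H (of_real t0) = 0" and M: "M >= 0"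
 shows "EX ro>0. ALL t. abs (t - t0) < ro --> M * abs (Re (H (of_real t))) <= abs (Re (deriv H (of_real t)))"
proof -
 obtain g r n where g: "0 < n" "0 < r" "ball (of_real t0) r <= S" "g holomorphic_on ball (of_real t0) r"
 "!!w. w : ball (of_real t0) r ==> H w = (w - of_real t0) ^ n * g w" "!!w. w : ball (of_real t0) r ==> g w ~= 0"
 using holomorphic_factor_zero_nonconstant[OF H t0 nc] by metis
 let ?B = "ball (complex_of_real t0) r"
 have inB: "complex_of_real t : ?B \<longleftrightarrow> abs (t - t0) < r" for t
 unfolding mem_ball dist_of_real dist_real_def by (simp add: abs_minus_commute)
 have c0: "complex_of_real t0 : ?B" using g(2) by simp
 have Hval: "Re (H (of_real t)) = (t - t0) ^ n * Re (g (of_real t))" "Im (H (of_real t)) = (t - t0) ^ n * Im (g (of_real t))" if "abs (t - t0) < r" for t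
 proof -
 have "H (of_real t) = of_real ((t - t0) ^ n) * g (of_real t)" using g(5)[of "of_real t"] inB that by simp
 thus "Re (H (of_real t)) = (t - t0) ^ n * Re (g (of_real t))" "Im (H (of_real t)) = (t - t0) ^ n * Im (g (of_real t))" by simp_all
 qed
 have Hder: "Re (deriv H (of_real t)) = (t - t0) ^ (n - 1) * (real n * Re (g (of_real t)) + (t - t0) * Re (deriv g (of_real t)))" if t: "abs (t - t0) < r" for t
 proof -
 let ?z = "complex_of_real t"
 have z: "?z : ?B" using inB t by simp
 have "(g has_field_derivative deriv g ?z) (at ?z)" by (rule holomorphic_derivI[OF g(4) open_ball z])
 hence "((%w. (w - of_real t0) ^ n * g w) has_field_derivative
 (of_nat n * (1 - 0) * (?z - of_real t0) ^ (n - 1)) * g ?z + deriv g ?z * (?z - of_real t0) ^ n) (at ?z)"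
 by (auto intro!: derivative_eq_intros)
 hence "(H has_field_derivative (of_nat n * (1 - 0) * (?z - of_real t0) ^ (n - 1)) * g ?z + deriv g ?z * (?z - of_real t0) ^ n) (at ?z)"
 by (rule has_field_derivative_transform_within_open[OF _ open_ball z]) (simp add: g(5))
 hence "deriv H ?z = of_nat n * (?z - of_real t0) ^ (n - 1) * g ?z + deriv g ?z * (?z - of_real t0) ^ n"
 by (simp add: DERIV_imp_deriv)
 also have "... = of_real ((t - t0) ^ (n - 1)) * (of_nat n * g ?z + of_real (t - t0) * deriv g ?z)"
 using g(1) by (cases n) (simp_all add: algebra_simps)
 finally show ?thesis by simp
 qed
 have "isCont g (complex_of_real t0)" "isCont (deriv g) (complex_of_real t0)"
 using holomorphic_on_imp_continuous_on[OF g(4)] holomorphic_on_imp_continuous_on[OF holomorphic_deriv[OF g(4) open_ball]] c0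
 by (simp_all add: continuous_on_eq_continuous_at)
 hence cg: "isCont (%t. g (complex_of_real t)) t0" and cg': "isCont (%t. deriv g (complex_of_real t)) t0"
 by (auto intro!: isCont_o2[where f = complex_of_real] continuous_intros)
 have evr: "\<forall>\<^sub>F t in at t0. abs (t - t0) < r" unfolding eventually_at using g(2) by (intro exI[of _ r]) (auto simp: dist_real_def)
 have Im0: "Im (g (of_real t0)) = 0"
 proof (rule tendsto_unique[of "at t0"])
 show "((%t. Im (g (of_real t))) \<longlongrightarrow> Im (g (of_real t0))) (at t0)"
 using cg unfolding isCont_def by (rule tendsto_Im)
 have "\<forall>\<^sub>F t in at t0. t ~= t0" by (simp add: eventually_at_filter)
 hence "\<forall>\<^sub>F t in at t0. Im (g (of_real t)) = 0"
 using evr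
 proof eventually_elim
 case (elim t)
 have "complex_of_real t : S" using g(3) inB elim by blast
 hence "(t - t0) ^ n * Im (g (of_real t)) = 0" using re Hval(2) elim by metis
 thus ?case using elim by simp
 qed
 thus "((%t. Im (g (of_real t))) \<longlongrightarrow> 0) (at t0)" by (rule tendsto_eventually)
 qed simp
 define c where "c = abs (Re (g (of_real t0))) / 2"
 have c: "c > 0" using g(6)[OF c0] Im0 by (simp add: c_def complex_eq_iff)
 define C where "C = abs (Re (deriv g (of_real t0))) + 1"
 have C: "C > 0" by (simp add: C_def)
 have "((%t. abs (Re (g (of_real t)))) \<longlongrightarrow> abs (Re (g (of_real t0)))) (nhds t0)"
 using cg tendsto_at_iff_tendsto_nhds[of "%t. g (complex_of_real t)" t0] by (intro tendsto_rabs tendsto_Re) (simp add: isCont_def)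
 hence e1: "\<forall>\<^sub>F t in nhds t0. c < abs (Re (g (of_real t)))"
 by (rule order_tendstoD) (use c in \<open>simp add: c_def\<close>)
 have "((%t. abs (Re (deriv g (of_real t)))) \<longlongrightarrow> abs (Re (deriv g (of_real t0)))) (nhds t0)"
 using cg' tendsto_at_iff_tendsto_nhds[of "%t. deriv g (complex_of_real t)" t0] by (intro tendsto_rabs tendsto_Re) (simp add: isCont_def)
 hence e2: "\<forall>\<^sub>F t in nhds t0. abs (Re (deriv g (of_real t))) < C"
 by (rule order_tendstoD) (simp add: C_def)
 from eventually_conj[OF e1 e2] obtain d where d: "d > 0"
 "!!t. abs (t - t0) < d ==> c < abs (Re (g (of_real t))) & abs (Re (deriv g (of_real t))) < C"
 unfolding eventually_nhds_metric by (auto simp: dist_real_def)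
 define ro where "ro = min (min r d) (min (1 / (2 * M + 1)) (c / (2 * C)))"
 have "ro > 0" using g(2) d(1) M c C by (simp add: ro_def)
 moreover have "M * abs (Re (H (of_real t))) <= abs (Re (deriv H (of_real t)))" if t: "abs (t - t0) < ro" for t
 proof -
 define tau where "tau = t - t0"
 define G where "G = Re (g (of_real t))"
 define G' where "G' = Re (deriv g (of_real t))"
 have tr: "abs (t - t0) < r" and td: "abs (t - t0) < d" and t1: "abs (tau) < 1 / (2 * M + 1)" and t2: "abs (tau) < c / (2 * C)"
 using t by (auto simp: ro_def tau_def)
 have G: "c < abs G" "abs G' < C" using d(2)[OF td] by (auto simp: G_def G'_def)
 have a1: "M * abs (tau) <= 1 / 2"
 proof -
 have "M * abs (tau) <= M * (1 / (2 * M + 1))" using t1 M by (intro mult_left_mono) auto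
 also have "... <= 1 / 2" using M by (simp add: field_simps)
 finally show ?thesis .
 qed
 have "abs (tau * G') <= abs (tau) * C" using G(2) by (simp add: abs_mult mult_left_mono)
 also have "... <= c / (2 * C) * C" using t2 C by (intro mult_right_mono) auto
 also have "... = c / 2" using C by simp
 finally have a2: "abs (tau * G') <= c / 2" .
 have "abs G <= real n * abs G" using g(1) by (simp add: mult_le_cancel_right1)
 hence n: "abs G <= abs (real n * G)" by (simp add: abs_mult)
 have "M * abs (tau) * abs G <= 1 / 2 * abs G" using a1 by (rule mult_right_mono) simp
 also have "... <= abs (real n * G + tau * G')" using n a2 G(1) by linarith
 finally have m: "M * abs (tau) * abs G <= abs (real n * G + tau * G')" .
 have "M * abs (Re (H (of_real t))) = abs (tau) ^ (n - 1) * (M * abs (tau) * abs G)"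
 unfolding Hval(1)[OF tr] G_def[symmetric] tau_def[symmetric]
 using g(1) by (cases n) (simp_all add: abs_mult power_abs)
 also have "... <= abs (tau) ^ (n - 1) * abs (real n * G + tau * G')" by (intro mult_left_mono m) simp
 also have "... = abs (Re (deriv H (of_real t)))"
 unfolding Hder[OF tr] G_def[symmetric] G'_def[symmetric] tau_def[symmetric] by (simp add: abs_mult power_abs)
 finally show ?thesis .
 qed
 ultimately show ?thesis by blast
qed

text \<open>In the variable \<open>s = 1 / (p - 1)\<close> this extends
  \<open>(cr p a + cr p b) powr (p - 1)\<close>, the part of \<open>lam0\<close> that varies with
  \<open>p\<close>, to complex arguments.\<close>

definition pfun :: "real => real => complex => complex" where
 "pfun a b s = exp (Ln (exp (s * of_real (ln a)) + exp (s * of_real (ln b))) / s)"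

text \<open>In a thin strip both exponentials have argument below \<open>pi / 2\<close>, so their
  sum has positive real part and avoids the branch cut of \<open>Ln\<close>.\<close>

lemma pfun_holomorphic:
 assumes ab: "1 <= a" "1 <= b" and S: "!!s. s : S ==> 0 < Re s & abs (Im s) * ln a < pi / 2 & abs (Im s) * ln b < pi / 2"
 shows "pfun a b holomorphic_on S"
proof -
 have pos: "Re (exp (s * of_real (ln c))) > 0" if "s : S" "c = a | c = b" for s c
 proof -
 have "abs (Im s * ln c) < pi / 2" using S[OF that(1)] that(2) ab by (auto simp: abs_mult)
 hence "cos (Im s * ln c) > 0" by (intro cos_gt_zero_pi) auto
 thus ?thesis by (simp add: Re_exp)
 qed
 have "exp (s * of_real (ln a)) + exp (s * of_real (ln b)) ~: \<real>\<^sub>\<le>\<^sub>0" if "s : S" for s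
 proof -
 have "Re (exp (s * of_real (ln a)) + exp (s * of_real (ln b))) > 0" using pos[OF that] by (simp add: add_pos_pos)
 thus ?thesis using complex_nonpos_Reals_iff by (metis not_less)
 qed
 moreover have "s ~= 0" if "s : S" for s using S[OF that] by auto
 ultimately show ?thesis unfolding pfun_def by (intro holomorphic_intros) auto
qed

lemma pfun_of_real:
 assumes "1 <= a" "1 <= b" "t > 0"
 shows "pfun a b (of_real t) = of_real ((a powr t + b powr t) powr (1 / t))"
proof -
 have e: "exp (of_real t * of_real (ln c) :: complex) = of_real (c powr t)" if "c >= 1" for c
 using that by (simp add: powr_def flip: of_real_mult exp_of_real)
 have p: "a powr t + b powr t > 0" using assms by (intro add_pos_pos) auto
 have "pfun a b (of_real t) = exp (of_real (ln (a powr t + b powr t)) / of_real t)"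
 unfolding pfun_def e[OF assms(1)] e[OF assms(2)] using p by (simp add: Ln_of_real flip: of_real_add)
 also have "... = of_real (exp (ln (a powr t + b powr t) / t))" by (simp flip: of_real_divide exp_of_real)
 finally show ?thesis using p by (simp add: powr_def)
qed

lemma lam0_3:
 fixes A B :: "'n::finite set"
 assumes "pair_ok A B"
 shows "lam0 3 A B = CARD('n) + 2 * (cr 3 (card A) * cr 3 (card B))" "cr 3 (card A) ^ 2 = card A"
proof -
 note okD = pair_okD[OF assms]
 have c: "cr 3 k ^ 2 = k" if "k >= 1" for k using cr_powr[of 3 k] that by (simp add: cr_def)
 have p: "cr 3 k > 0" if "k >= 1" for k using cr_ge_1[of 3 k] that by simp
 show "cr 3 (card A) ^ 2 = card A" using c okD by simp
 have "(cr 3 (card A) + cr 3 (card B)) powr (3 - 1) = (cr 3 (card A) + cr 3 (card B)) ^ 2"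
 using p[OF okD(1)] p[OF okD(2)] by (simp add: add_pos_pos)
 also have "... = card A + card B + 2 * (cr 3 (card A) * cr 3 (card B))"
 using c[of "card A"] c[of "card B"] okD by (simp add: power2_sum)
 finally show "lam0 3 A B = CARD('n) + 2 * (cr 3 (card A) * cr 3 (card B))"
 unfolding lam0_def using card_blocks[OF okD(3)] by linarith
qed

lemma lam0_4:
 fixes A B :: "'n::finite set"
 assumes "pair_ok A B"
 shows "lam0 4 A B = CARD('n) + 3 * (cr 4 (card A) * cr 4 (card B) * (cr 4 (card A) + cr 4 (card B)))" "cr 4 (card A) ^ 3 = card A"
proof -
 note okD = pair_okD[OF assms]
 have c: "cr 4 k ^ 3 = k" if "k >= 1" for k using cr_powr[of 4 k] that by (simp add: cr_def)
 have p: "cr 4 k > 0" if "k >= 1" for k using cr_ge_1[of 4 k] that by simp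
 show "cr 4 (card A) ^ 3 = card A" using c okD by simp
 have "(cr 4 (card A) + cr 4 (card B)) powr (4 - 1) = (cr 4 (card A) + cr 4 (card B)) ^ 3"
 using p[OF okD(1)] p[OF okD(2)] by (simp add: add_pos_pos)
 also have "... = cr 4 (card A) ^ 3 + cr 4 (card B) ^ 3 + 3 * (cr 4 (card A) * cr 4 (card B) * (cr 4 (card A) + cr 4 (card B)))"
 by (simp add: power3_eq_cube algebra_simps)
 finally show "lam0 4 A B = CARD('n) + 3 * (cr 4 (card A) * cr 4 (card B) * (cr 4 (card A) + cr 4 (card B)))"
 unfolding lam0_def using card_blocks[OF okD(3)] c okD by simp
qed

text \<open>At \<open>p = 3\<close> and \<open>p = 4\<close> the base eigenvalue determines the product and the sum of
  the cube roots of the two block sizes.\<close>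

lemma lam0_3_4_inj:
 fixes A B A' B' :: "'n::finite set"
 assumes ok: "pair_ok A B" "pair_ok A' B'" and e: "lam0 3 A B = lam0 3 A' B'" "lam0 4 A B = lam0 4 A' B'"
 shows "card A = card A' & card B = card B' | card A = card B' & card B = card A'"
proof -
 note sw = pair_ok_swap[OF ok(1)] pair_ok_swap[OF ok(2)]
 let ?a = "cr 4 (card A)" and ?b = "cr 4 (card B)" and ?c = "cr 4 (card A')" and ?d = "cr 4 (card B')"
 have q: "?a ^ 3 = card A" "?b ^ 3 = card B" "?c ^ 3 = card A'" "?d ^ 3 = card B'"
 using lam0_4(2) ok sw by blast+
 have pos: "?a > 0" "?b > 0" "?c > 0" "?d > 0"
 using cr_ge_1[of 4] pair_okD[OF ok(1)] pair_okD[OF ok(2)] by (auto intro: less_le_trans[OF zero_less_one])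
 have "cr 3 (card A) * cr 3 (card B) = cr 3 (card A') * cr 3 (card B')"
 using e(1) lam0_3(1)[OF ok(1)] lam0_3(1)[OF ok(2)] by simp
 hence "(cr 3 (card A))^2 * (cr 3 (card B))^2 = (cr 3 (card A'))^2 * (cr 3 (card B'))^2"
 by (simp flip: power_mult_distrib)
 hence "real (card A) * real (card B) = real (card A') * real (card B')"
 using lam0_3(2)[OF ok(1)] lam0_3(2)[OF sw(1)] lam0_3(2)[OF ok(2)] lam0_3(2)[OF sw(2)] by simp
 hence "(?a * ?b) ^ 3 = (?c * ?d) ^ 3" unfolding power_mult_distrib q .
 hence ab: "?a * ?b = ?c * ?d" using pos by (simp add: power_eq_iff_eq_base)
 have "?a * ?b * (?a + ?b) = ?c * ?d * (?c + ?d)" using e(2) lam0_4(1)[OF ok(1)] lam0_4(1)[OF ok(2)] by simp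
 hence sum: "?a + ?b = ?c + ?d" using ab pos by (simp add: mult_left_cancel)
 have b: "?b = ?c + ?d - ?a" using sum by simp
 have "(?a - ?c) * (?a - ?d) = 0" using ab unfolding b by (simp add: algebra_simps)
 hence "?a = ?c & ?b = ?d | ?a = ?d & ?b = ?c" using sum by auto
 hence "?a ^ 3 = ?c ^ 3 & ?b ^ 3 = ?d ^ 3 | ?a ^ 3 = ?d ^ 3 & ?b ^ 3 = ?c ^ 3" by auto
 thus ?thesis unfolding q by simp
qed

text \<open>The difference extends holomorphically in \<open>1 / (p - 1)\<close>, so it has finitely
  many zeros on a compact interval unless it is constant. A constant difference with a zero would
  vanish at \<open>p = 3\<close> and \<open>p = 4\<close>, against
  \<open>lam0_3_4_inj\<close>.\<close>

lemma lam0_crossing: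
 fixes A B A' B' :: "'n::finite set"
 assumes l: "1 < l" and ok: "pair_ok A B" "pair_ok A' B'"
 and ne: "~ (card A = card A' & card B = card B' | card A = card B' & card B = card A')"
 shows "EX D'. (ALL p:{l..r}. ((%p. lam0 p A B - lam0 p A' B') has_real_derivative D' p) (at p)) &
 finite {p:{l..r}. lam0 p A B = lam0 p A' B'} &
 (ALL p0:{l..r}. lam0 p0 A B = lam0 p0 A' B' --> (ALL M>=0. EX ro>0. ALL p:{l..r}. abs (p - p0) < ro -->
 M * abs (lam0 p A B - lam0 p A' B') <= abs (D' p)))"
proof -
 note okD = pair_okD[OF ok(1)] pair_okD[OF ok(2)]
 let ?a = "real (card A)" and ?b = "real (card B)" and ?c = "real (card A')" and ?d = "real (card B')"
 have ge1: "1 <= ?a" "1 <= ?b" "1 <= ?c" "1 <= ?d" using okD by auto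
 define n where "n = real CARD('n)"
 have "card X <= CARD('n)" for X :: "'n set" by (simp add: card_mono)
 hence le: "?a <= n" "?b <= n" "?c <= n" "?d <= n" by (simp_all add: n_def)
 have n1: "1 <= n" using ge1 le by linarith
 \<comment> \<open>Half-width of the strip, so that \<open>d * ln n < pi / 2\<close> for all block
   sizes at once; the summand 1 makes the inequality strict and keeps the denominator
   positive.\<close>
 define d where "d = pi / (2 * (ln n + 1))"
 have ln0: "0 <= ln n" using n1 by simp
 have d: "d > 0" using ln0 pi_gt_zero by (simp add: d_def)
 \<comment> \<open>Large enough to contain \<open>1 / (p - 1)\<close> for all \<open>p >= l\<close>
   and also for the test values 3 and 4, which may lie outside \<open>{l..r}\<close>.\<close>
 define R where "R = 1 / (l - 1) + 2"
 have R: "R > 2" using l by (simp add: R_def)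
 define S where "S = box (Complex 0 (- d)) (Complex R d)"
 have Siff: "s : S \<longleftrightarrow> 0 < Re s & Re s < R & - d < Im s & Im s < d" for s
 by (auto simp: S_def in_box_complex_iff)
 have S: "open S" "connected S" by (auto simp: S_def intro: convex_connected)
 have Sb: "0 < Re s & abs (Im s) * ln k < pi / 2" if "s : S" "1 <= k" "k <= n" for s k
 proof -
 have "abs (Im s) * ln k <= abs (Im s) * ln n" using that by (intro mult_left_mono) auto
 also have "... <= d * ln n" using that Siff ln0 by (intro mult_right_mono) auto
 also have "... < pi / 2" using ln0 pi_gt_zero by (simp add: d_def field_simps)
 finally show ?thesis using that Siff by auto
 qed
 define H where "H = (%s. of_real (real (card (- (A Un B))) - real (card (- (A' Un B')))) + (pfun ?a ?b s - pfun ?c ?d s))"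
 have hol: "H holomorphic_on S"
 proof -
 have "0 < Re s & abs (Im s) * ln ?a < pi / 2 & abs (Im s) * ln ?b < pi / 2" if "s : S" for s
 using Sb[OF that ge1(1) le(1)] Sb[OF that ge1(2) le(2)] by blast
 moreover have "0 < Re s & abs (Im s) * ln ?c < pi / 2 & abs (Im s) * ln ?d < pi / 2" if "s : S" for s
 using Sb[OF that ge1(3) le(3)] Sb[OF that ge1(4) le(4)] by blast
 ultimately show ?thesis
 unfolding H_def by (intro holomorphic_on_add holomorphic_on_diff holomorphic_on_const pfun_holomorphic ge1) blast+
 qed
 let ?D0 = "%p. lam0 p A B - lam0 p A' B'"
 have tS: "complex_of_real t : S \<longleftrightarrow> 0 < t & t < R" for t using d by (auto simp: Siff)
 have Hr: "H (of_real (1 / (p - 1))) = of_real (?D0 p)" if "p > 1" for p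
 proof -
 have t: "1 / (p - 1) > 0" using that by simp
 show ?thesis
 unfolding H_def pfun_of_real[OF ge1(1,2) t] pfun_of_real[OF ge1(3,4) t] using that
 by (simp add: lam0_def cr_def)
 qed
 have HrE: "Re (H (of_real (1 / (p - 1)))) = ?D0 p" if "p > 1" for p using Hr[OF that] by simp
 have im: "Im (H (of_real t)) = 0" if "complex_of_real t : S" for t
 proof -
 have "t > 0" using that tS by simp
 hence "1 + 1 / t > 1" "1 / (1 + 1 / t - 1) = t" by auto
 thus ?thesis using Hr[of "1 + 1 / t"] by (metis Im_complex_of_real)
 qed
 have Ip: "complex_of_real (1 / (p - 1)) : S" if "p >= l" for p
 proof -
 have "1 / (p - 1) <= 1 / (l - 1)" using that l by (intro divide_left_mono) auto
 thus ?thesis unfolding tS using that l by (auto simp: R_def)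
 qed
 have nc: "~ H constant_on S" if p0: "p0 >= l" "?D0 p0 = 0" for p0
 proof
 assume "H constant_on S"
 then obtain c where c: "!!s. s : S ==> H s = c" by (auto simp: constant_on_def)
 have "c = 0" using c[OF Ip[OF p0(1)]] Hr[of p0] p0 l by simp
 have "?D0 p = 0" if "p >= 3" for p
 proof -
 have "1 / (p - 1) <= 1 / 2" using that by (intro frac_le) auto
 hence "1 / (p - 1) < R" using R by linarith
 hence "complex_of_real (1 / (p - 1)) : S" unfolding tS using that by simp
 thus ?thesis using c \<open>c = 0\<close> Hr[of p] that by (metis HrE zero_complex.sel(1) less_le_trans one_less_numeral_iff semiring_norm(77))
 qed
 from this[of 3] this[of 4] show False using lam0_3_4_inj[OF ok] ne by simp
 qed
 define D' where "D' = (%p. Re (deriv H (of_real (1 / (p - 1)))) * (- 1 / (p - 1)^2))"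
 have der: "(?D0 has_real_derivative D' p) (at p)" if p: "p : {l..r}" for p
 proof -
 have p1: "p > 1" using p l by simp
 have g: "((%p. 1 / (p - 1)) has_real_derivative - 1 / (p - 1)^2) (at p)"
 using p1 by (auto intro!: derivative_eq_intros simp: power2_eq_square divide_simps)
 have "((%p. Re (H (of_real (1 / (p - 1))))) has_real_derivative D' p) (at p)"
 unfolding D'_def by (rule DERIV_chain2[OF holomorphic_Re_DERIV[OF hol S(1) Ip] g]) (use p in simp)
 thus ?thesis
 by (rule has_field_derivative_transform_within_open[of _ _ _ "{1<..}"]) (use p1 HrE in auto)
 qed
 moreover have "finite {p:{l..r}. lam0 p A B = lam0 p A' B'}"
 proof (cases "EX p0:{l..r}. ?D0 p0 = 0")
 case True
 then obtain p0 where p0: "p0 >= l" "?D0 p0 = 0" by auto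
 let ?K = "(%p. complex_of_real (1 / (p - 1))) ` {l..r}"
 have "compact ?K"
 using l by (intro compact_continuous_image continuous_intros) auto
 moreover have "?K <= S" using Ip by auto
 ultimately have "finite {z:?K. H z = 0}"
 using holomorphic_compact_finite_zeros[OF hol S] nc[OF p0] by blast
 moreover have "(%p. complex_of_real (1 / (p - 1))) ` {p:{l..r}. lam0 p A B = lam0 p A' B'} <= {z:?K. H z = 0}"
 using Hr l by auto
 ultimately have "finite ((%p. complex_of_real (1 / (p - 1))) ` {p:{l..r}. lam0 p A B = lam0 p A' B'})"
 by (rule rev_finite_subset)
 thus ?thesis by (rule finite_imageD) (use l in \<open>auto intro!: inj_onI simp: divide_simps\<close>)
 next
 case False
 hence "{p:{l..r}. lam0 p A B = lam0 p A' B'} = {}" by auto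
 thus ?thesis by (simp only: finite.emptyI)
 qed
 moreover have "EX ro>0. ALL p:{l..r}. abs (p - p0) < ro --> M * abs (?D0 p) <= abs (D' p)"
 if p0: "p0 : {l..r}" "lam0 p0 A B = lam0 p0 A' B'" and M: "M >= 0" for p0 M
 proof -
 have p01: "p0 > 1" using p0 l by simp
 let ?t0 = "1 / (p0 - 1)"
 have h0: "H (of_real ?t0) = 0" using Hr[OF p01] p0 by simp
 have ncH: "~ H constant_on S" using nc[of p0] p0 by simp
 \<comment> \<open>The chain rule from \<open>1 / (p - 1)\<close> back to \<open>p\<close> divides
   the derivative by \<open>(p - 1)^2\<close>, at most \<open>(r - 1)^2\<close>; this factor is put
   into the constant beforehand.\<close>
 obtain ro where ro: "ro > 0" "!!t. abs (t - ?t0) < ro ==> M * (r - 1)^2 * abs (Re (H (of_real t))) <= abs (Re (deriv H (of_real t)))"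
 using holomorphic_zero_growth[OF hol S ncH im Ip h0, of "M * (r - 1)^2"] p0 M by auto
 have "M * abs (?D0 p) <= abs (D' p)" if p: "p : {l..r}" "abs (p - p0) < ro * (l - 1)^2" for p
 proof -
 have p1: "p > 1" using p l by simp
 have "1 / (p - 1) - ?t0 = (p0 - p) / ((p - 1) * (p0 - 1))" using p1 p01 by (simp add: field_simps)
 hence "abs (1 / (p - 1) - ?t0) = abs (p - p0) / ((p - 1) * (p0 - 1))" using p1 p01 by (simp add: abs_mult abs_minus_commute)
 also have "... <= abs (p - p0) / (l - 1)^2"
 unfolding power2_eq_square using p p0 l by (intro divide_left_mono mult_mono mult_pos_pos) auto
 also have "... < ro" using p(2) l by (simp add: divide_less_eq)
 finally have a: "M * (r - 1)^2 * abs (?D0 p) <= abs (Re (deriv H (of_real (1 / (p - 1)))))"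
 using ro(2) HrE[OF p1] by metis
 have "M * (p - 1)^2 * abs (?D0 p) <= M * (r - 1)^2 * abs (?D0 p)"
 using p p1 M by (intro mult_right_mono mult_left_mono power_mono) auto
 hence "M * abs (?D0 p) * (p - 1)^2 <= abs (Re (deriv H (of_real (1 / (p - 1)))))" using a by (simp add: mult_ac)
 hence "M * abs (?D0 p) <= abs (Re (deriv H (of_real (1 / (p - 1))))) / (p - 1)^2"
 using p1 by (simp add: le_divide_eq)
 thus ?thesis by (simp add: D'_def abs_mult abs_divide)
 qed
 thus ?thesis using ro(1) l by (intro exI[of _ "ro * (l - 1)^2"]) auto
 qed
 ultimately show ?thesis by (intro exI[of _ D'] conjI) auto
qed

section \<open>Zeros of the difference of two eigenvalue branches\<close>

lemma finite_common_bound: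
 fixes Q :: "'a => real => bool"
 assumes "finite F" "!!x. x : F ==> EX d>0. ALL eps. 0 < eps --> eps <= d --> Q x eps"
 shows "EX d>0. ALL eps. 0 < eps --> eps <= d --> (ALL x:F. Q x eps)"
 using assms
proof (induction F rule: finite_induct)
 case empty
 show ?case by (intro exI[of _ 1]) auto
next
 case (insert x F)
 obtain d where d: "d > 0" "!!eps. 0 < eps ==> eps <= d ==> Q x eps" using insert.prems[of x] by auto
 obtain d' where d': "d' > 0" "!!eps. 0 < eps ==> eps <= d' ==> ALL x:F. Q x eps" using insert.IH insert.prems by auto
 show ?case using d d' by (intro exI[of _ "min d d'"]) auto
qed

text \<open>Models the difference of two perturbed eigenvalues. In value it is
  \<open>D0 + eps * dd\<close> up to order \<open>eps^2\<close>; as a function of \<open>p\<close>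
  its deviation from \<open>D0\<close> is only Lipschitz, with constant of order \<open>eps\<close>,
  which is what the max-min construction provides.\<close>

definition close_branch :: "real => real => (real => real) => (real => real) => real => real => (real => real) => bool" where
 "close_branch l r D0 dd K eps D \<longleftrightarrow> (ALL p:{l..r}. abs (D p - D0 p - eps * dd p) <= K * eps^2 &
 (ALL q:{l..r}. abs (D p - D0 p - (D q - D0 q)) <= K * eps * abs (p - q)))"

lemma close_branchD:
 assumes "close_branch l r D0 dd K eps D" "p : {l..r}"
 shows "abs (D p - D0 p - eps * dd p) <= K * eps^2" "q : {l..r} ==> abs (D p - D0 p - (D q - D0 q)) <= K * eps * abs (p - q)"
 using assms unfolding close_branch_def by blast+

text \<open>The situation of two pairs with equal block sizes: the leading part vanishes
  identically, and the first order term, bounded below by compactness, decides.\<close>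

lemma branch_nonzero_const:
 assumes K: "K > 0" and c: "continuous_on {l..r} dd" and nz: "!!p. p : {l..r} ==> dd p ~= 0" and D0: "!!p. p : {l..r} ==> D0 p = 0"
 shows "EX eps1>0. ALL eps. 0 < eps --> eps <= eps1 --> (ALL D. close_branch l r D0 dd K eps D --> (ALL p:{l..r}. D p ~= 0))"
proof -
 have "EX ka>0. ALL p:{l..r}. ka <= abs (dd p)"
 by (rule continuous_pos_lower_bound) (use c nz in \<open>auto intro!: continuous_intros\<close>)
 then obtain ka where ka: "ka > 0" "!!p. p : {l..r} ==> ka <= abs (dd p)" by blast
 have "D p ~= 0" if eps: "0 < eps" "eps <= ka / (2 * K)" and D: "close_branch l r D0 dd K eps D" and p: "p : {l..r}" for eps D p
 proof
 assume "D p = 0"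
 hence "abs (eps * dd p) <= K * eps^2" using close_branchD(1)[OF D p] D0[OF p] by simp
 hence "eps * abs (dd p) <= eps * (K * eps)" using eps by (simp add: abs_mult power2_eq_square mult_ac)
 hence "abs (dd p) <= K * eps" using eps(1) by simp
 moreover have "K * eps <= ka / 2" using eps(2) K by (simp add: field_simps)
 ultimately show False using ka(1) ka(2)[OF p] by linarith
 qed
 thus ?thesis using ka(1) K by (intro exI[of _ "ka / (2 * K)"]) auto
qed

text \<open>Keeps a prescribed exponent out of the exceptional set, which is how a statement for one
  fixed \<open>p\<close> is reached.\<close>

lemma branch_nonzero_point:
 assumes K: "K > 0" and p: "p : {l..r}" and nz: "D0 p ~= 0 | dd p ~= 0"
 shows "EX eps1>0. ALL eps. 0 < eps --> eps <= eps1 --> (ALL D. close_branch l r D0 dd K eps D --> D p ~= 0)"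
proof (cases "D0 p = 0")
 case True
 \<comment> \<open>The one-point interval \<open>{p..p}\<close> reduces this case to
   \<open>branch_nonzero_const\<close>.\<close>
 have "EX eps1>0. ALL eps. 0 < eps --> eps <= eps1 --> (ALL D. close_branch p p D0 dd K eps D --> (ALL q:{p..p}. D q ~= 0))"
 by (rule branch_nonzero_const[OF K]) (use True nz in auto)
 then obtain e where e: "e > 0" "!!eps D. 0 < eps ==> eps <= e ==> close_branch p p D0 dd K eps D ==> D p ~= 0" by auto
 moreover have "close_branch p p D0 dd K eps D" if "close_branch l r D0 dd K eps D" for eps D
 using that p by (auto simp: close_branch_def)
 ultimately show ?thesis by blast
next
 case False
 define e where "e = min 1 (abs (D0 p) / (2 * (K + abs (dd p))))"
 have "K + abs (dd p) > 0" using K by linarith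
 hence e: "e > 0" using False by (simp add: e_def)
 have "D p ~= 0" if eps: "0 < eps" "eps <= e" and D: "close_branch l r D0 dd K eps D" for eps D
 proof
 assume "D p = 0"
 hence "abs (D0 p) <= abs (eps * dd p) + K * eps^2" using close_branchD(1)[OF D p] by linarith
 moreover have "eps^2 <= eps" using eps by (simp add: e_def power2_eq_square mult_left_le)
 hence "K * eps^2 <= K * eps" using K by simp
 moreover have "abs (eps * dd p) = abs (dd p) * eps" using eps by (simp add: abs_mult)
 moreover have "(K + abs (dd p)) * eps <= abs (D0 p) / 2"
 proof -
 have k: "K + abs (dd p) > 0" using K by linarith
 have "eps <= abs (D0 p) / (2 * (K + abs (dd p)))" using eps by (simp add: e_def)
 hence "(K + abs (dd p)) * eps <= (K + abs (dd p)) * (abs (D0 p) / (2 * (K + abs (dd p))))" using k by (intro mult_left_mono) auto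
 also have "... = abs (D0 p) / 2"
 proof -
 have "c * (x / (2 * c)) = x / 2" if "c > 0" for c x :: real using that by simp
 thus ?thesis using k .
 qed
 finally show ?thesis .
 qed
 ultimately have "abs (D0 p) <= abs (D0 p) / 2" unfolding distrib_right by linarith
 thus False using False by simp
 qed
 thus ?thesis using e by (intro exI[of _ e]) auto
qed

text \<open>Near a zero of \<open>D0\<close> a zero of the branch forces \<open>D0\<close> to be of order \<open>eps\<close>, hence its slope to exceed
  the Lipschitz constant \<open>K * eps\<close> of the perturbation, so the zeros of the branch are isolated.\<close>

lemma branch_finite_zeros:
 fixes D0 dd D' :: "real => real"
 assumes K: "K > 0" and cd: "continuous_on {l..r} dd"
 and der: "!!p. p : {l..r} ==> (D0 has_real_derivative D' p) (at p)"
 and fin: "finite {p:{l..r}. D0 p = 0}"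
 and gr: "!!p0 M. p0 : {l..r} ==> D0 p0 = 0 ==> M >= 0 ==> EX ro>0. ALL p:{l..r}. abs (p - p0) < ro --> M * abs (D0 p) <= abs (D' p)"
 and nz: "!!p. p : {l..r} ==> D0 p = 0 ==> dd p ~= 0"
 shows "EX eps1>0. ALL eps. 0 < eps --> eps <= eps1 --> (ALL D. close_branch l r D0 dd K eps D --> finite {p:{l..r}. D p = 0})"
proof -
 let ?I = "{l..r}" and ?Z = "{p:{l..r}. D0 p = 0}"
 have cD0: "continuous_on ?I D0" using der DERIV_continuous_on has_field_derivative_at_within by (metis continuous_at_imp_continuous_on DERIV_isCont)
 obtain C where C: "C > 0" "!!p. p : ?I ==> abs (dd p) <= C" using continuous_upper_bound[OF compact_Icc cd] by blast
 \<comment> \<open>The factor \<open>8 * K / |dd p0|\<close> is dictated by the end of the argument: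
   at a zero of the branch near \<open>p0\<close> one has \<open>|D0| >= eps * |dd p0| / 4\<close>,
   so the slope of \<open>D0\<close> is at least \<open>2 * K * eps\<close>.\<close>
 have "EX ro>0. ALL p:?I. abs (p - p0) < ro --> abs (dd p) > abs (dd p0) / 2 & (8 * K / abs (dd p0)) * abs (D0 p) <= abs (D' p)" if p0: "p0 : ?Z" for p0
 proof -
 have d0: "dd p0 ~= 0" using nz p0 by auto
 obtain ro1 where 1: "ro1 > 0" "!!p. p : ?I ==> abs (p - p0) < ro1 ==> (8 * K / abs (dd p0)) * abs (D0 p) <= abs (D' p)"
 using gr[of p0 "8 * K / abs (dd p0)"] p0 K by auto
 have "p0 : ?I" "abs (dd p0) / 2 > 0" using p0 d0 by auto
 with cd obtain ro2 where 2: "ro2 > 0" "!!p. p : ?I ==> abs (p - p0) < ro2 ==> abs (dd p - dd p0) < abs (dd p0) / 2"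
 unfolding continuous_on_iff dist_real_def by metis
 have "abs (dd p) > abs (dd p0) / 2" if "p : ?I" "abs (p - p0) < ro2" for p using 2(2)[OF that] by linarith
 thus ?thesis using 1 2(1) by (intro exI[of _ "min ro1 ro2"]) auto
 qed
 hence "EX ro. ALL p0:?Z. ro p0 > 0 & (ALL p:?I. abs (p - p0) < ro p0 --> abs (dd p) > abs (dd p0) / 2 & (8 * K / abs (dd p0)) * abs (D0 p) <= abs (D' p))"
 by (intro bchoice ballI)
 then obtain ro where ro: "!!p0. p0 : ?Z ==> ro p0 > 0"
 "!!p0 p. p0 : ?Z ==> p : ?I ==> abs (p - p0) < ro p0 ==> abs (dd p) > abs (dd p0) / 2 & (8 * K / abs (dd p0)) * abs (D0 p) <= abs (D' p)"
 by blast
 \<comment> \<open>On this compact set \<open>D0\<close> is bounded away from 0, and small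
   \<open>eps\<close> excludes zeros of the branch there altogether.\<close>
 define F where "F = ?I - (UN p0:?Z. ball p0 (ro p0))"
 have cF: "compact F" unfolding F_def by (intro compact_diff compact_Icc open_UN) auto
 obtain m where m: "m > 0" "!!p. p : F ==> m <= abs (D0 p)"
 proof (cases "F = {}")
 case True
 thus thesis using that[of 1] by simp
 next
 case False
 have "continuous_on F (%p. abs (D0 p))"
 by (intro continuous_intros continuous_on_subset[OF cD0]) (auto simp: F_def)
 from continuous_attains_inf[OF cF False this] obtain q where q: "q : F" "!!p. p : F ==> abs (D0 q) <= abs (D0 p)" by blast
 have "D0 q ~= 0"
 proof
 assume "D0 q = 0"
 hence "q : ?Z" using q(1) by (auto simp: F_def)
 thus False using q(1) ro(1) unfolding F_def by force
 qed
 thus thesis using that[of "abs (D0 q)"] q(2) by simp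
 qed
 have "EX d>0. ALL eps. 0 < eps --> eps <= d --> (ALL p0:?Z. K * eps <= abs (dd p0) / 8)"
 proof (rule finite_common_bound[OF fin])
 fix p0 assume "p0 : ?Z"
 thus "EX d>0. ALL eps. 0 < eps --> eps <= d --> K * eps <= abs (dd p0) / 8"
 using nz K by (intro exI[of _ "abs (dd p0) / (8 * K)"]) (auto simp: field_simps)
 qed
 then obtain d where d: "d > 0" "!!eps p0. 0 < eps ==> eps <= d ==> p0 : ?Z ==> K * eps <= abs (dd p0) / 8" by blast
 define eps1 where "eps1 = min (min 1 d) (m / (2 * (C + K)))"
 have e1: "eps1 > 0" using d(1) m(1) C(1) K by (simp add: eps1_def)
 have "finite {p:?I. D p = 0}" if eps: "0 < eps" "eps <= eps1" and D: "close_branch l r D0 dd K eps D" for eps D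
 proof (rule ccontr)
 let ?S = "{p:?I. D p = 0}"
 assume inf: "infinite ?S"
 have cD: "continuous_on ?I D"
 proof -
 have "continuous_on ?I (%p. D p - D0 p)"
 proof (rule continuous_onI)
 fix p e :: real assume p: "p : ?I" and e: "e > 0"
 show "EX d>0. ALL q:?I. dist q p < d --> dist (D q - D0 q) (D p - D0 p) <= e"
 proof (intro exI[of _ "e / (K * eps)"] conjI ballI impI)
 show "0 < e / (K * eps)" using e K eps by simp
 fix q assume q: "q : ?I" "dist q p < e / (K * eps)"
 have "K * eps * abs (q - p) <= K * eps * (e / (K * eps))"
 using q(2) K eps by (intro mult_left_mono) (auto simp: dist_real_def)
 also have "... = e" using K eps by simp
 finally show "dist (D q - D0 q) (D p - D0 p) <= e"
 using close_branchD(2)[OF D q(1) p] by (simp add: dist_real_def)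
 qed
 qed
 from continuous_on_add[OF this cD0] show ?thesis by simp
 qed
 \<comment> \<open>At an accumulation point of zeros of \<open>D\<close>, the difference quotients
   of \<open>D0\<close> along those zeros are at most \<open>K * eps\<close>, which contradicts the
   slope bound.\<close>
 obtain p where p: "p : ?I" "p islimpt ?S"
 proof -
 have "EX x:?I. x islimpt ?S"
 proof (rule ccontr)
 assume "~ ?thesis"
 hence "finite (?I Int ?S)" by (intro finite_not_islimpt_in_compact) auto
 moreover have "?I Int ?S = ?S" by auto
 ultimately show False using inf by simp
 qed
 thus thesis using that by blast
 qed
 have "closed ?S"
 proof -
 have "closed (?I Int D -` {0})" using cD by (intro continuous_closed_preimage) auto
 moreover have "?I Int D -` {0} = ?S" by auto
 ultimately show ?thesis by simp
 qed
 hence Dp: "D p = 0" using p(2) closed_limpt by blast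
 have D0p: "abs (D0 p + eps * dd p) <= K * eps^2" using close_branchD(1)[OF D p(1)] Dp by linarith
 have eps1: "eps <= 1" "eps <= d" "eps <= m / (2 * (C + K))" using eps(2) by (auto simp: eps1_def)
 have "p ~: F"
 proof
 assume "p : F"
 hence "m <= abs (D0 p)" by (rule m(2))
 also have "abs (D0 p) <= abs (eps * dd p) + K * eps^2" using D0p by linarith
 also have "... <= eps * C + eps * K"
 proof (rule add_mono)
 show "abs (eps * dd p) <= eps * C" using eps C(2)[OF p(1)] by (simp add: abs_mult)
 have "eps * eps <= eps * 1" using eps(1) eps1(1) by (intro mult_left_mono) auto
 thus "K * eps^2 <= eps * K" using K by (simp add: power2_eq_square mult.commute)
 qed
 also have "... = (C + K) * eps" by (simp add: algebra_simps)
 also have "... <= (C + K) * (m / (2 * (C + K)))" using eps1(3) C(1) K by (intro mult_left_mono) auto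
 also have "... = m / 2" using C(1) K by (simp add: field_simps)
 finally show False using m(1) by linarith
 qed
 then obtain p0 where p0: "p0 : ?Z" "abs (p - p0) < ro p0"
 using p(1) by (auto simp: F_def dist_real_def abs_minus_commute)
 define ka where "ka = abs (dd p0)"
 have ka: "ka > 0" using nz p0(1) by (auto simp: ka_def)
 have ddp: "abs (dd p) > ka / 2" and gD: "8 * K / ka * abs (D0 p) <= abs (D' p)"
 using ro(2)[OF p0(1) p(1) p0(2)] by (auto simp: ka_def)
 have Ke: "K * eps <= ka / 8" using d(2)[OF eps(1) eps1(2) p0(1)] by (simp add: ka_def)
 have "eps * (ka / 2) <= eps * abs (dd p)" using ddp eps(1) by (intro mult_left_mono) auto
 also have "... = abs (eps * dd p)" using eps(1) by (simp add: abs_mult)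
 also have "... <= abs (D0 p) + K * eps^2" using D0p by linarith
 also have "K * eps^2 <= eps * (ka / 8)"
 using mult_left_mono[OF Ke, of eps] eps(1) by (simp add: power2_eq_square mult_ac)
 finally have D0ge: "eps * ka / 4 <= abs (D0 p)" using eps(1) ka by (simp add: algebra_simps)
 have "2 * (K * eps) = 8 * K / ka * (eps * ka / 4)" using ka by simp
 also have "... <= 8 * K / ka * abs (D0 p)" using K ka D0ge by (intro mult_left_mono) auto
 also have "... <= abs (D' p)" by (rule gD)
 finally have big: "K * eps < abs (D' p)" using K eps(1) by (smt (verit) mult_pos_pos)
 have "((%q. (D0 q - D0 p) / (q - p)) \<longlongrightarrow> D' p) (at p)"
 using der[OF p(1)] by (simp add: has_field_derivative_iff)
 hence "((%q. abs ((D0 q - D0 p) / (q - p))) \<longlongrightarrow> abs (D' p)) (at p)" by (rule tendsto_rabs)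
 from order_tendstoD(1)[OF this big] obtain e where e: "e > 0"
 "!!q. q ~= p ==> dist q p < e ==> K * eps < abs ((D0 q - D0 p) / (q - p))"
 unfolding eventually_at by auto
 obtain q where q: "q : ?S" "q ~= p" "dist q p < e" using p(2) e(1) unfolding islimpt_approachable by blast
 have "abs (D0 q - D0 p) <= K * eps * abs (q - p)"
 using close_branchD(2)[OF D, of q p] q(1) p(1) Dp by auto
 hence "abs ((D0 q - D0 p) / (q - p)) <= K * eps" using q(2) by (simp add: abs_divide divide_le_eq)
 thus False using e(2)[OF q(2,3)] by linarith
 qed
 thus ?thesis using e1 by blast
qed

section \<open>Integer weights that separate infinitely many coefficient arrays\<close>

text \<open>A uniform gap: each entry is 0 or at least \<open>ka\<close> in modulus, across the
  whole set. This is what allows one weight array to serve all exponents of an interval.\<close>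

definition tame :: "('n::finite => 'n => real) set => bool" where
 "tame S \<longleftrightarrow> (EX ka>0. EX C>0. ALL dl:S. (ALL i j. dl i j = dl j i & abs (dl i j) <= C & (dl i j = 0 | ka <= abs (dl i j))) &
 (ALL i. dl i i = 0) & (EX i j. dl i j ~= 0))"

lemma tame_empty: "tame {}"
 unfolding tame_def by (intro exI[of _ 1] conjI) auto

lemma tame_Un:
 assumes "tame S" "tame T"
 shows "tame (S Un T)"
proof -
 obtain k C where 1: "k > 0" "C > 0" "!!dl. dl : S ==> (ALL i j. dl i j = dl j i & abs (dl i j) <= C & (dl i j = 0 | k <= abs (dl i j))) & (ALL i. dl i i = 0) & (EX i j. dl i j ~= 0)"
 using assms(1) unfolding tame_def by blast
 obtain k' C' where 2: "k' > 0" "C' > 0" "!!dl. dl : T ==> (ALL i j. dl i j = dl j i & abs (dl i j) <= C' & (dl i j = 0 | k' <= abs (dl i j))) & (ALL i. dl i i = 0) & (EX i j. dl i j ~= 0)"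
 using assms(2) unfolding tame_def by blast
 have w1: "x <= max C C'" if "x <= C" for x using that by simp
 have w2: "x <= max C C'" if "x <= C'" for x using that by simp
 have w3: "min k k' <= x" if "k <= x" for x using that by simp
 have w4: "min k k' <= x" if "k' <= x" for x using that by simp
 show ?thesis
 unfolding tame_def
 proof (rule exI[of _ "min k k'"], rule conjI, use 1 2 in simp, rule exI[of _ "max C C'"], rule conjI, use 1 in simp, rule ballI)
 fix dl assume "dl : S Un T"
 thus "(ALL i j. dl i j = dl j i & abs (dl i j) <= max C C' & (dl i j = 0 | min k k' <= abs (dl i j))) & (ALL i. dl i i = 0) & (EX i j. dl i j ~= 0)"
 proof
 assume "dl : S"
 from 1(3)[OF this] show ?thesis using w1 w3 by blast
 next
 assume "dl : T"
 from 2(3)[OF this] show ?thesis using w2 w4 by blast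
 qed
 qed
qed

lemma tame_UN: "finite F ==> (!!x. x : F ==> tame (S x)) ==> tame (UN x:F. S x)"
 by (induction F rule: finite_induct) (auto simp: tame_empty intro!: tame_Un)

text \<open>Weights \<open>B ^ e {i, j}\<close> with an injective \<open>e\<close> and a large base \<open>B\<close>: the nonzero entry of largest
  exponent dominates the sum of all the others.\<close>

lemma separating_weights:
 fixes S :: "('n::finite => 'n => real) set"
 assumes "tame S"
 shows "EX b :: 'n => 'n => real. (ALL i j. b i j = b j i & b i j > 0 & b i j : \<int>) & (ALL dl:S. (SUM i:UNIV. SUM j:UNIV. b i j * dl i j) ~= 0)"
proof -
 obtain ka C where k: "ka > 0" "C > 0" and S: "!!dl. dl : S ==> (ALL i j. dl i j = dl j i & abs (dl i j) <= C & (dl i j = 0 | ka <= abs (dl i j))) & (ALL i. dl i i = 0) & (EX i j. dl i j ~= 0)"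
 using assms unfolding tame_def by blast
 \<comment> \<open>Exponents are attached to the unordered pair \<open>{i, j}\<close>, which makes
   the weights symmetric.\<close>
 obtain e :: "'n set => nat" where e: "inj e"
 using finite_imp_inj_to_nat_seg[of "UNIV :: 'n set set"] by auto
 define n where "n = real CARD('n \<times> 'n)"
 \<comment> \<open>Ensures \<open>n * C < B * ka\<close>: the leading entry outweighs at most
   \<open>n\<close> others, whose weights are smaller by a factor of at least
   \<open>B\<close>.\<close>
 obtain N :: nat where N: "N > n * C / ka + 1" using reals_Archimedean2 by blast
 define B where "B = real N"
 have n0: "n >= 0" by (simp add: n_def)
 have "0 <= n * C / ka" using n0 k by simp
 hence B1: "B >= 1" using N unfolding B_def by linarith
 have B2: "n * C < B * ka"
 proof -
 have "n * C / ka < B" using N by (simp add: B_def)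
 thus ?thesis using k by (simp add: divide_less_eq)
 qed
 define b where "b = (%i j. B ^ e {i, j})"
 have "(SUM i:UNIV. SUM j:UNIV. b i j * dl i j) ~= 0" if "dl : S" for dl
 proof -
 note D = S[OF that]
 have Dsym: "!!i j. dl i j = dl j i" and DC: "!!i j. abs (dl i j) <= C" and Dka: "!!i j. dl i j ~= 0 ==> ka <= abs (dl i j)"
 and Dd: "!!i. dl i i = 0" using D by blast+
 let ?U = "{(i, j). dl i j ~= 0}"
 let ?e = "%(i, j). e {i, j}"
 have U: "finite ?U" "?U ~= {}" using D by auto
 obtain i0 j0 where ij: "(i0, j0) : ?U" "!!i j. (i, j) : ?U ==> e {i, j} <= e {i0, j0}"
 proof -
 have "Max (?e ` ?U) : ?e ` ?U" using U by (intro Max_in) auto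
 then obtain u where u: "u : ?U" "Max (?e ` ?U) = ?e u" by auto
 have "?e v <= ?e u" if "v : ?U" for v using Max_ge[of "?e ` ?U" "?e v"] that U(1) u(2) by auto
 thus thesis using that[of "fst u" "snd u"] u(1) by (cases u) force
 qed
 define m where "m = e {i0, j0}"
 have ne: "i0 ~= j0" using ij(1) Dd by auto
 let ?T = "{(i0, j0), (j0, i0)}"
 have rest: "B * abs (b i j * dl i j) <= B ^ m * C" if "(i, j) ~: ?T" for i j
 proof (cases "dl i j = 0")
 case True
 thus ?thesis using k B1 by simp
 next
 case False
 have "{i, j} ~= {i0, j0}" using that by (auto simp: doubleton_eq_iff)
 hence "e {i, j} ~= m" using e unfolding m_def by (metis injD)
 moreover have "e {i, j} <= m" unfolding m_def by (rule ij(2)) (use False in simp)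
 ultimately have "Suc (e {i, j}) <= m" by simp
 hence "B * b i j <= B ^ m" unfolding b_def power_Suc[symmetric] by (rule power_increasing[OF _ B1])
 moreover have "b i j >= 0" using B1 by (simp add: b_def)
 ultimately have "B * b i j * abs (dl i j) <= B ^ m * C" using DC[of i j] k B1 by (intro mult_mono) auto
 thus ?thesis using \<open>b i j >= 0\<close> by (simp add: abs_mult mult.assoc)
 qed
 let ?f = "%(i, j). b i j * dl i j"
 have "(SUM i:UNIV. SUM j:UNIV. b i j * dl i j) = sum ?f UNIV" by (simp add: sum.cartesian_product)
 also have "... = sum ?f ?T + sum ?f (UNIV - ?T)" by (subst add.commute) (rule sum.subset_diff, auto)
 also have "sum ?f ?T = 2 * (B ^ m * dl i0 j0)"
 using ne Dsym[of j0 i0] by (simp add: b_def m_def insert_commute)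
 finally have sum: "(SUM i:UNIV. SUM j:UNIV. b i j * dl i j) = 2 * (B ^ m * dl i0 j0) + sum ?f (UNIV - ?T)" .
 have "B * abs (sum ?f (UNIV - ?T)) <= (SUM u:UNIV - ?T. B * abs (?f u))"
 unfolding sum_distrib_left[symmetric] using B1 by (intro mult_left_mono sum_abs) auto
 also have "... <= (SUM u:UNIV - ?T. B ^ m * C)" by (intro sum_mono) (use rest in force)
 also have "... <= n * (B ^ m * C)"
 using k B1 by (simp add: n_def card_mono mult_right_mono del: card_prod)
 finally have r: "B * abs (sum ?f (UNIV - ?T)) <= B ^ m * (n * C)" by (simp add: mult_ac)
 have "ka <= abs (dl i0 j0)" using Dka ij(1) by simp
 have Bm: "B ^ m > 0" using B1 by simp
 have "B ^ m * (n * C) < B ^ m * (B * ka)" using B2 Bm by simp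
 also have "... <= B ^ m * (B * abs (dl i0 j0))" using Bm B1 \<open>ka <= \<bar>dl i0 j0\<bar>\<close> by simp
 also have "... = B * abs (B ^ m * dl i0 j0)" using Bm by (simp add: abs_mult)
 finally have "B * abs (sum ?f (UNIV - ?T)) < B * abs (B ^ m * dl i0 j0)" using r by linarith
 hence "abs (sum ?f (UNIV - ?T)) < abs (B ^ m * dl i0 j0)" using B1 by simp
 thus ?thesis unfolding sum by linarith
 qed
 moreover have "b i j = b j i & b i j > 0 & b i j : \<int>" for i j
 using B1 by (auto simp: b_def B_def insert_commute)
 ultimately show ?thesis by blast
qed

text \<open>The share of the pair \<open>(i, j)\<close> in the quotient at the base vector. By
  \<open>Rq_dvec\<close> the first order shift of the eigenvalue is linear in the weights with these
  coefficients, up to the factor 1/2.\<close>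

definition dvec :: "real => 'n::finite set => 'n set => 'n => 'n => real" where
 "dvec p A B i j = abs (base p A B $ i - base p A B $ j) powr p / Nn p (base p A B)"

lemma Rq_dvec: "Rq p b (base p A B) = (SUM i:UNIV. SUM j:UNIV. b i j * dvec p A B i j) / 2"
 by (simp add: Rq_def Ew_def dvec_def sum_divide_distrib mult_ac)

text \<open>The pattern \<open>(u, v)\<close> does not depend on \<open>p\<close>; only the values
  of \<open>cr\<close> do. Both are 1 exactly when the gap runs between \<open>A\<close> and
  \<open>B\<close>.\<close>

lemma abs_base_diff:
 fixes A B :: "'n::finite set"
 assumes ok: "pair_ok A B"
 shows "EX (u :: nat) (v :: nat). u <= (1 :: nat) & v <= (1 :: nat) & (ALL p>1. abs (base p A B $ i - base p A B $ j) = real u * cr p (card A) + real v * cr p (card B))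
 & (u = (1 :: nat) & v = (1 :: nat) \<longleftrightarrow> (i, j) : A \<times> B Un B \<times> A)"
proof -
 note okD = pair_okD[OF ok]
 have c: "cr p (card A) > 0" "cr p (card B) > 0" if "p > 1" for p
 using cr_ge_1[OF that okD(1)] cr_ge_1[OF that okD(2)] by auto
 let ?s = "%X. if i : X then 1 else 0 :: nat" and ?t = "%X. if j : X then 1 else 0 :: nat"
 define u where "u = (if (i : B) = (j : B) then 0 else 1 :: nat)"
 define v where "v = (if (i : A) = (j : A) then 0 else 1 :: nat)"
 have "abs (base p A B $ i - base p A B $ j) = u * cr p (card A) + v * cr p (card B)" if "p > 1" for p
 using c[OF that] okD(3) unfolding u_def v_def base_def by (auto simp: disjoint_iff)
 moreover have "u = 1 & v = 1 \<longleftrightarrow> (i, j) : A \<times> B Un B \<times> A" using okD(3) by (auto simp: u_def v_def)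
 moreover have "u <= 1" "v <= 1" by (auto simp: u_def v_def)
 ultimately show ?thesis by blast
qed

lemma powr_le_cancel_base:
 fixes x y p :: real
 assumes "0 <= x" "0 <= y" "0 < p"
 shows "x powr p <= y powr p \<longleftrightarrow> x <= y"
 using powr_mono2[of p x y] powr_less_mono2[of p y x] assms by (meson less_imp_le not_less)

lemma dvec_max:
 fixes A B :: "'n::finite set"
 assumes p: "p > 1" and ok: "pair_ok A B"
 shows "(ALL k l. dvec p A B k l <= dvec p A B i j) \<longleftrightarrow> (i, j) : A \<times> B Un B \<times> A"
proof -
 note okD = pair_okD[OF ok]
 have c: "cr p (card A) > 0" "cr p (card B) > 0"
 using cr_ge_1[OF p okD(1)] cr_ge_1[OF p okD(2)] by auto
 let ?m = "cr p (card A) + cr p (card B)"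
 have N: "Nn p (base p A B) > 0" by (rule Nn_pos[OF base_nonzero[OF p ok]])
 have dle: "dvec p A B k l <= dvec p A B i j \<longleftrightarrow> abs (base p A B $ k - base p A B $ l) <= abs (base p A B $ i - base p A B $ j)" for i j k l
 unfolding dvec_def using N p by (simp add: divide_le_cancel powr_le_cancel_base)
 have le: "abs (base p A B $ k - base p A B $ l) <= ?m" and eq: "abs (base p A B $ k - base p A B $ l) = ?m \<longleftrightarrow> (k, l) : A \<times> B Un B \<times> A" for k l
 proof -
 obtain u v :: nat where uv: "u <= 1" "v <= 1" "abs (base p A B $ k - base p A B $ l) = u * cr p (card A) + v * cr p (card B)"
 "u = 1 & v = 1 \<longleftrightarrow> (k, l) : A \<times> B Un B \<times> A" using abs_base_diff[OF ok, of k l] p by blast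
 have uv01: "u = 0 | u = 1" "v = 0 | v = 1" using uv by auto
 show "abs (base p A B $ k - base p A B $ l) <= ?m" unfolding uv(3) using uv01 c by auto
 show "abs (base p A B $ k - base p A B $ l) = ?m \<longleftrightarrow> (k, l) : A \<times> B Un B \<times> A" unfolding uv(3) uv(4)[symmetric] using uv01 c by auto
 qed
 obtain k l where kl: "(k, l) : A \<times> B Un B \<times> A" using ok by (auto simp: pair_ok_def)
 show ?thesis unfolding dle using le eq kl by (metis order_antisym order_refl)
qed

text \<open>By \<open>dvec_max\<close> the largest entries mark the pairs between \<open>A\<close>
  and \<open>B\<close>. This complete bipartite pattern determines the two blocks up to exchange,
  and membership in \<open>half_pairs\<close> fixes the order.\<close>

lemma dvec_inj:
 fixes A B A' B' :: "'n::{finite,linorder} set"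
 assumes p: "p > 1" and h: "(A, B) : half_pairs" "(A', B') : half_pairs" and eq: "!!i j. dvec p A B i j = dvec p A' B' i j"
 shows "A = A' & B = B'"
proof -
 have ok: "pair_ok A B" "pair_ok A' B'" using h by (auto simp: half_pairs_def)
 have E: "A \<times> B Un B \<times> A = A' \<times> B' Un B' \<times> A'"
 using dvec_max[OF p ok(1)] dvec_max[OF p ok(2)] unfolding eq by auto
 have "A = A' & B = B' | A = B' & B = A'"
 proof -
 have ne: "A ~= {}" "B ~= {}" "A' ~= {}" "B' ~= {}" "A Int B = {}" "A' Int B' = {}" using ok by (auto simp: pair_ok_def)
 obtain i j where ij: "i : A" "j : B" using ne by blast
 have mem: "(x : A & y : B | x : B & y : A) \<longleftrightarrow> (x : A' & y : B' | x : B' & y : A')" for x y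
 using E by auto
 have iB: "i ~: B" "j ~: A" using ij ne by blast+
 have B: "x : B \<longleftrightarrow> (i : A' & x : B' | i : B' & x : A')" for x using mem[of i x] ij iB by blast
 have A: "x : A \<longleftrightarrow> (x : A' & j : B' | x : B' & j : A')" for x using mem[of x j] ij iB by blast
 have "i : A' & j : B' | i : B' & j : A'" using mem[of i j] ij by blast
 thus ?thesis
 proof
 assume as: "i : A' & j : B'"
 hence "i ~: B'" "j ~: A'" using ne by blast+
 hence "!!x. x : A \<longleftrightarrow> x : A'" "!!x. x : B \<longleftrightarrow> x : B'" using A B as by simp_all
 thus ?thesis by auto
 next
 assume as: "i : B' & j : A'"
 hence "i ~: A'" "j ~: B'" using ne by blast+
 hence "!!x. x : A \<longleftrightarrow> x : B'" "!!x. x : B \<longleftrightarrow> x : A'" using A B as by simp_all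
 thus ?thesis by auto
 qed
 qed
 moreover have "(B', A') ~: half_pairs" using half_pairs_cases[OF ok(2)] h(2) by blast
 ultimately show ?thesis using h(1) by auto
qed

definition same_size :: "'n set \<times> 'n set => 'n set \<times> 'n set => bool" where
 "same_size h h' \<longleftrightarrow> card (fst h) = card (fst h') & card (snd h) = card (snd h') | card (fst h) = card (snd h') & card (snd h) = card (fst h')"

lemma Nn_base:
 fixes A B :: "'n::finite set"
 assumes "pair_ok A B"
 shows "Nn p (base p A B) = card A * cr p (card B) powr p + card B * cr p (card A) powr p"
proof -
 note okD = pair_okD[OF assms]
 have c: "abs (cr p k) = cr p k" for k by (simp add: cr_def)
 show ?thesis
 unfolding Nn_def by (subst sum_UNIV_split[OF okD(3)]) (simp add: base_simps[OF okD(3)] c)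
qed

lemma lam0_same_size:
 fixes A B A' B' :: "'n::finite set"
 assumes "same_size (A, B) (A', B')" "pair_ok A B" "pair_ok A' B'"
 shows "lam0 p A B = lam0 p A' B'"
proof -
 have "card (- (A Un B)) = card (- (A' Un B'))"
 using card_blocks[OF pair_okD(3)[OF assms(2)]] card_blocks[OF pair_okD(3)[OF assms(3)]] assms(1) by (auto simp: same_size_def)
 thus ?thesis using assms(1) by (auto simp: lam0_def same_size_def add.commute)
qed

text \<open>Equal sizes give equal norms, so entries are compared through their 0/1 patterns, and
  whether two patterns give the same gap depends on the block sizes only. Hence an entry of the
  difference is 0 for every exponent or for none.\<close>

lemma dvec_same_size:
 fixes A B A' B' :: "'n::finite set"
 assumes ok: "pair_ok A B" "pair_ok A' B'" and ss: "same_size (A, B) (A', B')" and p: "p > 1" "q > 1"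
 and eq: "dvec p A B i j = dvec p A' B' i j"
 shows "dvec q A B i j = dvec q A' B' i j"
proof -
 note okD = pair_okD[OF ok(1)]
 let ?a = "card A" and ?b = "card B"
 have N: "Nn p (base p A B) = Nn p (base p A' B')" for p
 unfolding Nn_base[OF ok(1)] Nn_base[OF ok(2)] using ss by (auto simp: same_size_def)
 have dv: "dvec p A B i j = dvec p A' B' i j \<longleftrightarrow> abs (base p A B $ i - base p A B $ j) = abs (base p A' B' $ i - base p A' B' $ j)" if "p > 1" for p
 unfolding dvec_def N using Nn_pos[OF base_nonzero[OF that ok(2)], of p] that
 by (simp add: order_eq_iff[of "_ powr _"] powr_le_cancel_base) (simp add: order_eq_iff)
 obtain u v :: nat where uv: "u <= 1" "v <= 1" "!!p. p > 1 ==> abs (base p A B $ i - base p A B $ j) = u * cr p ?a + v * cr p ?b"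
 using abs_base_diff[OF ok(1), of i j] by blast
 obtain u' v' :: nat where uv': "u' <= 1" "v' <= 1" "!!p. p > 1 ==> abs (base p A' B' $ i - base p A' B' $ j) = u' * cr p ?a + v' * cr p ?b"
 proof -
 obtain s t :: nat where st: "s <= 1" "t <= 1" "!!p. p > 1 ==> abs (base p A' B' $ i - base p A' B' $ j) = s * cr p (card A') + t * cr p (card B')"
 using abs_base_diff[OF ok(2), of i j] by blast
 from ss consider "?a = card A' & ?b = card B'" | "?a = card B' & ?b = card A'" by (auto simp: same_size_def)
 thus thesis
 proof cases
 case 1
 thus thesis using that[of s t] st by simp
 next
 case 2
 thus thesis using that[of t s] st by (simp add: add.commute)
 qed
 qed
 have inj: "cr p ?a = cr p ?b \<longleftrightarrow> ?a = ?b" if "p > 1" for p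
 using cr_powr[OF that okD(1)] cr_powr[OF that okD(2)] by (metis of_nat_eq_iff)
 have key: "u * cr p ?a + v * cr p ?b = u' * cr p ?a + v' * cr p ?b \<longleftrightarrow> (u = u' & v = v') | (?a = ?b & u + v = u' + v')" if "p > 1" for p
 proof -
 have c: "cr p ?a > 0" "cr p ?b > 0" using cr_ge_1[OF that okD(1)] cr_ge_1[OF that okD(2)] by auto
 have "u = 0 | u = 1" "v = 0 | v = 1" "u' = 0 | u' = 1" "v' = 0 | v' = 1" using uv(1,2) uv'(1,2) by auto
 thus ?thesis using c inj[OF that] by auto
 qed
 show ?thesis
 using eq unfolding dv[OF p(1)] dv[OF p(2)] uv(3)[OF p(1)] uv(3)[OF p(2)] uv'(3)[OF p(1)] uv'(3)[OF p(2)] key[OF p(1)] key[OF p(2)] .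
qed

lemma continuous_on_dvec:
 assumes l: "1 < l" and ok: "pair_ok A B"
 shows "continuous_on {l..r} (%p. dvec p A B i j)"
proof -
 have b: "continuous_on {l..r} (%p. base p A B $ k)" for k
 proof (cases "k : A")
 case True
 thus ?thesis using pair_okD[OF ok] l by (auto simp: base_simps intro!: continuous_intros)
 next
 case False
 thus ?thesis using pair_okD[OF ok] l by (cases "k : B") (auto simp: base_def intro!: continuous_intros)
 qed
 have "Nn p (base p A B) ~= 0" if "p : {l..r}" for p
 using Nn_pos[OF base_nonzero[OF _ ok], of p p] that l by force
 thus ?thesis
 unfolding dvec_def Nn_def by (intro continuous_on_divide continuous_on_sum continuous_on_abs_powr continuous_on_diff continuous_on_id b) (use l in auto)
qed

definition dfam :: "real => 'n::finite set \<times> 'n set => 'n set \<times> 'n set => 'n => 'n => real" where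
 "dfam p h h' = (%i j. dvec p (fst h) (snd h) i j - dvec p (fst h') (snd h') i j)"

text \<open>Over an interval the gap condition needs entries that vanish for all exponents or for
  none, which \<open>dvec_same_size\<close> provides. For different sizes it is used one exponent at
  a time, as the case \<open>l = r\<close>.\<close>

lemma tame_dfam:
 fixes h h' :: "'n::{finite,linorder} set \<times> 'n set"
 assumes l: "1 < l" and h: "h : half_pairs" "h' : half_pairs" "h ~= h'" and s: "same_size h h' | l = r"
 shows "tame ((%p. dfam p h h') ` {l..r})"
proof -
 obtain A B where AB: "h = (A, B)" by force
 obtain A' B' where AB': "h' = (A', B')" by force
 have ok: "pair_ok A B" "pair_ok A' B'" using h by (auto simp: half_pairs_def AB AB')
 have c: "continuous_on {l..r} (%p. dfam p h h' i j)" for i j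
 unfolding dfam_def AB AB' fst_conv snd_conv by (intro continuous_on_diff continuous_on_dvec l ok)
 have "EX C>0. ALL p:{l..r}. abs (dfam p h h' i j) <= C" for i j by (rule continuous_upper_bound[OF compact_Icc c])
 then obtain CC where CC: "!!i j. CC i j > 0" "!!i j p. p : {l..r} ==> abs (dfam p h h' i j) <= CC i j" by metis
 have "EX k>0. ALL p:{l..r}. dfam p h h' i j = 0 | k <= abs (dfam p h h' i j)" for i j
 proof (cases "EX p:{l..r}. dfam p h h' i j = 0")
 case True
 then obtain p where p: "p : {l..r}" "dfam p h h' i j = 0" by blast
 have "dfam q h h' i j = 0" if q: "q : {l..r}" for q
 proof (cases "same_size h h'")
 case True
 have "dvec q A B i j = dvec q A' B' i j"
 by (rule dvec_same_size[OF ok, of p]) (use True p q l in \<open>auto simp: AB AB' dfam_def\<close>)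
 thus ?thesis by (simp add: AB AB' dfam_def)
 next
 case False
 hence "q = p" using s p q by auto
 thus ?thesis using p by simp
 qed
 thus ?thesis by (intro exI[of _ 1]) auto
 next
 case False
 have "EX k>0. ALL p:{l..r}. k <= abs (dfam p h h' i j)"
 by (rule continuous_pos_lower_bound) (use False c in \<open>auto intro!: continuous_intros\<close>)
 thus ?thesis by blast
 qed
 then obtain kk where kk: "!!i j. kk i j > 0" "!!i j p. p : {l..r} ==> dfam p h h' i j = 0 | kk i j <= abs (dfam p h h' i j)" by metis
 define C where "C = Max (range (%(i, j). CC i j))"
 define k where "k = Min (range (%(i, j). kk i j))"
 have C: "CC i j <= C" for i j unfolding C_def by (rule Max_ge) (auto intro: image_eqI[of _ _ "(i, j)"])
 have k: "k <= kk i j" for i j unfolding k_def by (rule Min_le) (auto intro: image_eqI[of _ _ "(i, j)"])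
 have k0: "k > 0" unfolding k_def using kk(1) by (subst Min_gr_iff) auto
 have C0: "C > 0" using CC(1) C by (metis less_le_trans)
 have "(ALL i j. dfam p h h' i j = dfam p h h' j i & abs (dfam p h h' i j) <= C & (dfam p h h' i j = 0 | k <= abs (dfam p h h' i j))) &
 (ALL i. dfam p h h' i i = 0) & (EX i j. dfam p h h' i j ~= 0)" if p: "p : {l..r}" for p
 proof (intro conjI allI)
 fix i j
 show "dfam p h h' i j = dfam p h h' j i" by (simp add: dfam_def dvec_def abs_minus_commute)
 show "abs (dfam p h h' i j) <= C" using CC(2)[OF p] C order_trans by blast
 show "dfam p h h' i j = 0 | k <= abs (dfam p h h' i j)" using kk(2)[OF p] k order_trans by blast
 show "dfam p h h' i i = 0" by (simp add: dfam_def dvec_def)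
 next
 show "EX i j. dfam p h h' i j ~= 0"
 proof (rule ccontr)
 assume "~ ?thesis"
 hence "dvec p A B i j = dvec p A' B' i j" for i j by (simp add: dfam_def AB AB')
 from dvec_inj[OF _ _ _ this] h p l show False by (auto simp: AB AB')
 qed
 qed
 thus ?thesis unfolding tame_def using k0 C0 by (intro exI[of _ k] conjI exI[of _ C]) auto
qed

lemma Rq_diff_dfam: "Rq p b (base p (fst h) (snd h)) - Rq p b (base p (fst h') (snd h')) = (SUM i:UNIV. SUM j:UNIV. b i j * dfam p h h' i j) / 2"
 unfolding Rq_dvec dfam_def by (simp add: right_diff_distrib sum_subtractf diff_divide_distrib)

text \<open>Base eigenvalues coincide for all \<open>p\<close> when the sizes agree, and otherwise
  at finitely many crossings. In both cases the differences to be separated form a tame set, and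
  \<open>separating_weights\<close> handles their finite union.\<close>

lemma ex_weights:
 assumes l: "1 < l"
 shows "EX b :: 'n::{finite,linorder} => 'n => real. (ALL i j. b i j = b j i & b i j > 0 & b i j : \<int>) &
 (ALL h:half_pairs. ALL h':half_pairs. h ~= h' --> (ALL p:{l..r}. lam0 p (fst h) (snd h) = lam0 p (fst h') (snd h') -->
 Rq p b (base p (fst h) (snd h)) ~= Rq p b (base p (fst h') (snd h'))))"
proof -
 let ?P = "{(h, h'). h : half_pairs & h' : half_pairs & h ~= (h' :: 'n set \<times> 'n set)}"
 define Z where "Z = (%(h :: 'n set \<times> 'n set, h'). {p:{l..r}. lam0 p (fst h) (snd h) = lam0 p (fst h') (snd (h' :: 'n set \<times> 'n set))})"
 define S where "S = (%hh. (%p. dfam p (fst hh) (snd hh)) ` Z hh)"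
 have "tame (S hh)" if "hh : ?P" for hh
 proof -
 obtain h h' where hh: "hh = (h, h')" "h : half_pairs" "h' : half_pairs" "h ~= h'" using \<open>hh : ?P\<close> by blast
 obtain A B where AB: "h = (A, B)" by force
 obtain A' B' where AB': "h' = (A', B')" by force
 have ok: "pair_ok A B" "pair_ok A' B'" using hh by (auto simp: half_pairs_def AB AB')
 show ?thesis
 proof (cases "same_size h h'")
 case True
 hence "Z hh = {l..r}" using lam0_same_size[OF _ ok] by (auto simp: Z_def hh AB AB')
 thus ?thesis unfolding S_def hh fst_conv snd_conv using tame_dfam[OF l hh(2-4)] True by (simp add: hh)
 next
 case False
 hence "finite {p:{l..r}. lam0 p A B = lam0 p A' B'}"
 using lam0_crossing[OF l ok, of r] by (auto simp: same_size_def AB AB')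
 hence "finite (Z hh)" by (simp add: Z_def hh AB AB')
 moreover have "tame ((%p. dfam p h h') ` {p..p})" if "p : Z hh" for p
 by (rule tame_dfam[OF _ hh(2-4)]) (use that l in \<open>auto simp: Z_def hh\<close>)
 ultimately have "tame (UN p:Z hh. (%p. dfam p h h') ` {p..p})" by (intro tame_UN)
 moreover have "(UN p:Z hh. (%p. dfam p h h') ` {p..p}) = S hh" by (auto simp: S_def hh)
 ultimately show ?thesis by simp
 qed
 qed
 hence "tame (UN hh:?P. S hh)" by (intro tame_UN) auto
 from separating_weights[OF this] obtain b where b: "!!i j. b i j = b j i & b i j > 0 & b i j : \<int>"
 "!!dl. dl : (UN hh:?P. S hh) ==> (SUM i:UNIV. SUM j:UNIV. b i j * dl i j) ~= 0" by blast
 have "Rq p b (base p (fst h) (snd h)) ~= Rq p b (base p (fst h') (snd h'))"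
 if "h : half_pairs" "h' : half_pairs" "h ~= h'" "p : {l..r}" "lam0 p (fst h) (snd h) = lam0 p (fst h') (snd h')" for h h' p
 proof -
 have "dfam p h h' : S (h, h')" using that by (auto simp: S_def Z_def)
 hence "dfam p h h' : (UN hh:?P. S hh)" using that by blast
 from b(2)[OF this] show ?thesis using Rq_diff_dfam[of p b h h'] by auto
 qed
 thus ?thesis using b(1) by (intro exI[of _ b]) auto
qed

section \<open>Simultaneous choice of weights and branches for all pairs\<close>

definition branch_ok :: "('n::finite => 'n => real) => real => real => 'n set \<times> 'n set => real => real => (real => real) => bool" where
 "branch_ok b l r h K eps La \<longleftrightarrow> (ALL p:{l..r}.
 (EX xi:slice (fst h) (snd h). norm xi <= K * eps & eigenpair p (%i j. 1 + eps * b i j) (La p) (base p (fst h) (snd h) + xi)) &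
 abs (La p - lam0 p (fst h) (snd h) - eps * Rq p b (base p (fst h) (snd h))) <= K * eps^2 &
 (ALL q:{l..r}. abs (La p - lam0 p (fst h) (snd h) - (La q - lam0 q (fst h) (snd h))) <= K * eps * abs (p - q)))"

lemma branch_ok_exists:
 fixes b :: "'n::finite => 'n => real"
 assumes "1 < l" "r < 2 | 2 < l" "pair_ok (fst h) (snd h)" "sym_weights b"
 shows "EX K>0. EX eps0>0. ALL eps. 0 < eps --> eps <= eps0 --> (EX La. branch_ok b l r h K eps La)"
 unfolding branch_ok_def by (rule eigen_branch[OF assms])

lemma branch_ok_close:
 assumes "branch_ok b l r h K eps La" "branch_ok b l r h' K' eps La'"
 shows "close_branch l r (%p. lam0 p (fst h) (snd h) - lam0 p (fst h') (snd h'))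
 (%p. Rq p b (base p (fst h) (snd h)) - Rq p b (base p (fst h') (snd h'))) (K + K') eps (%p. La p - La' p)"
 unfolding close_branch_def
proof (intro ballI conjI)
 fix p assume p: "p : {l..r}"
 have tri: "abs (x - y - (z - u) - e * (v - w)) <= (k + k') * s" if "abs (x - z - e * v) <= k * s" "abs (y - u - e * w) <= k' * s" for x y z u e v w k k' s :: real
 using that by (simp add: algebra_simps)
 show "abs (La p - La' p - (lam0 p (fst h) (snd h) - lam0 p (fst h') (snd h')) - eps * (Rq p b (base p (fst h) (snd h)) - Rq p b (base p (fst h') (snd h')))) <= (K + K') * eps^2"
 by (rule tri) (use assms p in \<open>simp_all add: branch_ok_def\<close>)
 fix q assume q: "q : {l..r}"
 have tri2: "abs (x - y - (z - u) - (x' - y' - (z' - u'))) <= (k + k') * e * s" if "abs (x - z - (x' - z')) <= k * e * s" "abs (y - u - (y' - u')) <= k' * e * s" for x y z u x' y' z' u' e k k' s :: real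
 using that by (simp add: algebra_simps)
 show "abs (La p - La' p - (lam0 p (fst h) (snd h) - lam0 p (fst h') (snd h')) - (La q - La' q - (lam0 q (fst h) (snd h) - lam0 q (fst h') (snd h')))) <= (K + K') * eps * abs (p - q)"
 by (rule tri2) (use assms p q in \<open>simp_all add: branch_ok_def\<close>)
qed

lemma continuous_on_Rq_base:
 assumes "1 < l" "pair_ok A B"
 shows "continuous_on {l..r} (%p. Rq p b (base p A B))"
 unfolding Rq_dvec by (intro continuous_on_divide continuous_on_sum continuous_on_mult continuous_on_const continuous_on_dvec assms) auto

text \<open>For equal sizes the branches differ at every exponent by
  \<open>branch_nonzero_const\<close>; for different sizes \<open>branch_finite_zeros\<close>
  applies, with its growth condition from \<open>lam0_crossing\<close>. Each exponent in
  \<open>P\<close> is protected separately.\<close>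

lemma branch_separation:
 fixes h h' :: "'n::{finite,linorder} set \<times> 'n set"
 assumes l: "1 < l" and P: "finite P" and K: "K > 0" and ok: "pair_ok (fst h) (snd h)" "pair_ok (fst h') (snd h')"
 and nz: "!!p. p : {l..r} ==> lam0 p (fst h) (snd h) = lam0 p (fst h') (snd h') ==>
 Rq p b (base p (fst h) (snd h)) ~= Rq p b (base p (fst h') (snd h'))"
 shows "EX eps1>0. ALL eps. 0 < eps --> eps <= eps1 --> (ALL D. close_branch l r (%p. lam0 p (fst h) (snd h) - lam0 p (fst h') (snd h'))
 (%p. Rq p b (base p (fst h) (snd h)) - Rq p b (base p (fst h') (snd h'))) K eps D -->
 finite {p:{l..r}. D p = 0} & (ALL p:P Int {l..r}. D p ~= 0))"
proof -
 define D0 where "D0 = (%p. lam0 p (fst h) (snd h) - lam0 p (fst h') (snd h'))"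
 define dd where "dd = (%p. Rq p b (base p (fst h) (snd h)) - Rq p b (base p (fst h') (snd h')))"
 have cd: "continuous_on {l..r} dd" unfolding dd_def by (intro continuous_on_diff continuous_on_Rq_base l ok)
 have nz': "dd p ~= 0" if "p : {l..r}" "D0 p = 0" for p using nz[OF that(1)] that(2) by (auto simp: dd_def D0_def)
 have 1: "EX eps1>0. ALL eps. 0 < eps --> eps <= eps1 --> (ALL p:P Int {l..r}. ALL D. close_branch l r D0 dd K eps D --> D p ~= 0)"
 proof (rule finite_common_bound)
 show "finite (P Int {l..r})" using P by simp
 fix p assume "p : P Int {l..r}"
 thus "EX d>0. ALL eps. 0 < eps --> eps <= d --> (ALL D. close_branch l r D0 dd K eps D --> D p ~= 0)"
 using branch_nonzero_point[OF K, of p l r D0 dd] nz' by blast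
 qed
 have 2: "EX eps1>0. ALL eps. 0 < eps --> eps <= eps1 --> (ALL D. close_branch l r D0 dd K eps D --> finite {p:{l..r}. D p = 0})"
 proof (cases "same_size h h'")
 case True
 hence "D0 p = 0" for p
 using lam0_same_size[of "fst h" "snd h" "fst h'" "snd h'" p] ok by (simp add: D0_def)
 then obtain eps1 where "eps1 > 0" "!!eps D. 0 < eps ==> eps <= eps1 ==> close_branch l r D0 dd K eps D ==> ALL p:{l..r}. D p ~= 0"
 using branch_nonzero_const[OF K cd, of D0] nz' by blast
 moreover have "finite {p:{l..r}. D p = 0}" if "ALL p:{l..r}. D p ~= 0" for D :: "real => real"
 proof -
 have "{p:{l..r}. D p = 0} = {}" using that by auto
 thus ?thesis by (simp only: finite.emptyI)
 qed
 ultimately show ?thesis by blast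
 next
 case False
 then obtain D' where D': "!!p. p : {l..r} ==> (D0 has_real_derivative D' p) (at p)"
 "finite {p:{l..r}. lam0 p (fst h) (snd h) = lam0 p (fst h') (snd h')}"
 "!!p0 M. p0 : {l..r} ==> lam0 p0 (fst h) (snd h) = lam0 p0 (fst h') (snd h') ==> M >= 0 ==>
 EX ro>0. ALL p:{l..r}. abs (p - p0) < ro --> M * abs (D0 p) <= abs (D' p)"
 using lam0_crossing[OF l ok, of r] unfolding same_size_def D0_def by blast
 show ?thesis
 proof (rule branch_finite_zeros[OF K cd D'(1)])
 show "finite {p:{l..r}. D0 p = 0}" using D'(2) by (simp add: D0_def)
 show "EX ro>0. ALL p:{l..r}. abs (p - p0) < ro --> M * abs (D0 p) <= abs (D' p)" if "p0 : {l..r}" "D0 p0 = 0" "M >= 0" for p0 M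
 by (rule D'(3)) (use that in \<open>auto simp: D0_def\<close>)
 qed (use nz' in auto)
 qed
 obtain e1 where e1: "e1 > 0" "!!eps p D. 0 < eps ==> eps <= e1 ==> p : P Int {l..r} ==> close_branch l r D0 dd K eps D ==> D p ~= 0"
 using 1 by blast
 obtain e2 where e2: "e2 > 0" "!!eps D. 0 < eps ==> eps <= e2 ==> close_branch l r D0 dd K eps D ==> finite {p:{l..r}. D p = 0}"
 using 2 by blast
 show ?thesis
 unfolding D0_def[symmetric] dd_def[symmetric]
 proof (intro exI[of _ "min e1 e2"] conjI allI impI ballI)
 show "0 < min e1 e2" using e1(1) e2(1) by simp
 fix eps D assume eps: "0 < eps" "eps <= min e1 e2" and D: "close_branch l r D0 dd K eps D"
 show "finite {p:{l..r}. D p = 0}" by (rule e2(2)[OF eps(1) _ D]) (use eps(2) in simp)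
 fix p assume p: "p : P Int {l..r}"
 show "D p ~= 0" by (rule e1(2)[OF eps(1) _ p D]) (use eps(2) in simp)
 qed
qed

definition form_ok :: "real => real => 'n::finite set \<times> 'n set => real => bool" where
 "form_ok l r h dl \<longleftrightarrow> (ALL p:{l..r}. ALL w x v. (ALL i j. abs (w i j - 1) <= dl) --> norm (x - base p (fst h) (snd h)) <= dl --> v ~= 0 -->
 (v : Wsp (fst h) (snd h) --> qf p w (Rq p w x) x v v < 0) & (v : Zsp (fst h) (snd h) --> 0 < qf p w (Rq p w x) x v v))"

lemma form_ok_mono:
 fixes h :: "'n::finite set \<times> 'n set"
 assumes "form_ok l r h d" "d' <= d"
 shows "form_ok l r h d'"
 unfolding form_ok_def
proof (rule ballI, intro allI, rule impI, rule impI, rule impI)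
 fix p and w :: "'n => 'n => real" and x v :: "real ^ 'n"
 assume p: "p : {l..r}" and w: "ALL i j. abs (w i j - 1) <= d'" and x: "norm (x - base p (fst h) (snd h)) <= d'" and v: "v ~= 0"
 have w': "ALL i j. abs (w i j - 1) <= d" using w assms(2) order_trans by blast
 have x': "norm (x - base p (fst h) (snd h)) <= d" using x assms(2) by (rule order_trans)
 show "(v : Wsp (fst h) (snd h) --> qf p w (Rq p w x) x v v < 0) & (v : Zsp (fst h) (snd h) --> 0 < qf p w (Rq p w x) x v v)"
 by (rule assms(1)[unfolded form_ok_def, THEN bspec, OF p, THEN spec, THEN spec, THEN spec, THEN mp, OF w', THEN mp, OF x', THEN mp, OF v])
qed

lemma form_ok_exists:
 fixes h :: "'n::finite set \<times> 'n set"
 assumes l: "2 < l" and ok: "pair_ok (fst h) (snd h)"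
 shows "EX dl>0. form_ok l r h dl"
proof -
 have "EX dl>0. ALL p:{l..r}. ALL w x v. (ALL i j. abs (w i j - 1) <= dl) --> norm (x - base p (fst h) (snd h)) <= dl --> v : Wsp (fst h) (snd h) --> v ~= 0 -->
 0 < (- 1) * qf p w (Rq p w x) x v v"
 by (rule form_sign[OF l ok subspace_Wsp]) (use qf_base(1)[OF _ ok] l in force)
 then obtain d1 where d1: "d1 > 0" "ALL p:{l..r}. ALL w x v. (ALL i j. abs (w i j - 1) <= d1) --> norm (x - base p (fst h) (snd h)) <= d1 --> v : Wsp (fst h) (snd h) --> v ~= 0 -->
 0 < (- 1) * qf p w (Rq p w x) x v v" by (elim exE conjE) (rule that)
 have "EX dl>0. ALL p:{l..r}. ALL w x v. (ALL i j. abs (w i j - 1) <= dl) --> norm (x - base p (fst h) (snd h)) <= dl --> v : Zsp (fst h) (snd h) --> v ~= 0 -->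
 0 < 1 * qf p w (Rq p w x) x v v"
 by (rule form_sign[OF l ok subspace_Zsp]) (use qf_base(2)[OF _ ok] l in force)
 then obtain d2 where d2: "d2 > 0" "ALL p:{l..r}. ALL w x v. (ALL i j. abs (w i j - 1) <= d2) --> norm (x - base p (fst h) (snd h)) <= d2 --> v : Zsp (fst h) (snd h) --> v ~= 0 -->
 0 < 1 * qf p w (Rq p w x) x v v" by (elim exE conjE) (rule that)
 have "form_ok l r h (min d1 d2)"
 unfolding form_ok_def
 proof (rule ballI, intro allI, rule impI, rule impI, rule impI)
 fix p and w :: "'n => 'n => real" and x v :: "real ^ 'n"
 assume p: "p : {l..r}" and w: "ALL i j. abs (w i j - 1) <= min d1 d2" and x: "norm (x - base p (fst h) (snd h)) <= min d1 d2" and v: "v ~= 0"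
 have w1: "ALL i j. abs (w i j - 1) <= d1" and w2: "ALL i j. abs (w i j - 1) <= d2" using w by simp_all
 have x1: "norm (x - base p (fst h) (snd h)) <= d1" and x2: "norm (x - base p (fst h) (snd h)) <= d2" using x by simp_all
 note q1 = d1(2)[THEN bspec, OF p, THEN spec, THEN spec, THEN spec, THEN mp, OF w1, THEN mp, OF x1]
 note q2 = d2(2)[THEN bspec, OF p, THEN spec, THEN spec, THEN spec, THEN mp, OF w2, THEN mp, OF x2]
 show "(v : Wsp (fst h) (snd h) --> qf p w (Rq p w x) x v v < 0) & (v : Zsp (fst h) (snd h) --> 0 < qf p w (Rq p w x) x v v)"
 using q1[of v] q2[of v] v by simp
 qed
 thus ?thesis using d1(1) d2(1) by (intro exI[of _ "min d1 d2"]) auto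
qed

lemma Rq_weight_scale: "Rq p (%i j. M * w i j) x = M * Rq p w x"
 by (simp add: Rq_def Ew_def sum_distrib_left mult.assoc)

lemma qf_weight_scale: "qf p (%i j. M * w i j) (M * lam) y u v = M * qf p w lam y u v"
proof -
 have "hb p (%i j. M * w i j) (M * lam) y u v = M * hb p w lam y u v"
 by (simp add: hb_def right_diff_distrib[of M] sum_distrib_left mult.assoc)
 thus ?thesis by (simp add: qf_def distrib_left)
qed

text \<open>An eigenvalue is the Rayleigh quotient of any of its eigenvectors, and this quotient is
  constant on a line.\<close>

lemma eigenvalues_card_le:
 assumes s: "sym_weights a" and f: "finite (eigenlines p a)"
 shows "finite (eigenvalues p a)" "card (eigenvalues p a) <= card (eigenlines p a)"
proof -
 let ?g = "%L. Rq p a (SOME x. x : L)"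
 have "lam : ?g ` eigenlines p a" if "lam : eigenvalues p a" for lam
 proof -
 obtain x where x: "eigenpair p a lam x" using \<open>lam : eigenvalues p a\<close> by (auto simp: eigenvalues_def)
 have "x : line_class x" unfolding line_class_def by (rule CollectI, rule exI[of _ 1]) simp
 hence "(SOME y. y : line_class x) : line_class x" by (rule someI)
 then obtain c where "c ~= 0" "(SOME y. y : line_class x) = c *\<^sub>R x" unfolding line_class_def by blast
 hence "?g (line_class x) = lam" using eigenpair_Rq[OF s x] by (simp add: Rq_scale)
 moreover have "line_class x : eigenlines p a" using x by (auto simp: eigenlines_def)
 ultimately show ?thesis by blast
 qed
 hence sub: "eigenvalues p a <= ?g ` eigenlines p a" by blast
 show "finite (eigenvalues p a)" by (rule finite_subset[OF sub]) (use f in simp)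
 have "card (eigenvalues p a) <= card (?g ` eigenlines p a)" by (rule card_mono[OF _ sub]) (use f in simp)
 also have "... <= card (eigenlines p a)" by (rule card_image_le[OF f])
 finally show "card (eigenvalues p a) <= card (eigenlines p a)" .
qed

lemma has_at_least_missing:
 fixes a :: "'n::{finite,linorder} => 'n => real"
 assumes "has_at_least (eigenvalues p a) R"
 shows "has_at_least (missing_eigenvalues p a) (R - real CARD('n))"
proof -
 obtain V where V: "V <= eigenvalues p a" "finite V" "real (card V) >= R" using assms by (auto simp: has_at_least_def)
 let ?F = "krasnoselskii_value p a ` {1..CARD('n)}"
 have "card ?F <= CARD('n)" using card_image_le[of "{1..CARD('n)}" "krasnoselskii_value p a"] by simp
 moreover have "card V - card ?F <= card (V - ?F)" by (rule diff_card_le_card_Diff) simp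
 ultimately have "R - real CARD('n) <= real (card (V - ?F))" using V(3) by linarith
 moreover have "V - ?F <= missing_eigenvalues p a" using V(1) by (auto simp: missing_eigenvalues_def)
 ultimately show ?thesis using V(2) unfolding has_at_least_def by (intro exI[of _ "V - ?F"]) auto
qed

text \<open>\<open>P\<close> lists exponents that the exceptional set must avoid, so that a single
  prescribed exponent can be treated by the same construction. The array \<open>b\<close> is fixed
  first; all later requirements are finitely many upper bounds on \<open>eps\<close>.\<close>

lemma main_construction:
 fixes l r :: real and P :: "real set"
 assumes l: "1 < l" and r: "r < 2 | 2 < l" and P: "finite P"
 shows "EX a :: 'n::{finite,linorder} => 'n => real. positive_integer_weights a & sym_weights a &
 (EX X. finite X & X Int P = {} & (ALL p:{l..r} - X. has_at_least (eigenvalues p a) (R_count CARD('n)))) &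
 (2 < l --> (ALL p:{l..r}. finite (eigenlines p a) & real (card (eigenlines p a)) = R_count CARD('n) &
 morse_function (reduced_quotient p a) & morse_polynomial (reduced_quotient p a) = M_plus CARD('n)))"
proof -
 let ?I = "{l..r}" and ?H = "half_pairs :: ('n set \<times> 'n set) set"
 obtain b :: "'n => 'n => real" where b: "!!i j. b i j = b j i & b i j > 0 & b i j : \<int>"
 and bsep: "!!h h' p. h : ?H ==> h' : ?H ==> h ~= h' ==> p : ?I ==> lam0 p (fst h) (snd h) = lam0 p (fst h') (snd h') ==>
 Rq p b (base p (fst h) (snd h)) ~= Rq p b (base p (fst h') (snd h'))"
 using ex_weights[OF l, of r, where 'n = 'n] by blast
 have bs: "sym_weights b" using b by (simp add: sym_weights_def)
 have ok: "pair_ok (fst h) (snd h)" if "h : ?H" for h using that by (auto simp: half_pairs_def)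
 have finH: "finite ?H" by simp
 obtain K E where KE: "!!h. h : ?H ==> K h > 0" "!!h. h : ?H ==> E h > 0"
 "!!h eps. h : ?H ==> 0 < eps ==> eps <= E h ==> EX La. branch_ok b l r h (K h) eps La"
 using branch_ok_exists[OF l r ok bs] by metis
 define Q1 where "Q1 = (%h eps. K h * eps <= 1/4 & (EX La. branch_ok b l r h (K h) eps La))"
 have "EX d>0. ALL eps. 0 < eps --> eps <= d --> (ALL h:?H. Q1 h eps)"
 proof (rule finite_common_bound[OF finH])
 fix h assume h: "h : ?H"
 have "Q1 h eps" if eps: "0 < eps" "eps <= min (E h) (1 / (4 * K h))" for eps
 proof -
 have "K h * eps <= 1/4" using eps(2) KE(1)[OF h] by (simp add: field_simps)
 thus ?thesis using KE(3)[OF h eps(1)] eps(2) by (simp add: Q1_def)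
 qed
 thus "EX d>0. ALL eps. 0 < eps --> eps <= d --> Q1 h eps"
 using KE(1,2)[OF h] by (intro exI[of _ "min (E h) (1 / (4 * K h))"]) auto
 qed
 then obtain e1 where e1: "e1 > 0" "!!eps h. 0 < eps ==> eps <= e1 ==> h : ?H ==> Q1 h eps" by blast
 define Q2 where "Q2 = (%(h, h') eps. ALL D. close_branch l r (%p. lam0 p (fst h) (snd h) - lam0 p (fst h') (snd h'))
 (%p. Rq p b (base p (fst h) (snd h)) - Rq p b (base p (fst h') (snd h'))) (K h + K h') eps D -->
 finite {p:?I. D p = 0} & (ALL p:P Int ?I. D p ~= 0))"
 let ?HH = "{(h, h'). h : ?H & h' : ?H & h ~= h'}"
 have "EX d>0. ALL eps. 0 < eps --> eps <= d --> (ALL x:?HH. Q2 x eps)"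
 proof (rule finite_common_bound)
 fix x assume "x : ?HH"
 then obtain h h' where x: "x = (h, h')" "h : ?H" "h' : ?H" "h ~= h'" by blast
 have K0: "K h + K h' > 0" using KE(1) x by (simp add: add_pos_pos)
 show "EX d>0. ALL eps. 0 < eps --> eps <= d --> Q2 x eps"
 unfolding Q2_def x(1) prod.case by (rule branch_separation[OF l P K0 ok[OF x(2)] ok[OF x(3)] bsep[OF x(2-4)]])
 qed simp
 then obtain e2 where e2: "e2 > 0" "!!eps h h'. 0 < eps ==> eps <= e2 ==> h : ?H ==> h' : ?H ==> h ~= h' ==> Q2 (h, h') eps" by blast
 have "EX dl>0. 2 < l --> (ALL h:?H. form_ok l r h dl)"
 proof (cases "2 < l")
 case True
 have "EX d>0. ALL eps. 0 < eps --> eps <= d --> (ALL h:?H. form_ok l r h eps)"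
 proof (rule finite_common_bound[OF finH])
 fix h assume "h : ?H"
 from form_ok_exists[OF True ok[OF this], of r] show "EX d>0. ALL eps. 0 < eps --> eps <= d --> form_ok l r h eps"
 using form_ok_mono by blast
 qed
 thus ?thesis by blast
 qed (auto intro: exI[of _ 1])
 then obtain dl where dl: "dl > 0" "!!h. 2 < l ==> h : ?H ==> form_ok l r h dl" by blast
 have "EX e>0. 2 < l --> (ALL eps. 0 < eps --> eps <= e --> (ALL p:?I. EX X. eigen_system p (%i j. 1 + eps * b i j) dl X))"
 using eigen_system_exists[OF _ bs dl(1), of l r] by (cases "2 < l") (auto intro: exI[of _ 1])
 then obtain e3 where e3: "e3 > 0" "!!eps p. 2 < l ==> 0 < eps ==> eps <= e3 ==> p : ?I ==> EX X. eigen_system p (%i j. 1 + eps * b i j) dl X" by blast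
 define Bm where "Bm = 1 + (SUM i:UNIV. SUM j:UNIV. b i j)"
 have b0: "0 <= b i j" for i j using b[of i j] by simp
 have bB: "b i j <= Bm" for i j
 proof -
 have "b i j <= (SUM j:UNIV. b i j)" by (rule member_le_sum) (use b0 in auto)
 also have "... <= (SUM i:UNIV. SUM j:UNIV. b i j)"
 by (rule member_le_sum[of i UNIV "%i. SUM j:UNIV. b i j"]) (auto intro: sum_nonneg b0)
 finally show ?thesis by (simp add: Bm_def)
 qed
 have Bm: "Bm > 0" unfolding Bm_def by (intro add_pos_nonneg sum_nonneg b0) auto
 define e where "e = min (min e1 e2) (min e3 (dl / Bm))"
 have e: "e > 0" using e1(1) e2(1) e3(1) dl(1) Bm by (simp add: e_def)
 obtain m :: nat where m: "real m > 1 / e" using reals_Archimedean2 by blast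
 define M where "M = real m"
 have "1 / e > 0" using e by simp
 hence M: "M > 0" unfolding M_def using m by linarith
 \<comment> \<open>Multiplication by \<open>M\<close> turns the weights \<open>1 + eps * b\<close>
   into the integers \<open>M + b\<close> and scales every eigenvalue by \<open>M\<close>.\<close>
 define eps where "eps = 1 / M"
 have eps0: "eps > 0" using M by (simp add: eps_def)
 have "eps <= e" using m e M by (simp add: eps_def M_def field_simps)
 hence eps: "eps <= e1" "eps <= e2" "eps <= e3" "eps <= dl / Bm" by (auto simp: e_def)
 define w where "w = (%i j. 1 + eps * b i j)"
 define a where "a = (%i j. M * w i j)"
 have aM: "a i j = M + b i j" for i j using M by (simp add: a_def w_def eps_def field_simps)
 have apos: "a i j > 0" for i j unfolding aM using M b0[of i j] by linarith
 have as: "sym_weights a" using b by (simp add: sym_weights_def aM)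
 have ws: "sym_weights w" using b by (simp add: sym_weights_def w_def)
 have wpos: "w i j > 0" for i j unfolding w_def using eps0 b0[of i j] by (simp add: add_pos_nonneg)
 have "M : \<int>" by (simp add: M_def)
 hence pint: "positive_integer_weights a"
 using b apos as unfolding positive_integer_weights_def sym_weights_def by (simp add: aM)
 have w1: "abs (w i j - 1) <= dl" for i j
 proof -
 have "eps * b i j <= eps * Bm" using bB eps0 by (simp add: mult_left_mono)
 also have "... <= dl" using eps(4) Bm by (simp add: field_simps)
 finally show ?thesis using eps0 b0[of i j] by (simp add: w_def)
 qed
 obtain La where La: "!!h. h : ?H ==> branch_ok b l r h (K h) eps (La h)"
 using e1(2)[OF eps0 eps(1)] unfolding Q1_def by metis
 have eig: "La h p > 0 & (EX x. eigenpair p a (M * La h p) x)" if h: "h : ?H" and p: "p : ?I" for h p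
 proof -
 have p1: "p > 1" using p l by simp
 obtain xi where xi: "norm xi <= K h * eps" "eigenpair p w (La h p) (base p (fst h) (snd h) + xi)"
 using La[OF h] p unfolding branch_ok_def w_def by blast
 have "norm xi <= 1/4" using xi(1) e1(2)[OF eps0 eps(1) h] by (simp add: Q1_def)
 hence nc: "\<nexists>c. base p (fst h) (snd h) + xi = c *\<^sub>R 1" by (intro near_base_nonconst[OF p1 ok[OF h]]) simp
 have "La h p > 0" by (rule eigenpair_sum_Phi(1)[OF ws _ _ xi(2) nc]) (use wpos in \<open>auto intro: less_imp_le\<close>)
 moreover have "eigenpair p a (M * La h p) (base p (fst h) (snd h) + xi)"
 unfolding a_def using xi(2) M by (subst eigenpair_weight_scale) auto
 ultimately show ?thesis by blast
 qed
 define X where "X = (UN (h, h'):?HH. {p:?I. La h p - La h' p = 0})"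
 have sep: "finite {p:?I. La h p - La h' p = 0} & (ALL p:P Int ?I. La h p - La h' p ~= 0)" if "h : ?H" "h' : ?H" "h ~= h'" for h h'
 using e2(2)[OF eps0 eps(2) that] branch_ok_close[OF La[OF that(1)] La[OF that(2)]] unfolding Q2_def prod.case by blast
 have finX: "finite X" unfolding X_def by (rule finite_UN_I) (use sep in auto)
 have XP: "X Int P = {}" using sep unfolding X_def by fast
 have many: "has_at_least (eigenvalues p a) (R_count CARD('n))" if p: "p : ?I - X" for p
 proof -
 \<comment> \<open>The constant vector gives the eigenvalue 0 and the branches give positive ones,
   so the count is \<open>card half_pairs + 1\<close>, which is
   \<open>R_count CARD('n)\<close>.\<close>
 let ?V = "insert 0 ((%h. M * La h p) ` ?H)"
 have inj: "inj_on (%h. M * La h p) ?H"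
 proof (rule inj_onI, rule ccontr)
 fix h h' assume h: "h : ?H" "h' : ?H" "M * La h p = M * La h' p" "h ~= h'"
 hence "La h p - La h' p = 0" using M by simp
 hence "p : X" using h p unfolding X_def by blast
 thus False using p by simp
 qed
 have "0 ~: (%h. M * La h p) ` ?H" using eig p M by force
 hence "card ?V = Suc (card ?H)" by (simp add: card_image[OF inj])
 hence "real (card ?V) = R_count CARD('n)" using card_half_pairs[where 'n = 'n] by simp
 moreover have "?V <= eigenvalues p a"
 proof -
 have "eigenpair p a 0 1" by (simp add: eigenpair_def)
 thus ?thesis using eig p by (auto simp: eigenvalues_def)
 qed
 ultimately show ?thesis unfolding has_at_least_def by (intro exI[of _ ?V]) auto
 qed
 have morse: "finite (eigenlines p a) & real (card (eigenlines p a)) = R_count CARD('n) &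
 morse_function (reduced_quotient p a) & morse_polynomial (reduced_quotient p a) = M_plus CARD('n)" if l2: "2 < l" and p: "p : ?I" for p
 proof -
 have p2: "p > 2" using l2 p by simp
 obtain Y where Y: "eigen_system p w dl Y" using e3(2)[OF l2 eps0 eps(3) p] unfolding w_def by blast
 have Ya: "eigen_system p a dl Y" unfolding a_def by (rule eigen_system_scale[OF _ Y]) (use M in simp)
 have form: "(v : Wsp A B --> qf p w (Rq p w (Y (A, B))) (Y (A, B)) v v < 0) & (v : Zsp A B --> 0 < qf p w (Rq p w (Y (A, B))) (Y (A, B)) v v)"
 if h: "(A, B) : ?H" and v: "v ~= 0" for A B v
 proof -
 have n: "norm (Y (A, B) - base p A B) <= dl"
 using Y[unfolded eigen_system_def, THEN conjunct1, THEN bspec, OF h] by (simp only: prod.case)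
 have w1': "ALL i j. abs (w i j - 1) <= dl" using w1 by simp
 show ?thesis
 by (rule dl(2)[OF l2 h, unfolded form_ok_def fst_conv snd_conv, THEN bspec, OF p, THEN spec, THEN spec, THEN spec, THEN mp, OF w1', THEN mp, OF n, THEN mp, OF v])
 qed
 have scale: "qf p a (Rq p a x) x v v = M * qf p w (Rq p w x) x v v" for x v
 unfolding a_def Rq_weight_scale qf_weight_scale ..
 note mor = morse_of_eigen_system[OF p2 as apos Ya]
 have neg: "qf p a (Rq p a (Y (A, B))) (Y (A, B)) v v < 0" if "(A, B) : ?H" "v : Wsp A B" "v ~= 0" for A B v
 unfolding scale using form[OF that(1,3)] that(2) M by (simp add: mult_pos_neg)
 have pos: "0 < qf p a (Rq p a (Y (A, B))) (Y (A, B)) v v" if "(A, B) : ?H" "v : Zsp A B" "v ~= 0" for A B v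
 unfolding scale using form[OF that(1,3)] that(2) M by simp
 have "real (card (eigenlines p a)) = R_count CARD('n)"
 using mor(4)[OF neg pos] card_half_pairs[where 'n = 'n] by simp
 thus ?thesis using mor(1,2,3)[OF neg pos] sum_half_pairs_monom[where 'n = 'n] by simp
 qed
 show ?thesis
 using pint as finX XP many morse by (intro exI[of _ a]) blast
qed

lemma asymptotics:
 shows "EX dl :: nat => real. dl \<longlonglongrightarrow> 0 & (ALL m. R_count m - real m = (1 / 2 + dl m) * 3 ^ m)"
 and "EX dl :: nat => real. dl \<longlonglongrightarrow> 0 & (ALL m. R_count m = (1 / 2 + dl m) * 3 ^ m)"
proof -
 let ?d = "%m. 3 / 2 * (1 / 3) ^ m - (2 / 3 :: real) ^ m"
 have d: "?d \<longlonglongrightarrow> 3 / 2 * 0 - 0"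
 by (intro tendsto_intros LIMSEQ_power_zero) auto
 have R: "R_count m = (1 / 2 + ?d m) * 3 ^ m" for m
 by (simp add: R_count_def power_divide field_simps)
 thus "EX dl :: nat => real. dl \<longlonglongrightarrow> 0 & (ALL m. R_count m = (1 / 2 + dl m) * 3 ^ m)"
 using d by (intro exI[of _ ?d]) simp
 have n: "(%m. real m * (1 / 3) ^ m) \<longlonglongrightarrow> 0"
 by (rule powser_times_n_limit_0) simp
 have "(%m. ?d m - real m * (1 / 3) ^ m) \<longlonglongrightarrow> (3 / 2 * 0 - 0) - 0" by (intro tendsto_diff d n)
 moreover have "R_count m - real m = (1 / 2 + (?d m - real m * (1 / 3) ^ m)) * 3 ^ m" for m
 unfolding R by (simp add: power_divide field_simps)
 ultimately show "EX dl :: nat => real. dl \<longlonglongrightarrow> 0 & (ALL m. R_count m - real m = (1 / 2 + dl m) * 3 ^ m)"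
 by (intro exI[of _ "%m. ?d m - real m * (1 / 3) ^ m"]) simp
qed

text \<open>The growth \<open>(1/2 + o(1)) * 3^n\<close> is expressed by expansions of
  \<open>R_count m - real m\<close>, the lower bound for the number of missing eigenvalues, and of
  \<open>R_count m\<close>, the upper bound given for \<open>p > 2\<close>.\<close>

theorem corollary12p3:
  assumes n: "CARD('n::{finite,linorder}) \<ge> 2"
  shows
    "(\<forall>p::real. 1 < p \<and> p \<noteq> 2 \<longrightarrow>
        (\<exists>a :: 'n \<Rightarrow> 'n \<Rightarrow> real. positive_integer_weights a \<and>
           has_at_least (missing_eigenvalues p a) (R_count CARD('n) - real CARD('n)) \<and>
           (p > 2 \<longrightarrow> finite (missing_eigenvalues p a) \<and>
              real (card (missing_eigenvalues p a)) \<le> R_count CARD('n))))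
     \<and> (\<forall>m. R_count m - real m = (3 ^ m - 2 ^ (m + 1) + 3 - 2 * real m) / 2)
     \<and> (\<exists>\<delta> :: nat \<Rightarrow> real. \<delta> \<longlonglongrightarrow> 0 \<and>
          (\<forall>m. R_count m - real m = (1 / 2 + \<delta> m) * 3 ^ m))
     \<and> (\<exists>\<delta> :: nat \<Rightarrow> real. \<delta> \<longlonglongrightarrow> 0 \<and>
          (\<forall>m. R_count m = (1 / 2 + \<delta> m) * 3 ^ m))
     \<and> (\<forall>J :: real set. compact J \<and> (J \<subseteq> {1<..<2} \<or> J \<subseteq> {2<..}) \<longrightarrow>
        (\<exists>a :: 'n \<Rightarrow> 'n \<Rightarrow> real. positive_integer_weights a \<and>
           (\<exists>X. finite X \<and> (\<forall>p\<in>J - X.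
              has_at_least (missing_eigenvalues p a) (R_count CARD('n) - real CARD('n)))) \<and>
           (J \<subseteq> {2<..} \<longrightarrow> (\<forall>p\<in>J.
              finite (eigenlines p a) \<and> real (card (eigenlines p a)) = R_count CARD('n) \<and>
              morse_function (reduced_quotient p a) \<and>
              morse_polynomial (reduced_quotient p a) = M_plus CARD('n)))))"
proof (intro conjI, goal_cases)
  case 1
  show ?case
  proof (intro allI impI, goal_cases)
    case p: (1 p)
    have p1: "1 < p" and p2: "p < 2 \<or> 2 < p" using p by auto
    \<comment> \<open>The degenerate interval \<open>{p..p}\<close> with \<open>P = {p}\<close>: the
      exceptional set then misses the only exponent of interest.\<close>
    obtain a :: "'n \<Rightarrow> 'n \<Rightarrow> real" and X where a: "positive_integer_weights a" "sym_weights a" "X \<inter> {p} = {}"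
      "\<forall>q\<in>{p..p} - X. has_at_least (eigenvalues q a) (R_count CARD('n))"
      "2 < p \<Longrightarrow> \<forall>q\<in>{p..p}. finite (eigenlines q a) \<and> real (card (eigenlines q a)) = R_count CARD('n)"
      using main_construction[OF p1 p2, of "{p}", where 'n = 'n] by auto
    have "has_at_least (missing_eigenvalues p a) (R_count CARD('n) - real CARD('n))"
      by (rule has_at_least_missing) (use a(3,4) in auto)
    moreover have "finite (missing_eigenvalues p a) \<and> real (card (missing_eigenvalues p a)) \<le> R_count CARD('n)" if "p > 2"
    proof -
      have f: "finite (eigenlines p a)" "real (card (eigenlines p a)) = R_count CARD('n)" using a(5)[OF that] by auto
      note ev = eigenvalues_card_le[OF a(2) f(1)]
      have sub: "missing_eigenvalues p a \<subseteq> eigenvalues p a" by (auto simp: missing_eigenvalues_def)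
      have "card (missing_eigenvalues p a) \<le> card (eigenlines p a)" using card_mono[OF ev(1) sub] ev(2) by linarith
      then show ?thesis using f(2) finite_subset[OF sub ev(1)] by linarith
    qed
    ultimately show ?case using a(1) by blast
  qed
next
  case 2
  show ?case by (simp add: R_count_def field_simps)
next
  case 3
  show ?case by (rule asymptotics)
next
  case 4
  show ?case by (rule asymptotics)
next
  case 5
  show ?case
  proof (intro allI impI, goal_cases)
    case J: (1 J)
    obtain l r where lr: "J \<subseteq> {l..r}" "1 < l" "r < 2 \<or> 2 < l" "J \<subseteq> {2<..} \<Longrightarrow> J \<noteq> {} \<Longrightarrow> 2 < l"
    proof (cases "J = {}")
      case True
      \<comment> \<open>For empty \<open>J\<close> any admissible interval will do;
        \<open>{3..3}\<close> is one.\<close>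
      then show thesis using that[of 3 3] by simp
    next
      case False
      obtain l where l: "l \<in> J" "\<And>x. x \<in> J \<Longrightarrow> l \<le> x" using compact_attains_inf[of J] J False by blast
      obtain r where r: "r \<in> J" "\<And>x. x \<in> J \<Longrightarrow> x \<le> r" using compact_attains_sup[of J] J False by blast
      have "J \<subseteq> {l..r}" using l r by auto
      moreover have "1 < l" "r < 2 \<or> 2 < l" using J l(1) r(1) by force+
      moreover have "2 < l" if "J \<subseteq> {2<..}" using that l(1) by auto
      ultimately show thesis using that by blast
    qed
    obtain a :: "'n \<Rightarrow> 'n \<Rightarrow> real" and X where a: "positive_integer_weights a" "finite X"
      "\<And>p. p \<in> {l..r} - X \<Longrightarrow> has_at_least (eigenvalues p a) (R_count CARD('n))"
      "\<And>p. 2 < l \<Longrightarrow> p \<in> {l..r} \<Longrightarrow> finite (eigenlines p a) \<and> real (card (eigenlines p a)) = R_count CARD('n) \<and>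
         morse_function (reduced_quotient p a) \<and> morse_polynomial (reduced_quotient p a) = M_plus CARD('n)"
      using main_construction[OF lr(2,3), of "{}", where 'n = 'n] by auto
    have "\<forall>p\<in>J - X. has_at_least (missing_eigenvalues p a) (R_count CARD('n) - real CARD('n))"
      using a(3) lr(1) has_at_least_missing by blast
    moreover have "\<forall>p\<in>J. finite (eigenlines p a) \<and> real (card (eigenlines p a)) = R_count CARD('n) \<and>
         morse_function (reduced_quotient p a) \<and> morse_polynomial (reduced_quotient p a) = M_plus CARD('n)" if "J \<subseteq> {2<..}"
      using a(4) lr(1) lr(4)[OF that] by blast
    ultimately show ?case using a(1,2) by blast
  qed
qed

end
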